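(* Let $X$ be an $\mathbb{F}_1$-scheme of finite type, and let $X_{\mathbb Z}$ be the $\mathbb{Z}$-scheme obtained from it by ascent. Then there exist a natural number $e$ and a polynomial $N(x)$ with integer coefficients such that for every prime power $q$ one has $$\gcd(q-1,e)=1 \ \Longrightarrow\ \# X_{\mathbb Z}(\mathbb{F}_q) = N(q),$$ where $\mathbb{F}_q$ is the field with $q$ elements. Moreover, this condition determines the polynomial $N$ uniquely, i.e. if $(e,N)$ and $(e',N')$ both satisfy it, then $N=N'$.
   Context: All monoids are commutative (multiplicatively written, with unit), all rings commutative with unit. An ideal of a monoid $A$ is a subset $\mathfrak a$ with $A\mathfrak a\subset\mathfrak a$; a prime ideal is an ideal $\mathfrak p$ such that $A\setminus\mathfrak p$ is a submonoid. The spectrum $\mathrm{spec}(A)$ is the set of prime ideals with the Zariski topology, carrying a structure sheaf of monoids built from localisations $A_{\mathfrak p}=(A\setminus \mathfrak p)^{-1}A$ exactly as for rings. An $\mathbb{F}_1$-scheme is a topological space with a sheaf of monoids, locally isomorphic to spectra of monoids. It is of finite type if it has a finite covering by affine opens $\mathrm{spec}(A_i)$ with each $A_i$ finitely generated. The ascent functor sends a monoid $A$ to the monoid ring $\mathbb{Z}[A]$ and, by gluing, an $\mathbb{F}_1$-scheme $X$ to a $\mathbb{Z}$-scheme $X_{\mathbb Z}$ (locally $\mathrm{spec}(A)\mapsto\mathrm{spec}(\mathbb{Z}[A])$). $X_{\mathbb Z}(\mathbb{F}_q)$ denotes the set of $\mathbb{F}_q$-valued points of $X_{\mathbb Z}$.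 *)

theory Defs
  imports
    "HOL-Analysis.Abstract_Topology"
    "HOL-Algebra.RingHom"
    "HOL-Library.Poly_Mapping"
    "HOL-Computational_Algebra.Polynomial"
    "HOL-Number_Theory.Prime_Powers"
begin

section \<open>Spaces with a sheaf of algebraic structures\<close>

text \<open>
  The parameter \<open>'r\<close> is the record type of the structure carried by the sections:
  \<open>'s monoid\<close> for spaces with a sheaf of monoids, \<open>'s ring\<close> for ringed spaces.
  The fields \<open>sect\<close> and \<open>restr\<close> are only meaningful at open sets; \<open>restr X U V\<close> is the
  restriction map from \<open>U\<close> to \<open>V \<subseteq> U\<close>.
\<close>

record ('p, 's, 'r) sheafed_space =
  topo :: "'p topology"
  sect :: "'p set \<Rightarrow> 'r"
  restr :: "'p set \<Rightarrow> 'p set \<Rightarrow> 's \<Rightarrow> 's"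

type_synonym ('p, 's) monoidal_space = "('p, 's, 's monoid) sheafed_space"
type_synonym ('p, 's) ringed_space = "('p, 's, 's ring) sheafed_space"

definition open_subspace ::
    "('p, 's, 'r) sheafed_space \<Rightarrow> 'p set \<Rightarrow> ('p, 's, 'r) sheafed_space" where
  "open_subspace X U = X\<lparr>topo := subtopology (topo X) U\<rparr>"

definition preim :: "('p, 's, 'r) sheafed_space \<Rightarrow> ('p \<Rightarrow> 'p') \<Rightarrow> 'p' set \<Rightarrow> 'p set" where
  "preim X f V = {x \<in> topspace (topo X). f x \<in> V}"

locale monoid_sheaf =
  fixes X :: "('p, 's) monoidal_space"
  assumes sect_monoid: "\<And>U. openin (topo X) U \<Longrightarrow> comm_monoid (sect X U)"
    and restr_hom: "\<And>U V. \<lbrakk>openin (topo X) U; openin (topo X) V; V \<subseteq> U\<rbrakk>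
      \<Longrightarrow> restr X U V \<in> hom (sect X U) (sect X V)"
    and restr_one: "\<And>U V. \<lbrakk>openin (topo X) U; openin (topo X) V; V \<subseteq> U\<rbrakk>
      \<Longrightarrow> restr X U V \<one>\<^bsub>sect X U\<^esub> = \<one>\<^bsub>sect X V\<^esub>"
    and restr_id: "\<And>U s. \<lbrakk>openin (topo X) U; s \<in> carrier (sect X U)\<rbrakk> \<Longrightarrow> restr X U U s = s"
    and restr_comp: "\<And>U V W s. \<lbrakk>openin (topo X) U; openin (topo X) V; openin (topo X) W;
        W \<subseteq> V; V \<subseteq> U; s \<in> carrier (sect X U)\<rbrakk>
      \<Longrightarrow> restr X V W (restr X U V s) = restr X U W s"
    and locality: "\<And>\<V> s t. \<lbrakk>\<forall>V\<in>\<V>. openin (topo X) V;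
        s \<in> carrier (sect X (\<Union>\<V>)); t \<in> carrier (sect X (\<Union>\<V>));
        \<forall>V\<in>\<V>. restr X (\<Union>\<V>) V s = restr X (\<Union>\<V>) V t\<rbrakk> \<Longrightarrow> s = t"
    and gluing: "\<And>\<V> \<sigma>. \<lbrakk>\<forall>V\<in>\<V>. openin (topo X) V; \<forall>V\<in>\<V>. \<sigma> V \<in> carrier (sect X V);
        \<forall>V\<in>\<V>. \<forall>W\<in>\<V>. restr X V (V \<inter> W) (\<sigma> V) = restr X W (V \<inter> W) (\<sigma> W)\<rbrakk>
      \<Longrightarrow> \<exists>t\<in>carrier (sect X (\<Union>\<V>)). \<forall>V\<in>\<V>. restr X (\<Union>\<V>) V t = \<sigma> V"

definition monoidal_space_iso ::
    "('p, 's) monoidal_space \<Rightarrow> ('p', 's') monoidal_space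
      \<Rightarrow> ('p \<Rightarrow> 'p') \<Rightarrow> ('p' set \<Rightarrow> 's' \<Rightarrow> 's) \<Rightarrow> bool" where
  "monoidal_space_iso X Y f \<phi> \<longleftrightarrow>
     homeomorphic_map (topo X) (topo Y) f \<and>
     (\<forall>V. openin (topo Y) V \<longrightarrow> \<phi> V \<in> iso (sect Y V) (sect X (preim X f V))) \<and>
     (\<forall>V W. openin (topo Y) V \<and> openin (topo Y) W \<and> W \<subseteq> V \<longrightarrow>
        (\<forall>s\<in>carrier (sect Y V).
           \<phi> W (restr Y V W s) = restr X (preim X f V) (preim X f W) (\<phi> V s)))"


section \<open>Localisation of monoids and rings\<close>

text \<open>
  The fraction \<open>a / s\<close> is the class of \<open>(a, s)\<close> under the relation
  \<open>(a, s) \<sim> (b, t) \<longleftrightarrow> (\<exists>u\<in>S. u a t = u b s)\<close>.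
\<close>

definition fraction ::
    "('a, 'z) monoid_scheme \<Rightarrow> 'a set \<Rightarrow> 'a \<Rightarrow> 'a \<Rightarrow> ('a \<times> 'a) set" where
  "fraction M S a s =
     {(b, t). b \<in> carrier M \<and> t \<in> S \<and> (\<exists>u\<in>S. u \<otimes>\<^bsub>M\<^esub> (a \<otimes>\<^bsub>M\<^esub> t) = u \<otimes>\<^bsub>M\<^esub> (b \<otimes>\<^bsub>M\<^esub> s))}"

definition fractions :: "('a, 'z) monoid_scheme \<Rightarrow> 'a set \<Rightarrow> ('a \<times> 'a) set set" where
  "fractions M S = {fraction M S a s | a s. a \<in> carrier M \<and> s \<in> S}"

definition fraction_mult ::
    "('a, 'z) monoid_scheme \<Rightarrow> 'a set \<Rightarrow> ('a \<times> 'a) set \<Rightarrow> ('a \<times> 'a) set \<Rightarrow> ('a \<times> 'a) set" where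
  "fraction_mult M S x y =
     (\<Union>(a, s)\<in>x. \<Union>(b, t)\<in>y. fraction M S (a \<otimes>\<^bsub>M\<^esub> b) (s \<otimes>\<^bsub>M\<^esub> t))"

definition fraction_add ::
    "'a ring \<Rightarrow> 'a set \<Rightarrow> ('a \<times> 'a) set \<Rightarrow> ('a \<times> 'a) set \<Rightarrow> ('a \<times> 'a) set" where
  "fraction_add R S x y =
     (\<Union>(a, s)\<in>x. \<Union>(b, t)\<in>y.
        fraction R S ((a \<otimes>\<^bsub>R\<^esub> t) \<oplus>\<^bsub>R\<^esub> (b \<otimes>\<^bsub>R\<^esub> s)) (s \<otimes>\<^bsub>R\<^esub> t))"

definition monoid_localisation :: "'a monoid \<Rightarrow> 'a set \<Rightarrow> ('a \<times> 'a) set monoid" where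
  "monoid_localisation A S =
     \<lparr>carrier = fractions A S, monoid.mult = fraction_mult A S, one = fraction A S \<one>\<^bsub>A\<^esub> \<one>\<^bsub>A\<^esub>\<rparr>"

definition ring_localisation :: "'a ring \<Rightarrow> 'a set \<Rightarrow> ('a \<times> 'a) set ring" where
  "ring_localisation R S =
     \<lparr>carrier = fractions R S, monoid.mult = fraction_mult R S, one = fraction R S \<one>\<^bsub>R\<^esub> \<one>\<^bsub>R\<^esub>,
      zero = fraction R S \<zero>\<^bsub>R\<^esub> \<one>\<^bsub>R\<^esub>, add = fraction_add R S\<rparr>"

text \<open>
  The sections over an open set \<open>U\<close> of primes: functions sending each \<open>P \<in> U\<close> to an element of
  the localisation at \<open>P\<close> that are locally given by a single fraction.
\<close>

definition structure_sections ::
    "('a, 'z) monoid_scheme \<Rightarrow> 'a set topology \<Rightarrow> 'a set set \<Rightarrow> ('a set \<Rightarrow> ('a \<times> 'a) set) set" where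
  "structure_sections M T U =
     {s \<in> (\<Pi>\<^sub>E P\<in>U. fractions M (carrier M - P)).
        \<forall>P\<in>U. \<exists>V a f. openin T V \<and> P \<in> V \<and> V \<subseteq> U \<and> a \<in> carrier M \<and> f \<in> carrier M \<and>
          (\<forall>Q\<in>V. f \<notin> Q \<and> s Q = fraction M (carrier M - Q) a f)}"


section \<open>Spectra of monoids\<close>

definition monoid_ideal :: "'m set \<Rightarrow> 'm monoid \<Rightarrow> bool" where
  "monoid_ideal I A \<longleftrightarrow> I \<subseteq> carrier A \<and> (\<forall>a\<in>carrier A. \<forall>x\<in>I. a \<otimes>\<^bsub>A\<^esub> x \<in> I)"

definition monoid_prime :: "'m set \<Rightarrow> 'm monoid \<Rightarrow> bool" where
  "monoid_prime P A \<longleftrightarrow> monoid_ideal P A \<and> submonoid (carrier A - P) A"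

definition monoid_zariski :: "'m monoid \<Rightarrow> 'm set topology" where
  "monoid_zariski A =
     topology (\<lambda>U. \<exists>I. monoid_ideal I A \<and> U = {P. monoid_prime P A \<and> \<not> I \<subseteq> P})"

definition monoid_spec :: "'m monoid \<Rightarrow> ('m set, 'm set \<Rightarrow> ('m \<times> 'm) set) monoidal_space" where
  "monoid_spec A =
     \<lparr>topo = monoid_zariski A,
      sect = (\<lambda>U.
        \<lparr>carrier = structure_sections A (monoid_zariski A) U,
         monoid.mult = (\<lambda>s t. \<lambda>P\<in>U. s P \<otimes>\<^bsub>monoid_localisation A (carrier A - P)\<^esub> t P),
         one = (\<lambda>P\<in>U. \<one>\<^bsub>monoid_localisation A (carrier A - P)\<^esub>)\<rparr>),
      restr = (\<lambda>U V s. restrict s V)\<rparr>"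

lemma istopology_monoid_zariski:
  assumes "comm_monoid A"
  shows "istopology (\<lambda>U. \<exists>I. monoid_ideal I A \<and> U = {P. monoid_prime P A \<and> \<not> I \<subseteq> P})"
proof -
  interpret comm_monoid A by fact
  have "\<exists>K. monoid_ideal K A \<and>
      {P. monoid_prime P A \<and> \<not> I \<subseteq> P} \<inter> {P. monoid_prime P A \<and> \<not> J \<subseteq> P} =
      {P. monoid_prime P A \<and> \<not> K \<subseteq> P}"
    if "monoid_ideal I A" "monoid_ideal J A" for I J
  proof (intro exI[of _ "I \<inter> J"] conjI)
    show "monoid_ideal (I \<inter> J) A"
      using that by (auto simp: monoid_ideal_def)
    have "I \<subseteq> P \<or> J \<subseteq> P" if P: "monoid_prime P A" and sub: "I \<inter> J \<subseteq> P" for P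
    proof (rule ccontr)
      assume "\<not> (I \<subseteq> P \<or> J \<subseteq> P)"
      then obtain x y where xy: "x \<in> I" "x \<notin> P" "y \<in> J" "y \<notin> P" by blast
      have c: "x \<in> carrier A" "y \<in> carrier A"
        using xy \<open>monoid_ideal I A\<close> \<open>monoid_ideal J A\<close> by (auto simp: monoid_ideal_def)
      have "x \<otimes>\<^bsub>A\<^esub> y \<in> J" "y \<otimes>\<^bsub>A\<^esub> x \<in> I"
        using xy c \<open>monoid_ideal I A\<close> \<open>monoid_ideal J A\<close> by (auto simp: monoid_ideal_def)
      then have "x \<otimes>\<^bsub>A\<^esub> y \<in> P"
        using sub c m_comm by auto
      moreover have "x \<otimes>\<^bsub>A\<^esub> y \<in> carrier A - P"
        using P xy c by (auto simp: monoid_prime_def submonoid_def)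
      ultimately show False by blast
    qed
    then show "{P. monoid_prime P A \<and> \<not> I \<subseteq> P} \<inter> {P. monoid_prime P A \<and> \<not> J \<subseteq> P} =
      {P. monoid_prime P A \<and> \<not> I \<inter> J \<subseteq> P}" by blast
  qed
  moreover have "\<exists>K. monoid_ideal K A \<and> \<Union>\<K> = {P. monoid_prime P A \<and> \<not> K \<subseteq> P}"
    if K: "\<forall>U\<in>\<K>. \<exists>I. monoid_ideal I A \<and> U = {P. monoid_prime P A \<and> \<not> I \<subseteq> P}" for \<K>
  proof -
    obtain I where I: "\<And>U. U \<in> \<K> \<Longrightarrow> monoid_ideal (I U) A"
        "\<And>U. U \<in> \<K> \<Longrightarrow> U = {P. monoid_prime P A \<and> \<not> I U \<subseteq> P}"
      using bchoice[OF K] by blast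
    have mem: "P \<in> U \<longleftrightarrow> monoid_prime P A \<and> \<not> I U \<subseteq> P" if "U \<in> \<K>" for U P
      using arg_cong[OF I(2)[OF that], of "\<lambda>S. P \<in> S"] by (simp only: mem_Collect_eq)
    have "monoid_ideal (\<Union>U\<in>\<K>. I U) A"
      unfolding monoid_ideal_def
    proof (intro conjI ballI)
      show "(\<Union>U\<in>\<K>. I U) \<subseteq> carrier A"
        using I(1) unfolding monoid_ideal_def by (intro UN_least) simp
      fix a x assume "a \<in> carrier A" "x \<in> (\<Union>U\<in>\<K>. I U)"
      then obtain U where "U \<in> \<K>" "x \<in> I U" by (elim UN_E)
      then show "a \<otimes>\<^bsub>A\<^esub> x \<in> (\<Union>U\<in>\<K>. I U)"
        using I(1)[of U] \<open>a \<in> carrier A\<close> unfolding monoid_ideal_def by (intro UN_I) blast+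
    qed
    moreover have "\<Union>\<K> = {P. monoid_prime P A \<and> \<not> (\<Union>U\<in>\<K>. I U) \<subseteq> P}"
    proof (rule Set.set_eqI)
      fix P
      have "P \<in> \<Union>\<K> \<longleftrightarrow> (\<exists>U\<in>\<K>. P \<in> U)" by (rule Union_iff)
      also have "\<dots> \<longleftrightarrow> (\<exists>U\<in>\<K>. monoid_prime P A \<and> \<not> I U \<subseteq> P)"
        by (rule bex_cong[OF refl mem])
      also have "\<dots> \<longleftrightarrow> monoid_prime P A \<and> \<not> (\<Union>U\<in>\<K>. I U) \<subseteq> P"
        using UN_subset_iff[of I \<K> P] by blast
      finally show "P \<in> \<Union>\<K> \<longleftrightarrow> P \<in> {P. monoid_prime P A \<and> \<not> (\<Union>U\<in>\<K>. I U) \<subseteq> P}"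
        by (simp only: mem_Collect_eq)
    qed
    ultimately show ?thesis by (intro exI conjI)
  qed
  ultimately show ?thesis
    unfolding istopology_def by (intro conjI allI impI) (elim exE conjE, simp, simp)
qed


section \<open>Schemes over the field with one element\<close>

text \<open>
  The witnesses \<open>A\<close> in the following definitions range over monoids on the type of sections of \<open>X\<close>. This is no
  restriction: \<open>A\<close> is isomorphic to the monoid of global sections of its spectrum, hence to the
  monoid of sections of \<open>X\<close> over \<open>U\<close>.
\<close>

definition affine_open :: "('p, 'm) monoidal_space \<Rightarrow> 'p set \<Rightarrow> bool" where
  "affine_open X U \<longleftrightarrow>
     openin (topo X) U \<and>
     (\<exists>A f \<phi>. comm_monoid (A :: 'm monoid) \<and>
        monoidal_space_iso (open_subspace X U) (monoid_spec A) f \<phi>)"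

locale F1_scheme = monoid_sheaf X for X :: "('p, 'm) monoidal_space" +
  assumes locally_affine: "\<And>x. x \<in> topspace (topo X) \<Longrightarrow> \<exists>U. x \<in> U \<and> affine_open X U"

definition finitely_generated_monoid :: "'m monoid \<Rightarrow> bool" where
  "finitely_generated_monoid A \<longleftrightarrow>
     (\<exists>E. finite E \<and> E \<subseteq> carrier A \<and> (\<forall>H. submonoid H A \<and> E \<subseteq> H \<longrightarrow> H = carrier A))"

locale F1_scheme_of_finite_type = F1_scheme X for X :: "('p, 'm) monoidal_space" +
  assumes finite_type: "\<exists>\<U>. finite \<U> \<and> \<Union>\<U> = topspace (topo X) \<and>
    (\<forall>U\<in>\<U>. openin (topo X) U \<and>
       (\<exists>A f \<phi>. comm_monoid (A :: 'm monoid) \<and> finitely_generated_monoid A \<and>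
          monoidal_space_iso (open_subspace X U) (monoid_spec A) f \<phi>))"


section \<open>Spectra of rings\<close>

definition zariski :: "'r ring \<Rightarrow> 'r set topology" where
  "zariski R = topology (\<lambda>U. \<exists>I. ideal I R \<and> U = {P. primeideal P R \<and> \<not> I \<subseteq> P})"

definition ring_spec :: "'r ring \<Rightarrow> ('r set, 'r set \<Rightarrow> ('r \<times> 'r) set) ringed_space" where
  "ring_spec R =
     \<lparr>topo = zariski R,
      sect = (\<lambda>U.
        \<lparr>carrier = structure_sections R (zariski R) U,
         monoid.mult = (\<lambda>s t. \<lambda>P\<in>U. s P \<otimes>\<^bsub>ring_localisation R (carrier R - P)\<^esub> t P),
         one = (\<lambda>P\<in>U. \<one>\<^bsub>ring_localisation R (carrier R - P)\<^esub>),
         zero = (\<lambda>P\<in>U. \<zero>\<^bsub>ring_localisation R (carrier R - P)\<^esub>),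
         add = (\<lambda>s t. \<lambda>P\<in>U. s P \<oplus>\<^bsub>ring_localisation R (carrier R - P)\<^esub> t P)\<rparr>),
      restr = (\<lambda>U V s. restrict s V)\<rparr>"

text \<open>
  A ring homomorphism \<open>h\<close> from \<open>R\<close> to \<open>S\<close> induces \<open>ring_spec_map R h\<close> from the spectrum of \<open>S\<close> to
  that of \<open>R\<close>, and, via the maps \<open>a / f \<mapsto> h a / h f\<close> on localisations, the pullback
  \<open>ring_spec_comap R S h U\<close> of sections over an open set \<open>U\<close> of primes of \<open>R\<close>.
\<close>

definition ring_spec_map :: "'r ring \<Rightarrow> ('r \<Rightarrow> 's) \<Rightarrow> 's set \<Rightarrow> 'r set" where
  "ring_spec_map R h Q = {a \<in> carrier R. h a \<in> Q}"

definition ring_spec_comap ::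
    "'r ring \<Rightarrow> 's ring \<Rightarrow> ('r \<Rightarrow> 's) \<Rightarrow> 'r set set
      \<Rightarrow> ('r set \<Rightarrow> ('r \<times> 'r) set) \<Rightarrow> ('s set \<Rightarrow> ('s \<times> 's) set)" where
  "ring_spec_comap R S h U s =
     (\<lambda>Q \<in> preim (ring_spec S) (ring_spec_map R h) U.
        \<Union>(a, f)\<in>s (ring_spec_map R h Q). fraction S (carrier S - Q) (h a) (h f))"

lemma istopology_zariski:
  assumes "cring R"
  shows "istopology (\<lambda>U. \<exists>I. ideal I R \<and> U = {P. primeideal P R \<and> \<not> I \<subseteq> P})"
proof -
  interpret cring R by fact
  have "\<exists>K. ideal K R \<and>
      {P. primeideal P R \<and> \<not> I \<subseteq> P} \<inter> {P. primeideal P R \<and> \<not> J \<subseteq> P} =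
      {P. primeideal P R \<and> \<not> K \<subseteq> P}"
    if IJ: "ideal I R" "ideal J R" for I J
  proof (intro exI[of _ "I \<inter> J"] conjI)
    interpret I: ideal I R by fact
    interpret J: ideal J R by fact
    show "ideal (I \<inter> J) R"
      using IJ by (rule i_intersect)
    have "I \<subseteq> P \<or> J \<subseteq> P" if P: "primeideal P R" and sub: "I \<inter> J \<subseteq> P" for P
    proof (rule ccontr)
      assume "\<not> (I \<subseteq> P \<or> J \<subseteq> P)"
      then obtain x y where xy: "x \<in> I" "x \<notin> P" "y \<in> J" "y \<notin> P" by blast
      have c: "x \<in> carrier R" "y \<in> carrier R"
        using xy by auto
      have "x \<otimes>\<^bsub>R\<^esub> y \<in> I \<inter> J"
        using xy c I.I_r_closed J.I_l_closed by auto
      then have "x \<otimes>\<^bsub>R\<^esub> y \<in> P" using sub by blast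
      then show False using primeideal.I_prime[OF P c] xy by blast
    qed
    then show "{P. primeideal P R \<and> \<not> I \<subseteq> P} \<inter> {P. primeideal P R \<and> \<not> J \<subseteq> P} =
      {P. primeideal P R \<and> \<not> I \<inter> J \<subseteq> P}" by blast
  qed
  moreover have "\<exists>K. ideal K R \<and> \<Union>\<K> = {P. primeideal P R \<and> \<not> K \<subseteq> P}"
    if K: "\<forall>U\<in>\<K>. \<exists>I. ideal I R \<and> U = {P. primeideal P R \<and> \<not> I \<subseteq> P}" for \<K>
  proof -
    obtain I where I: "\<And>U. U \<in> \<K> \<Longrightarrow> ideal (I U) R"
        "\<And>U. U \<in> \<K> \<Longrightarrow> U = {P. primeideal P R \<and> \<not> I U \<subseteq> P}"
      using bchoice[OF K] by blast
    have mem: "P \<in> U \<longleftrightarrow> primeideal P R \<and> \<not> I U \<subseteq> P" if "U \<in> \<K>" for U P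
      using arg_cong[OF I(2)[OF that], of "\<lambda>S. P \<in> S"] by (simp only: mem_Collect_eq)
    have sub: "(\<Union>U\<in>\<K>. I U) \<subseteq> carrier R"
      by (intro UN_least subsetI) (rule ideal.Icarr[OF I(1)])
    have idl: "Idl\<^bsub>R\<^esub> (\<Union>U\<in>\<K>. I U) \<subseteq> P \<longleftrightarrow> (\<forall>U\<in>\<K>. I U \<subseteq> P)" if "primeideal P R" for P
    proof
      assume "Idl\<^bsub>R\<^esub> (\<Union>U\<in>\<K>. I U) \<subseteq> P"
      then show "\<forall>U\<in>\<K>. I U \<subseteq> P" using genideal_self[OF sub] by blast
    next
      assume "\<forall>U\<in>\<K>. I U \<subseteq> P"
      then have "(\<Union>U\<in>\<K>. I U) \<subseteq> P" by blast
      then show "Idl\<^bsub>R\<^esub> (\<Union>U\<in>\<K>. I U) \<subseteq> P"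
        using genideal_minimal[of P "\<Union>U\<in>\<K>. I U"] primeideal.axioms(1)[OF that] by blast
    qed
    have union: "\<Union>\<K> = {P. primeideal P R \<and> \<not> Idl\<^bsub>R\<^esub> (\<Union>U\<in>\<K>. I U) \<subseteq> P}"
    proof (rule Set.set_eqI)
      fix P
      have "P \<in> \<Union>\<K> \<longleftrightarrow> (\<exists>U\<in>\<K>. P \<in> U)" by (rule Union_iff)
      also have "\<dots> \<longleftrightarrow> (\<exists>U\<in>\<K>. primeideal P R \<and> \<not> I U \<subseteq> P)"
        by (rule bex_cong[OF refl mem])
      also have "\<dots> \<longleftrightarrow> primeideal P R \<and> \<not> Idl\<^bsub>R\<^esub> (\<Union>U\<in>\<K>. I U) \<subseteq> P"
        using idl[of P] by blast
      finally show "P \<in> \<Union>\<K> \<longleftrightarrow> P \<in> {P. primeideal P R \<and> \<not> Idl\<^bsub>R\<^esub> (\<Union>U\<in>\<K>. I U) \<subseteq> P}"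
        by (simp only: mem_Collect_eq)
    qed
    show ?thesis
      by (rule exI, rule conjI, rule genideal_ideal[OF sub], rule union)
  qed
  ultimately show ?thesis
    unfolding istopology_def by (intro conjI allI impI) (elim exE conjE, simp, simp)
qed


section \<open>Morphisms of locally ringed spaces\<close>

definition germ :: "('p, 's) ringed_space \<Rightarrow> 'p \<Rightarrow> 'p set \<Rightarrow> 's \<Rightarrow> ('p set \<times> 's) set" where
  "germ X x U s =
     {(V, t). openin (topo X) V \<and> x \<in> V \<and> t \<in> carrier (sect X V) \<and>
        (\<exists>W. openin (topo X) W \<and> x \<in> W \<and> W \<subseteq> U \<inter> V \<and> restr X U W s = restr X V W t)}"

definition stalk :: "('p, 's) ringed_space \<Rightarrow> 'p \<Rightarrow> ('p set \<times> 's) set ring" where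
  "stalk X x =
    (let lift = (\<lambda>f A B. \<Union>(U, s)\<in>A. \<Union>(V, t)\<in>B.
           germ X x (U \<inter> V)
             (f (sect X (U \<inter> V)) (restr X U (U \<inter> V) s) (restr X V (U \<inter> V) t)));
         E = topspace (topo X)
     in \<lparr>carrier = {germ X x U s | U s.
            openin (topo X) U \<and> x \<in> U \<and> s \<in> carrier (sect X U)},
         monoid.mult = lift monoid.mult, one = germ X x E \<one>\<^bsub>sect X E\<^esub>,
         zero = germ X x E \<zero>\<^bsub>sect X E\<^esub>, add = lift ring.add\<rparr>)"

text \<open>
  Locality of the maps on stalks: the preimage of the maximal ideal, which consists of the
  non-units, is the maximal ideal. The extensionality conditions remove the junk values of \<open>f\<close>
  and \<open>\<phi>\<close> outside their domains, so that morphisms can be counted.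
\<close>

definition lrs_morphisms ::
    "('p, 's) ringed_space \<Rightarrow> ('p', 's') ringed_space
      \<Rightarrow> (('p \<Rightarrow> 'p') \<times> ('p' set \<Rightarrow> 's' \<Rightarrow> 's)) set" where
  "lrs_morphisms X Y =
     {(f, \<phi>).
        f \<in> extensional (topspace (topo X)) \<and> continuous_map (topo X) (topo Y) f \<and>
        \<phi> \<in> (\<Pi>\<^sub>E V\<in>{V. openin (topo Y) V}.
              ring_hom (sect Y V) (sect X (preim X f V)) \<inter> extensional (carrier (sect Y V))) \<and>
        (\<forall>V W. openin (topo Y) V \<and> openin (topo Y) W \<and> W \<subseteq> V \<longrightarrow>
           (\<forall>s\<in>carrier (sect Y V).
              \<phi> W (restr Y V W s) = restr X (preim X f V) (preim X f W) (\<phi> V s))) \<and>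
        (\<forall>x\<in>topspace (topo X). \<forall>V s.
           openin (topo Y) V \<and> f x \<in> V \<and> s \<in> carrier (sect Y V) \<longrightarrow>
             (germ X x (preim X f V) (\<phi> V s) \<in> Units (stalk X x) \<longleftrightarrow>
              germ Y (f x) V s \<in> Units (stalk Y (f x))))}"


section \<open>Ascent\<close>

definition monoid_ring :: "'m monoid \<Rightarrow> ('m \<Rightarrow>\<^sub>0 int) ring" where
  "monoid_ring A =
     \<lparr>carrier = {c. Poly_Mapping.keys c \<subseteq> carrier A},
      monoid.mult = (\<lambda>c d. frag_extend (\<lambda>a. frag_extend (\<lambda>b. frag_of (a \<otimes>\<^bsub>A\<^esub> b)) d) c),
      one = frag_of \<one>\<^bsub>A\<^esub>, zero = 0, add = (+)\<rparr>"

definition monoid_ring_map :: "('m \<Rightarrow> 'n) \<Rightarrow> ('m \<Rightarrow>\<^sub>0 int) \<Rightarrow> ('n \<Rightarrow>\<^sub>0 int)" where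
  "monoid_ring_map h = frag_extend (\<lambda>a. frag_of (h a))"

text \<open>
  Gluing of ringed spaces \<open>Y i\<close>, for \<open>i \<in> I\<close>, along morphisms \<open>(f i j, \<phi> i j)\<close> from \<open>Y i\<close> to \<open>Y j\<close>
  given for \<open>below i j\<close>: the quotient space of the disjoint union by the equivalence relation
  generated by \<open>(i, p) \<sim> (j, f i j p)\<close>, whose sections over \<open>V\<close> are the compatible families of
  sections of the \<open>Y i\<close> over the preimages of \<open>V\<close>.
\<close>

definition glue_class ::
    "'i set \<Rightarrow> ('i \<Rightarrow> 'i \<Rightarrow> bool) \<Rightarrow> ('i \<Rightarrow> ('p, 's) ringed_space) \<Rightarrow> ('i \<Rightarrow> 'i \<Rightarrow> 'p \<Rightarrow> 'p)
      \<Rightarrow> 'i \<Rightarrow> 'p \<Rightarrow> ('i \<times> 'p) set" where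
  "glue_class I below Y f i p =
    (let E = {((j, q), (k, f j k q)) | j k q.
                j \<in> I \<and> k \<in> I \<and> below j k \<and> q \<in> topspace (topo (Y j))}
     in (E \<union> E\<inverse>)\<^sup>* `` {(i, p)})"

definition glue_topology ::
    "'i set \<Rightarrow> ('i \<Rightarrow> 'i \<Rightarrow> bool) \<Rightarrow> ('i \<Rightarrow> ('p, 's) ringed_space) \<Rightarrow> ('i \<Rightarrow> 'i \<Rightarrow> 'p \<Rightarrow> 'p)
      \<Rightarrow> ('i \<times> 'p) set topology" where
  "glue_topology I below Y f =
     topology (\<lambda>V. V \<subseteq> {glue_class I below Y f i p | i p. i \<in> I \<and> p \<in> topspace (topo (Y i))} \<and>
       (\<forall>i\<in>I. openin (topo (Y i)) (preim (Y i) (glue_class I below Y f i) V)))"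

definition glue ::
    "'i set \<Rightarrow> ('i \<Rightarrow> 'i \<Rightarrow> bool) \<Rightarrow> ('i \<Rightarrow> ('p, 's) ringed_space) \<Rightarrow> ('i \<Rightarrow> 'i \<Rightarrow> 'p \<Rightarrow> 'p)
      \<Rightarrow> ('i \<Rightarrow> 'i \<Rightarrow> 'p set \<Rightarrow> 's \<Rightarrow> 's) \<Rightarrow> (('i \<times> 'p) set, 'i \<Rightarrow> 's) ringed_space" where
  "glue I below Y f \<phi> =
    (let pre = (\<lambda>V i. preim (Y i) (glue_class I below Y f i) V)
     in \<lparr>topo = glue_topology I below Y f,
         sect = (\<lambda>V.
           \<lparr>carrier = {s \<in> (\<Pi>\<^sub>E i\<in>I. carrier (sect (Y i) (pre V i))).
              \<forall>i\<in>I. \<forall>j\<in>I. below i j \<longrightarrow> \<phi> i j (pre V j) (s j) = s i},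
            monoid.mult = (\<lambda>s t. \<lambda>i\<in>I. s i \<otimes>\<^bsub>sect (Y i) (pre V i)\<^esub> t i),
            one = (\<lambda>i\<in>I. \<one>\<^bsub>sect (Y i) (pre V i)\<^esub>),
            zero = (\<lambda>i\<in>I. \<zero>\<^bsub>sect (Y i) (pre V i)\<^esub>),
            add = (\<lambda>s t. \<lambda>i\<in>I. s i \<oplus>\<^bsub>sect (Y i) (pre V i)\<^esub> t i)\<rparr>),
         restr = (\<lambda>V W s. \<lambda>i\<in>I. restr (Y i) (pre V i) (pre W i) (s i))\<rparr>)"

lemma preim_Int: "preim X g (V \<inter> W) = preim X g V \<inter> preim X g W"
  by (auto simp: preim_def)

lemma preim_Union: "preim X g (\<Union>\<K>) = (\<Union>V\<in>\<K>. preim X g V)"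
  by (auto simp: preim_def)

lemma istopology_glue:
  "istopology (\<lambda>V. V \<subseteq> {glue_class I below Y f i p | i p. i \<in> I \<and> p \<in> topspace (topo (Y i))} \<and>
     (\<forall>i\<in>I. openin (topo (Y i)) (preim (Y i) (glue_class I below Y f i) V)))"
  (is "istopology (\<lambda>V. V \<subseteq> ?E \<and> ?Q V)")
  unfolding istopology_def
proof (intro conjI allI impI)
  fix V W assume V: "V \<subseteq> ?E \<and> ?Q V" and W: "W \<subseteq> ?E \<and> ?Q W"
  show "V \<inter> W \<subseteq> ?E" using V by blast
  show "?Q (V \<inter> W)" using V W unfolding preim_Int by (meson openin_Int)
next
  fix \<K> assume K: "\<forall>V\<in>\<K>. V \<subseteq> ?E \<and> ?Q V"
  show "\<Union>\<K> \<subseteq> ?E" using K by (meson Sup_least)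
  show "?Q (\<Union>\<K>)"
  proof
    fix i assume "i \<in> I"
    then show "openin (topo (Y i)) (preim (Y i) (glue_class I below Y f i) (\<Union>\<K>))"
      unfolding preim_Union by (intro openin_Union) (use K in force)
  qed
qed

text \<open>
  The \<open>\<int>\<close>-scheme of \<open>X\<close>: the spectra of the rings \<open>\<int>[A]\<close>, where \<open>A\<close> is the monoid of sections over
  an affine open \<open>U\<close> (so that \<open>U\<close> is isomorphic to the spectrum of \<open>A\<close>), glued along the maps
  induced by restriction to smaller affine opens.
\<close>

definition ascent ::
    "('p, 'm) monoidal_space
      \<Rightarrow> (('p set \<times> ('m \<Rightarrow>\<^sub>0 int) set) set,
          'p set \<Rightarrow> ('m \<Rightarrow>\<^sub>0 int) set \<Rightarrow> (('m \<Rightarrow>\<^sub>0 int) \<times> ('m \<Rightarrow>\<^sub>0 int)) set) ringed_space" where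
  "ascent X =
    (let R = (\<lambda>U. monoid_ring (sect X U))
     in glue {U. affine_open X U} (\<subseteq>) (\<lambda>U. ring_spec (R U))
          (\<lambda>W U. ring_spec_map (R U) (monoid_ring_map (restr X U W)))
          (\<lambda>W U. ring_spec_comap (R U) (R W) (monoid_ring_map (restr X U W))))"


section \<open>Points over finite fields\<close>

definition valued_points ::
    "('p, 's) ringed_space \<Rightarrow> 'k ring
      \<Rightarrow> (('k set \<Rightarrow> 'p) \<times> ('p set \<Rightarrow> 's \<Rightarrow> 'k set \<Rightarrow> ('k \<times> 'k) set)) set" where
  "valued_points Y K = lrs_morphisms (ring_spec K) Y"

text \<open>
  Finite fields are represented on the type \<open>nat\<close>, where every finite field has an isomorphic copy.
\<close>

definition counts_points :: "('p, 'm) monoidal_space \<Rightarrow> nat \<Rightarrow> int poly \<Rightarrow> bool" where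
  "counts_points X e N \<longleftrightarrow>
     (\<forall>q::nat. primepow q \<longrightarrow> gcd (q - 1) e = 1 \<longrightarrow>
        (\<forall>K :: nat ring. field K \<and> card (carrier K) = q \<longrightarrow>
           finite (valued_points (ascent X) K) \<and>
           int (card (valued_points (ascent X) K)) = poly N (int q)))"

end

theory Submission
  imports
    Defs
    "HOL-Algebra.Algebraic_Closure_Type"
    "HOL-Algebra.Multiplicative_Group"
    "HOL-Algebra.Free_Abelian_Groups"
    "HOL-Library.Z2"
    "HOL-Number_Theory.Number_Theory"
begin

text \<open>
  Every affine open \<open>U\<close> of \<open>X\<close> is the smallest neighbourhood of its closed point, so \<open>X\<close> has finitely
  many of them, and each prime of \<open>\<int>[\<Gamma>(U)]\<close> comes from exactly one affine open \<open>V \<subseteq> U\<close> and a prime of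
  \<open>\<int>[\<Gamma>(V)]\<close> that contains precisely the nonunits of \<open>\<Gamma>(V)\<close>. Hence a \<open>K\<close>-valued point of the ascent is an
  affine open \<open>V\<close> with a ring homomorphism from \<open>\<int>[\<Gamma>(V)]\<close> to \<open>K\<close> that vanishes exactly on the nonunits of
  \<open>\<Gamma>(V)\<close>, that is, with a character of the finitely generated group of units of \<open>\<Gamma>(V)\<close>. If \<open>q - 1\<close> is
  prime to the order of the torsion of this group, there are \<open>(q - 1)\<^sup>r\<close> characters with values in the
  units of the field with \<open>q\<close> elements, where \<open>r\<close> is the rank. The polynomial is unique since for each
  \<open>e > 0\<close> there are infinitely many powers \<open>q\<close> of \<open>2\<close> with \<open>q - 1\<close> prime to \<open>e\<close>.
\<close>

text \<open>Where the unique affine open \<open>V\<close> comes from: a prime of the monoid ring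
  meets the monoid of sections over \<open>U\<close> in a monoid prime. Finite generation makes the
  primes inside a given one a basic open set, so every point has a least neighbourhood and
  localising at a prime is restricting to that neighbourhood. The monoid prime then consists of the
  sections that do not become units on \<open>V\<close>.

  The obstacle is that the ascent glues all affine opens at once along the equivalence relation
  generated by restriction, so that equal points are a priori linked only by zigzags. The centre
  does not change along any link; equivalent points therefore come from one point of a chart below
  both, and no zigzag has to be analysed.

  Characters are counted by adjoining generators one at a time, and \<open>e\<close> arises as a
  product of relative orders over all affine opens. It has to be positive: for \<open>e = 0\<close>
  the condition would leave only \<open>q = 2\<close>, and a single value determines no
  polynomial.\<close>

no_notation Polynomials.var ("X\<index>")

subsection \<open>Fractions\<close>

locale fraction_setting = comm_monoid M for M (structure) and S +
  assumes submonoid_S: "submonoid S M"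
begin

interpretation S: submonoid S M by (rule submonoid_S)

lemma S_carrier: "s \<in> S \<Longrightarrow> s \<in> carrier M"
  using S.subset by blast

text \<open>Cancellation fails in a monoid, so the middle denominator \<open>t\<close> cannot be
  removed. It is absorbed into the auxiliary factor, which is why that factor is
  \<open>u \<otimes> v \<otimes> t\<close>.\<close>

lemma fraction_relation_trans:
  assumes "a \<in> carrier M" "b \<in> carrier M" "c \<in> carrier M" "s \<in> S" "t \<in> S" "r \<in> S" "u \<in> S" "v \<in> S"
    and 1: "u \<otimes> (a \<otimes> t) = u \<otimes> (b \<otimes> s)" and 2: "v \<otimes> (b \<otimes> r) = v \<otimes> (c \<otimes> t)"
  shows "(u \<otimes> v \<otimes> t) \<otimes> (a \<otimes> r) = (u \<otimes> v \<otimes> t) \<otimes> (c \<otimes> s)"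
proof -
  note c = assms(1-3) assms(4-8)[THEN S_carrier]
  have "(u \<otimes> v \<otimes> t) \<otimes> (a \<otimes> r) = (u \<otimes> (a \<otimes> t)) \<otimes> (v \<otimes> r)"
    using c by (simp add: m_ac)
  also have "\<dots> = (v \<otimes> (b \<otimes> r)) \<otimes> (u \<otimes> s)"
    unfolding 1 using c by (simp add: m_ac)
  also have "\<dots> = (u \<otimes> v \<otimes> t) \<otimes> (c \<otimes> s)"
    unfolding 2 using c by (simp add: m_ac)
  finally show ?thesis .
qed

lemma mem_fraction:
  "(b, t) \<in> fraction M S a s \<longleftrightarrow>
     b \<in> carrier M \<and> t \<in> S \<and> (\<exists>u\<in>S. u \<otimes> (a \<otimes> t) = u \<otimes> (b \<otimes> s))"
  by (simp add: fraction_def)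

lemma fraction_self: "a \<in> carrier M \<Longrightarrow> s \<in> S \<Longrightarrow> (a, s) \<in> fraction M S a s"
  using S.one_closed by (auto simp: mem_fraction)

lemma fraction_mem_subset:
  assumes "a \<in> carrier M" "s \<in> S" "(b, t) \<in> fraction M S a s"
  shows "fraction M S a s \<subseteq> fraction M S b t" "fraction M S b t \<subseteq> fraction M S a s"
proof -
  obtain u where u: "u \<in> S" "u \<otimes> (a \<otimes> t) = u \<otimes> (b \<otimes> s)" "b \<in> carrier M" "t \<in> S"
    using assms by (auto simp: mem_fraction)
  show "fraction M S a s \<subseteq> fraction M S b t"
  proof safe
    fix c r assume "(c, r) \<in> fraction M S a s"
    then obtain v where v: "v \<in> S" "v \<otimes> (a \<otimes> r) = v \<otimes> (c \<otimes> s)" "c \<in> carrier M" "r \<in> S"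
      by (auto simp: mem_fraction)
    show "(c, r) \<in> fraction M S b t"
      unfolding mem_fraction
      using fraction_relation_trans[OF u(3) assms(1) v(3) u(4) assms(2) v(4) u(1) v(1) u(2)[symmetric] v(2)]
        u(1,4) v(1,3,4) assms(2) by (intro conjI bexI[of _ "u \<otimes> v \<otimes> s"]) simp_all
  qed
  show "fraction M S b t \<subseteq> fraction M S a s"
  proof safe
    fix c r assume "(c, r) \<in> fraction M S b t"
    then obtain v where v: "v \<in> S" "v \<otimes> (b \<otimes> r) = v \<otimes> (c \<otimes> t)" "c \<in> carrier M" "r \<in> S"
      by (auto simp: mem_fraction)
    show "(c, r) \<in> fraction M S a s"
      unfolding mem_fraction
      using fraction_relation_trans[OF assms(1) u(3) v(3) assms(2) u(4) v(4) u(1) v(1) u(2) v(2)]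
        u(1,4) v(1,3,4) by (intro conjI bexI[of _ "u \<otimes> v \<otimes> t"]) simp_all
  qed
qed

lemma fraction_mem_eq:
  "a \<in> carrier M \<Longrightarrow> s \<in> S \<Longrightarrow> (b, t) \<in> fraction M S a s \<Longrightarrow> fraction M S b t = fraction M S a s"
  by (intro equalityI fraction_mem_subset)

lemma fraction_eq_iff:
  assumes "a \<in> carrier M" "b \<in> carrier M" "s \<in> S" "t \<in> S"
  shows "fraction M S a s = fraction M S b t \<longleftrightarrow> (\<exists>u\<in>S. u \<otimes> (a \<otimes> t) = u \<otimes> (b \<otimes> s))"
proof
  assume "fraction M S a s = fraction M S b t"
  then have "(b, t) \<in> fraction M S a s"
    using assms fraction_self[of b t] by simp
  then show "\<exists>u\<in>S. u \<otimes> (a \<otimes> t) = u \<otimes> (b \<otimes> s)"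
    by (simp add: mem_fraction)
next
  assume "\<exists>u\<in>S. u \<otimes> (a \<otimes> t) = u \<otimes> (b \<otimes> s)"
  then show "fraction M S a s = fraction M S b t"
    using assms fraction_mem_eq[of a s b t] by (simp add: mem_fraction)
qed

lemma fraction_eqI:
  assumes "u \<otimes> (a \<otimes> t) = u \<otimes> (b \<otimes> s)" "u \<in> S" "a \<in> carrier M" "b \<in> carrier M" "s \<in> S" "t \<in> S"
  shows "fraction M S a s = fraction M S b t"
  using assms fraction_eq_iff by blast

lemma fractionsI: "a \<in> carrier M \<Longrightarrow> s \<in> S \<Longrightarrow> fraction M S a s \<in> fractions M S"
  by (auto simp: fractions_def)

lemma fractionsE:
  assumes "x \<in> fractions M S"
  obtains a s where "a \<in> carrier M" "s \<in> S" "x = fraction M S a s"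
  using assms by (auto simp: fractions_def)

lemma fractions_mem:
  assumes "x \<in> fractions M S" "(a, s) \<in> x"
  shows "a \<in> carrier M" "s \<in> S" "x = fraction M S a s"
proof -
  obtain b t where bt: "b \<in> carrier M" "t \<in> S" "x = fraction M S b t"
    using assms(1) by (rule fractionsE)
  show "a \<in> carrier M" "s \<in> S"
    using assms(2) unfolding bt by (simp_all add: mem_fraction)
  show "x = fraction M S a s"
    using fraction_mem_eq[OF bt(1,2)] assms(2) unfolding bt by simp
qed

text \<open>Operations on fractions, and later the maps induced on localisations, are unions over
  all representatives. Such a union is the common value as soon as the value is independent of the
  representative; a fraction is never empty because it contains the pair that defines it.\<close>

lemma UN_fraction_eq:
  assumes "x \<in> fractions M S" "\<And>a s. (a, s) \<in> x \<Longrightarrow> F a s = c"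
  shows "(\<Union>(a, s)\<in>x. F a s) = c"
proof -
  obtain a s where "(a, s) \<in> x"
    using assms(1) fraction_self by (auto simp: fractions_def)
  then have ne: "x \<noteq> {}" by blast
  have "(\<Union>(a, s)\<in>x. F a s) = (\<Union>p\<in>x. c)"
    by (rule SUP_cong) (use assms(2) in auto)
  with ne show ?thesis by simp
qed

lemma fraction_mult_fraction:
  assumes "a \<in> carrier M" "b \<in> carrier M" "s \<in> S" "t \<in> S"
  shows "fraction_mult M S (fraction M S a s) (fraction M S b t) = fraction M S (a \<otimes> b) (s \<otimes> t)"
  unfolding fraction_mult_def
proof (intro UN_fraction_eq fractionsI assms)
  fix a' s' b' t' assume 1: "(a', s') \<in> fraction M S a s" and 2: "(b', t') \<in> fraction M S b t"
  from 1 obtain u where u: "u \<in> S" "u \<otimes> (a \<otimes> s') = u \<otimes> (a' \<otimes> s)" "a' \<in> carrier M" "s' \<in> S"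
    by (auto simp: mem_fraction)
  from 2 obtain v where v: "v \<in> S" "v \<otimes> (b \<otimes> t') = v \<otimes> (b' \<otimes> t)" "b' \<in> carrier M" "t' \<in> S"
    by (auto simp: mem_fraction)
  note c = assms(1,2) u(3) v(3) assms(3,4)[THEN S_carrier] u(1,4)[THEN S_carrier] v(1,4)[THEN S_carrier]
  have "(u \<otimes> v) \<otimes> ((a \<otimes> b) \<otimes> (s' \<otimes> t')) = (u \<otimes> (a \<otimes> s')) \<otimes> (v \<otimes> (b \<otimes> t'))"
    using c by (simp add: m_ac)
  also have "\<dots> = (u \<otimes> v) \<otimes> ((a' \<otimes> b') \<otimes> (s \<otimes> t))"
    unfolding u(2) v(2) using c by (simp add: m_ac)
  finally show "fraction M S (a' \<otimes> b') (s' \<otimes> t') = fraction M S (a \<otimes> b) (s \<otimes> t)"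
    by (rule fraction_eqI[OF sym]) (use c u(1,4) v(1,4) assms in auto)
qed

end

lemma fraction_add_fraction:
  assumes "cring R" "submonoid S R" "a \<in> carrier R" "b \<in> carrier R" "s \<in> S" "t \<in> S"
  shows "fraction_add R S (fraction R S a s) (fraction R S b t) =
    fraction R S ((a \<otimes>\<^bsub>R\<^esub> t) \<oplus>\<^bsub>R\<^esub> (b \<otimes>\<^bsub>R\<^esub> s)) (s \<otimes>\<^bsub>R\<^esub> t)"
proof -
  interpret cring R by fact
  interpret S: submonoid S R by fact
  interpret fraction_setting R S
    by (intro fraction_setting.intro fraction_setting_axioms.intro assms comm_monoid_axioms)
  note assms = assms(3-)
  show ?thesis
    unfolding fraction_add_def
  proof (intro UN_fraction_eq fractionsI assms)
    fix a' s' b' t' assume 1: "(a', s') \<in> fraction R S a s" and 2: "(b', t') \<in> fraction R S b t"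
    from 1 obtain u where u: "u \<in> S" "u \<otimes>\<^bsub>R\<^esub> (a \<otimes>\<^bsub>R\<^esub> s') = u \<otimes>\<^bsub>R\<^esub> (a' \<otimes>\<^bsub>R\<^esub> s)" "a' \<in> carrier R" "s' \<in> S"
      by (auto simp: mem_fraction)
    from 2 obtain v where v: "v \<in> S" "v \<otimes>\<^bsub>R\<^esub> (b \<otimes>\<^bsub>R\<^esub> t') = v \<otimes>\<^bsub>R\<^esub> (b' \<otimes>\<^bsub>R\<^esub> t)" "b' \<in> carrier R" "t' \<in> S"
      by (auto simp: mem_fraction)
    have c: "a' \<in> carrier R" "b' \<in> carrier R" "s' \<in> carrier R" "t' \<in> carrier R" "u \<in> carrier R" "v \<in> carrier R"
        "a \<in> carrier R" "b \<in> carrier R" "s \<in> carrier R" "t \<in> carrier R"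
      using u(1,3,4) v(1,3,4) assms by (auto intro: S_carrier)
    have "(u \<otimes>\<^bsub>R\<^esub> v) \<otimes>\<^bsub>R\<^esub> (((a \<otimes>\<^bsub>R\<^esub> t) \<oplus>\<^bsub>R\<^esub> (b \<otimes>\<^bsub>R\<^esub> s)) \<otimes>\<^bsub>R\<^esub> (s' \<otimes>\<^bsub>R\<^esub> t')) =
        (u \<otimes>\<^bsub>R\<^esub> (a \<otimes>\<^bsub>R\<^esub> s')) \<otimes>\<^bsub>R\<^esub> (v \<otimes>\<^bsub>R\<^esub> (t \<otimes>\<^bsub>R\<^esub> t')) \<oplus>\<^bsub>R\<^esub> (v \<otimes>\<^bsub>R\<^esub> (b \<otimes>\<^bsub>R\<^esub> t')) \<otimes>\<^bsub>R\<^esub> (u \<otimes>\<^bsub>R\<^esub> (s \<otimes>\<^bsub>R\<^esub> s'))"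
      using c by (simp add: l_distr r_distr m_ac)
    also have "\<dots> = (u \<otimes>\<^bsub>R\<^esub> v) \<otimes>\<^bsub>R\<^esub> (((a' \<otimes>\<^bsub>R\<^esub> t') \<oplus>\<^bsub>R\<^esub> (b' \<otimes>\<^bsub>R\<^esub> s')) \<otimes>\<^bsub>R\<^esub> (s \<otimes>\<^bsub>R\<^esub> t))"
      unfolding u(2) v(2) using c by (simp add: l_distr r_distr m_ac)
    finally show "fraction R S ((a' \<otimes>\<^bsub>R\<^esub> t') \<oplus>\<^bsub>R\<^esub> (b' \<otimes>\<^bsub>R\<^esub> s')) (s' \<otimes>\<^bsub>R\<^esub> t') =
        fraction R S ((a \<otimes>\<^bsub>R\<^esub> t) \<oplus>\<^bsub>R\<^esub> (b \<otimes>\<^bsub>R\<^esub> s)) (s \<otimes>\<^bsub>R\<^esub> t)"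
      by (rule fraction_eqI[OF sym]) (use c u(1,4) v(1,4) assms in auto)
  qed
qed

subsection \<open>Monoid rings\<close>

lemma frag_cmul_diff2: "frag_cmul k (a - b) = frag_cmul k a - frag_cmul k b"
  by (rule poly_mapping_eqI) (simp add: lookup_minus algebra_simps)

lemma frag_extend_diff_fun:
  "frag_extend (\<lambda>x. f x - g x) c = frag_extend f c - frag_extend g c"
  by (simp add: frag_extend_def frag_cmul_diff2 sum_subtractf)

lemma carrier_monoid_ring [simp]: "c \<in> carrier (monoid_ring A) \<longleftrightarrow> Poly_Mapping.keys c \<subseteq> carrier A"
  by (simp add: monoid_ring_def)

lemma monoid_ring_one [simp]: "\<one>\<^bsub>monoid_ring A\<^esub> = frag_of \<one>\<^bsub>A\<^esub>"
  and monoid_ring_zero [simp]: "\<zero>\<^bsub>monoid_ring A\<^esub> = 0"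
  and monoid_ring_add [simp]: "c \<oplus>\<^bsub>monoid_ring A\<^esub> d = c + d"
  by (simp_all add: monoid_ring_def)

lemma monoid_ring_mult_of [simp]:
  "frag_of a \<otimes>\<^bsub>monoid_ring A\<^esub> d = frag_extend (\<lambda>b. frag_of (a \<otimes>\<^bsub>A\<^esub> b)) d"
  by (simp add: monoid_ring_def)

lemma monoid_ring_diff_l: "(c - d) \<otimes>\<^bsub>monoid_ring A\<^esub> x = c \<otimes>\<^bsub>monoid_ring A\<^esub> x - d \<otimes>\<^bsub>monoid_ring A\<^esub> x"
  by (simp add: monoid_ring_def frag_extend_diff)

lemma monoid_ring_diff_r: "x \<otimes>\<^bsub>monoid_ring A\<^esub> (c - d) = x \<otimes>\<^bsub>monoid_ring A\<^esub> c - x \<otimes>\<^bsub>monoid_ring A\<^esub> d"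
  by (simp add: monoid_ring_def frag_extend_diff frag_extend_diff_fun)

lemma monoid_ring_zero_mult [simp]:
  "0 \<otimes>\<^bsub>monoid_ring A\<^esub> x = 0" "x \<otimes>\<^bsub>monoid_ring A\<^esub> 0 = 0"
  by (simp_all add: monoid_ring_def frag_extend_eq_0)

text \<open>Subtraction alone generates the free abelian group from its basis. One inductive step
  thus covers sums, negatives and integer multiples, and a property that respects differences needs
  checking on 0 and on monomials only.\<close>

lemma monoid_ring_induct [consumes 1, case_names zero one diff]:
  assumes "c \<in> carrier (monoid_ring A)" "P 0" "\<And>a. a \<in> carrier A \<Longrightarrow> P (frag_of a)"
    "\<And>c d. c \<in> carrier (monoid_ring A) \<Longrightarrow> d \<in> carrier (monoid_ring A) \<Longrightarrow> P c \<Longrightarrow> P d \<Longrightarrow> P (c - d)"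
  shows "P c"
proof -
  have "Poly_Mapping.keys c \<subseteq> carrier A" using assms(1) by simp
  then have "c \<in> carrier (monoid_ring A) \<and> P c"
  proof (induction rule: frag_induction)
    case (diff a b)
    then have "Poly_Mapping.keys (a - b) \<subseteq> carrier A" using keys_diff[of a b] by auto
    with diff show ?case using assms(4) by simp
  qed (use assms(2,3) in auto)
  then show ?thesis by simp
qed

lemma monoid_ring_mult_closed:
  assumes "comm_monoid A" "c \<in> carrier (monoid_ring A)" "d \<in> carrier (monoid_ring A)"
  shows "c \<otimes>\<^bsub>monoid_ring A\<^esub> d \<in> carrier (monoid_ring A)"
proof -
  interpret comm_monoid A by fact
  show ?thesis
    using assms(2,3) by (force simp: monoid_ring_def dest!: keys_frag_extend[THEN subsetD])
qed

lemma monoid_ring_mult_single: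
  "frag_of a \<otimes>\<^bsub>monoid_ring A\<^esub> frag_of b = frag_of (a \<otimes>\<^bsub>A\<^esub> b)"
  by simp

text \<open>Multiplication is additive in both arguments, so commutativity, associativity and the
  unit law descend by induction to monomials, where they are the laws of \<open>A\<close>.\<close>

lemma cring_monoid_ring:
  assumes "comm_monoid A"
  shows "cring (monoid_ring A)"
proof -
  interpret comm_monoid A by fact
  let ?R = "monoid_ring A"
  note closed = monoid_ring_mult_closed[OF assms]
  note bilin = monoid_ring_diff_l monoid_ring_diff_r
  have comm: "c \<otimes>\<^bsub>?R\<^esub> d = d \<otimes>\<^bsub>?R\<^esub> c" if c: "c \<in> carrier ?R" and d: "d \<in> carrier ?R" for c d
    using c
  proof (induction c rule: monoid_ring_induct)
    case (one a)
    show ?case using d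
      by (induction d rule: monoid_ring_induct)
        (simp_all only: bilin monoid_ring_mult_single monoid_ring_zero_mult m_comm[OF one])
  qed (simp_all only: bilin monoid_ring_zero_mult)
  have assoc: "(c \<otimes>\<^bsub>?R\<^esub> d) \<otimes>\<^bsub>?R\<^esub> e = c \<otimes>\<^bsub>?R\<^esub> (d \<otimes>\<^bsub>?R\<^esub> e)"
    if c: "c \<in> carrier ?R" and d: "d \<in> carrier ?R" and e: "e \<in> carrier ?R" for c d e
    using c
  proof (induction c rule: monoid_ring_induct)
    case (one a)
    show ?case using d
    proof (induction d rule: monoid_ring_induct)
      case (one b)
      show ?case using e
        by (induction e rule: monoid_ring_induct)
          (simp_all only: bilin monoid_ring_mult_single monoid_ring_zero_mult m_assoc[OF \<open>a \<in> carrier A\<close> one])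
    qed (simp_all only: bilin monoid_ring_zero_mult)
  qed (simp_all only: bilin monoid_ring_zero_mult)
  have l_one: "frag_of \<one>\<^bsub>A\<^esub> \<otimes>\<^bsub>?R\<^esub> c = c" if "c \<in> carrier ?R" for c
    using that by (induction c rule: monoid_ring_induct)
      (simp_all only: bilin monoid_ring_mult_single monoid_ring_zero_mult l_one)
  show ?thesis
  proof (rule cringI)
    show "abelian_group ?R"
    proof (rule abelian_groupI)
      fix x assume "x \<in> carrier ?R"
      then show "\<exists>y\<in>carrier ?R. y \<oplus>\<^bsub>?R\<^esub> x = \<zero>\<^bsub>?R\<^esub>"
        by (intro bexI[of _ "- x"]) simp_all
    qed (use keys_add in \<open>fastforce simp: add_ac\<close>)+
    show "comm_monoid ?R"
      using closed comm assoc l_one by (intro comm_monoidI) (auto simp del: monoid_ring_mult_of)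
    fix x y z
    assume xyz: "x \<in> carrier ?R" "y \<in> carrier ?R" "z \<in> carrier ?R"
    show "(x \<oplus>\<^bsub>?R\<^esub> y) \<otimes>\<^bsub>?R\<^esub> z = x \<otimes>\<^bsub>?R\<^esub> z \<oplus>\<^bsub>?R\<^esub> y \<otimes>\<^bsub>?R\<^esub> z"
      by (simp add: monoid_ring_def frag_extend_add)
  qed
qed

lemma monoid_ring_minus:
  assumes "comm_monoid A" "c \<in> carrier (monoid_ring A)" "d \<in> carrier (monoid_ring A)"
  shows "c - d \<in> carrier (monoid_ring A)" "c \<ominus>\<^bsub>monoid_ring A\<^esub> d = c - d"
proof -
  interpret R: cring "monoid_ring A" by (rule cring_monoid_ring[OF assms(1)])
  show "c - d \<in> carrier (monoid_ring A)"
    using assms(2,3) keys_diff[of c d] by auto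
  have "\<ominus>\<^bsub>monoid_ring A\<^esub> d = - d"
    using assms(3) by (intro R.minus_equality) auto
  then show "c \<ominus>\<^bsub>monoid_ring A\<^esub> d = c - d"
    by (simp add: a_minus_def)
qed

lemma monoid_ring_map_frag_of [simp]: "monoid_ring_map h (frag_of a) = frag_of (h a)"
  by (simp add: monoid_ring_map_def)

lemma monoid_ring_map_diff: "monoid_ring_map h (c - d) = monoid_ring_map h c - monoid_ring_map h d"
  by (simp add: monoid_ring_map_def frag_extend_diff)

lemma monoid_ring_map_hom:
  assumes "comm_monoid A" "comm_monoid B" "h \<in> hom A B" "h \<one>\<^bsub>A\<^esub> = \<one>\<^bsub>B\<^esub>"
  shows "monoid_ring_map h \<in> ring_hom (monoid_ring A) (monoid_ring B)"
proof (rule ring_hom_memI)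
  let ?h = "monoid_ring_map h" let ?A = "monoid_ring A" let ?B = "monoid_ring B"
  have z: "?h 0 = 0" by (simp add: monoid_ring_map_def)
  fix c assume c: "c \<in> carrier ?A"
  then show "?h c \<in> carrier ?B"
    using assms(3) by (force simp: monoid_ring_map_def hom_def dest!: keys_frag_extend[THEN subsetD])
  fix d assume d: "d \<in> carrier ?A"
  show "?h (c \<oplus>\<^bsub>?A\<^esub> d) = ?h c \<oplus>\<^bsub>?B\<^esub> ?h d"
    by (simp add: monoid_ring_map_def frag_extend_add)
  show "?h (c \<otimes>\<^bsub>?A\<^esub> d) = ?h c \<otimes>\<^bsub>?B\<^esub> ?h d"
    using c
  proof (induction c rule: monoid_ring_induct)
    case (one a)
    have mult: "h (a \<otimes>\<^bsub>A\<^esub> b) = h a \<otimes>\<^bsub>B\<^esub> h b" if "b \<in> carrier A" for b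
      using hom_mult[OF assms(3) one that] .
    show ?case using d
      by (induction d rule: monoid_ring_induct)
        (simp_all only: monoid_ring_diff_l monoid_ring_diff_r monoid_ring_mult_single monoid_ring_zero_mult
          monoid_ring_map_frag_of monoid_ring_map_diff mult z)
  qed (simp_all only: monoid_ring_diff_l monoid_ring_zero_mult monoid_ring_map_diff z)
next
  show "monoid_ring_map h \<one>\<^bsub>monoid_ring A\<^esub> = \<one>\<^bsub>monoid_ring B\<^esub>" by (simp add: assms(4))
qed

lemma monoid_ring_hom_diff:
  assumes "comm_monoid A" "ring R" "\<psi> \<in> ring_hom (monoid_ring A) R"
    "c \<in> carrier (monoid_ring A)" "d \<in> carrier (monoid_ring A)"
  shows "\<psi> (c - d) = \<psi> c \<ominus>\<^bsub>R\<^esub> \<psi> d"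
proof -
  interpret R: ring R by fact
  have m: "c - d \<in> carrier (monoid_ring A)" by (rule monoid_ring_minus(1)[OF assms(1,4,5)])
  have "\<psi> c = \<psi> (c - d) \<oplus>\<^bsub>R\<^esub> \<psi> d"
    using ring_hom_add[OF assms(3) m assms(5)] by simp
  then show ?thesis
    using ring_hom_closed[OF assms(3) m] ring_hom_closed[OF assms(3,5)]
    by (simp add: a_minus_def R.a_assoc R.r_neg)
qed

lemma monoid_ring_hom_zero:
  assumes "ring R" "\<psi> \<in> ring_hom (monoid_ring A) R"
  shows "\<psi> 0 = \<zero>\<^bsub>R\<^esub>"
proof -
  interpret R: ring R by fact
  have z: "0 \<in> carrier (monoid_ring A)" by simp
  have "\<psi> 0 \<oplus>\<^bsub>R\<^esub> \<psi> 0 = \<psi> 0" using ring_hom_add[OF assms(2) z z] by simp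
  then show ?thesis using ring_hom_closed[OF assms(2) z] by (simp add: R.add.l_cancel_one)
qed

lemma monoid_ring_hom_eqI:
  assumes "comm_monoid A" "ring R" "\<psi> \<in> ring_hom (monoid_ring A) R" "\<psi>' \<in> ring_hom (monoid_ring A) R"
    "\<And>a. a \<in> carrier A \<Longrightarrow> \<psi> (frag_of a) = \<psi>' (frag_of a)" "c \<in> carrier (monoid_ring A)"
  shows "\<psi> c = \<psi>' c"
  using assms(6)
  by (induction c rule: monoid_ring_induct)
    (simp_all only: monoid_ring_hom_diff[OF assms(1-3)] monoid_ring_hom_diff[OF assms(1,2,4)]
      monoid_ring_hom_zero[OF assms(2,3)] monoid_ring_hom_zero[OF assms(2,4)] assms(5))

text \<open>The adjunction between monoid rings and multiplicative monoids of rings. The additive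
  extension exists because the additive group of the monoid ring is free on \<open>A\<close>; it is
  multiplicative because it is so on monomials.\<close>

lemma monoid_ring_universal:
  assumes "comm_monoid A" "cring R" "\<chi> \<in> hom A R" "\<chi> \<one>\<^bsub>A\<^esub> = \<one>\<^bsub>R\<^esub>"
  shows "\<exists>\<psi>\<in>ring_hom (monoid_ring A) R. \<forall>a\<in>carrier A. \<psi> (frag_of a) = \<chi> a"
proof -
  interpret A: comm_monoid A by fact
  interpret R: cring R by fact
  let ?A = "monoid_ring A"
  obtain \<psi> where \<psi>: "\<psi> \<in> hom (free_Abelian_group (carrier A)) (add_monoid R)"
      "\<And>a. a \<in> carrier A \<Longrightarrow> \<psi> (frag_of a) = \<chi> a"
    using comm_group.free_Abelian_group_universal[OF R.a_comm_group, of \<chi> "carrier A"] assms(3)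
    by (auto simp: hom_def)
  have add: "\<psi> (c + d) = \<psi> c \<oplus>\<^bsub>R\<^esub> \<psi> d" if "c \<in> carrier ?A" "d \<in> carrier ?A" for c d
    using \<psi>(1) that by (auto simp: hom_def free_Abelian_group_def)
  have closed: "\<psi> c \<in> carrier R" if "c \<in> carrier ?A" for c
    using \<psi>(1) that by (auto simp: hom_def free_Abelian_group_def)
  have diff: "\<psi> (c - d) = \<psi> c \<ominus>\<^bsub>R\<^esub> \<psi> d" if "c \<in> carrier ?A" "d \<in> carrier ?A" for c d
  proof -
    have m: "c - d \<in> carrier ?A" by (rule monoid_ring_minus(1)[OF assms(1) that])
    have "\<psi> c = \<psi> (c - d) \<oplus>\<^bsub>R\<^esub> \<psi> d" using add[OF m that(2)] by simp
    then show ?thesis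
      using closed[OF m] closed[OF that(2)] by (simp add: a_minus_def R.a_assoc R.r_neg)
  qed
  have zero: "\<psi> 0 = \<zero>\<^bsub>R\<^esub>"
    using diff[of 0 0] closed[of 0] by (simp add: a_minus_def R.r_neg)
  have "\<psi> (c \<otimes>\<^bsub>?A\<^esub> d) = \<psi> c \<otimes>\<^bsub>R\<^esub> \<psi> d" if c: "c \<in> carrier ?A" and d: "d \<in> carrier ?A" for c d
    using c
  proof (induction c rule: monoid_ring_induct)
    case (one a)
    have fa: "frag_of a \<in> carrier ?A" using one by simp
    show ?case using d
    proof (induction d rule: monoid_ring_induct)
      case (diff d e)
      then show ?case
        using closed[OF diff(1)] closed[OF diff(2)] closed[OF fa]
          monoid_ring_mult_closed[OF assms(1) fa diff(1)] monoid_ring_mult_closed[OF assms(1) fa diff(2)]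
        by (simp only: monoid_ring_diff_r \<open>\<And>c d. c \<in> carrier ?A \<Longrightarrow> d \<in> carrier ?A \<Longrightarrow> \<psi> (c - d) = \<psi> c \<ominus>\<^bsub>R\<^esub> \<psi> d\<close>)
          (simp only: a_minus_def R.r_distr R.a_inv_closed R.r_minus)
    next
      case (one b)
      then show ?case
        using \<psi>(2) hom_mult[OF assms(3) \<open>a \<in> carrier A\<close> one] \<open>a \<in> carrier A\<close> by simp
    next
      case zero
      then show ?case
        using closed[OF fa] by (simp only: monoid_ring_zero_mult \<open>\<psi> 0 = \<zero>\<^bsub>R\<^esub>\<close> R.r_null)
    qed
  next
    case (diff c e)
    then show ?case
      using closed[OF diff(1)] closed[OF diff(2)] closed[OF d]
        monoid_ring_mult_closed[OF assms(1) diff(1) d] monoid_ring_mult_closed[OF assms(1) diff(2) d]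
      by (simp only: monoid_ring_diff_l \<open>\<And>c d. c \<in> carrier ?A \<Longrightarrow> d \<in> carrier ?A \<Longrightarrow> \<psi> (c - d) = \<psi> c \<ominus>\<^bsub>R\<^esub> \<psi> d\<close>)
        (simp only: a_minus_def R.l_distr R.a_inv_closed R.l_minus)
  next
    case zero
    then show ?case
      using closed[OF d] by (simp only: monoid_ring_zero_mult \<open>\<psi> 0 = \<zero>\<^bsub>R\<^esub>\<close> R.l_null)
  qed
  then have "\<psi> \<in> ring_hom ?A R"
    using closed add \<psi>(2) assms(4) by (intro ring_hom_memI) (simp_all del: carrier_monoid_ring)
  then show ?thesis using \<psi>(2) by blast
qed

subsection \<open>Localisation homomorphisms\<close>

text \<open>Localisation up to isomorphism, expressed without fractions, so that restriction maps of
  a sheaf can be recognised as localisations wherever their target lives. The record scheme lets one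
  notion serve monoids and the multiplicative monoids of rings.\<close>

locale localisation_hom =
  fixes M :: "('a, 'x) monoid_scheme" and M' :: "('b, 'y) monoid_scheme" and h S
  assumes comm_monoid_dom: "comm_monoid M" and comm_monoid_cod: "comm_monoid M'"
    and hom: "h \<in> hom M M'" and hom_one: "h \<one>\<^bsub>M\<^esub> = \<one>\<^bsub>M'\<^esub>"
    and submonoid: "submonoid S M"
    and units: "\<And>s. s \<in> S \<Longrightarrow> h s \<in> Units M'"
    and surj: "\<And>x. x \<in> carrier M' \<Longrightarrow> \<exists>a\<in>carrier M. \<exists>b\<in>S. h b \<otimes>\<^bsub>M'\<^esub> x = h a"
    and ker: "\<And>a a'. a \<in> carrier M \<Longrightarrow> a' \<in> carrier M \<Longrightarrow> h a = h a' \<Longrightarrow>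
      \<exists>b\<in>S. b \<otimes>\<^bsub>M\<^esub> a = b \<otimes>\<^bsub>M\<^esub> a'"

lemma Units_monoid_ring:
  assumes "comm_monoid A" "u \<in> Units A"
  shows "frag_of u \<in> Units (monoid_ring A)"
proof -
  interpret comm_monoid A by fact
  have "frag_of (inv\<^bsub>A\<^esub> u) \<otimes>\<^bsub>monoid_ring A\<^esub> frag_of u = \<one>\<^bsub>monoid_ring A\<^esub>"
    "frag_of u \<otimes>\<^bsub>monoid_ring A\<^esub> frag_of (inv\<^bsub>A\<^esub> u) = \<one>\<^bsub>monoid_ring A\<^esub>"
    using assms(2) by (simp_all add: Units_l_inv Units_r_inv)
  then show ?thesis
    using assms(2) unfolding Units_def[of "monoid_ring A"] by (auto simp del: monoid_ring_mult_of)
qed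

text \<open>\<open>ker\<close> supplies a factor for one pair at a time; the product over the
  finitely many pairs serves all of them. It will be applied to the support of an element of the
  monoid ring.\<close>

lemma (in localisation_hom) common_annihilator:
  assumes "finite F" "F \<subseteq> carrier M"
  shows "\<exists>b\<in>S. \<forall>m\<in>F. \<forall>m'\<in>F. h m = h m' \<longrightarrow> b \<otimes>\<^bsub>M\<^esub> m = b \<otimes>\<^bsub>M\<^esub> m'"
proof -
  interpret M: comm_monoid M by (rule comm_monoid_dom)
  interpret S: submonoid S M by (rule submonoid)
  have S_carr: "s \<in> carrier M" if "s \<in> S" for s using that S.subset by blast
  have "\<exists>b\<in>S. \<forall>(m, m')\<in>P. h m = h m' \<longrightarrow> b \<otimes>\<^bsub>M\<^esub> m = b \<otimes>\<^bsub>M\<^esub> m'"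
    if "finite P" "P \<subseteq> F \<times> F" for P
    using that
  proof (induction P rule: finite_induct)
    case empty
    then show ?case using S.one_closed by blast
  next
    case (insert p P)
    obtain m m' where p: "p = (m, m')" by (cases p)
    have mm: "m \<in> carrier M" "m' \<in> carrier M" using insert.prems p assms(2) by auto
    obtain b where b: "b \<in> S" "\<And>n n'. (n, n') \<in> P \<Longrightarrow> h n = h n' \<Longrightarrow> b \<otimes>\<^bsub>M\<^esub> n = b \<otimes>\<^bsub>M\<^esub> n'"
      using insert by auto
    obtain c where c: "c \<in> S" "h m = h m' \<Longrightarrow> c \<otimes>\<^bsub>M\<^esub> m = c \<otimes>\<^bsub>M\<^esub> m'"
      using ker[OF mm] S.one_closed by blast
    show ?case
    proof (intro bexI[of _ "b \<otimes>\<^bsub>M\<^esub> c"] ballI)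
      show "b \<otimes>\<^bsub>M\<^esub> c \<in> S" using b c by simp
      fix x assume x: "x \<in> insert p P"
      obtain n n' where nn: "x = (n, n')" by (cases x)
      have nc: "n \<in> carrier M" "n' \<in> carrier M" using x nn insert.prems assms(2) by auto
      note carr = nc S_carr[OF b(1)] S_carr[OF c(1)]
      have "(b \<otimes>\<^bsub>M\<^esub> c) \<otimes>\<^bsub>M\<^esub> n = (b \<otimes>\<^bsub>M\<^esub> c) \<otimes>\<^bsub>M\<^esub> n'" if eq: "h n = h n'"
      proof (cases "x = p")
        case True
        then have "c \<otimes>\<^bsub>M\<^esub> n = c \<otimes>\<^bsub>M\<^esub> n'" using c(2) eq p nn by simp
        then show ?thesis using carr by (simp add: M.m_assoc)
      next
        case False
        then have "b \<otimes>\<^bsub>M\<^esub> n = b \<otimes>\<^bsub>M\<^esub> n'" using b(2) eq x nn by simp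
        then have "c \<otimes>\<^bsub>M\<^esub> (b \<otimes>\<^bsub>M\<^esub> n) = c \<otimes>\<^bsub>M\<^esub> (b \<otimes>\<^bsub>M\<^esub> n')" by simp
        then show ?thesis using carr by (simp add: M.m_ac)
      qed
      then show "case x of (m, m') \<Rightarrow> h m = h m' \<longrightarrow> b \<otimes>\<^bsub>M\<^esub> c \<otimes>\<^bsub>M\<^esub> m = b \<otimes>\<^bsub>M\<^esub> c \<otimes>\<^bsub>M\<^esub> m'"
        unfolding nn by simp
    qed
  qed
  from this[OF _ subset_refl] assms(1) obtain b where b: "b \<in> S"
    "\<forall>(m, m')\<in>F \<times> F. h m = h m' \<longrightarrow> b \<otimes>\<^bsub>M\<^esub> m = b \<otimes>\<^bsub>M\<^esub> m'" by auto
  have "b \<otimes>\<^bsub>M\<^esub> m = b \<otimes>\<^bsub>M\<^esub> m'" if "m \<in> F" "m' \<in> F" "h m = h m'" for m m'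
    using bspec[OF b(2), of "(m, m')"] that by simp
  then show ?thesis using b(1) by blast
qed

text \<open>Localising commutes with forming the monoid ring. Every element over \<open>M'\<close>
  has finitely many monomials and hence a common denominator, which is found by induction over
  differences and is itself a monomial from \<open>S\<close>.\<close>

lemma localisation_hom_monoid_ring:
  assumes "localisation_hom M M' h S"
  shows "localisation_hom (monoid_ring M) (monoid_ring M') (monoid_ring_map h) (frag_of ` S)"
proof -
  interpret localisation_hom M M' h S by fact
  interpret M: comm_monoid M by (rule comm_monoid_dom)
  interpret M': comm_monoid M' by (rule comm_monoid_cod)
  interpret S: submonoid S M by (rule submonoid)
  let ?R = "monoid_ring M" let ?R' = "monoid_ring M'" let ?h = "monoid_ring_map h"
  interpret R: cring ?R by (rule cring_monoid_ring[OF comm_monoid_dom])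
  interpret R': cring ?R' by (rule cring_monoid_ring[OF comm_monoid_cod])
  have rh: "?h \<in> ring_hom ?R ?R'"
    by (rule monoid_ring_map_hom[OF comm_monoid_dom comm_monoid_cod hom hom_one])
  have S_carr: "s \<in> carrier M" if "s \<in> S" for s using that S.subset by blast
  have fS: "frag_of s \<in> carrier ?R" if "s \<in> S" for s using S_carr[OF that] by simp
  show ?thesis
  proof (rule localisation_hom.intro)
    show "comm_monoid ?R" "comm_monoid ?R'"
      using R.comm_monoid_axioms R'.comm_monoid_axioms .
    show "?h \<in> hom ?R ?R'" using rh by (auto simp: ring_hom_def hom_def)
    show "?h \<one>\<^bsub>?R\<^esub> = \<one>\<^bsub>?R'\<^esub>" using ring_hom_one[OF rh] .
    show "submonoid (frag_of ` S) ?R"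
    proof
      show "frag_of ` S \<subseteq> carrier ?R" using fS by blast
      show "\<one>\<^bsub>?R\<^esub> \<in> frag_of ` S" by simp
      fix x y assume "x \<in> frag_of ` S" "y \<in> frag_of ` S"
      then show "x \<otimes>\<^bsub>?R\<^esub> y \<in> frag_of ` S" by auto
    qed
  next
    fix s assume "s \<in> frag_of ` S"
    then show "?h s \<in> Units ?R'"
      using units Units_monoid_ring[OF comm_monoid_cod] by auto
  next
    fix x assume "x \<in> carrier ?R'"
    then show "\<exists>a\<in>carrier ?R. \<exists>b\<in>frag_of ` S. ?h b \<otimes>\<^bsub>?R'\<^esub> x = ?h a"
    proof (induction x rule: monoid_ring_induct)
      case zero
      show ?case
        using S.one_closed
        by (intro bexI[of _ 0] bexI[of _ "frag_of \<one>\<^bsub>M\<^esub>"]) (auto simp: monoid_ring_map_def)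
    next
      case (one x)
      from surj[OF one] obtain a b where "a \<in> carrier M" "b \<in> S" "h b \<otimes>\<^bsub>M'\<^esub> x = h a" by blast
      then show ?case by (intro bexI[of _ "frag_of a"] bexI[of _ "frag_of b"]) auto
    next
      case (diff x y)
      from diff(3) obtain a b where ab: "a \<in> carrier ?R" "b \<in> S" "?h (frag_of b) \<otimes>\<^bsub>?R'\<^esub> x = ?h a" by blast
      from diff(4) obtain c d where cd: "c \<in> carrier ?R" "d \<in> S" "?h (frag_of d) \<otimes>\<^bsub>?R'\<^esub> y = ?h c" by blast
      define B D where "B = frag_of b" and "D = frag_of d"
      have BD: "B \<in> carrier ?R" "D \<in> carrier ?R" using fS ab cd by (simp_all add: B_def D_def del: carrier_monoid_ring)
      have 1: "?h B \<otimes>\<^bsub>?R'\<^esub> x = ?h a" "?h D \<otimes>\<^bsub>?R'\<^esub> y = ?h c" using ab cd by (simp_all add: B_def D_def)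
      note hBD = ring_hom_closed[OF rh BD(1)] ring_hom_closed[OF rh BD(2)]
      have "?h (B \<otimes>\<^bsub>?R\<^esub> D) \<otimes>\<^bsub>?R'\<^esub> x = ?h D \<otimes>\<^bsub>?R'\<^esub> (?h B \<otimes>\<^bsub>?R'\<^esub> x)"
        unfolding ring_hom_mult[OF rh BD] using hBD diff(1) by (simp only: R'.m_ac R'.m_closed)
      also have "\<dots> = ?h (D \<otimes>\<^bsub>?R\<^esub> a)"
        unfolding 1 ring_hom_mult[OF rh BD(2) ab(1)] ..
      finally have x: "?h (B \<otimes>\<^bsub>?R\<^esub> D) \<otimes>\<^bsub>?R'\<^esub> x = ?h (D \<otimes>\<^bsub>?R\<^esub> a)" .
      have "?h (B \<otimes>\<^bsub>?R\<^esub> D) \<otimes>\<^bsub>?R'\<^esub> y = ?h B \<otimes>\<^bsub>?R'\<^esub> (?h D \<otimes>\<^bsub>?R'\<^esub> y)"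
        unfolding ring_hom_mult[OF rh BD] using hBD diff(2) by (simp only: R'.m_ac R'.m_closed)
      also have "\<dots> = ?h (B \<otimes>\<^bsub>?R\<^esub> c)"
        unfolding 1 ring_hom_mult[OF rh BD(1) cd(1)] ..
      finally have y: "?h (B \<otimes>\<^bsub>?R\<^esub> D) \<otimes>\<^bsub>?R'\<^esub> y = ?h (B \<otimes>\<^bsub>?R\<^esub> c)" .
      have "?h (B \<otimes>\<^bsub>?R\<^esub> D) \<otimes>\<^bsub>?R'\<^esub> (x - y) = ?h (D \<otimes>\<^bsub>?R\<^esub> a - B \<otimes>\<^bsub>?R\<^esub> c)"
        unfolding monoid_ring_diff_r x y monoid_ring_map_diff ..
      moreover have "B \<otimes>\<^bsub>?R\<^esub> D \<in> frag_of ` S" using ab(2) cd(2) by (auto simp: B_def D_def)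
      moreover have "D \<otimes>\<^bsub>?R\<^esub> a - B \<otimes>\<^bsub>?R\<^esub> c \<in> carrier ?R"
        by (rule monoid_ring_minus(1)[OF comm_monoid_dom R.m_closed[OF BD(2) ab(1)] R.m_closed[OF BD(1) cd(1)]])
      ultimately show ?case by blast
    qed
  next
    fix a a' assume a: "a \<in> carrier ?R" "a' \<in> carrier ?R" and eq: "?h a = ?h a'"
    define c where "c = a - a'"
    have c: "c \<in> carrier ?R" unfolding c_def by (rule monoid_ring_minus(1)[OF comm_monoid_dom a])
    have hc0: "?h c = 0" unfolding c_def monoid_ring_map_diff eq by simp
    obtain b where b: "b \<in> S"
      "\<And>m m'. m \<in> Poly_Mapping.keys c \<Longrightarrow> m' \<in> Poly_Mapping.keys c \<Longrightarrow> h m = h m' \<Longrightarrow> b \<otimes>\<^bsub>M\<^esub> m = b \<otimes>\<^bsub>M\<^esub> m'"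
      using common_annihilator[of "Poly_Mapping.keys c"] c by auto
    \<comment> \<open>On the support of \<open>c\<close>, multiplication by \<open>b\<close>
      identifies whatever \<open>h\<close> identifies, so it factors as \<open>g\<close> after
      \<open>h\<close>, whichever preimage is chosen. Hence \<open>b\<close> times \<open>c\<close>
      is the image under \<open>g\<close> of \<open>?h c\<close>, which is 0.\<close>
    define g where "g = (\<lambda>y. b \<otimes>\<^bsub>M\<^esub> (SOME m. m \<in> Poly_Mapping.keys c \<and> h m = y))"
    have g: "g (h m) = b \<otimes>\<^bsub>M\<^esub> m" if "m \<in> Poly_Mapping.keys c" for m
    proof -
      have "\<exists>m'. m' \<in> Poly_Mapping.keys c \<and> h m' = h m" using that by blast
      from someI_ex[OF this] show ?thesis unfolding g_def using b(2) that by blast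
    qed
    have "frag_of b \<otimes>\<^bsub>?R\<^esub> c = frag_extend (\<lambda>m. frag_of (g (h m))) c"
      unfolding monoid_ring_mult_of by (rule frag_extend_eq) (simp add: g)
    also have "\<dots> = frag_extend (\<lambda>y. frag_of (g y)) (?h c)"
      using frag_extend_compose[of "\<lambda>y. frag_of (g y)" h c] by (simp add: monoid_ring_map_def o_def)
    finally have "frag_of b \<otimes>\<^bsub>?R\<^esub> c = 0" unfolding hc0 by simp
    then have "frag_of b \<otimes>\<^bsub>?R\<^esub> a = frag_of b \<otimes>\<^bsub>?R\<^esub> a'"
      unfolding c_def monoid_ring_diff_r by simp
    then show "\<exists>b\<in>frag_of ` S. b \<otimes>\<^bsub>?R\<^esub> a = b \<otimes>\<^bsub>?R\<^esub> a'"
      using b(1) by blast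
  qed
qed

subsection \<open>Spectra\<close>

text \<open>What the spectra of monoids and of rings share: primes whose complements are submonoids,
  and a topology with basic open sets as a base. Fractions as sections involve multiplication only,
  so they are studied once for both.\<close>

locale spectrum = comm_monoid M for M :: "('a, 'z) monoid_scheme" (structure) +
  fixes Spec :: "'a set set" and T :: "'a set topology"
  assumes prime_compl: "\<And>P. P \<in> Spec \<Longrightarrow> submonoid (carrier M - P) M"
    and prime_ideal: "\<And>P a b. P \<in> Spec \<Longrightarrow> a \<in> P \<Longrightarrow> b \<in> carrier M \<Longrightarrow> a \<otimes> b \<in> P"
    and openin_iff: "\<And>U. openin T U \<longleftrightarrow>
      U \<subseteq> Spec \<and> (\<forall>P\<in>U. \<exists>f\<in>carrier M - P. \<forall>Q\<in>Spec. f \<notin> Q \<longrightarrow> Q \<in> U)"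
begin

lemma fraction_setting: "P \<in> Spec \<Longrightarrow> fraction_setting M (carrier M - P)"
  by (intro fraction_setting.intro fraction_setting_axioms.intro comm_monoid_axioms prime_compl)

lemma prime_one: "P \<in> Spec \<Longrightarrow> \<one> \<notin> P"
  using submonoid.one_closed[OF prime_compl] by auto

lemma prime_mult:
  assumes "P \<in> Spec" "a \<in> carrier M" "b \<in> carrier M"
  shows "a \<otimes> b \<in> P \<longleftrightarrow> a \<in> P \<or> b \<in> P"
  using submonoid.m_closed[OF prime_compl[OF assms(1)], of a b] prime_ideal[OF assms(1), of a b]
    prime_ideal[OF assms(1), of b a] m_comm[OF assms(2,3)] assms(2,3) by auto

lemma prime_unit: "P \<in> Spec \<Longrightarrow> u \<in> Units M \<Longrightarrow> u \<notin> P"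
  using prime_ideal[of P u "inv u"] prime_one[of P] by auto

lemma topspace_eq: "topspace T = Spec"
proof -
  have "openin T Spec"
    unfolding openin_iff using prime_one by (auto intro!: bexI[of _ \<one>])
  then show ?thesis
    using openin_topspace[of T] openin_iff openin_subset[of T Spec] by auto
qed

lemma openin_basic: "f \<in> carrier M \<Longrightarrow> openin T {Q \<in> Spec. f \<notin> Q}"
  unfolding openin_iff by auto

lemma sectionI:
  assumes ext: "s \<in> extensional U"
    and loc: "\<And>P. P \<in> U \<Longrightarrow> P \<in> Spec \<and> (\<exists>a\<in>carrier M. \<exists>b\<in>carrier M. \<exists>g\<in>carrier M. g \<notin> P \<and>
      (\<forall>Q\<in>Spec. g \<notin> Q \<longrightarrow> Q \<in> U \<and> b \<notin> Q \<and> s Q = fraction M (carrier M - Q) a b))"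
  shows "s \<in> structure_sections M T U"
proof -
  have "\<exists>V a f. openin T V \<and> P \<in> V \<and> V \<subseteq> U \<and> a \<in> carrier M \<and> f \<in> carrier M \<and>
      (\<forall>Q\<in>V. f \<notin> Q \<and> s Q = fraction M (carrier M - Q) a f)" if P: "P \<in> U" for P
  proof -
    have Ps: "P \<in> Spec" by (rule conjunct1[OF loc[OF P]])
    obtain a b g where abg: "a \<in> carrier M" "b \<in> carrier M" "g \<in> carrier M" "g \<notin> P"
      "\<forall>Q\<in>Spec. g \<notin> Q \<longrightarrow> Q \<in> U \<and> b \<notin> Q \<and> s Q = fraction M (carrier M - Q) a b"
      using conjunct2[OF loc[OF P]] by (elim bexE conjE) (rule that)
    show ?thesis
    proof (rule exI[of _ "{Q \<in> Spec. g \<notin> Q}"], rule exI[of _ a], rule exI[of _ b], intro conjI ballI)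
      show "openin T {Q \<in> Spec. g \<notin> Q}" by (rule openin_basic[OF abg(3)])
      show "P \<in> {Q \<in> Spec. g \<notin> Q}" using Ps abg(4) by simp
      show "{Q \<in> Spec. g \<notin> Q} \<subseteq> U" using abg(5) by auto
      show "a \<in> carrier M" "b \<in> carrier M" by fact+
      fix Q assume "Q \<in> {Q \<in> Spec. g \<notin> Q}"
      then have "Q \<in> Spec" "g \<notin> Q" by simp_all
      then show "b \<notin> Q" "s Q = fraction M (carrier M - Q) a b" using bspec[OF abg(5)] by simp_all
    qed
  qed
  moreover have "s P \<in> fractions M (carrier M - P)" if P: "P \<in> U" for P
  proof -
    have Ps: "P \<in> Spec" by (rule conjunct1[OF loc[OF P]])
    obtain a b g where abg: "a \<in> carrier M" "b \<in> carrier M" "g \<in> carrier M" "g \<notin> P"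
      "\<forall>Q\<in>Spec. g \<notin> Q \<longrightarrow> Q \<in> U \<and> b \<notin> Q \<and> s Q = fraction M (carrier M - Q) a b"
      using conjunct2[OF loc[OF P]] by (elim bexE conjE) (rule that)
    then have "s P = fraction M (carrier M - P) a b" "b \<notin> P" using Ps by auto
    then show ?thesis using fraction_setting.fractionsI[OF fraction_setting[OF Ps], of a b] abg by simp
  qed
  ultimately show ?thesis
    unfolding structure_sections_def using ext by (auto simp: PiE_def)
qed

text \<open>The fraction is expanded by an element \<open>g\<close> that cuts out a small
  neighbourhood. Afterwards the denominator itself cuts out a neighbourhood on which the fraction
  represents the section.\<close>

lemma sectionE:
  assumes s: "s \<in> structure_sections M T U" and P: "P \<in> U"
  obtains a f where "a \<in> carrier M" "f \<in> carrier M" "f \<notin> P" "P \<in> Spec"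
    "\<forall>Q\<in>Spec. f \<notin> Q \<longrightarrow> Q \<in> U \<and> s Q = fraction M (carrier M - Q) a f"
proof -
  from s P obtain V a b where V: "openin T V" "P \<in> V" "V \<subseteq> U" "a \<in> carrier M" "b \<in> carrier M"
    "\<forall>Q\<in>V. b \<notin> Q \<and> s Q = fraction M (carrier M - Q) a b"
    unfolding structure_sections_def by blast
  from V(1,2) obtain g where g: "g \<in> carrier M" "g \<notin> P" "\<forall>Q\<in>Spec. g \<notin> Q \<longrightarrow> Q \<in> V" and P': "P \<in> Spec"
    unfolding openin_iff by blast
  show ?thesis
  proof
    show "a \<otimes> g \<in> carrier M" "b \<otimes> g \<in> carrier M" using V g by auto
    show "b \<otimes> g \<notin> P" using prime_mult[OF P' V(5) g(1)] V(2,6) g(2) by auto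
    show "P \<in> Spec" by fact
    show "\<forall>Q\<in>Spec. b \<otimes> g \<notin> Q \<longrightarrow> Q \<in> U \<and> s Q = fraction M (carrier M - Q) (a \<otimes> g) (b \<otimes> g)"
    proof (intro ballI impI)
      fix Q assume Q: "Q \<in> Spec" "b \<otimes> g \<notin> Q"
      then have bg: "b \<notin> Q" "g \<notin> Q" using prime_mult[OF Q(1) V(5) g(1)] by auto
      then have QV: "Q \<in> V" using g Q by blast
      interpret F: fraction_setting M "carrier M - Q" by (rule fraction_setting[OF Q(1)])
      have "fraction M (carrier M - Q) a b = fraction M (carrier M - Q) (a \<otimes> g) (b \<otimes> g)"
      proof (rule F.fraction_eqI[of \<one>])
        show "\<one> \<otimes> (a \<otimes> (b \<otimes> g)) = \<one> \<otimes> (a \<otimes> g \<otimes> b)" using V(4,5) g(1) by (simp add: m_ac)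
      qed (use V g bg Q prime_one in auto)
      then show "Q \<in> U \<and> s Q = fraction M (carrier M - Q) (a \<otimes> g) (b \<otimes> g)"
        using V QV by auto
    qed
  qed
qed

lemma section_subset: "s \<in> structure_sections M T U \<Longrightarrow> U \<subseteq> Spec"
  by (auto elim: sectionE)

lemma section_fractions:
  assumes "s \<in> structure_sections M T U" "P \<in> U"
  shows "s P \<in> fractions M (carrier M - P)"
  using assms by (auto simp: structure_sections_def PiE_def)

lemma section_ext: "s \<in> structure_sections M T U \<Longrightarrow> s \<in> extensional U"
  by (auto simp: structure_sections_def PiE_def)

lemma section_restrict:
  assumes s: "s \<in> structure_sections M T U" and W: "openin T W" "W \<subseteq> U"
  shows "restrict s W \<in> structure_sections M T W"
proof (rule sectionI)
  fix P assume P: "P \<in> W"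
  then have PU: "P \<in> U" using W by blast
  obtain a f where af: "a \<in> carrier M" "f \<in> carrier M" "f \<notin> P" "P \<in> Spec"
    "\<forall>Q\<in>Spec. f \<notin> Q \<longrightarrow> Q \<in> U \<and> s Q = fraction M (carrier M - Q) a f" by (rule sectionE[OF s PU])
  from W(1) P obtain g where g: "g \<in> carrier M" "g \<notin> P" "\<forall>Q\<in>Spec. g \<notin> Q \<longrightarrow> Q \<in> W"
    unfolding openin_iff by blast
  show "P \<in> Spec \<and> (\<exists>a\<in>carrier M. \<exists>b\<in>carrier M. \<exists>g\<in>carrier M. g \<notin> P \<and>
      (\<forall>Q\<in>Spec. g \<notin> Q \<longrightarrow> Q \<in> W \<and> b \<notin> Q \<and> restrict s W Q = fraction M (carrier M - Q) a b))"
  proof (rule conjI[OF af(4)], rule bexI[of _ a], rule bexI[of _ f], rule bexI[of _ "f \<otimes> g"], intro conjI ballI impI)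
    fix Q assume Q: "Q \<in> Spec" "f \<otimes> g \<notin> Q"
    then have fg: "f \<notin> Q" "g \<notin> Q" using prime_mult[OF Q(1) af(2) g(1)] by auto
    show "Q \<in> W" "f \<notin> Q" using fg g Q by auto
    then show "restrict s W Q = fraction M (carrier M - Q) a f" using af(5)[rule_format, OF Q(1) fg(1)] by simp
  qed (use af g prime_mult in auto)
qed simp

lemma section_one:
  assumes "openin T U"
  shows "(\<lambda>P\<in>U. fraction M (carrier M - P) \<one> \<one>) \<in> structure_sections M T U"
proof (rule sectionI)
  fix P assume P: "P \<in> U"
  then obtain f where f: "f \<in> carrier M - P" "\<forall>Q\<in>Spec. f \<notin> Q \<longrightarrow> Q \<in> U" and Ps: "P \<in> Spec"
    using assms unfolding openin_iff by blast
  show "P \<in> Spec \<and> (\<exists>a\<in>carrier M. \<exists>b\<in>carrier M. \<exists>g\<in>carrier M. g \<notin> P \<and>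
      (\<forall>Q\<in>Spec. g \<notin> Q \<longrightarrow> Q \<in> U \<and> b \<notin> Q \<and>
        (\<lambda>P\<in>U. fraction M (carrier M - P) \<one> \<one>) Q = fraction M (carrier M - Q) a b))"
    by (rule conjI[OF Ps], rule bexI[of _ \<one>], rule bexI[of _ \<one>], rule bexI[of _ f]) (use f prime_one in auto)
qed simp

lemma section_mult:
  assumes s: "s \<in> structure_sections M T U" and t: "t \<in> structure_sections M T U"
  shows "(\<lambda>P\<in>U. fraction_mult M (carrier M - P) (s P) (t P)) \<in> structure_sections M T U"
proof (rule sectionI)
  fix P assume P: "P \<in> U"
  obtain a f where af: "a \<in> carrier M" "f \<in> carrier M" "f \<notin> P" "P \<in> Spec"
    "\<forall>Q\<in>Spec. f \<notin> Q \<longrightarrow> Q \<in> U \<and> s Q = fraction M (carrier M - Q) a f" by (rule sectionE[OF s P])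
  obtain b g where bg: "b \<in> carrier M" "g \<in> carrier M" "g \<notin> P" "P \<in> Spec"
    "\<forall>Q\<in>Spec. g \<notin> Q \<longrightarrow> Q \<in> U \<and> t Q = fraction M (carrier M - Q) b g" by (rule sectionE[OF t P])
  show "P \<in> Spec \<and> (\<exists>a\<in>carrier M. \<exists>b\<in>carrier M. \<exists>g\<in>carrier M. g \<notin> P \<and>
      (\<forall>Q\<in>Spec. g \<notin> Q \<longrightarrow> Q \<in> U \<and> b \<notin> Q \<and>
        (\<lambda>P\<in>U. fraction_mult M (carrier M - P) (s P) (t P)) Q = fraction M (carrier M - Q) a b))"
  proof (rule conjI[OF af(4)], rule bexI[of _ "a \<otimes> b"], rule bexI[of _ "f \<otimes> g"], rule bexI[of _ "f \<otimes> g"], intro conjI ballI impI)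
    fix Q assume Q: "Q \<in> Spec" "f \<otimes> g \<notin> Q"
    then have fg: "f \<notin> Q" "g \<notin> Q" using prime_mult[OF Q(1) af(2) bg(2)] by auto
    interpret F: fraction_setting M "carrier M - Q" by (rule fraction_setting[OF Q(1)])
    show "f \<otimes> g \<notin> Q" by fact
    show "Q \<in> U" using af(5)[rule_format, OF Q(1) fg(1)] by simp
    then show "(\<lambda>P\<in>U. fraction_mult M (carrier M - P) (s P) (t P)) Q = fraction M (carrier M - Q) (a \<otimes> b) (f \<otimes> g)"
      using af(5)[rule_format, OF Q(1) fg(1)] bg(5)[rule_format, OF Q(1) fg(2)] F.fraction_mult_fraction[of a b f g] af bg fg by simp
  qed (use af bg prime_mult in auto)
qed simp

text \<open>Whether a fraction is a unit of the localisation at \<open>P\<close> can be read off any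
  numerator, because \<open>P\<close> is prime and an equation of two fractions involves, besides
  the numerators, only factors outside \<open>P\<close>.\<close>

lemma fraction_num_notin:
  assumes "P \<in> Spec" "x \<in> fractions M (carrier M - P)" "(a, f) \<in> x" "(b, g) \<in> x" "a \<notin> P"
  shows "b \<notin> P"
proof -
  interpret F: fraction_setting M "carrier M - P" by (rule fraction_setting[OF assms(1)])
  note 1 = F.fractions_mem[OF assms(2,3)] and 2 = F.fractions_mem[OF assms(2,4)]
  have "fraction M (carrier M - P) a f = fraction M (carrier M - P) b g" using 1 2 by simp
  then obtain u where u: "u \<in> carrier M - P" "u \<otimes> (a \<otimes> g) = u \<otimes> (b \<otimes> f)"
    using F.fraction_eq_iff[of a b f g] 1(1,2) 2(1,2) by auto
  have "u \<otimes> (a \<otimes> g) \<notin> P"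
    using u(1) 1 2 assms(1,5) by (auto simp: prime_mult)
  then show ?thesis
    unfolding u(2) using u(1) 1(1,2) 2(1,2) assms(1) by (auto simp: prime_mult)
qed

text \<open>A fraction is the relation of its numerators to their denominators, so inverting it is
  taking the converse relation. This inverse does not depend on a representative.\<close>

lemma converse_fraction:
  assumes P: "P \<in> Spec" and a: "a \<in> carrier M - P" and f: "f \<in> carrier M - P"
  shows "(fraction M (carrier M - P) a f)\<inverse> = fraction M (carrier M - P) f a"
proof -
  interpret F: fraction_setting M "carrier M - P" by (rule fraction_setting[OF P])
  have *: "(g, b) \<in> fraction M (carrier M - P) f a" if "a \<in> carrier M - P" "f \<in> carrier M - P"
    "(b, g) \<in> fraction M (carrier M - P) a f" for a f b g
  proof -
    from that(3) obtain u where u: "b \<in> carrier M" "g \<in> carrier M - P" "u \<in> carrier M - P"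
      "u \<otimes> (a \<otimes> g) = u \<otimes> (b \<otimes> f)" by (auto simp: F.mem_fraction)
    have "b \<notin> P"
      by (rule fraction_num_notin[OF P F.fractionsI F.fraction_self that(3)]) (use that in auto)
    moreover have "u \<otimes> (f \<otimes> b) = u \<otimes> (g \<otimes> a)"
      using u that m_comm[of f b] m_comm[of g a] by simp
    ultimately show ?thesis using u by (auto simp: F.mem_fraction)
  qed
  show ?thesis
    using *[OF a f] *[OF f a] by auto
qed

text \<open>Equality of two fractions at \<open>P\<close> is witnessed by a single \<open>u\<close>
  outside \<open>P\<close>, and the same \<open>u\<close> works at every prime that avoids
  \<open>u\<close> and both denominators.\<close>

lemma equal_locus_open:
  assumes s: "s \<in> structure_sections M T U" and t: "t \<in> structure_sections M T U"
  shows "openin T {P \<in> U. s P = t P}"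
  unfolding openin_iff
proof (intro conjI ballI)
  show "{P \<in> U. s P = t P} \<subseteq> Spec" by (auto dest: section_subset[OF s, THEN subsetD])
  fix P assume "P \<in> {P \<in> U. s P = t P}"
  then have P: "P \<in> U" "s P = t P" by auto
  obtain a f where af: "a \<in> carrier M" "f \<in> carrier M" "f \<notin> P" "P \<in> Spec"
    "\<forall>Q\<in>Spec. f \<notin> Q \<longrightarrow> Q \<in> U \<and> s Q = fraction M (carrier M - Q) a f" by (rule sectionE[OF s P(1)])
  obtain b g where bg: "b \<in> carrier M" "g \<in> carrier M" "g \<notin> P" "P \<in> Spec"
    "\<forall>Q\<in>Spec. g \<notin> Q \<longrightarrow> Q \<in> U \<and> t Q = fraction M (carrier M - Q) b g" by (rule sectionE[OF t P(1)])
  interpret F: fraction_setting M "carrier M - P" by (rule fraction_setting[OF af(4)])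
  have "fraction M (carrier M - P) a f = fraction M (carrier M - P) b g"
    using P(2) af(3-5) bg(3,5) by simp
  then obtain u where u: "u \<in> carrier M" "u \<notin> P" "u \<otimes> (a \<otimes> g) = u \<otimes> (b \<otimes> f)"
    using F.fraction_eq_iff[of a b f g] af bg by auto
  show "\<exists>f\<in>carrier M - P. \<forall>Q\<in>Spec. f \<notin> Q \<longrightarrow> Q \<in> {P \<in> U. s P = t P}"
  proof (intro bexI[of _ "u \<otimes> (f \<otimes> g)"] ballI impI)
    show "u \<otimes> (f \<otimes> g) \<in> carrier M - P"
      using u(1,2) af(1-4) bg(1-3) by (simp add: prime_mult)
    fix Q assume Q: "Q \<in> Spec" "u \<otimes> (f \<otimes> g) \<notin> Q"
    then have ufg: "u \<notin> Q" "f \<notin> Q" "g \<notin> Q" using u(1) af(2) bg(2) by (auto simp: prime_mult)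
    interpret G: fraction_setting M "carrier M - Q" by (rule fraction_setting[OF Q(1)])
    have "fraction M (carrier M - Q) a f = fraction M (carrier M - Q) b g"
      by (rule G.fraction_eqI[OF u(3)]) (use u(1) af(1,2) bg(1,2) ufg in auto)
    then show "Q \<in> {P \<in> U. s P = t P}"
      using af(5)[rule_format, OF Q(1) ufg(2)] bg(5)[rule_format, OF Q(1) ufg(3)] by simp
  qed
qed

text \<open>Where one fraction \<open>a / f\<close> represents the section, being a unit means that
  \<open>a\<close> avoids the prime, which is an open condition.\<close>

lemma unit_locus_open:
  assumes s: "s \<in> structure_sections M T U"
  shows "openin T {P \<in> U. \<exists>a f. (a, f) \<in> s P \<and> a \<notin> P}"
  unfolding openin_iff
proof (intro conjI ballI)
  show "{P \<in> U. \<exists>a f. (a, f) \<in> s P \<and> a \<notin> P} \<subseteq> Spec" by (auto dest: section_subset[OF s, THEN subsetD])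
  fix P assume "P \<in> {P \<in> U. \<exists>a f. (a, f) \<in> s P \<and> a \<notin> P}"
  then obtain b g where P: "P \<in> U" "(b, g) \<in> s P" "b \<notin> P" by auto
  obtain a f where af: "a \<in> carrier M" "f \<in> carrier M" "f \<notin> P" "P \<in> Spec"
    "\<forall>Q\<in>Spec. f \<notin> Q \<longrightarrow> Q \<in> U \<and> s Q = fraction M (carrier M - Q) a f" by (rule sectionE[OF s P(1)])
  have mem: "(a, f) \<in> s Q" if "Q \<in> Spec" "f \<notin> Q" for Q
    using af(5)[rule_format, OF that] fraction_setting.fraction_self[OF fraction_setting[OF that(1)], of a f] af(1,2) that by simp
  have aP: "a \<notin> P"
    by (rule fraction_num_notin[OF af(4) section_fractions[OF s P(1)] P(2) mem[OF af(4,3)] P(3)])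
  show "\<exists>f\<in>carrier M - P. \<forall>Q\<in>Spec. f \<notin> Q \<longrightarrow> Q \<in> {P \<in> U. \<exists>a f. (a, f) \<in> s P \<and> a \<notin> P}"
  proof (intro bexI[of _ "a \<otimes> f"] ballI impI)
    show "a \<otimes> f \<in> carrier M - P" using af(1-4) aP by (simp add: prime_mult)
    fix Q assume Q: "Q \<in> Spec" "a \<otimes> f \<notin> Q"
    then have "a \<notin> Q" "f \<notin> Q" using af(1,2) by (auto simp: prime_mult)
    then show "Q \<in> {P \<in> U. \<exists>a f. (a, f) \<in> s P \<and> a \<notin> P}"
      using af(5)[rule_format, OF Q(1)] mem[OF Q(1)] by blast
  qed
qed

text \<open>The pointwise converse is again locally one fraction: where \<open>a / f\<close>
  represents \<open>s\<close>, the numerator \<open>a\<close> avoids every prime concerned because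
  \<open>s\<close> is a unit there, so that it can serve as a denominator.\<close>

lemma section_converse:
  assumes s: "s \<in> structure_sections M T U" and unit: "\<And>P. P \<in> U \<Longrightarrow> \<exists>a f. (a, f) \<in> s P \<and> a \<notin> P"
  shows "(\<lambda>P\<in>U. (s P)\<inverse>) \<in> structure_sections M T U"
    and "\<And>P. P \<in> U \<Longrightarrow> fraction_mult M (carrier M - P) (s P) ((s P)\<inverse>) = fraction M (carrier M - P) \<one> \<one>"
proof -
  have rep: "\<exists>a f. a \<in> carrier M - P \<and> f \<in> carrier M - P \<and> s P = fraction M (carrier M - P) a f"
    if "P \<in> U" "P \<in> Spec" for P
    using unit[OF that(1)] fraction_setting.fractions_mem[OF fraction_setting[OF that(2)] section_fractions[OF s that(1)]]
    by blast
  show "(\<lambda>P\<in>U. (s P)\<inverse>) \<in> structure_sections M T U"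
  proof (rule sectionI)
    fix P assume P: "P \<in> U"
    obtain a f where af: "a \<in> carrier M" "f \<in> carrier M" "f \<notin> P" "P \<in> Spec"
      "\<forall>Q\<in>Spec. f \<notin> Q \<longrightarrow> Q \<in> U \<and> s Q = fraction M (carrier M - Q) a f" by (rule sectionE[OF s P])
    have aQ: "a \<notin> Q" if Q: "Q \<in> Spec" "f \<notin> Q" for Q
    proof -
      interpret F: fraction_setting M "carrier M - Q" by (rule fraction_setting[OF Q(1)])
      have "(a, f) \<in> s Q" using af Q F.fraction_self[of a f] by simp
      then show ?thesis
        using unit[of Q] fraction_num_notin[OF Q(1) section_fractions[OF s, of Q]] af(5)[rule_format, OF Q] by blast
    qed
    show "P \<in> Spec \<and> (\<exists>a\<in>carrier M. \<exists>b\<in>carrier M. \<exists>g\<in>carrier M. g \<notin> P \<and>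
      (\<forall>Q\<in>Spec. g \<notin> Q \<longrightarrow> Q \<in> U \<and> b \<notin> Q \<and>
        (\<lambda>P\<in>U. (s P)\<inverse>) Q = fraction M (carrier M - Q) a b))"
    proof (rule conjI[OF af(4)], rule bexI[of _ f], rule bexI[of _ a], rule bexI[of _ f], intro conjI ballI impI)
      fix Q assume Q: "Q \<in> Spec" "f \<notin> Q"
      show "Q \<in> U" "a \<notin> Q" using af(5)[rule_format, OF Q] aQ[OF Q] by auto
      then show "(\<lambda>P\<in>U. (s P)\<inverse>) Q = fraction M (carrier M - Q) f a"
        using af(5)[rule_format, OF Q] converse_fraction[OF Q(1), of a f] af(1,2) Q(2) by simp
    qed (use af in auto)
  qed simp
  fix P assume P: "P \<in> U"
  then have Ps: "P \<in> Spec" using section_subset[OF s] by blast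
  interpret F: fraction_setting M "carrier M - P" by (rule fraction_setting[OF Ps])
  from rep[OF P Ps] obtain a f where af: "a \<in> carrier M - P" "f \<in> carrier M - P"
    "s P = fraction M (carrier M - P) a f" by blast
  have "fraction M (carrier M - P) (a \<otimes> f) (f \<otimes> a) = fraction M (carrier M - P) \<one> \<one>"
    by (rule F.fraction_eqI[of \<one>]) (use af(1,2) Ps prime_one in \<open>auto simp: prime_mult m_comm\<close>)
  then show "fraction_mult M (carrier M - P) (s P) ((s P)\<inverse>) = fraction M (carrier M - P) \<one> \<one>"
    unfolding af(3) converse_fraction[OF Ps af(1,2)]
    using F.fraction_mult_fraction[of a f f a] af(1,2) by simp
qed

end

lemma spectrum_ring:
  assumes "cring R"
  shows "spectrum R {P. primeideal P R} (zariski R)"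
proof -
  interpret cring R by fact
  have op: "openin (zariski R) U \<longleftrightarrow> (\<exists>I. ideal I R \<and> U = {P. primeideal P R \<and> \<not> I \<subseteq> P})" for U
    unfolding zariski_def by (simp add: topology_inverse'[OF istopology_zariski[OF assms]])
  show ?thesis
  proof (intro spectrum.intro spectrum_axioms.intro comm_monoid_axioms)
    fix P assume "P \<in> {P. primeideal P R}"
    then interpret primeideal P R by simp
    have "\<one>\<^bsub>R\<^esub> \<notin> P" using I_notcarr one_imp_carrier by auto
    then show "submonoid (carrier R - P) R" using I_prime by unfold_locales auto
    show "a \<otimes>\<^bsub>R\<^esub> b \<in> P" if "a \<in> P" "b \<in> carrier R" for a b using that by (rule I_r_closed)
  next
    fix U
    show "openin (zariski R) U \<longleftrightarrow> U \<subseteq> {P. primeideal P R} \<and>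
      (\<forall>P\<in>U. \<exists>f\<in>carrier R - P. \<forall>Q\<in>{P. primeideal P R}. f \<notin> Q \<longrightarrow> Q \<in> U)"
    proof
      assume "openin (zariski R) U"
      then obtain I where I: "ideal I R" "U = {P. primeideal P R \<and> \<not> I \<subseteq> P}" unfolding op by blast
      then show "U \<subseteq> {P. primeideal P R} \<and>
        (\<forall>P\<in>U. \<exists>f\<in>carrier R - P. \<forall>Q\<in>{P. primeideal P R}. f \<notin> Q \<longrightarrow> Q \<in> U)"
        using ideal.Icarr[OF I(1)] by blast
    next
      assume a: "U \<subseteq> {P. primeideal P R} \<and>
        (\<forall>P\<in>U. \<exists>f\<in>carrier R - P. \<forall>Q\<in>{P. primeideal P R}. f \<notin> Q \<longrightarrow> Q \<in> U)"
      show "openin (zariski R) U"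
      proof (subst openin_subopen, intro ballI)
        fix P assume P: "P \<in> U"
        have Pp: "primeideal P R" using subsetD[OF conjunct1[OF a] P] by simp
        obtain f where "f \<in> carrier R - P" and fU: "\<forall>Q\<in>{P. primeideal P R}. f \<notin> Q \<longrightarrow> Q \<in> U"
          using bspec[OF conjunct2[OF a] P] by (elim bexE) (rule that)
        then have f: "f \<in> carrier R" "f \<notin> P" by simp_all
        have sub: "{Q. primeideal Q R \<and> f \<notin> Q} \<subseteq> U" using fU by auto
        have D: "{Q. primeideal Q R \<and> \<not> Idl\<^bsub>R\<^esub> {f} \<subseteq> Q} = {Q. primeideal Q R \<and> f \<notin> Q}"
          using genideal_self[of "{f}"] genideal_minimal[of _ "{f}"] f(1) primeideal.axioms(1) by blast
        have "openin (zariski R) {Q. primeideal Q R \<and> f \<notin> Q}"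
          unfolding op D[symmetric] using genideal_ideal[of "{f}"] f(1) by blast
        then show "\<exists>W. openin (zariski R) W \<and> P \<in> W \<and> W \<subseteq> U"
          using f Pp sub by (intro exI[of _ "{Q. primeideal Q R \<and> f \<notin> Q}"]) simp
      qed
    qed
  qed
qed

lemma spectrum_monoid:
  assumes "comm_monoid A"
  shows "spectrum A {P. monoid_prime P A} (monoid_zariski A)"
proof -
  interpret comm_monoid A by fact
  have op: "openin (monoid_zariski A) U \<longleftrightarrow> (\<exists>I. monoid_ideal I A \<and> U = {P. monoid_prime P A \<and> \<not> I \<subseteq> P})" for U
    unfolding monoid_zariski_def by (simp add: topology_inverse'[OF istopology_monoid_zariski[OF assms]])
  show ?thesis
  proof (intro spectrum.intro spectrum_axioms.intro comm_monoid_axioms)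
    fix P assume P: "P \<in> {P. monoid_prime P A}"
    then show "submonoid (carrier A - P) A" by (simp add: monoid_prime_def)
    fix a b assume ab: "a \<in> P" "b \<in> carrier A"
    then have "a \<in> carrier A" "b \<otimes>\<^bsub>A\<^esub> a \<in> P" using P by (auto simp: monoid_prime_def monoid_ideal_def)
    then show "a \<otimes>\<^bsub>A\<^esub> b \<in> P" using ab m_comm[of a b] by simp
  next
    fix U
    show "openin (monoid_zariski A) U \<longleftrightarrow> U \<subseteq> {P. monoid_prime P A} \<and>
      (\<forall>P\<in>U. \<exists>f\<in>carrier A - P. \<forall>Q\<in>{P. monoid_prime P A}. f \<notin> Q \<longrightarrow> Q \<in> U)"
    proof
      assume "openin (monoid_zariski A) U"
      then obtain I where I: "monoid_ideal I A" "U = {P. monoid_prime P A \<and> \<not> I \<subseteq> P}" unfolding op by blast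
      then show "U \<subseteq> {P. monoid_prime P A} \<and>
        (\<forall>P\<in>U. \<exists>f\<in>carrier A - P. \<forall>Q\<in>{P. monoid_prime P A}. f \<notin> Q \<longrightarrow> Q \<in> U)"
        unfolding monoid_ideal_def by blast
    next
      assume a: "U \<subseteq> {P. monoid_prime P A} \<and>
        (\<forall>P\<in>U. \<exists>f\<in>carrier A - P. \<forall>Q\<in>{P. monoid_prime P A}. f \<notin> Q \<longrightarrow> Q \<in> U)"
      show "openin (monoid_zariski A) U"
      proof (subst openin_subopen, intro ballI)
        fix P assume P: "P \<in> U"
        have Pp: "monoid_prime P A" using subsetD[OF conjunct1[OF a] P] by simp
        obtain f where "f \<in> carrier A - P" and fU: "\<forall>Q\<in>{P. monoid_prime P A}. f \<notin> Q \<longrightarrow> Q \<in> U"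
          using bspec[OF conjunct2[OF a] P] by (elim bexE) (rule that)
        then have f: "f \<in> carrier A" "f \<notin> P" by simp_all
        have sub: "{Q. monoid_prime Q A \<and> f \<notin> Q} \<subseteq> U" using fU by auto
        let ?I = "(\<lambda>a. a \<otimes>\<^bsub>A\<^esub> f) ` carrier A"
        have I: "monoid_ideal ?I A"
          unfolding monoid_ideal_def using f(1) by (auto simp: m_assoc[symmetric])
        have "f = \<one>\<^bsub>A\<^esub> \<otimes>\<^bsub>A\<^esub> f" using f(1) by simp
        then have "f \<in> ?I" by blast
        then have D: "{Q. monoid_prime Q A \<and> \<not> ?I \<subseteq> Q} = {Q. monoid_prime Q A \<and> f \<notin> Q}"
          unfolding monoid_prime_def monoid_ideal_def by blast
        have "openin (monoid_zariski A) {Q. monoid_prime Q A \<and> f \<notin> Q}"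
          unfolding op D[symmetric] using I by blast
        then show "\<exists>W. openin (monoid_zariski A) W \<and> P \<in> W \<and> W \<subseteq> U"
          using f Pp sub by (intro exI[of _ "{Q. monoid_prime Q A \<and> f \<notin> Q}"]) simp
      qed
    qed
  qed
qed

subsection \<open>Primes of a localisation\<close>

locale ring_localisation_hom = localisation_hom R R' h S + R: cring R + R': cring R'
  for R :: "'a ring" and R' :: "'b ring" and h S +
  assumes ring_hom: "h \<in> ring_hom R R'"
begin

interpretation S: submonoid S R by (rule submonoid)

sublocale Sp: spectrum R "{P. primeideal P R}" "zariski R" by (rule spectrum_ring) (rule R.cring_axioms)
sublocale Sp': spectrum R' "{P. primeideal P R'}" "zariski R'" by (rule spectrum_ring) (rule R'.cring_axioms)

lemma S_carrier: "s \<in> S \<Longrightarrow> s \<in> carrier R" using S.subset by blast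

lemma h_closed: "a \<in> carrier R \<Longrightarrow> h a \<in> carrier R'" by (rule ring_hom_closed[OF ring_hom])
lemma h_mult: "a \<in> carrier R \<Longrightarrow> b \<in> carrier R \<Longrightarrow> h (a \<otimes>\<^bsub>R\<^esub> b) = h a \<otimes>\<^bsub>R'\<^esub> h b"
  by (rule ring_hom_mult[OF ring_hom])
lemma h_add: "a \<in> carrier R \<Longrightarrow> b \<in> carrier R \<Longrightarrow> h (a \<oplus>\<^bsub>R\<^esub> b) = h a \<oplus>\<^bsub>R'\<^esub> h b"
  by (rule ring_hom_add[OF ring_hom])
lemma h_one: "h \<one>\<^bsub>R\<^esub> = \<one>\<^bsub>R'\<^esub>" by (rule ring_hom_one[OF ring_hom])

lemma prime_S:
  assumes "primeideal r R'" "s \<in> S" shows "s \<notin> ring_spec_map R h r"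
  using Sp'.prime_unit[of r "h s"] units[OF assms(2)] assms(1) by (auto simp: ring_spec_map_def)

lemma primeideal_preimage:
  assumes "primeideal r R'"
  shows "primeideal (ring_spec_map R h r) R"
proof -
  interpret ring_hom_ring R R' h
    by (rule ring_hom_ringI2[OF R.ring_axioms R'.ring_axioms ring_hom])
  show ?thesis
    unfolding ring_spec_map_def by (rule primeideal_vimage[OF R.cring_axioms assms])
qed

text \<open>The local rings at \<open>r\<close> and at its preimage agree. A witness
  \<open>u\<close> over \<open>R'\<close> has the form \<open>a / b\<close>; multiplying by
  \<open>h b\<close> moves the equation into the image of \<open>h\<close>, and \<open>ker\<close>
  moves it on to \<open>R\<close> at the cost of a factor from \<open>S\<close>, which no preimage
  of a prime contains.\<close>

lemma local_eq_iff:
  assumes r: "primeideal r R'" and x: "x \<in> carrier R" and y: "y \<in> carrier R"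
  shows "(\<exists>u\<in>carrier R' - r. u \<otimes>\<^bsub>R'\<^esub> h x = u \<otimes>\<^bsub>R'\<^esub> h y) \<longleftrightarrow>
    (\<exists>u\<in>carrier R - ring_spec_map R h r. u \<otimes>\<^bsub>R\<^esub> x = u \<otimes>\<^bsub>R\<^esub> y)"
proof
  assume "\<exists>u\<in>carrier R - ring_spec_map R h r. u \<otimes>\<^bsub>R\<^esub> x = u \<otimes>\<^bsub>R\<^esub> y"
  then obtain u where u: "u \<in> carrier R" "h u \<notin> r" "u \<otimes>\<^bsub>R\<^esub> x = u \<otimes>\<^bsub>R\<^esub> y"
    by (auto simp: ring_spec_map_def)
  then show "\<exists>u\<in>carrier R' - r. u \<otimes>\<^bsub>R'\<^esub> h x = u \<otimes>\<^bsub>R'\<^esub> h y"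
    using h_mult[OF u(1) x] h_mult[OF u(1) y] h_closed[OF u(1)] by (intro bexI[of _ "h u"]) auto
next
  assume "\<exists>u\<in>carrier R' - r. u \<otimes>\<^bsub>R'\<^esub> h x = u \<otimes>\<^bsub>R'\<^esub> h y"
  then obtain u where u: "u \<in> carrier R'" "u \<notin> r" "u \<otimes>\<^bsub>R'\<^esub> h x = u \<otimes>\<^bsub>R'\<^esub> h y" by auto
  from surj[OF u(1)] obtain a b where ab: "a \<in> carrier R" "b \<in> S" "h b \<otimes>\<^bsub>R'\<^esub> u = h a" by blast
  have hb: "h b \<in> carrier R'" "h b \<notin> r"
    using h_closed S_carrier ab(2) prime_S[OF r ab(2)] by (auto simp: ring_spec_map_def)
  have hx: "h x \<in> carrier R'" "h y \<in> carrier R'" using h_closed x y by auto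
  have "h a \<notin> r" unfolding ab(3)[symmetric] using Sp'.prime_mult[of r "h b" u] r hb u by auto
  have "h (a \<otimes>\<^bsub>R\<^esub> x) = h b \<otimes>\<^bsub>R'\<^esub> (u \<otimes>\<^bsub>R'\<^esub> h x)"
    unfolding h_mult[OF ab(1) x] ab(3)[symmetric] using hb(1) u(1) hx by (simp add: R'.m_assoc)
  also have "\<dots> = h (a \<otimes>\<^bsub>R\<^esub> y)"
    unfolding h_mult[OF ab(1) y] ab(3)[symmetric] u(3) using hb(1) u(1) hx by (simp add: R'.m_assoc)
  finally obtain s where s: "s \<in> S" "s \<otimes>\<^bsub>R\<^esub> (a \<otimes>\<^bsub>R\<^esub> x) = s \<otimes>\<^bsub>R\<^esub> (a \<otimes>\<^bsub>R\<^esub> y)"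
    using ker[of "a \<otimes>\<^bsub>R\<^esub> x" "a \<otimes>\<^bsub>R\<^esub> y"] ab(1) x y by auto
  have sc: "s \<in> carrier R" by (rule S_carrier[OF s(1)])
  show "\<exists>u\<in>carrier R - ring_spec_map R h r. u \<otimes>\<^bsub>R\<^esub> x = u \<otimes>\<^bsub>R\<^esub> y"
  proof (intro bexI[of _ "s \<otimes>\<^bsub>R\<^esub> a"])
    show "s \<otimes>\<^bsub>R\<^esub> a \<otimes>\<^bsub>R\<^esub> x = s \<otimes>\<^bsub>R\<^esub> a \<otimes>\<^bsub>R\<^esub> y"
      using s(2) sc ab(1) x y by (simp add: R.m_assoc)
    have "a \<notin> ring_spec_map R h r" using \<open>h a \<notin> r\<close> by (simp add: ring_spec_map_def)
    then have "s \<otimes>\<^bsub>R\<^esub> a \<notin> ring_spec_map R h r"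
      using Sp.prime_mult[of "ring_spec_map R h r" s a] primeideal_preimage[OF r] sc ab(1)
        prime_S[OF r s(1)] by simp
    then show "s \<otimes>\<^bsub>R\<^esub> a \<in> carrier R - ring_spec_map R h r" using sc ab(1) by simp
  qed
qed

text \<open>Denominators map to units and hence lie in no prime. This is why a prime of the
  localisation is determined by its preimage.\<close>

lemma mem_iff_numerator:
  assumes "primeideal r R'" "x \<in> carrier R'" "a \<in> carrier R" "b \<in> S" "h b \<otimes>\<^bsub>R'\<^esub> x = h a"
  shows "x \<in> r \<longleftrightarrow> a \<in> ring_spec_map R h r"
proof -
  have "h b \<in> carrier R'" "h b \<notin> r"
    using h_closed[OF S_carrier[OF assms(4)]] Sp'.prime_unit[of r "h b"] units[OF assms(4)] assms(1) by auto
  then show ?thesis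
    using Sp'.prime_mult[of r "h b" x] assms by (auto simp: ring_spec_map_def)
qed

lemma prime_unique:
  assumes r: "primeideal r R'" "primeideal r' R'" and eq: "ring_spec_map R h r = ring_spec_map R h r'"
  shows "r = r'"
proof -
  have sub: "r \<subseteq> r'" if r: "primeideal r R'" "primeideal r' R'" and eq: "ring_spec_map R h r = ring_spec_map R h r'" for r r'
  proof
    fix x assume x: "x \<in> r"
    then have xc: "x \<in> carrier R'" using ideal.Icarr[OF primeideal.axioms(1)[OF r(1)]] by blast
    from surj[OF xc] obtain a b where ab: "a \<in> carrier R" "b \<in> S" "h b \<otimes>\<^bsub>R'\<^esub> x = h a" by blast
    show "x \<in> r'" using mem_iff_numerator[OF r(1) xc ab] mem_iff_numerator[OF r(2) xc ab] x eq by simp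
  qed
  show ?thesis using sub[OF r eq] sub[OF r(2,1) eq[symmetric]] by blast
qed

text \<open>The prime sought is the extension of \<open>q\<close>, the set of fractions with
  numerator in \<open>q\<close>. Since \<open>q\<close> avoids \<open>S\<close>, membership can be
  tested on any fraction (\<open>key\<close>), and every closure property becomes one of
  \<open>q\<close> after passing to a common denominator.\<close>

lemma prime_lift:
  assumes q: "primeideal q R" and qS: "q \<inter> S = {}"
  shows "\<exists>r. primeideal r R' \<and> ring_spec_map R h r = q"
proof -
  interpret q: primeideal q R by fact
  define r where "r = {x \<in> carrier R'. \<exists>a\<in>q. \<exists>b\<in>S. h b \<otimes>\<^bsub>R'\<^esub> x = h a}"
  have pm: "a \<otimes>\<^bsub>R\<^esub> b \<in> q \<longleftrightarrow> a \<in> q \<or> b \<in> q" if "a \<in> carrier R" "b \<in> carrier R" for a b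
    using Sp.prime_mult[of q a b] q that by simp
  have key: "x \<in> r \<longleftrightarrow> a \<in> q"
    if x: "x \<in> carrier R'" and a: "a \<in> carrier R" and b: "b \<in> S" and eq: "h b \<otimes>\<^bsub>R'\<^esub> x = h a" for x a b
  proof
    assume "x \<in> r"
    then obtain a' b' where ab': "a' \<in> q" "b' \<in> S" "h b' \<otimes>\<^bsub>R'\<^esub> x = h a'" by (auto simp: r_def)
    have c: "b \<in> carrier R" "b' \<in> carrier R" "a' \<in> carrier R"
      using S_carrier b ab' q.Icarr by auto
    note hc = h_closed[OF c(1)] h_closed[OF c(2)]
    have "h (b' \<otimes>\<^bsub>R\<^esub> a) = h b' \<otimes>\<^bsub>R'\<^esub> (h b \<otimes>\<^bsub>R'\<^esub> x)" unfolding eq h_mult[OF c(2) a] ..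
    also have "\<dots> = h b \<otimes>\<^bsub>R'\<^esub> (h b' \<otimes>\<^bsub>R'\<^esub> x)" using hc x by (simp add: R'.m_ac)
    also have "\<dots> = h (b \<otimes>\<^bsub>R\<^esub> a')" unfolding ab'(3) h_mult[OF c(1,3)] ..
    finally obtain s where s: "s \<in> S" "s \<otimes>\<^bsub>R\<^esub> (b' \<otimes>\<^bsub>R\<^esub> a) = s \<otimes>\<^bsub>R\<^esub> (b \<otimes>\<^bsub>R\<^esub> a')"
      using ker[of "b' \<otimes>\<^bsub>R\<^esub> a" "b \<otimes>\<^bsub>R\<^esub> a'"] c a by auto
    have "s \<otimes>\<^bsub>R\<^esub> (b \<otimes>\<^bsub>R\<^esub> a') \<in> q" using S_carrier[OF s(1)] c ab'(1) q.I_l_closed by auto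
    then have "s \<otimes>\<^bsub>R\<^esub> (b' \<otimes>\<^bsub>R\<^esub> a) \<in> q" using s(2) by simp
    then show "a \<in> q" using S_carrier[OF s(1)] c a s(1) ab'(2) qS by (auto simp: pm)
  qed (use that in \<open>auto simp: r_def\<close>)
  have rc: "r \<subseteq> carrier R'" by (auto simp: r_def)
  have rep: "\<exists>a\<in>carrier R. \<exists>b\<in>S. h b \<otimes>\<^bsub>R'\<^esub> x = h a \<and> (x \<in> r \<longleftrightarrow> a \<in> q)" if "x \<in> carrier R'" for x
    using surj[OF that] key[OF that] by blast
  have "ideal r R'"
  proof (rule idealI)
    show "ring R'" by (rule R'.ring_axioms)
    have add: "x \<oplus>\<^bsub>R'\<^esub> y \<in> r" if xy: "x \<in> r" "y \<in> r" for x y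
    proof -
      have xyc: "x \<in> carrier R'" "y \<in> carrier R'" using xy rc by auto
      obtain a b where ab: "a \<in> carrier R" "b \<in> S" "h b \<otimes>\<^bsub>R'\<^esub> x = h a" "a \<in> q" using rep[OF xyc(1)] xy by blast
      obtain c d where cd: "c \<in> carrier R" "d \<in> S" "h d \<otimes>\<^bsub>R'\<^esub> y = h c" "c \<in> q" using rep[OF xyc(2)] xy by blast
      note bd = S_carrier[OF ab(2)] S_carrier[OF cd(2)]
      note hbd = h_closed[OF bd(1)] h_closed[OF bd(2)]
      have "h (b \<otimes>\<^bsub>R\<^esub> d) \<otimes>\<^bsub>R'\<^esub> (x \<oplus>\<^bsub>R'\<^esub> y) = h d \<otimes>\<^bsub>R'\<^esub> (h b \<otimes>\<^bsub>R'\<^esub> x) \<oplus>\<^bsub>R'\<^esub> h b \<otimes>\<^bsub>R'\<^esub> (h d \<otimes>\<^bsub>R'\<^esub> y)"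
        unfolding h_mult[OF bd] using hbd xyc by (simp add: R'.r_distr R'.m_ac)
      also have "\<dots> = h (d \<otimes>\<^bsub>R\<^esub> a \<oplus>\<^bsub>R\<^esub> b \<otimes>\<^bsub>R\<^esub> c)"
        unfolding ab(3) cd(3) using bd ab(1) cd(1) by (simp add: h_add h_mult)
      finally have e: "h (b \<otimes>\<^bsub>R\<^esub> d) \<otimes>\<^bsub>R'\<^esub> (x \<oplus>\<^bsub>R'\<^esub> y) = h (d \<otimes>\<^bsub>R\<^esub> a \<oplus>\<^bsub>R\<^esub> b \<otimes>\<^bsub>R\<^esub> c)" .
      have m: "d \<otimes>\<^bsub>R\<^esub> a \<oplus>\<^bsub>R\<^esub> b \<otimes>\<^bsub>R\<^esub> c \<in> q"
        using bd ab cd q.I_l_closed q.a_closed by auto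
      show ?thesis
        using key[OF _ _ S.m_closed[OF ab(2) cd(2)] e] m q.Icarr[OF m] xyc by simp
    qed
    have l: "x \<otimes>\<^bsub>R'\<^esub> y \<in> r" if xy: "y \<in> r" "x \<in> carrier R'" for x y
    proof -
      have yc: "y \<in> carrier R'" using xy rc by auto
      obtain a b where ab: "a \<in> carrier R" "b \<in> S" "h b \<otimes>\<^bsub>R'\<^esub> x = h a" using rep[OF xy(2)] by blast
      obtain c d where cd: "c \<in> carrier R" "d \<in> S" "h d \<otimes>\<^bsub>R'\<^esub> y = h c" "c \<in> q" using rep[OF yc] xy by blast
      note bd = S_carrier[OF ab(2)] S_carrier[OF cd(2)]
      note hbd = h_closed[OF bd(1)] h_closed[OF bd(2)]
      have "h (b \<otimes>\<^bsub>R\<^esub> d) \<otimes>\<^bsub>R'\<^esub> (x \<otimes>\<^bsub>R'\<^esub> y) = (h b \<otimes>\<^bsub>R'\<^esub> x) \<otimes>\<^bsub>R'\<^esub> (h d \<otimes>\<^bsub>R'\<^esub> y)"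
        unfolding h_mult[OF bd] using hbd xy(2) yc by (simp add: R'.m_ac)
      also have "\<dots> = h (a \<otimes>\<^bsub>R\<^esub> c)"
        unfolding ab(3) cd(3) using ab(1) cd(1) by (simp add: h_mult)
      finally have e: "h (b \<otimes>\<^bsub>R\<^esub> d) \<otimes>\<^bsub>R'\<^esub> (x \<otimes>\<^bsub>R'\<^esub> y) = h (a \<otimes>\<^bsub>R\<^esub> c)" .
      have m: "a \<otimes>\<^bsub>R\<^esub> c \<in> q" using ab cd q.I_l_closed by auto
      show ?thesis
        using key[OF _ _ S.m_closed[OF ab(2) cd(2)] e] m q.Icarr[OF m] xy(2) yc by simp
    qed
    show "x \<otimes>\<^bsub>R'\<^esub> y \<in> r" if "y \<in> r" "x \<in> carrier R'" for x y using l[OF that] .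
    show "y \<otimes>\<^bsub>R'\<^esub> x \<in> r" if "y \<in> r" "x \<in> carrier R'" for x y
      using l[OF that] that rc R'.m_comm[of x y] by auto
    show "subgroup r (add_monoid R')"
    proof (rule R'.add.subgroupI)
      show "r \<subseteq> carrier R'" by (rule rc)
      have "h \<one>\<^bsub>R\<^esub> \<otimes>\<^bsub>R'\<^esub> \<zero>\<^bsub>R'\<^esub> = h \<zero>\<^bsub>R\<^esub>"
        by (simp add: h_one ring_hom_zero[OF ring_hom R.ring_axioms R'.ring_axioms])
      from key[OF R'.zero_closed R.zero_closed S.one_closed this]
      have "\<zero>\<^bsub>R'\<^esub> \<in> r" using additive_subgroup.zero_closed[OF q.additive_subgroup_axioms] by simp
      then show "r \<noteq> {}" by blast
      show "\<ominus>\<^bsub>R'\<^esub> x \<in> r" if x: "x \<in> r" for x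
      proof -
        have xc: "x \<in> carrier R'" using x rc by blast
        have "\<ominus>\<^bsub>R'\<^esub> x = \<ominus>\<^bsub>R'\<^esub> \<one>\<^bsub>R'\<^esub> \<otimes>\<^bsub>R'\<^esub> x" using xc by (simp add: R'.l_minus)
        then show ?thesis using l[OF x, of "\<ominus>\<^bsub>R'\<^esub> \<one>\<^bsub>R'\<^esub>"] by simp
      qed
      show "x \<oplus>\<^bsub>R'\<^esub> y \<in> r" if "x \<in> r" "y \<in> r" for x y using add[OF that] .
    qed
  qed
  have pre: "h a \<in> r \<longleftrightarrow> a \<in> q" if "a \<in> carrier R" for a
    using key[OF h_closed[OF that] that S.one_closed] h_closed[OF that] by (simp add: h_one)
  have "primeideal r R'"
  proof (rule primeidealI)
    show "ideal r R'" "cring R'" using \<open>ideal r R'\<close> R'.cring_axioms by auto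
    have "\<one>\<^bsub>R\<^esub> \<notin> q" using q.I_notcarr q.one_imp_carrier by auto
    then have "\<one>\<^bsub>R'\<^esub> \<notin> r" using pre[of "\<one>\<^bsub>R\<^esub>"] by (simp add: h_one)
    then show "carrier R' \<noteq> r" by auto
    fix x y assume xy: "x \<in> carrier R'" "y \<in> carrier R'" "x \<otimes>\<^bsub>R'\<^esub> y \<in> r"
    obtain a b where ab: "a \<in> carrier R" "b \<in> S" "h b \<otimes>\<^bsub>R'\<^esub> x = h a" "x \<in> r \<longleftrightarrow> a \<in> q" using rep[OF xy(1)] by (elim bexE conjE) (rule that)
    obtain c d where cd: "c \<in> carrier R" "d \<in> S" "h d \<otimes>\<^bsub>R'\<^esub> y = h c" "y \<in> r \<longleftrightarrow> c \<in> q" using rep[OF xy(2)] by (elim bexE conjE) (rule that)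
    note bd = S_carrier[OF ab(2)] S_carrier[OF cd(2)]
    note hbd = h_closed[OF bd(1)] h_closed[OF bd(2)]
    have "h (b \<otimes>\<^bsub>R\<^esub> d) \<otimes>\<^bsub>R'\<^esub> (x \<otimes>\<^bsub>R'\<^esub> y) = (h b \<otimes>\<^bsub>R'\<^esub> x) \<otimes>\<^bsub>R'\<^esub> (h d \<otimes>\<^bsub>R'\<^esub> y)"
      unfolding h_mult[OF bd] using hbd xy(1,2) by (simp add: R'.m_ac)
    also have "\<dots> = h (a \<otimes>\<^bsub>R\<^esub> c)"
      unfolding ab(3) cd(3) using ab(1) cd(1) by (simp add: h_mult)
    finally have e: "h (b \<otimes>\<^bsub>R\<^esub> d) \<otimes>\<^bsub>R'\<^esub> (x \<otimes>\<^bsub>R'\<^esub> y) = h (a \<otimes>\<^bsub>R\<^esub> c)" .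
    then have "a \<otimes>\<^bsub>R\<^esub> c \<in> q" using key[OF _ _ S.m_closed[OF ab(2) cd(2)] e] xy ab(1) cd(1) by simp
    then show "x \<in> r \<or> y \<in> r" using ab cd by (simp add: pm)
  qed
  moreover have "ring_spec_map R h r = q"
    using pre q.Icarr by (auto simp: ring_spec_map_def)
  ultimately show ?thesis by blast
qed

end

subsection \<open>Units in stalks\<close>

text \<open>Being a unit in a stalk is a multiplicative and local notion, so the axioms concern
  multiplication and restriction. Both the spectrum of a ring and the glued space are
  instances.\<close>

locale ring_presheaf =
  fixes X :: "('p, 's) ringed_space"
  assumes mult_closed: "\<And>U s t. openin (topo X) U \<Longrightarrow> s \<in> carrier (sect X U) \<Longrightarrow> t \<in> carrier (sect X U) \<Longrightarrow>
      s \<otimes>\<^bsub>sect X U\<^esub> t \<in> carrier (sect X U)"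
    and mult_comm: "\<And>U s t. openin (topo X) U \<Longrightarrow> s \<in> carrier (sect X U) \<Longrightarrow> t \<in> carrier (sect X U) \<Longrightarrow>
      s \<otimes>\<^bsub>sect X U\<^esub> t = t \<otimes>\<^bsub>sect X U\<^esub> s"
    and one_closed: "\<And>U. openin (topo X) U \<Longrightarrow> \<one>\<^bsub>sect X U\<^esub> \<in> carrier (sect X U)"
    and restr_closed: "\<And>U V s. openin (topo X) U \<Longrightarrow> openin (topo X) V \<Longrightarrow> V \<subseteq> U \<Longrightarrow> s \<in> carrier (sect X U) \<Longrightarrow>
      restr X U V s \<in> carrier (sect X V)"
    and restr_mult: "\<And>U V s t. openin (topo X) U \<Longrightarrow> openin (topo X) V \<Longrightarrow> V \<subseteq> U \<Longrightarrow>
      s \<in> carrier (sect X U) \<Longrightarrow> t \<in> carrier (sect X U) \<Longrightarrow>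
      restr X U V (s \<otimes>\<^bsub>sect X U\<^esub> t) = restr X U V s \<otimes>\<^bsub>sect X V\<^esub> restr X U V t"
    and restr_one: "\<And>U V. openin (topo X) U \<Longrightarrow> openin (topo X) V \<Longrightarrow> V \<subseteq> U \<Longrightarrow>
      restr X U V \<one>\<^bsub>sect X U\<^esub> = \<one>\<^bsub>sect X V\<^esub>"
    and restr_id: "\<And>U s. openin (topo X) U \<Longrightarrow> s \<in> carrier (sect X U) \<Longrightarrow> restr X U U s = s"
    and restr_comp: "\<And>U V W s. openin (topo X) U \<Longrightarrow> openin (topo X) V \<Longrightarrow> openin (topo X) W \<Longrightarrow>
      W \<subseteq> V \<Longrightarrow> V \<subseteq> U \<Longrightarrow> s \<in> carrier (sect X U) \<Longrightarrow> restr X V W (restr X U V s) = restr X U W s"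
begin

lemma mem_germ:
  "(V, t) \<in> germ X x U s \<longleftrightarrow> openin (topo X) V \<and> x \<in> V \<and> t \<in> carrier (sect X V) \<and>
     (\<exists>W. openin (topo X) W \<and> x \<in> W \<and> W \<subseteq> U \<inter> V \<and> restr X U W s = restr X V W t)"
  by (simp add: germ_def)

lemma germ_self:
  "openin (topo X) U \<Longrightarrow> x \<in> U \<Longrightarrow> s \<in> carrier (sect X U) \<Longrightarrow> (U, s) \<in> germ X x U s"
  unfolding mem_germ by (intro conjI exI[of _ U]) auto

lemma germ_trans:
  assumes U: "openin (topo X) U" "s \<in> carrier (sect X U)" and V: "openin (topo X) V" "t \<in> carrier (sect X V)"
    and W: "openin (topo X) W" "x \<in> W" "W \<subseteq> U \<inter> V" "restr X U W s = restr X V W t"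
    and m: "(V', t') \<in> germ X x U s"
  shows "(V', t') \<in> germ X x V t"
proof -
  obtain W' where W': "openin (topo X) W'" "x \<in> W'" "W' \<subseteq> U \<inter> V'" "restr X U W' s = restr X V' W' t'"
    and V': "openin (topo X) V'" "x \<in> V'" "t' \<in> carrier (sect X V')"
    using m unfolding mem_germ by (elim conjE exE) (rule that)
  let ?W = "W \<inter> W'"
  have o: "openin (topo X) ?W" using W W' by (simp add: openin_Int)
  have s1: "?W \<subseteq> W" "W \<subseteq> V" "W \<subseteq> U" "?W \<subseteq> W'" "W' \<subseteq> U" "W' \<subseteq> V'" using W W' by auto
  have "restr X V ?W t = restr X W ?W (restr X V W t)"
    by (rule restr_comp[OF V(1) W(1) o s1(1,2) V(2), symmetric])
  also have "\<dots> = restr X U ?W s"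
    unfolding W(4)[symmetric] by (rule restr_comp[OF U(1) W(1) o s1(1,3) U(2)])
  also have "\<dots> = restr X W' ?W (restr X U W' s)"
    by (rule restr_comp[OF U(1) W'(1) o s1(4,5) U(2), symmetric])
  also have "\<dots> = restr X V' ?W t'"
    unfolding W'(4) by (rule restr_comp[OF V'(1) W'(1) o s1(4,6) V'(3)])
  finally show ?thesis
    unfolding mem_germ using V' o W(2) W'(2) s1 by (intro conjI exI[of _ ?W]) auto
qed

lemma germ_eqI:
  assumes U: "openin (topo X) U" "s \<in> carrier (sect X U)" and V: "openin (topo X) V" "t \<in> carrier (sect X V)"
    and W: "openin (topo X) W" "x \<in> W" "W \<subseteq> U \<inter> V" "restr X U W s = restr X V W t"
  shows "germ X x U s = germ X x V t"
proof -
  have W': "W \<subseteq> V \<inter> U" using W(3) by blast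
  show ?thesis
    using germ_trans[OF U V W] germ_trans[OF V U W(1,2) W' W(4)[symmetric]]
    by (intro equalityI subrelI)
qed

lemma germ_memE:
  assumes U: "openin (topo X) U" "s \<in> carrier (sect X U)" and m: "(V, t) \<in> germ X x U s"
  obtains W where "openin (topo X) V" "x \<in> V" "t \<in> carrier (sect X V)"
    "openin (topo X) W" "x \<in> W" "W \<subseteq> U" "W \<subseteq> V" "restr X U W s = restr X V W t"
  using m unfolding mem_germ by (elim conjE exE) (rule that, auto)

text \<open>The product of germs is a union over representatives. All of them give one germ: two
  products agree on the intersection of the neighbourhoods on which their factors agree.\<close>

lemma stalk_mult:
  assumes U: "openin (topo X) U" "x \<in> U" "s \<in> carrier (sect X U)"
    and V: "openin (topo X) V" "x \<in> V" "t \<in> carrier (sect X V)"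
  shows "germ X x U s \<otimes>\<^bsub>stalk X x\<^esub> germ X x V t =
    germ X x (U \<inter> V) (restr X U (U \<inter> V) s \<otimes>\<^bsub>sect X (U \<inter> V)\<^esub> restr X V (U \<inter> V) t)"
proof -
  let ?f = "\<lambda>U s V t. germ X x (U \<inter> V) (restr X U (U \<inter> V) s \<otimes>\<^bsub>sect X (U \<inter> V)\<^esub> restr X V (U \<inter> V) t)"
  have eq: "?f U' s' V' t' = ?f U s V t" if 1: "(U', s') \<in> germ X x U s" and 2: "(V', t') \<in> germ X x V t"
    for U' s' V' t'
  proof -
    obtain W1 where U': "openin (topo X) U'" "x \<in> U'" "s' \<in> carrier (sect X U')"
      and W1: "openin (topo X) W1" "x \<in> W1" "W1 \<subseteq> U" "W1 \<subseteq> U'" "restr X U W1 s = restr X U' W1 s'"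
      by (rule germ_memE[OF U(1,3) 1])
    obtain W2 where V': "openin (topo X) V'" "x \<in> V'" "t' \<in> carrier (sect X V')"
      and W2: "openin (topo X) W2" "x \<in> W2" "W2 \<subseteq> V" "W2 \<subseteq> V'" "restr X V W2 t = restr X V' W2 t'"
      by (rule germ_memE[OF V(1,3) 2])
    let ?W = "W1 \<inter> W2"
    have o: "openin (topo X) ?W" "openin (topo X) (U \<inter> V)" "openin (topo X) (U' \<inter> V')"
      using U U' V V' W1 W2 by (simp_all add: openin_Int)
    have rs: "restr X A ?W a = restr X B ?W b"
      if "openin (topo X) A" "a \<in> carrier (sect X A)" "openin (topo X) B" "b \<in> carrier (sect X B)"
        "openin (topo X) W" "W \<subseteq> A" "W \<subseteq> B" "?W \<subseteq> W" "restr X A W a = restr X B W b" for A a B b W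
      using restr_comp[OF that(1,5) o(1) that(8,6,2)] restr_comp[OF that(3,5) o(1) that(8,7,4)] that(9) by simp
    have r: "restr X (A \<inter> B) ?W (restr X A (A \<inter> B) a \<otimes>\<^bsub>sect X (A \<inter> B)\<^esub> restr X B (A \<inter> B) b) =
        restr X A ?W a \<otimes>\<^bsub>sect X ?W\<^esub> restr X B ?W b"
      if A: "openin (topo X) A" "a \<in> carrier (sect X A)" and B: "openin (topo X) B" "b \<in> carrier (sect X B)"
        and s: "?W \<subseteq> A \<inter> B" for A a B b
    proof -
      have oo: "openin (topo X) (A \<inter> B)" using A B by (simp add: openin_Int)
      have c: "restr X A (A \<inter> B) a \<in> carrier (sect X (A \<inter> B))" "restr X B (A \<inter> B) b \<in> carrier (sect X (A \<inter> B))"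
        using restr_closed[OF A(1) oo _ A(2)] restr_closed[OF B(1) oo _ B(2)] by auto
      show ?thesis
        unfolding restr_mult[OF oo o(1) s c]
        using restr_comp[OF A(1) oo o(1) s _ A(2)] restr_comp[OF B(1) oo o(1) s _ B(2)] by simp
    qed
    have c: "restr X A (A \<inter> B) a \<otimes>\<^bsub>sect X (A \<inter> B)\<^esub> restr X B (A \<inter> B) b \<in> carrier (sect X (A \<inter> B))"
      if A: "openin (topo X) A" "a \<in> carrier (sect X A)" and B: "openin (topo X) B" "b \<in> carrier (sect X B)" for A a B b
    proof -
      have oo: "openin (topo X) (A \<inter> B)" using A B by (simp add: openin_Int)
      show ?thesis
        by (rule mult_closed[OF oo restr_closed[OF A(1) oo _ A(2)] restr_closed[OF B(1) oo _ B(2)]]) auto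
    qed
    have sW: "?W \<subseteq> U \<inter> V" "?W \<subseteq> U' \<inter> V'" using W1 W2 by auto
    show ?thesis
    proof (rule germ_eqI[OF o(3) c[OF U'(1,3) V'(1,3)] o(2) c[OF U(1,3) V(1,3)] o(1)])
      show "x \<in> ?W" "?W \<subseteq> U' \<inter> V' \<inter> (U \<inter> V)" using W1 W2 by auto
      show "restr X (U' \<inter> V') ?W (restr X U' (U' \<inter> V') s' \<otimes>\<^bsub>sect X (U' \<inter> V')\<^esub> restr X V' (U' \<inter> V') t') =
        restr X (U \<inter> V) ?W (restr X U (U \<inter> V) s \<otimes>\<^bsub>sect X (U \<inter> V)\<^esub> restr X V (U \<inter> V) t)"
        unfolding r[OF U'(1,3) V'(1,3) sW(2)] r[OF U(1,3) V(1,3) sW(1)]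
        using rs[OF U(1,3) U'(1,3) W1(1,3,4) _ W1(5)] rs[OF V(1,3) V'(1,3) W2(1,3,4) _ W2(5)] by simp
    qed
  qed
  have "germ X x U s \<otimes>\<^bsub>stalk X x\<^esub> germ X x V t =
      (\<Union>(U', s')\<in>germ X x U s. \<Union>(V', t')\<in>germ X x V t. ?f U' s' V' t')"
    by (simp add: stalk_def Let_def)
  also have "\<dots> = (\<Union>p\<in>germ X x U s. \<Union>p'\<in>germ X x V t. ?f U s V t)"
    by (intro SUP_cong refl) (auto simp: eq)
  also have "\<dots> = ?f U s V t"
    using germ_self[OF U] germ_self[OF V] by auto
  finally show ?thesis .
qed

text \<open>An inverse in the stalk is a germ, so the product becomes 1 only after shrinking;
  conversely an inverse on a smaller neighbourhood represents one. This turns the locality condition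
  on morphisms into a statement about sections.\<close>

lemma germ_unit_iff:
  assumes U: "openin (topo X) U" "x \<in> U" "s \<in> carrier (sect X U)"
  shows "germ X x U s \<in> Units (stalk X x) \<longleftrightarrow>
    (\<exists>W t. openin (topo X) W \<and> x \<in> W \<and> W \<subseteq> U \<and> t \<in> carrier (sect X W) \<and>
       restr X U W s \<otimes>\<^bsub>sect X W\<^esub> t = \<one>\<^bsub>sect X W\<^esub>)"
proof
  let ?E = "topspace (topo X)"
  have E: "openin (topo X) ?E" by simp
  have car: "carrier (stalk X x) = {germ X x U s | U s. openin (topo X) U \<and> x \<in> U \<and> s \<in> carrier (sect X U)}"
    and one: "\<one>\<^bsub>stalk X x\<^esub> = germ X x ?E \<one>\<^bsub>sect X ?E\<^esub>"
    by (simp_all add: stalk_def Let_def)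
  {
    assume "germ X x U s \<in> Units (stalk X x)"
    then obtain y where "y \<in> carrier (stalk X x)" and y: "germ X x U s \<otimes>\<^bsub>stalk X x\<^esub> y = \<one>\<^bsub>stalk X x\<^esub>"
      unfolding Units_def by blast
    then obtain V t where V: "openin (topo X) V" "x \<in> V" "t \<in> carrier (sect X V)" and yV: "y = germ X x V t"
      unfolding car by blast
    have oo: "openin (topo X) (U \<inter> V)" using U V by (simp add: openin_Int)
    let ?m = "restr X U (U \<inter> V) s \<otimes>\<^bsub>sect X (U \<inter> V)\<^esub> restr X V (U \<inter> V) t"
    have c: "restr X U (U \<inter> V) s \<in> carrier (sect X (U \<inter> V))" "restr X V (U \<inter> V) t \<in> carrier (sect X (U \<inter> V))"
      using restr_closed[OF U(1) oo _ U(3)] restr_closed[OF V(1) oo _ V(3)] by auto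
    have mc: "?m \<in> carrier (sect X (U \<inter> V))" by (rule mult_closed[OF oo c])
    have "germ X x (U \<inter> V) ?m = germ X x ?E \<one>\<^bsub>sect X ?E\<^esub>"
      using y unfolding yV stalk_mult[OF U V] one .
    moreover have "x \<in> ?E" using openin_subset[OF U(1)] U(2) by blast
    ultimately have "(?E, \<one>\<^bsub>sect X ?E\<^esub>) \<in> germ X x (U \<inter> V) ?m"
      using germ_self[OF E _ one_closed[OF E]] by simp
    from germ_memE[OF oo mc this] obtain W where
      W: "openin (topo X) W" "x \<in> W" "W \<subseteq> U \<inter> V" "W \<subseteq> ?E" "restr X (U \<inter> V) W ?m = restr X ?E W \<one>\<^bsub>sect X ?E\<^esub>"
      by metis
    have "restr X U W s \<otimes>\<^bsub>sect X W\<^esub> restr X V W t = restr X (U \<inter> V) W ?m"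
      unfolding restr_mult[OF oo W(1,3) c]
      using restr_comp[OF U(1) oo W(1,3) _ U(3)] restr_comp[OF V(1) oo W(1,3) _ V(3)] by simp
    also have "\<dots> = \<one>\<^bsub>sect X W\<^esub>" unfolding W(5) by (rule restr_one[OF E W(1,4)])
    finally show "\<exists>W t. openin (topo X) W \<and> x \<in> W \<and> W \<subseteq> U \<and> t \<in> carrier (sect X W) \<and>
       restr X U W s \<otimes>\<^bsub>sect X W\<^esub> t = \<one>\<^bsub>sect X W\<^esub>"
      using W restr_closed[OF V(1) W(1) _ V(3)] by (intro exI[of _ W] exI[of _ "restr X V W t"] conjI) auto
  next
    assume "\<exists>W t. openin (topo X) W \<and> x \<in> W \<and> W \<subseteq> U \<and> t \<in> carrier (sect X W) \<and>
       restr X U W s \<otimes>\<^bsub>sect X W\<^esub> t = \<one>\<^bsub>sect X W\<^esub>"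
    then obtain W t where W: "openin (topo X) W" "x \<in> W" "t \<in> carrier (sect X W)" "W \<subseteq> U"
       "restr X U W s \<otimes>\<^bsub>sect X W\<^esub> t = \<one>\<^bsub>sect X W\<^esub>" by (elim exE conjE) (rule that)
    have int: "U \<inter> W = W" "W \<inter> U = W" using W(4) by auto
    have c: "restr X U W s \<in> carrier (sect X W)" by (rule restr_closed[OF U(1) W(1,4) U(3)])
    have tt: "restr X W W t = t" by (rule restr_id[OF W(1,3)])
    have WE: "W \<subseteq> ?E" by (rule openin_subset[OF W(1)])
    have g1: "germ X x W \<one>\<^bsub>sect X W\<^esub> = \<one>\<^bsub>stalk X x\<^esub>"
      unfolding one
      by (rule germ_eqI[OF W(1) one_closed[OF W(1)] E one_closed[OF E] W(1,2)])
        (use WE restr_one[OF E W(1) WE] restr_id[OF W(1) one_closed[OF W(1)]] in auto)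
    have "germ X x U s \<otimes>\<^bsub>stalk X x\<^esub> germ X x W t = \<one>\<^bsub>stalk X x\<^esub>"
      unfolding stalk_mult[OF U W(1,2,3)] int tt W(5) g1 ..
    moreover have "germ X x W t \<otimes>\<^bsub>stalk X x\<^esub> germ X x U s = \<one>\<^bsub>stalk X x\<^esub>"
      unfolding stalk_mult[OF W(1,2,3) U] int tt mult_comm[OF W(1,3) c] W(5) g1 ..
    moreover have "germ X x U s \<in> carrier (stalk X x)" "germ X x W t \<in> carrier (stalk X x)"
      unfolding car using U W by blast+
    ultimately show "germ X x U s \<in> Units (stalk X x)"
      unfolding Units_def by blast
  }
qed

end

lemma ring_spec_simps [simp]:
  "topo (ring_spec R) = zariski R"
  "restr (ring_spec R) U V s = restrict s V"
  "carrier (sect (ring_spec R) U) = structure_sections R (zariski R) U"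
  "s \<otimes>\<^bsub>sect (ring_spec R) U\<^esub> t = (\<lambda>P\<in>U. fraction_mult R (carrier R - P) (s P) (t P))"
  "s \<oplus>\<^bsub>sect (ring_spec R) U\<^esub> t = (\<lambda>P\<in>U. fraction_add R (carrier R - P) (s P) (t P))"
  "\<one>\<^bsub>sect (ring_spec R) U\<^esub> = (\<lambda>P\<in>U. fraction R (carrier R - P) \<one>\<^bsub>R\<^esub> \<one>\<^bsub>R\<^esub>)"
  "\<zero>\<^bsub>sect (ring_spec R) U\<^esub> = (\<lambda>P\<in>U. fraction R (carrier R - P) \<zero>\<^bsub>R\<^esub> \<one>\<^bsub>R\<^esub>)"
  by (simp_all add: ring_spec_def ring_localisation_def)

context spectrum
begin

lemma fraction_mult_commute:
  assumes "s \<in> structure_sections M T U" "t \<in> structure_sections M T U" "P \<in> U"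
  shows "fraction_mult M (carrier M - P) (s P) (t P) = fraction_mult M (carrier M - P) (t P) (s P)"
proof -
  have Ps: "P \<in> Spec" using section_subset[OF assms(1)] assms(3) by blast
  interpret F: fraction_setting M "carrier M - P" by (rule fraction_setting[OF Ps])
  obtain a f where 1: "a \<in> carrier M" "f \<in> carrier M - P" "s P = fraction M (carrier M - P) a f"
    by (rule F.fractionsE[OF section_fractions[OF assms(1,3)]])
  obtain b g where 2: "b \<in> carrier M" "g \<in> carrier M - P" "t P = fraction M (carrier M - P) b g"
    by (rule F.fractionsE[OF section_fractions[OF assms(2,3)]])
  show ?thesis
    unfolding 1(3) 2(3) F.fraction_mult_fraction[OF 1(1) 2(1) 1(2) 2(2)] F.fraction_mult_fraction[OF 2(1) 1(1) 2(2) 1(2)]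
    using 1 2 m_comm[of a b] m_comm[of f g] by simp
qed

text \<open>Up to a factor outside \<open>P\<close>, the product of the two numerators equals the
  product of the denominators. As \<open>P\<close> is prime, neither numerator can lie in
  it.\<close>

lemma unit_of_inverse:
  assumes P: "P \<in> Spec" and x: "x \<in> fractions M (carrier M - P)" and y: "y \<in> fractions M (carrier M - P)"
    and eq: "fraction_mult M (carrier M - P) x y = fraction M (carrier M - P) \<one> \<one>" and m: "(a, f) \<in> x"
  shows "a \<notin> P"
proof -
  interpret F: fraction_setting M "carrier M - P" by (rule fraction_setting[OF P])
  note 1 = F.fractions_mem[OF x m]
  obtain b g where 2: "b \<in> carrier M" "g \<in> carrier M - P" "y = fraction M (carrier M - P) b g"
    by (rule F.fractionsE[OF y])
  have gf: "f \<otimes> g \<in> carrier M - P" using 1(2) 2(2) P by (auto simp: prime_mult)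
  have one: "\<one> \<in> carrier M - P" using prime_one[OF P] by simp
  have "fraction M (carrier M - P) (a \<otimes> b) (f \<otimes> g) = fraction M (carrier M - P) \<one> \<one>"
    using eq unfolding 1(3) 2(3) F.fraction_mult_fraction[OF 1(1) 2(1) 1(2) 2(2)] .
  then obtain u where u: "u \<in> carrier M - P" "u \<otimes> (a \<otimes> b \<otimes> \<one>) = u \<otimes> (\<one> \<otimes> (f \<otimes> g))"
    using F.fraction_eq_iff[OF _ _ gf one, of "a \<otimes> b" \<one>] 1(1) 2(1) by auto
  have "u \<otimes> (\<one> \<otimes> (f \<otimes> g)) \<notin> P" using u(1) gf P by (simp add: prime_mult)
  then have "u \<otimes> (a \<otimes> b \<otimes> \<one>) \<notin> P" unfolding u(2) .
  then show ?thesis using u(1) 1(1) 2(1) P by (auto simp: prime_mult)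
qed

end

lemma ring_presheaf_ring_spec:
  assumes "cring R"
  shows "ring_presheaf (ring_spec R)"
proof -
  interpret spectrum R "{P. primeideal P R}" "zariski R" by (rule spectrum_ring[OF assms])
  show ?thesis
  proof (rule ring_presheaf.intro; unfold ring_spec_simps)
    fix U V :: "'a set set" assume o: "openin (zariski R) U" "openin (zariski R) V" "V \<subseteq> U"
    fix s t assume st: "s \<in> structure_sections R (zariski R) U" "t \<in> structure_sections R (zariski R) U"
    show "restrict (\<lambda>P\<in>U. fraction_mult R (carrier R - P) (s P) (t P)) V =
      (\<lambda>P\<in>V. fraction_mult R (carrier R - P) (restrict s V P) (restrict t V P))"
      using o(3) by (auto simp: restrict_def fun_eq_iff)
  next
    fix U V :: "'a set set" assume o: "openin (zariski R) U" "openin (zariski R) V" "V \<subseteq> U"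
    show "restrict (\<lambda>P\<in>U. fraction R (carrier R - P) \<one>\<^bsub>R\<^esub> \<one>\<^bsub>R\<^esub>) V =
      (\<lambda>P\<in>V. fraction R (carrier R - P) \<one>\<^bsub>R\<^esub> \<one>\<^bsub>R\<^esub>)"
      using o(3) by (auto simp: restrict_def fun_eq_iff)
  next
    fix U s t assume st: "s \<in> structure_sections R (zariski R) U" "t \<in> structure_sections R (zariski R) U"
    show "(\<lambda>P\<in>U. fraction_mult R (carrier R - P) (s P) (t P)) = (\<lambda>P\<in>U. fraction_mult R (carrier R - P) (t P) (s P))"
      by (rule restrict_ext) (rule fraction_mult_commute[OF st])
  next
    fix U V W :: "'a set set" and s assume "W \<subseteq> V" and st: "s \<in> structure_sections R (zariski R) U"
    then show "restrict (restrict s V) W = restrict s W" by (simp add: Int_absorb1)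
  next
    fix U s assume st: "s \<in> structure_sections R (zariski R) U"
    then show "restrict s U = s" by (rule extensional_restrict[OF section_ext])
  qed (rule section_mult section_one section_restrict; assumption)+
qed

text \<open>The stalk at \<open>P\<close> is the localisation at \<open>P\<close>, whose nonunits
  are the fractions with numerator in \<open>P\<close>. A section that is a unit at \<open>P\<close>
  is one on the open unit locus, where the pointwise converse inverts it.\<close>

lemma germ_ring_spec_unit_iff:
  assumes R: "cring R" and U: "openin (zariski R) U" "P \<in> U" and s: "s \<in> structure_sections R (zariski R) U"
    and m: "(a, f) \<in> s P"
  shows "germ (ring_spec R) P U s \<in> Units (stalk (ring_spec R) P) \<longleftrightarrow> a \<notin> P"
proof -
  interpret Sp: spectrum R "{P. primeideal P R}" "zariski R" by (rule spectrum_ring[OF R])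
  interpret ring_presheaf "ring_spec R" by (rule ring_presheaf_ring_spec[OF R])
  have P: "P \<in> {P. primeideal P R}" using Sp.section_subset[OF s] U(2) by blast
  have iff: "germ (ring_spec R) P U s \<in> Units (stalk (ring_spec R) P) \<longleftrightarrow>
    (\<exists>W t. openin (zariski R) W \<and> P \<in> W \<and> W \<subseteq> U \<and> t \<in> structure_sections R (zariski R) W \<and>
      (\<lambda>Q\<in>W. fraction_mult R (carrier R - Q) (restrict s W Q) (t Q)) = (\<lambda>Q\<in>W. fraction R (carrier R - Q) \<one>\<^bsub>R\<^esub> \<one>\<^bsub>R\<^esub>))"
    using germ_unit_iff[of U P s] U s by (simp only: ring_spec_simps)
  show ?thesis
    unfolding iff
  proof
    assume "\<exists>W t. openin (zariski R) W \<and> P \<in> W \<and> W \<subseteq> U \<and> t \<in> structure_sections R (zariski R) W \<and>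
      (\<lambda>Q\<in>W. fraction_mult R (carrier R - Q) (restrict s W Q) (t Q)) = (\<lambda>Q\<in>W. fraction R (carrier R - Q) \<one>\<^bsub>R\<^esub> \<one>\<^bsub>R\<^esub>)"
    then obtain W t where W: "P \<in> W" "t \<in> structure_sections R (zariski R) W"
      "(\<lambda>Q\<in>W. fraction_mult R (carrier R - Q) (restrict s W Q) (t Q)) = (\<lambda>Q\<in>W. fraction R (carrier R - Q) \<one>\<^bsub>R\<^esub> \<one>\<^bsub>R\<^esub>)"
      by (elim exE conjE) (rule that)
    from fun_cong[OF W(3), of P] W(1)
    have "fraction_mult R (carrier R - P) (s P) (t P) = fraction R (carrier R - P) \<one>\<^bsub>R\<^esub> \<one>\<^bsub>R\<^esub>" by simp
    from Sp.unit_of_inverse[OF P Sp.section_fractions[OF s U(2)] Sp.section_fractions[OF W(2,1)] this m]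
    show "a \<notin> P" .
  next
    assume a: "a \<notin> P"
    let ?W = "{P \<in> U. \<exists>a f. (a, f) \<in> s P \<and> a \<notin> P}"
    have oW: "openin (zariski R) ?W" by (rule Sp.unit_locus_open[OF s])
    have PW: "P \<in> ?W" using U(2) a m by blast
    have sW: "restrict s ?W \<in> structure_sections R (zariski R) ?W"
      by (rule Sp.section_restrict[OF s oW]) auto
    have un: "\<exists>a f. (a, f) \<in> restrict s ?W Q \<and> a \<notin> Q" if "Q \<in> ?W" for Q using that by simp
    let ?t = "\<lambda>Q\<in>?W. (restrict s ?W Q)\<inverse>"
    have "(\<lambda>Q\<in>?W. fraction_mult R (carrier R - Q) (restrict s ?W Q) (?t Q)) = (\<lambda>Q\<in>?W. fraction R (carrier R - Q) \<one>\<^bsub>R\<^esub> \<one>\<^bsub>R\<^esub>)"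
      by (rule restrict_ext) (use Sp.section_converse(2)[OF sW un] in simp)
    with oW PW Sp.section_converse(1)[OF sW un]
    show "\<exists>W t. openin (zariski R) W \<and> P \<in> W \<and> W \<subseteq> U \<and> t \<in> structure_sections R (zariski R) W \<and>
      (\<lambda>Q\<in>W. fraction_mult R (carrier R - Q) (restrict s W Q) (t Q)) = (\<lambda>Q\<in>W. fraction R (carrier R - Q) \<one>\<^bsub>R\<^esub> \<one>\<^bsub>R\<^esub>)"
      by (intro exI[of _ ?W] exI[of _ ?t] conjI) auto
  qed
qed

subsection \<open>Gluing spectra along localisations\<close>

text \<open>
  \<open>loc i p\<close> singles out, in each glued class of points, one preferred representative: every prime of
  \<open>R j\<close> comes from exactly one such \<open>p\<close> over some \<open>i\<close> below \<open>j\<close>, its centre. This makes two points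
  equivalent iff they have the same centre.
\<close>

locale glue_diagram =
  fixes I :: "'i set" and le :: "'i \<Rightarrow> 'i \<Rightarrow> bool" and R :: "'i \<Rightarrow> 'r ring"
    and h :: "'i \<Rightarrow> 'i \<Rightarrow> 'r \<Rightarrow> 'r" and S :: "'i \<Rightarrow> 'i \<Rightarrow> 'r set" and loc :: "'i \<Rightarrow> 'r set \<Rightarrow> bool"
  assumes le_refl: "\<And>i. i \<in> I \<Longrightarrow> le i i"
    and le_trans: "\<And>i j k. i \<in> I \<Longrightarrow> j \<in> I \<Longrightarrow> k \<in> I \<Longrightarrow> le i j \<Longrightarrow> le j k \<Longrightarrow> le i k"
    and localisation: "\<And>i j. i \<in> I \<Longrightarrow> j \<in> I \<Longrightarrow> le i j \<Longrightarrow> ring_localisation_hom (R j) (R i) (h i j) (S i j)"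
    and h_id: "\<And>i a. i \<in> I \<Longrightarrow> a \<in> carrier (R i) \<Longrightarrow> h i i a = a"
    and h_comp: "\<And>i j k a. i \<in> I \<Longrightarrow> j \<in> I \<Longrightarrow> k \<in> I \<Longrightarrow> le i j \<Longrightarrow> le j k \<Longrightarrow> a \<in> carrier (R k) \<Longrightarrow>
      h i j (h j k a) = h i k a"
    and open_image: "\<And>i j. i \<in> I \<Longrightarrow> j \<in> I \<Longrightarrow> le i j \<Longrightarrow>
      \<exists>f\<in>S i j. \<forall>q. primeideal q (R j) \<and> f \<notin> q \<longrightarrow> q \<inter> S i j = {}"
    and centre_ex: "\<And>j q. j \<in> I \<Longrightarrow> primeideal q (R j) \<Longrightarrow>
      \<exists>i r. i \<in> I \<and> le i j \<and> primeideal r (R i) \<and> loc i r \<and> ring_spec_map (R j) (h i j) r = q"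
    and centre_unique: "\<And>i i' j r r'. i \<in> I \<Longrightarrow> i' \<in> I \<Longrightarrow> j \<in> I \<Longrightarrow> le i j \<Longrightarrow> le i' j \<Longrightarrow>
      primeideal r (R i) \<Longrightarrow> primeideal r' (R i') \<Longrightarrow> loc i r \<Longrightarrow> loc i' r' \<Longrightarrow>
      ring_spec_map (R j) (h i j) r = ring_spec_map (R j) (h i' j) r' \<Longrightarrow> i = i'"
begin

abbreviation Sp where "Sp i \<equiv> {p. primeideal p (R i)}"
abbreviation pr where "pr i j \<equiv> ring_spec_map (R j) (h i j)"
abbreviation cl where "cl \<equiv> glue_class I le (\<lambda>i. ring_spec (R i)) (\<lambda>i j. ring_spec_map (R j) (h i j))"
abbreviation frac where "frac i p \<equiv> fraction (R i) (carrier (R i) - p)"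

definition Y where
  "Y = glue I le (\<lambda>i. ring_spec (R i)) (\<lambda>i j. ring_spec_map (R j) (h i j))
     (\<lambda>i j. ring_spec_comap (R j) (R i) (h i j))"

definition pre where "pre V i = {p. primeideal p (R i) \<and> cl i p \<in> V}"

definition points where "points = {cl i p | i p. i \<in> I \<and> primeideal p (R i)}"

definition Sec where
  "Sec V = {s \<in> (\<Pi>\<^sub>E i\<in>I. structure_sections (R i) (zariski (R i)) (pre V i)).
     \<forall>i\<in>I. \<forall>j\<in>I. le i j \<longrightarrow> ring_spec_comap (R j) (R i) (h i j) (pre V j) (s j) = s i}"

lemma cring_R: "i \<in> I \<Longrightarrow> cring (R i)"
  using localisation[OF _ _ le_refl] ring_localisation_hom.axioms(2) by blast

lemma spec_R: "i \<in> I \<Longrightarrow> spectrum (R i) (Sp i) (zariski (R i))"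
  by (rule spectrum_ring[OF cring_R])

lemma frac_setting: "i \<in> I \<Longrightarrow> primeideal p (R i) \<Longrightarrow> fraction_setting (R i) (carrier (R i) - p)"
  using spectrum.fraction_setting[OF spec_R, of i p] by simp

lemma topspace_R: "i \<in> I \<Longrightarrow> topspace (zariski (R i)) = Sp i"
  by (rule spectrum.topspace_eq[OF spec_R])

lemma preim_pre: "i \<in> I \<Longrightarrow> preim (ring_spec (R i)) (cl i) V = pre V i"
  by (simp add: preim_def pre_def topspace_R)

lemma pr_prime: "i \<in> I \<Longrightarrow> j \<in> I \<Longrightarrow> le i j \<Longrightarrow> primeideal p (R i) \<Longrightarrow> primeideal (pr i j p) (R j)"
  by (rule ring_localisation_hom.primeideal_preimage[OF localisation])

lemma h_closed: "i \<in> I \<Longrightarrow> j \<in> I \<Longrightarrow> le i j \<Longrightarrow> a \<in> carrier (R j) \<Longrightarrow> h i j a \<in> carrier (R i)"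
  by (rule ring_localisation_hom.h_closed[OF localisation])

lemma mem_pr: "a \<in> pr i j p \<longleftrightarrow> a \<in> carrier (R j) \<and> h i j a \<in> p"
  by (simp add: ring_spec_map_def)

lemma h_notin: "i \<in> I \<Longrightarrow> j \<in> I \<Longrightarrow> le i j \<Longrightarrow> a \<in> carrier (R j) - pr i j p \<Longrightarrow> h i j a \<in> carrier (R i) - p"
  using h_closed[of i j a] by (simp add: mem_pr)

lemma pr_comp:
  assumes "i \<in> I" "j \<in> I" "k \<in> I" "le i j" "le j k"
  shows "pr j k (pr i j p) = pr i k p"
  using h_closed[OF assms(2,3,5)] h_comp[OF assms] by (auto simp: mem_pr)

lemma pr_id: "i \<in> I \<Longrightarrow> primeideal p (R i) \<Longrightarrow> pr i i p = p"
  using h_id[of i] ideal.Icarr[OF primeideal.axioms(1), of p "R i"] by (auto simp: mem_pr)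

lemma pr_inj:
  "i \<in> I \<Longrightarrow> j \<in> I \<Longrightarrow> le i j \<Longrightarrow> primeideal p (R i) \<Longrightarrow> primeideal p' (R i) \<Longrightarrow> pr i j p = pr i j p' \<Longrightarrow> p = p'"
  by (rule ring_localisation_hom.prime_unique[OF localisation])

definition E where
  "E = {((j, q), (k, pr j k q)) | j k q. j \<in> I \<and> k \<in> I \<and> le j k \<and> primeideal q (R j)}"

lemma cl_def: "i \<in> I \<Longrightarrow> cl i p = (E \<union> E\<inverse>)\<^sup>* `` {(i, p)}"
proof -
  have "E = {((j, q), (k, pr j k q)) | j k q. j \<in> I \<and> k \<in> I \<and> le j k \<and> q \<in> topspace (topo (ring_spec (R j)))}"
    unfolding E_def using topspace_R by auto
  then show ?thesis by (simp add: glue_class_def Let_def)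
qed

lemma cl_self: "i \<in> I \<Longrightarrow> (i, p) \<in> cl i p"
  by (simp add: cl_def)

lemma cl_pull:
  assumes "i \<in> I" "j \<in> I" "le i j" "primeideal p (R i)"
  shows "cl j (pr i j p) = cl i p"
proof -
  have "((i, p), (j, pr i j p)) \<in> E" unfolding E_def using assms by blast
  then have 1: "((i, p), (j, pr i j p)) \<in> (E \<union> E\<inverse>)\<^sup>*" "((j, pr i j p), (i, p)) \<in> (E \<union> E\<inverse>)\<^sup>*" by auto
  show ?thesis
    unfolding cl_def[OF assms(1)] cl_def[OF assms(2)]
    using rtrancl_trans[OF 1(1)] rtrancl_trans[OF 1(2)] by auto
qed

text \<open>The possible centres of \<open>(j, q)\<close>. There is exactly one if \<open>q\<close>
  is a prime of a chart \<open>j\<close>; keeping them as a set lets invariance of the centre be an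
  equation.\<close>

definition Ctr where
  "Ctr j q = {(v, r). v \<in> I \<and> le v j \<and> primeideal r (R v) \<and> loc v r \<and> pr v j r = q}"

text \<open>The axiom \<open>centre_unique\<close> determines the chart; within one chart the prime
  is determined because the spectrum of a localisation embeds.\<close>

lemma Ctr_unique:
  assumes "j \<in> I" "(v, r) \<in> Ctr j q" "(v', r') \<in> Ctr j q"
  shows "v' = v \<and> r' = r"
proof -
  have 1: "v \<in> I" "le v j" "primeideal r (R v)" "loc v r" "pr v j r = q"
    and 2: "v' \<in> I" "le v' j" "primeideal r' (R v')" "loc v' r'" "pr v' j r' = q"
    using assms(2,3) by (auto simp: Ctr_def)
  have v: "v' = v"
    by (rule centre_unique[OF 2(1) 1(1) assms(1) 2(2) 1(2) 2(3) 1(3) 2(4) 1(4)]) (simp only: 1 2)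
  then show ?thesis using pr_inj[OF 1(1) assms(1) 1(2), of r' r] 1 2 by simp
qed

text \<open>By composing the maps, a centre of \<open>(i, p)\<close> is also one of its image in
  \<open>j\<close>. Since the first set is nonempty and the second has at most one element, they
  coincide.\<close>

lemma Ctr_edge:
  assumes "i \<in> I" "j \<in> I" "le i j" "primeideal p (R i)"
  shows "Ctr j (pr i j p) = Ctr i p"
proof -
  have sub: "Ctr i p \<subseteq> Ctr j (pr i j p)"
    using le_trans[OF _ assms(1,2) _ assms(3)] pr_comp[OF _ assms(1,2) _ assms(3)] by (auto simp: Ctr_def)
  obtain v r where vr: "(v, r) \<in> Ctr i p"
    using centre_ex[OF assms(1,4)] by (auto simp: Ctr_def)
  then have "(v, r) \<in> Ctr j (pr i j p)" using sub by blast
  then have "Ctr j (pr i j p) \<subseteq> Ctr i p"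
    using Ctr_unique[OF assms(2), of v r] vr by auto
  then show ?thesis using sub by blast
qed

text \<open>Induction along the zigzag: every generating edge preserves the set of centres,
  whichever way it is traversed.\<close>

lemma cl_member:
  assumes "i \<in> I" "primeideal p (R i)" "(j, q) \<in> cl i p"
  shows "j \<in> I \<and> primeideal q (R j) \<and> Ctr j q = Ctr i p"
proof -
  have "((i, p), (j, q)) \<in> (E \<union> E\<inverse>)\<^sup>*" using assms(3) by (simp add: cl_def[OF assms(1)])
  then show ?thesis
  proof (induction "(j, q)" arbitrary: j q rule: rtrancl_induct)
    case base
    show ?case using assms by simp
  next
    case (step x)
    obtain k r where x: "x = (k, r)" by (cases x)
    have IH: "k \<in> I" "primeideal r (R k)" "Ctr k r = Ctr i p" using step(3)[OF x] by auto
    from step(2) x consider "((k, r), (j, q)) \<in> E" | "((j, q), (k, r)) \<in> E" by auto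
    then show ?case
    proof cases
      case 1
      then have "j \<in> I" "le k j" "q = pr k j r" by (auto simp: E_def)
      then show ?thesis using IH pr_prime Ctr_edge by simp
    next
      case 2
      then have "j \<in> I" "le j k" "r = pr j k q" "primeideal q (R j)" by (auto simp: E_def)
      then show ?thesis using IH Ctr_edge[of j k q] by simp
    qed
  qed
qed

text \<open>Equality of classes is always exploited in this form: instead of a zigzag of unknown
  length there is one representative in a chart below both.\<close>

lemma common_centre:
  assumes i: "i \<in> I" "primeideal p (R i)" and j: "j \<in> I" "primeideal q (R j)" and eq: "cl i p = cl j q"
  obtains v r where "v \<in> I" "primeideal r (R v)" "loc v r" "le v i" "le v j" "pr v i r = p" "pr v j r = q"
proof -
  have "(j, q) \<in> cl i p" using cl_self[OF j(1)] eq by simp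
  from cl_member[OF i this] have C: "Ctr j q = Ctr i p" by simp
  obtain v r where vr: "v \<in> I" "le v i" "primeideal r (R v)" "loc v r" "pr v i r = p"
    using centre_ex[OF i] by (elim exE conjE) (rule that)
  then have "(v, r) \<in> Ctr j q" unfolding C by (simp add: Ctr_def)
  then have "le v j" "pr v j r = q" by (simp_all add: Ctr_def)
  with vr show ?thesis using that by simp
qed

lemma openin_Y: "openin (topo Y) V \<longleftrightarrow> V \<subseteq> points \<and> (\<forall>i\<in>I. openin (zariski (R i)) (pre V i))"
proof -
  have pts: "{cl i p | i p. i \<in> I \<and> p \<in> topspace (topo (ring_spec (R i)))} = points"
    unfolding points_def using topspace_R by auto
  have topoY: "topo Y = glue_topology I le (\<lambda>i. ring_spec (R i)) (\<lambda>i j. ring_spec_map (R j) (h i j))"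
    by (simp add: Y_def glue_def Let_def)
  have "openin (topo Y) V \<longleftrightarrow> V \<subseteq> {cl i p | i p. i \<in> I \<and> p \<in> topspace (topo (ring_spec (R i)))} \<and>
    (\<forall>i\<in>I. openin (topo (ring_spec (R i))) (preim (ring_spec (R i)) (cl i) V))"
    unfolding topoY glue_topology_def topology_inverse'[OF istopology_glue] by (rule refl)
  also have "\<dots> \<longleftrightarrow> V \<subseteq> points \<and> (\<forall>i\<in>I. openin (zariski (R i)) (pre V i))"
    unfolding pts by (intro arg_cong2[of _ _ _ _ "(\<and>)"] ball_cong refl) (simp add: preim_pre)
  finally show ?thesis .
qed

lemma topspace_Y: "topspace (topo Y) = points"
proof -
  have "openin (topo Y) points"
    unfolding openin_Y
  proof (intro conjI ballI subset_refl)
    fix i assume i: "i \<in> I"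
    have "pre points i = topspace (zariski (R i))"
      unfolding topspace_R[OF i] using i by (auto simp: pre_def points_def)
    then show "openin (zariski (R i)) (pre points i)" by simp
  qed
  then have "points \<subseteq> topspace (topo Y)" by (rule openin_subset)
  moreover have "topspace (topo Y) \<subseteq> points"
    using openin_topspace[of "topo Y"] unfolding openin_Y by (rule conjunct1)
  ultimately show ?thesis by (rule antisym[rotated])
qed

lemma sect_Y_carrier: "carrier (sect Y V) = Sec V"
proof -
  have pi: "(\<Pi>\<^sub>E i\<in>I. carrier (sect (ring_spec (R i)) (preim (ring_spec (R i)) (cl i) V))) =
      (\<Pi>\<^sub>E i\<in>I. structure_sections (R i) (zariski (R i)) (pre V i))"
    by (rule PiE_cong) (simp add: preim_pre)
  show ?thesis
    unfolding Y_def glue_def Let_def Sec_def sheafed_space.simps partial_object.simps pi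
    by (intro Collect_cong conj_cong refl ball_cong imp_cong) (simp add: preim_pre)
qed

lemma Y_simps:
  "s \<otimes>\<^bsub>sect Y V\<^esub> t = (\<lambda>i\<in>I. \<lambda>p\<in>pre V i. fraction_mult (R i) (carrier (R i) - p) (s i p) (t i p))"
  "s \<oplus>\<^bsub>sect Y V\<^esub> t = (\<lambda>i\<in>I. \<lambda>p\<in>pre V i. fraction_add (R i) (carrier (R i) - p) (s i p) (t i p))"
  "\<one>\<^bsub>sect Y V\<^esub> = (\<lambda>i\<in>I. \<lambda>p\<in>pre V i. frac i p \<one>\<^bsub>R i\<^esub> \<one>\<^bsub>R i\<^esub>)"
  "restr Y V W s = (\<lambda>i\<in>I. restrict (s i) (pre W i))"
proof -
  show "s \<otimes>\<^bsub>sect Y V\<^esub> t = (\<lambda>i\<in>I. \<lambda>p\<in>pre V i. fraction_mult (R i) (carrier (R i) - p) (s i p) (t i p))"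
    unfolding Y_def glue_def Let_def by (simp, rule restrict_ext, simp add: preim_pre)
  show "s \<oplus>\<^bsub>sect Y V\<^esub> t = (\<lambda>i\<in>I. \<lambda>p\<in>pre V i. fraction_add (R i) (carrier (R i) - p) (s i p) (t i p))"
    unfolding Y_def glue_def Let_def by (simp, rule restrict_ext, simp add: preim_pre)
  show "\<one>\<^bsub>sect Y V\<^esub> = (\<lambda>i\<in>I. \<lambda>p\<in>pre V i. frac i p \<one>\<^bsub>R i\<^esub> \<one>\<^bsub>R i\<^esub>)"
    unfolding Y_def glue_def Let_def by (simp, rule restrict_ext, simp add: preim_pre)
  show "restr Y V W s = (\<lambda>i\<in>I. restrict (s i) (pre W i))"
    unfolding Y_def glue_def Let_def by (simp, rule restrict_ext, simp add: preim_pre)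
qed

lemma pre_mono: "W \<subseteq> V \<Longrightarrow> pre W i \<subseteq> pre V i"
  by (auto simp: pre_def)

lemma pre_prime: "p \<in> pre V i \<Longrightarrow> primeideal p (R i)"
  by (simp add: pre_def)

lemma pr_pre_iff:
  assumes "i \<in> I" "j \<in> I" "le i j" "primeideal p (R i)"
  shows "pr i j p \<in> pre V j \<longleftrightarrow> p \<in> pre V i"
  using cl_pull[OF assms] pr_prime[OF assms] assms(4) by (simp add: pre_def)

text \<open>Read from right to left, the induced map on local rings is well defined; read from left
  to right, it is injective. Both come from \<open>local_eq_iff\<close>, applied to the cross
  products.\<close>

lemma frac_map_eq_iff:
  assumes ij: "i \<in> I" "j \<in> I" "le i j" and p: "primeideal p (R i)"
    and a: "a \<in> carrier (R j)" "b \<in> carrier (R j)"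
    and f: "f \<in> carrier (R j) - pr i j p" "g \<in> carrier (R j) - pr i j p"
  shows "frac i p (h i j a) (h i j f) = frac i p (h i j b) (h i j g) \<longleftrightarrow> frac j (pr i j p) a f = frac j (pr i j p) b g"
proof -
  interpret L: ring_localisation_hom "R j" "R i" "h i j" "S i j" by (rule localisation[OF ij])
  interpret Fi: fraction_setting "R i" "carrier (R i) - p" by (rule frac_setting[OF ij(1) p])
  interpret Fj: fraction_setting "R j" "carrier (R j) - pr i j p" by (rule frac_setting[OF ij(2) pr_prime[OF ij p]])
  have fg: "f \<in> carrier (R j)" "g \<in> carrier (R j)" using f by auto
  have "frac i p (h i j a) (h i j f) = frac i p (h i j b) (h i j g) \<longleftrightarrow>
      (\<exists>u\<in>carrier (R i) - p. u \<otimes>\<^bsub>R i\<^esub> h i j (a \<otimes>\<^bsub>R j\<^esub> g) = u \<otimes>\<^bsub>R i\<^esub> h i j (b \<otimes>\<^bsub>R j\<^esub> f))"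
    unfolding L.h_mult[OF a(1) fg(2)] L.h_mult[OF a(2) fg(1)]
    by (rule Fi.fraction_eq_iff[OF L.h_closed[OF a(1)] L.h_closed[OF a(2)] h_notin[OF ij f(1)] h_notin[OF ij f(2)]])
  also have "\<dots> \<longleftrightarrow> (\<exists>u\<in>carrier (R j) - pr i j p. u \<otimes>\<^bsub>R j\<^esub> (a \<otimes>\<^bsub>R j\<^esub> g) = u \<otimes>\<^bsub>R j\<^esub> (b \<otimes>\<^bsub>R j\<^esub> f))"
    by (rule L.local_eq_iff[OF p]) (use a fg in auto)
  also have "\<dots> \<longleftrightarrow> frac j (pr i j p) a f = frac j (pr i j p) b g"
    by (rule Fj.fraction_eq_iff[OF a f, symmetric])
  finally show ?thesis .
qed

lemma comap_value:
  assumes ij: "i \<in> I" "j \<in> I" "le i j" and p: "primeideal p (R i)"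
    and x: "x \<in> fractions (R j) (carrier (R j) - pr i j p)" and m: "(a, f) \<in> x"
  shows "(\<Union>(a, f)\<in>x. frac i p (h i j a) (h i j f)) = frac i p (h i j a) (h i j f)"
proof -
  interpret Fj: fraction_setting "R j" "carrier (R j) - pr i j p" by (rule frac_setting[OF ij(2) pr_prime[OF ij p]])
  note 1 = Fj.fractions_mem[OF x m]
  show ?thesis
  proof (rule Fj.UN_fraction_eq[OF x])
    fix b g assume "(b, g) \<in> x"
    note 2 = Fj.fractions_mem[OF x this]
    show "frac i p (h i j b) (h i j g) = frac i p (h i j a) (h i j f)"
      unfolding frac_map_eq_iff[OF ij p 2(1) 1(1) 2(2) 1(2)] using 1(3) 2(3) by simp
  qed
qed

lemma comap_eq:
  assumes ij: "i \<in> I" "j \<in> I" "le i j"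
  shows "ring_spec_comap (R j) (R i) (h i j) (pre V j) s =
    (\<lambda>p\<in>pre V i. \<Union>(a, f)\<in>s (pr i j p). frac i p (h i j a) (h i j f))"
proof -
  have "preim (ring_spec (R i)) (pr i j) (pre V j) = pre V i"
    using pr_pre_iff[OF ij] by (auto simp: preim_def topspace_R[OF ij(1)] pre_prime)
  then show ?thesis by (simp add: ring_spec_comap_def)
qed

lemma SecD:
  assumes s: "s \<in> Sec V"
  shows "s \<in> extensional I" "\<And>i. i \<in> I \<Longrightarrow> s i \<in> structure_sections (R i) (zariski (R i)) (pre V i)"
    "\<And>i p. i \<in> I \<Longrightarrow> p \<in> pre V i \<Longrightarrow> s i p \<in> fractions (R i) (carrier (R i) - p)"
    "\<And>i j p a f. i \<in> I \<Longrightarrow> j \<in> I \<Longrightarrow> le i j \<Longrightarrow> p \<in> pre V i \<Longrightarrow> (a, f) \<in> s j (pr i j p) \<Longrightarrow>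
      s i p = frac i p (h i j a) (h i j f)"
proof -
  show "s \<in> extensional I" using s by (simp add: Sec_def PiE_def)
  show ss: "s i \<in> structure_sections (R i) (zariski (R i)) (pre V i)" if "i \<in> I" for i
    using s that by (auto simp: Sec_def)
  show fr: "s i p \<in> fractions (R i) (carrier (R i) - p)" if "i \<in> I" "p \<in> pre V i" for i p
    by (rule spectrum.section_fractions[OF spec_R[OF that(1)] ss[OF that(1)] that(2)])
  fix i j p a f
  assume ij: "i \<in> I" "j \<in> I" "le i j" and p: "p \<in> pre V i" and m: "(a, f) \<in> s j (pr i j p)"
  have pj: "pr i j p \<in> pre V j" using pr_pre_iff[OF ij pre_prime[OF p]] p by simp
  have "ring_spec_comap (R j) (R i) (h i j) (pre V j) (s j) = s i" using s ij by (simp add: Sec_def)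
  from fun_cong[OF this, of p] show "s i p = frac i p (h i j a) (h i j f)"
    unfolding comap_eq[OF ij] using p comap_value[OF ij pre_prime[OF p] fr[OF ij(2) pj] m] by simp
qed

text \<open>By \<open>comap_value\<close> the pullback of a fraction can be computed on any
  representative, so compatibility is asked for one representative at each point.\<close>

lemma SecI:
  assumes ext: "s \<in> extensional I"
    and ss: "\<And>i. i \<in> I \<Longrightarrow> s i \<in> structure_sections (R i) (zariski (R i)) (pre V i)"
    and comp: "\<And>i j p. i \<in> I \<Longrightarrow> j \<in> I \<Longrightarrow> le i j \<Longrightarrow> p \<in> pre V i \<Longrightarrow>
      \<exists>a f. (a, f) \<in> s j (pr i j p) \<and> s i p = frac i p (h i j a) (h i j f)"
  shows "s \<in> Sec V"
proof -
  have "ring_spec_comap (R j) (R i) (h i j) (pre V j) (s j) = s i" if ij: "i \<in> I" "j \<in> I" "le i j" for i j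
    unfolding comap_eq[OF ij]
  proof (rule extensionalityI[of _ "pre V i"])
    show "s i \<in> extensional (pre V i)" by (rule spectrum.section_ext[OF spec_R[OF ij(1)] ss[OF ij(1)]])
    fix p assume p: "p \<in> pre V i"
    from comp[OF ij p] obtain a f where af: "(a, f) \<in> s j (pr i j p)" "s i p = frac i p (h i j a) (h i j f)"
      by (elim exE conjE) (rule that)
    have pj: "pr i j p \<in> pre V j" using pr_pre_iff[OF ij pre_prime[OF p]] p by simp
    have "s j (pr i j p) \<in> fractions (R j) (carrier (R j) - pr i j p)"
      by (rule spectrum.section_fractions[OF spec_R[OF ij(2)] ss[OF ij(2)] pj])
    from comap_value[OF ij pre_prime[OF p] this af(1)] p af(2)
    show "(\<lambda>p\<in>pre V i. \<Union>(a, f)\<in>s j (pr i j p). frac i p (h i j a) (h i j f)) p = s i p" by simp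
  qed simp
  then show ?thesis using ext ss by (auto simp: Sec_def PiE_def)
qed

lemma Sec_rep:
  assumes "s \<in> Sec V" "i \<in> I" "p \<in> pre V i"
  obtains a f where "a \<in> carrier (R i)" "f \<in> carrier (R i) - p" "s i p = frac i p a f" "(a, f) \<in> s i p"
proof -
  interpret F: fraction_setting "R i" "carrier (R i) - p" by (rule frac_setting[OF assms(2) pre_prime[OF assms(3)]])
  obtain a f where "a \<in> carrier (R i)" "f \<in> carrier (R i) - p" "s i p = frac i p a f"
    by (rule F.fractionsE[OF SecD(3)[OF assms]])
  then show ?thesis using that F.fraction_self[of a f] by simp
qed

lemma Sec_eq_iff:
  assumes s: "s \<in> Sec V" "t \<in> Sec V" and ij: "i \<in> I" "j \<in> I" "le i j" and p: "p \<in> pre V i"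
  shows "s i p = t i p \<longleftrightarrow> s j (pr i j p) = t j (pr i j p)"
proof -
  have pj: "pr i j p \<in> pre V j" using pr_pre_iff[OF ij pre_prime[OF p]] p by simp
  obtain a f where 1: "a \<in> carrier (R j)" "f \<in> carrier (R j) - pr i j p" "s j (pr i j p) = frac j (pr i j p) a f"
    "(a, f) \<in> s j (pr i j p)" by (rule Sec_rep[OF s(1) ij(2) pj])
  obtain b g where 2: "b \<in> carrier (R j)" "g \<in> carrier (R j) - pr i j p" "t j (pr i j p) = frac j (pr i j p) b g"
    "(b, g) \<in> t j (pr i j p)" by (rule Sec_rep[OF s(2) ij(2) pj])
  show ?thesis
    unfolding SecD(4)[OF s(1) ij p 1(4)] SecD(4)[OF s(2) ij p 2(4)] 1(3) 2(3)
    by (rule frac_map_eq_iff[OF ij pre_prime[OF p] 1(1) 2(1) 1(2) 2(2)])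
qed

lemma Sec_map_mem:
  assumes s: "s \<in> Sec V" and ij: "i \<in> I" "j \<in> I" "le i j" and p: "p \<in> pre V i" and m: "(a, f) \<in> s j (pr i j p)"
  shows "(h i j a, h i j f) \<in> s i p" "a \<in> carrier (R j)" "f \<in> carrier (R j) - pr i j p"
proof -
  have pj: "pr i j p \<in> pre V j" using pr_pre_iff[OF ij pre_prime[OF p]] p by simp
  interpret Fj: fraction_setting "R j" "carrier (R j) - pr i j p" by (rule frac_setting[OF ij(2) pre_prime[OF pj]])
  interpret Fi: fraction_setting "R i" "carrier (R i) - p" by (rule frac_setting[OF ij(1) pre_prime[OF p]])
  note 1 = Fj.fractions_mem[OF SecD(3)[OF s ij(2) pj] m]
  show "a \<in> carrier (R j)" "f \<in> carrier (R j) - pr i j p" by (fact 1(1), fact 1(2))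
  show "(h i j a, h i j f) \<in> s i p"
    unfolding SecD(4)[OF s ij p m] by (rule Fi.fraction_self[OF h_closed[OF ij 1(1)] h_notin[OF ij 1(2)]])
qed

definition unit_at where "unit_at s i p \<longleftrightarrow> (\<exists>a f. (a, f) \<in> s i p \<and> a \<notin> p)"

lemma unit_at_iff:
  assumes s: "s \<in> Sec V" and i: "i \<in> I" "p \<in> pre V i" and m: "(a, f) \<in> s i p"
  shows "unit_at s i p \<longleftrightarrow> a \<notin> p"
  unfolding unit_at_def
  using spectrum.fraction_num_notin[OF spec_R[OF i(1)] _ SecD(3)[OF s i] _ m] pre_prime[OF i(2)] m by auto

lemma unit_at_pr:
  assumes s: "s \<in> Sec V" and ij: "i \<in> I" "j \<in> I" "le i j" and p: "p \<in> pre V i"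
  shows "unit_at s i p \<longleftrightarrow> unit_at s j (pr i j p)"
proof -
  have pj: "pr i j p \<in> pre V j" using pr_pre_iff[OF ij pre_prime[OF p]] p by simp
  obtain a f where 1: "a \<in> carrier (R j)" "f \<in> carrier (R j) - pr i j p" "s j (pr i j p) = frac j (pr i j p) a f"
    "(a, f) \<in> s j (pr i j p)" by (rule Sec_rep[OF s ij(2) pj])
  show ?thesis
    unfolding unit_at_iff[OF s ij(1) p Sec_map_mem(1)[OF s ij p 1(4)]] unit_at_iff[OF s ij(2) pj 1(4)]
    using 1(1) by (simp add: mem_pr)
qed

text \<open>The danger in descending compatible loci from the charts is that identification adds
  points to them. A point of the descended set has a representative satisfying \<open>D\<close> in
  some chart, and \<open>common_centre\<close> carries \<open>D\<close> from there to every other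
  representative.\<close>

lemma saturated_open:
  assumes V: "openin (topo Y) V"
    and inv: "\<And>i j p. i \<in> I \<Longrightarrow> j \<in> I \<Longrightarrow> le i j \<Longrightarrow> p \<in> pre V i \<Longrightarrow> D i p \<longleftrightarrow> D j (pr i j p)"
    and op: "\<And>i. i \<in> I \<Longrightarrow> openin (zariski (R i)) {p \<in> pre V i. D i p}"
  obtains V' where "openin (topo Y) V'" "V' \<subseteq> V" "\<forall>i\<in>I. pre V' i = {p \<in> pre V i. D i p}"
proof
  define V' where "V' = {cl i p | i p. i \<in> I \<and> p \<in> pre V i \<and> D i p}"
  show sub: "V' \<subseteq> V" by (auto simp: V'_def pre_def)
  have pre: "pre V' i = {p \<in> pre V i. D i p}" if i: "i \<in> I" for i
  proof (intro equalityI subsetI)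
    fix p assume p: "p \<in> pre V' i"
    then have pV: "p \<in> pre V i" using pre_mono[OF sub] by blast
    from p obtain j q where jq: "cl i p = cl j q" "j \<in> I" "q \<in> pre V j" "D j q" by (auto simp: pre_def V'_def)
    obtain v r where vr: "v \<in> I" "primeideal r (R v)" "loc v r" "le v i" "le v j" "pr v i r = p" "pr v j r = q"
      by (rule common_centre[OF i pre_prime[OF pV] jq(2) pre_prime[OF jq(3)] jq(1)])
    have r: "r \<in> pre V v" using pr_pre_iff[OF vr(1) i vr(4,2)] pV vr(6) by simp
    have "D v r" using inv[OF vr(1) jq(2) vr(5) r] vr(7) jq(4) by simp
    then show "p \<in> {p \<in> pre V i. D i p}" using inv[OF vr(1) i vr(4) r] vr(6) pV by simp
  next
    fix p assume "p \<in> {p \<in> pre V i. D i p}"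
    then show "p \<in> pre V' i" using i by (auto simp: V'_def pre_def)
  qed
  then show "\<forall>i\<in>I. pre V' i = {p \<in> pre V i. D i p}" by simp
  have "V' \<subseteq> points" by (rule order_trans[OF sub conjunct1[OF V[unfolded openin_Y]]])
  then show "openin (topo Y) V'" unfolding openin_Y using pre op by simp
qed

text \<open>The locus where two sections agree is open in every chart and, by
  \<open>Sec_eq_iff\<close>, compatible with the gluing maps. It is therefore open in the glued
  space, and equality at one representative spreads to a neighbourhood of the point.\<close>

lemma germ_equal:
  assumes V: "openin (topo Y) V" and s: "s \<in> Sec V" "t \<in> Sec V" and z: "z \<in> I" "p \<in> pre V z" "s z p = t z p"
  obtains V' where "openin (topo Y) V'" "V' \<subseteq> V" "cl z p \<in> V'" "restr Y V V' s = restr Y V V' t"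
proof -
  obtain V' where V': "openin (topo Y) V'" "V' \<subseteq> V" "\<forall>i\<in>I. pre V' i = {p \<in> pre V i. s i p = t i p}"
  proof (rule saturated_open[OF V, of "\<lambda>i p. s i p = t i p"])
    show "s i p = t i p \<longleftrightarrow> s j (pr i j p) = t j (pr i j p)" if "i \<in> I" "j \<in> I" "le i j" "p \<in> pre V i" for i j p
      by (rule Sec_eq_iff[OF s that])
    show "openin (zariski (R i)) {p \<in> pre V i. s i p = t i p}" if "i \<in> I" for i
      by (rule spectrum.equal_locus_open[OF spec_R[OF that] SecD(2)[OF s(1) that] SecD(2)[OF s(2) that]])
  qed
  have "p \<in> pre V' z" using V'(3)[rule_format, OF z(1)] z(2,3) by simp
  then have "cl z p \<in> V'" by (simp add: pre_def)
  moreover have "restr Y V V' s = restr Y V V' t"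
    unfolding Y_simps by (intro restrict_ext) (auto simp: V'(3))
  ultimately show ?thesis by (rule that[OF V'(1,2)])
qed

lemma Sec_mult:
  assumes V: "openin (topo Y) V" and s: "s \<in> Sec V" "t \<in> Sec V"
  shows "(\<lambda>i\<in>I. \<lambda>p\<in>pre V i. fraction_mult (R i) (carrier (R i) - p) (s i p) (t i p)) \<in> Sec V"
proof (rule SecI)
  fix i assume i: "i \<in> I"
  show "(\<lambda>i\<in>I. \<lambda>p\<in>pre V i. fraction_mult (R i) (carrier (R i) - p) (s i p) (t i p)) i \<in>
    structure_sections (R i) (zariski (R i)) (pre V i)"
    using spectrum.section_mult[OF spec_R[OF i] SecD(2)[OF s(1) i] SecD(2)[OF s(2) i]] i by simp
next
  fix i j p assume ij: "i \<in> I" "j \<in> I" "le i j" and p: "p \<in> pre V i"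
  have pj: "pr i j p \<in> pre V j" using pr_pre_iff[OF ij pre_prime[OF p]] p by simp
  interpret L: ring_localisation_hom "R j" "R i" "h i j" "S i j" by (rule localisation[OF ij])
  interpret Fi: fraction_setting "R i" "carrier (R i) - p" by (rule frac_setting[OF ij(1) pre_prime[OF p]])
  interpret Fj: fraction_setting "R j" "carrier (R j) - pr i j p" by (rule frac_setting[OF ij(2) pre_prime[OF pj]])
  obtain a f where 1: "a \<in> carrier (R j)" "f \<in> carrier (R j) - pr i j p" "s j (pr i j p) = frac j (pr i j p) a f"
    "(a, f) \<in> s j (pr i j p)" by (rule Sec_rep[OF s(1) ij(2) pj])
  obtain b g where 2: "b \<in> carrier (R j)" "g \<in> carrier (R j) - pr i j p" "t j (pr i j p) = frac j (pr i j p) b g"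
    "(b, g) \<in> t j (pr i j p)" by (rule Sec_rep[OF s(2) ij(2) pj])
  have fg: "f \<otimes>\<^bsub>R j\<^esub> g \<in> carrier (R j) - pr i j p"
    by (rule submonoid.m_closed[OF Fj.submonoid_S 1(2) 2(2)])
  have "fraction_mult (R j) (carrier (R j) - pr i j p) (s j (pr i j p)) (t j (pr i j p)) =
      frac j (pr i j p) (a \<otimes>\<^bsub>R j\<^esub> b) (f \<otimes>\<^bsub>R j\<^esub> g)"
    unfolding 1(3) 2(3) by (rule Fj.fraction_mult_fraction[OF 1(1) 2(1) 1(2) 2(2)])
  then have m: "(a \<otimes>\<^bsub>R j\<^esub> b, f \<otimes>\<^bsub>R j\<^esub> g) \<in> fraction_mult (R j) (carrier (R j) - pr i j p) (s j (pr i j p)) (t j (pr i j p))"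
    using Fj.fraction_self[OF _ fg, of "a \<otimes>\<^bsub>R j\<^esub> b"] 1(1) 2(1) by simp
  have "fraction_mult (R i) (carrier (R i) - p) (s i p) (t i p) = frac i p (h i j (a \<otimes>\<^bsub>R j\<^esub> b)) (h i j (f \<otimes>\<^bsub>R j\<^esub> g))"
    unfolding SecD(4)[OF s(1) ij p 1(4)] SecD(4)[OF s(2) ij p 2(4)]
    using Fi.fraction_mult_fraction[OF L.h_closed[OF 1(1)] L.h_closed[OF 2(1)] h_notin[OF ij 1(2)] h_notin[OF ij 2(2)]]
      L.h_mult[OF 1(1) 2(1)] L.h_mult[of f g] 1(2) 2(2) by simp
  then show "\<exists>a f. (a, f) \<in> (\<lambda>i\<in>I. \<lambda>p\<in>pre V i. fraction_mult (R i) (carrier (R i) - p) (s i p) (t i p)) j (pr i j p) \<and>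
      (\<lambda>i\<in>I. \<lambda>p\<in>pre V i. fraction_mult (R i) (carrier (R i) - p) (s i p) (t i p)) i p = frac i p (h i j a) (h i j f)"
    using m p pj ij by (intro exI[of _ "a \<otimes>\<^bsub>R j\<^esub> b"] exI[of _ "f \<otimes>\<^bsub>R j\<^esub> g"] conjI) simp_all
qed simp

lemma Sec_one:
  assumes V: "openin (topo Y) V"
  shows "(\<lambda>i\<in>I. \<lambda>p\<in>pre V i. frac i p \<one>\<^bsub>R i\<^esub> \<one>\<^bsub>R i\<^esub>) \<in> Sec V"
proof (rule SecI)
  fix i assume i: "i \<in> I"
  have "openin (zariski (R i)) (pre V i)" using V i by (simp add: openin_Y)
  then show "(\<lambda>i\<in>I. \<lambda>p\<in>pre V i. frac i p \<one>\<^bsub>R i\<^esub> \<one>\<^bsub>R i\<^esub>) i \<in> structure_sections (R i) (zariski (R i)) (pre V i)"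
    using spectrum.section_one[OF spec_R[OF i]] i by simp
next
  fix i j p assume ij: "i \<in> I" "j \<in> I" "le i j" and p: "p \<in> pre V i"
  have pj: "pr i j p \<in> pre V j" using pr_pre_iff[OF ij pre_prime[OF p]] p by simp
  interpret L: ring_localisation_hom "R j" "R i" "h i j" "S i j" by (rule localisation[OF ij])
  interpret Fj: fraction_setting "R j" "carrier (R j) - pr i j p" by (rule frac_setting[OF ij(2) pre_prime[OF pj]])
  have "\<one>\<^bsub>R j\<^esub> \<in> carrier (R j) - pr i j p" by (rule submonoid.one_closed[OF Fj.submonoid_S])
  then show "\<exists>a f. (a, f) \<in> (\<lambda>i\<in>I. \<lambda>p\<in>pre V i. frac i p \<one>\<^bsub>R i\<^esub> \<one>\<^bsub>R i\<^esub>) j (pr i j p) \<and>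
      (\<lambda>i\<in>I. \<lambda>p\<in>pre V i. frac i p \<one>\<^bsub>R i\<^esub> \<one>\<^bsub>R i\<^esub>) i p = frac i p (h i j a) (h i j f)"
    using p pj ij Fj.fraction_self[of "\<one>\<^bsub>R j\<^esub>" "\<one>\<^bsub>R j\<^esub>"]
    by (intro exI[of _ "\<one>\<^bsub>R j\<^esub>"] conjI) (simp_all add: L.h_one)
qed simp

lemma Sec_restr:
  assumes V: "openin (topo Y) V" "openin (topo Y) W" "W \<subseteq> V" and s: "s \<in> Sec V"
  shows "(\<lambda>i\<in>I. restrict (s i) (pre W i)) \<in> Sec W"
proof (rule SecI)
  fix i assume i: "i \<in> I"
  have "openin (zariski (R i)) (pre W i)" using V i by (simp add: openin_Y)
  then show "(\<lambda>i\<in>I. restrict (s i) (pre W i)) i \<in> structure_sections (R i) (zariski (R i)) (pre W i)"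
    using spectrum.section_restrict[OF spec_R[OF i] SecD(2)[OF s i] _ pre_mono[OF V(3)]] i by simp
next
  fix i j p assume ij: "i \<in> I" "j \<in> I" "le i j" and p: "p \<in> pre W i"
  have pj: "pr i j p \<in> pre W j" using pr_pre_iff[OF ij pre_prime[OF p]] p by simp
  have pV: "p \<in> pre V i" "pr i j p \<in> pre V j" using p pj pre_mono[OF V(3)] by auto
  obtain a f where 1: "(a, f) \<in> s j (pr i j p)" by (rule Sec_rep[OF s ij(2) pV(2)])
  show "\<exists>a f. (a, f) \<in> (\<lambda>i\<in>I. restrict (s i) (pre W i)) j (pr i j p) \<and>
      (\<lambda>i\<in>I. restrict (s i) (pre W i)) i p = frac i p (h i j a) (h i j f)"
    using p pj ij 1 SecD(4)[OF s ij pV(1) 1] by (intro exI[of _ a] exI[of _ f] conjI) simp_all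
qed simp

lemma ring_presheaf_Y: "ring_presheaf Y"
proof (rule ring_presheaf.intro; unfold sect_Y_carrier Y_simps)
  fix U s t assume st: "s \<in> Sec U" "t \<in> Sec U"
  show "(\<lambda>i\<in>I. \<lambda>p\<in>pre U i. fraction_mult (R i) (carrier (R i) - p) (s i p) (t i p)) =
    (\<lambda>i\<in>I. \<lambda>p\<in>pre U i. fraction_mult (R i) (carrier (R i) - p) (t i p) (s i p))"
    by (intro restrict_ext) (rule spectrum.fraction_mult_commute[OF spec_R SecD(2)[OF st(1)] SecD(2)[OF st(2)]])
next
  fix U V :: "('i \<times> 'r set) set set" and s t assume o: "V \<subseteq> U"
  show "(\<lambda>i\<in>I. restrict ((\<lambda>i\<in>I. \<lambda>p\<in>pre U i. fraction_mult (R i) (carrier (R i) - p) (s i p) (t i p)) i) (pre V i)) =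
     (\<lambda>i\<in>I. \<lambda>p\<in>pre V i. fraction_mult (R i) (carrier (R i) - p) ((\<lambda>i\<in>I. restrict (s i) (pre V i)) i p)
        ((\<lambda>i\<in>I. restrict (t i) (pre V i)) i p))"
    by (rule restrict_ext) (auto simp: restrict_def fun_eq_iff dest: pre_mono[OF o, THEN subsetD])
next
  fix U V :: "('i \<times> 'r set) set set" assume o: "V \<subseteq> U"
  show "(\<lambda>i\<in>I. restrict ((\<lambda>i\<in>I. \<lambda>p\<in>pre U i. frac i p \<one>\<^bsub>R i\<^esub> \<one>\<^bsub>R i\<^esub>) i) (pre V i)) =
     (\<lambda>i\<in>I. \<lambda>p\<in>pre V i. frac i p \<one>\<^bsub>R i\<^esub> \<one>\<^bsub>R i\<^esub>)"
    by (rule restrict_ext) (auto simp: restrict_def fun_eq_iff dest: pre_mono[OF o, THEN subsetD])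
next
  fix U s assume s: "s \<in> Sec U"
  show "(\<lambda>i\<in>I. restrict (s i) (pre U i)) = s"
    by (rule extensionalityI[of _ I]) (use SecD(1)[OF s] extensional_restrict[OF spectrum.section_ext[OF spec_R SecD(2)[OF s]]] in auto)
next
  fix U V W :: "('i \<times> 'r set) set set" and s assume o: "W \<subseteq> V"
  show "(\<lambda>i\<in>I. restrict ((\<lambda>i\<in>I. restrict (s i) (pre V i)) i) (pre W i)) = (\<lambda>i\<in>I. restrict (s i) (pre W i))"
    by (rule restrict_ext) (simp add: Int_absorb1[OF pre_mono[OF o]])
qed (rule Sec_mult Sec_one Sec_restr; assumption)+

text \<open>Gluing does not change local rings, so units are recognised by a numerator in any chart.
  The inverse is built chart by chart as the converse on the unit locus; the converses are
  compatible because the gluing maps act on numerators and denominators alike.\<close>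

lemma germ_Y_unit_iff:
  assumes V: "openin (topo Y) V" and s: "s \<in> Sec V" and z: "z \<in> I" "p \<in> pre V z" and m: "(a, f) \<in> s z p"
  shows "germ Y (cl z p) V s \<in> Units (stalk Y (cl z p)) \<longleftrightarrow> a \<notin> p"
proof -
  interpret ring_presheaf Y by (rule ring_presheaf_Y)
  have y: "cl z p \<in> V" using z(2) by (simp add: pre_def)
  have iff: "germ Y (cl z p) V s \<in> Units (stalk Y (cl z p)) \<longleftrightarrow>
    (\<exists>W t. openin (topo Y) W \<and> cl z p \<in> W \<and> W \<subseteq> V \<and> t \<in> Sec W \<and>
       restr Y V W s \<otimes>\<^bsub>sect Y W\<^esub> t = \<one>\<^bsub>sect Y W\<^esub>)"
    using germ_unit_iff[OF V y, of s] s by (simp only: sect_Y_carrier)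
  have ps: "p \<in> Sp z" using pre_prime[OF z(2)] by simp
  show ?thesis
    unfolding iff
  proof
    assume "\<exists>W t. openin (topo Y) W \<and> cl z p \<in> W \<and> W \<subseteq> V \<and> t \<in> Sec W \<and>
       restr Y V W s \<otimes>\<^bsub>sect Y W\<^esub> t = \<one>\<^bsub>sect Y W\<^esub>"
    then obtain W t where W: "cl z p \<in> W" "t \<in> Sec W" "restr Y V W s \<otimes>\<^bsub>sect Y W\<^esub> t = \<one>\<^bsub>sect Y W\<^esub>"
      by (elim exE conjE) (rule that)
    have pW: "p \<in> pre W z" using W(1) ps by (simp add: pre_def)
    from fun_cong[OF fun_cong[OF W(3), of z], of p] pW z(1)
    have "fraction_mult (R z) (carrier (R z) - p) (s z p) (t z p) = frac z p \<one>\<^bsub>R z\<^esub> \<one>\<^bsub>R z\<^esub>"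
      by (simp add: Y_simps)
    from spectrum.unit_of_inverse[OF spec_R[OF z(1)] ps SecD(3)[OF s z] SecD(3)[OF W(2) z(1) pW] this m]
    show "a \<notin> p" .
  next
    assume a: "a \<notin> p"
    obtain W where W: "openin (topo Y) W" "W \<subseteq> V" "\<forall>i\<in>I. pre W i = {p \<in> pre V i. unit_at s i p}"
    proof (rule saturated_open[OF V, of "unit_at s"])
      show "unit_at s i p \<longleftrightarrow> unit_at s j (pr i j p)" if "i \<in> I" "j \<in> I" "le i j" "p \<in> pre V i" for i j p
        by (rule unit_at_pr[OF s that])
      show "openin (zariski (R i)) {p \<in> pre V i. unit_at s i p}" if "i \<in> I" for i
        unfolding unit_at_def by (rule spectrum.unit_locus_open[OF spec_R[OF that] SecD(2)[OF s that]])
    qed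
    have "p \<in> pre W z" using W(3)[rule_format, OF z(1)] z(2) a m by (auto simp: unit_at_def)
    then have yW: "cl z p \<in> W" by (simp add: pre_def)
    let ?s = "\<lambda>i\<in>I. restrict (s i) (pre W i)"
    have sW: "?s \<in> Sec W" by (rule Sec_restr[OF V W(1,2) s])
    have un: "\<exists>a f. (a, f) \<in> ?s i p \<and> a \<notin> p" if "i \<in> I" "p \<in> pre W i" for i p
    proof -
      have "unit_at s i p" using W(3)[rule_format, OF that(1)] that(2) by simp
      then show ?thesis using that by (simp add: unit_at_def)
    qed
    define t where "t = (\<lambda>i\<in>I. \<lambda>p\<in>pre W i. (?s i p)\<inverse>)"
    have "t \<in> Sec W"
    proof (rule SecI)
      show "t i \<in> structure_sections (R i) (zariski (R i)) (pre W i)" if i: "i \<in> I" for i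
        using spectrum.section_converse(1)[OF spec_R[OF i] SecD(2)[OF sW i] un[OF i]] i by (simp add: t_def)
      fix i j p assume ij: "i \<in> I" "j \<in> I" "le i j" and p: "p \<in> pre W i"
      have pj: "pr i j p \<in> pre W j" using pr_pre_iff[OF ij pre_prime[OF p]] p by simp
      obtain a f where 1: "(a, f) \<in> ?s j (pr i j p)" "a \<notin> pr i j p"
        using un[OF ij(2) pj] by (elim exE conjE) (rule that)
      note 2 = Sec_map_mem[OF sW ij p 1(1)]
      have "t i p = (frac i p (h i j a) (h i j f))\<inverse>"
        using SecD(4)[OF sW ij p 1(1)] p ij(1) by (simp add: t_def)
      also have "\<dots> = frac i p (h i j f) (h i j a)"
        by (rule spectrum.converse_fraction[OF spec_R[OF ij(1)] _ h_notin[OF ij] h_notin[OF ij]])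
          (use pre_prime[OF p] 2(2,3) 1(2) in auto)
      finally show "\<exists>a f. (a, f) \<in> t j (pr i j p) \<and> t i p = frac i p (h i j a) (h i j f)"
        using 1(1) pj ij(2) by (intro exI[of _ f] exI[of _ a] conjI) (simp_all add: t_def)
    qed (simp add: t_def)
    moreover have "restr Y V W s \<otimes>\<^bsub>sect Y W\<^esub> t = \<one>\<^bsub>sect Y W\<^esub>"
      unfolding Y_simps
    proof (intro restrict_ext)
      fix i p assume i: "i \<in> I" and p: "p \<in> pre W i"
      show "fraction_mult (R i) (carrier (R i) - p) (?s i p) (t i p) = frac i p \<one>\<^bsub>R i\<^esub> \<one>\<^bsub>R i\<^esub>"
        using spectrum.section_converse(2)[OF spec_R[OF i] SecD(2)[OF sW i] un[OF i] p] i p by (simp add: t_def)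
    qed
    ultimately show "\<exists>W t. openin (topo Y) W \<and> cl z p \<in> W \<and> W \<subseteq> V \<and> t \<in> Sec W \<and>
       restr Y V W s \<otimes>\<^bsub>sect Y W\<^esub> t = \<one>\<^bsub>sect Y W\<^esub>"
      using W(1,2) yW by - (rule exI[of _ W], rule exI[of _ t], intro conjI)
  qed
qed

end

section \<open>Charts as open subsets of the glued space, and the sections over them\<close>

context glue_diagram
begin

definition Vz where "Vz z = {cl z q | q. primeideal q (R z)}"

lemma mem_pre_Vz:
  assumes "i \<in> I" "z \<in> I" "v \<in> I" "le v i" "le v z" "primeideal q (R v)"
  shows "pr v i q \<in> pre (Vz z) i"
proof -
  have "cl i (pr v i q) = cl z (pr v z q)"
    using cl_pull[OF assms(3,1,4,6)] cl_pull[OF assms(3,2,5,6)] by simp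
  then show ?thesis
    using pr_prime[OF assms(3,1,4,6)] pr_prime[OF assms(3,2,5,6)] by (auto simp: pre_def Vz_def)
qed

lemma pre_VzE:
  assumes "i \<in> I" "z \<in> I" "p \<in> pre (Vz z) i"
  obtains v q where "v \<in> I" "primeideal q (R v)" "loc v q" "le v i" "le v z" "pr v i q = p"
proof -
  from assms(3) obtain q where q: "cl i p = cl z q" "primeideal q (R z)" by (auto simp: pre_def Vz_def)
  obtain v r where "v \<in> I" "primeideal r (R v)" "loc v r" "le v i" "le v z" "pr v i r = p" "pr v z r = q"
    by (rule common_centre[OF assms(1) pre_prime[OF assms(3)] assms(2) q(2) q(1)])
  then show ?thesis using that by simp
qed

text \<open>A prime of \<open>R i\<close> comes from the localisation \<open>R v\<close> exactly if
  it avoids \<open>S v i\<close>, and by \<open>open_image\<close> it does so as soon as it misses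
  one element \<open>f\<close>. Hence the image of a smaller chart is a neighbourhood of each of its
  points.\<close>

lemma Vz_neighbourhood:
  assumes "i \<in> I" "z \<in> I" "v \<in> I" "le v i" "le v z" "primeideal q (R v)"
  obtains f where "f \<in> S v i" "f \<in> carrier (R i) - pr v i q"
    "\<forall>Q\<in>Sp i. f \<notin> Q \<longrightarrow> Q \<inter> S v i = {} \<and> (\<exists>q'. primeideal q' (R v) \<and> pr v i q' = Q)"
proof -
  interpret L: ring_localisation_hom "R i" "R v" "h v i" "S v i" by (rule localisation[OF assms(3,1,4)])
  from open_image[OF assms(3,1,4)] obtain f where f: "f \<in> S v i"
    "\<forall>q. primeideal q (R i) \<and> f \<notin> q \<longrightarrow> q \<inter> S v i = {}" by (elim bexE) (rule that)
  show ?thesis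
  proof (rule that[OF f(1)])
    show "f \<in> carrier (R i) - pr v i q"
      using L.S_carrier[OF f(1)] L.prime_S[OF assms(6) f(1)] by simp
    show "\<forall>Q\<in>Sp i. f \<notin> Q \<longrightarrow> Q \<inter> S v i = {} \<and> (\<exists>q'. primeideal q' (R v) \<and> pr v i q' = Q)"
    proof (intro ballI impI conjI)
      fix Q assume Q: "Q \<in> Sp i" "f \<notin> Q"
      show "Q \<inter> S v i = {}" using f(2) Q by simp
      then show "\<exists>q'. primeideal q' (R v) \<and> pr v i q' = Q"
        using L.prime_lift[of Q] Q(1) by simp
    qed
  qed
qed

text \<open>Seen in another chart \<open>i\<close>, the chart \<open>z\<close> is the union of the
  images of the charts below both, and each of these images is open.\<close>

lemma Vz_open:
  assumes z: "z \<in> I"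
  shows "openin (topo Y) (Vz z)"
  unfolding openin_Y
proof (intro conjI ballI)
  show "Vz z \<subseteq> points" using z by (auto simp: Vz_def points_def)
  fix i assume i: "i \<in> I"
  show "openin (zariski (R i)) (pre (Vz z) i)"
    unfolding spectrum.openin_iff[OF spec_R[OF i]]
  proof (intro conjI ballI)
    show "pre (Vz z) i \<subseteq> Sp i" using pre_prime by blast
    fix p assume p: "p \<in> pre (Vz z) i"
    obtain v q where v: "v \<in> I" "primeideal q (R v)" "loc v q" "le v i" "le v z" "pr v i q = p"
      by (rule pre_VzE[OF i z p])
    obtain f where f: "f \<in> carrier (R i) - pr v i q"
      "\<forall>Q\<in>Sp i. f \<notin> Q \<longrightarrow> Q \<inter> S v i = {} \<and> (\<exists>q'. primeideal q' (R v) \<and> pr v i q' = Q)"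
      by (rule Vz_neighbourhood[OF i z v(1,4,5,2)])
    show "\<exists>f\<in>carrier (R i) - p. \<forall>Q\<in>Sp i. f \<notin> Q \<longrightarrow> Q \<in> pre (Vz z) i"
    proof (intro bexI[of _ f] ballI impI)
      show "f \<in> carrier (R i) - p" using f(1) v(6) by simp
      fix Q assume "Q \<in> Sp i" "f \<notin> Q"
      then obtain q' where "primeideal q' (R v)" "pr v i q' = Q" using f(2) by auto
      then show "Q \<in> pre (Vz z) i" using mem_pre_Vz[OF i z v(1,4,5)] by auto
    qed
  qed
qed

text \<open>The section over \<open>Vz z\<close> extending \<open>r \<in> R z\<close>: at \<open>(i, p)\<close> it consists of the fractions \<open>a / b\<close>
  that agree with \<open>r\<close> at the centre of \<open>p\<close>.\<close>

definition gsec where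
  "gsec z r = (\<lambda>i\<in>I. \<lambda>p\<in>pre (Vz z) i. {(a, b). a \<in> carrier (R i) \<and> b \<in> carrier (R i) - p \<and>
     (\<exists>v q. v \<in> I \<and> le v i \<and> le v z \<and> primeideal q (R v) \<and> loc v q \<and> pr v i q = p \<and>
        (\<exists>u\<in>carrier (R v) - q. u \<otimes>\<^bsub>R v\<^esub> (h v z r \<otimes>\<^bsub>R v\<^esub> h v i b) = u \<otimes>\<^bsub>R v\<^esub> h v i a))})"

text \<open>In \<open>R v\<close> the fraction \<open>a / b\<close> represents \<open>r\<close>, so
  it satisfies the condition that defines the value of the section, and the set of all fractions
  satisfying it is the class of \<open>a / b\<close>.\<close>

lemma gsec_value_centre:
  assumes iz: "i \<in> I" "z \<in> I" and v: "v \<in> I" "le v i" "le v z" "primeideal q (R v)" "loc v q" "pr v i q = p"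
    and r: "r \<in> carrier (R z)" and ab: "a \<in> carrier (R i)" "b \<in> carrier (R i) - p"
    and eq: "h v i b \<otimes>\<^bsub>R v\<^esub> h v z r = h v i a"
  shows "gsec z r i p = frac i p a b"
proof -
  interpret L: ring_localisation_hom "R i" "R v" "h v i" "S v i" by (rule localisation[OF v(1) iz(1) v(2)])
  have pp: "primeideal p (R i)" using pr_prime[OF v(1) iz(1) v(2,4)] v(6) by simp
  interpret F: fraction_setting "R i" "carrier (R i) - p" by (rule frac_setting[OF iz(1) pp])
  have p: "p \<in> pre (Vz z) i" using mem_pre_Vz[OF iz v(1-4)] v(6) by simp
  have \<rho>: "h v z r \<in> carrier (R v)" by (rule h_closed[OF v(1) iz(2) v(3) r])
  have hb: "h v i b \<in> carrier (R v)" "h v i b \<notin> q"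
    using h_notin[OF v(1) iz(1) v(2), of b q] ab(2) v(6) by auto
  \<comment> \<open>Replaces the image of \<open>r\<close> by \<open>a / b\<close>. The equation
    over \<open>R v\<close> is multiplied by \<open>h v i b\<close>, which is outside
    \<open>q\<close> and can be moved into the witness; \<open>local_eq_iff\<close> then brings the
    equation down to \<open>R i\<close>.\<close>
  have core: "(\<exists>u\<in>carrier (R v) - q. u \<otimes>\<^bsub>R v\<^esub> (h v z r \<otimes>\<^bsub>R v\<^esub> h v i b') = u \<otimes>\<^bsub>R v\<^esub> h v i a') \<longleftrightarrow>
      (\<exists>u\<in>carrier (R i) - p. u \<otimes>\<^bsub>R i\<^esub> (a \<otimes>\<^bsub>R i\<^esub> b') = u \<otimes>\<^bsub>R i\<^esub> (a' \<otimes>\<^bsub>R i\<^esub> b))"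
    if a': "a' \<in> carrier (R i)" and b': "b' \<in> carrier (R i)" for a' b'
  proof -
    have c: "h v i a' \<in> carrier (R v)" "h v i b' \<in> carrier (R v)" using L.h_closed a' b' by auto
    have bc: "b \<in> carrier (R i)" using ab(2) by simp
    have e1: "u \<otimes>\<^bsub>R v\<^esub> h v i (a \<otimes>\<^bsub>R i\<^esub> b') = h v i b \<otimes>\<^bsub>R v\<^esub> (u \<otimes>\<^bsub>R v\<^esub> (h v z r \<otimes>\<^bsub>R v\<^esub> h v i b'))"
      and e2: "u \<otimes>\<^bsub>R v\<^esub> h v i (a' \<otimes>\<^bsub>R i\<^esub> b) = h v i b \<otimes>\<^bsub>R v\<^esub> (u \<otimes>\<^bsub>R v\<^esub> h v i a')"
      if "u \<in> carrier (R v)" for u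
      unfolding L.h_mult[OF ab(1) b'] L.h_mult[OF a' bc] eq[symmetric]
      using that c hb(1) \<rho> by (simp_all add: L.R'.m_ac)
    have "(\<exists>u\<in>carrier (R v) - q. u \<otimes>\<^bsub>R v\<^esub> (h v z r \<otimes>\<^bsub>R v\<^esub> h v i b') = u \<otimes>\<^bsub>R v\<^esub> h v i a') \<longleftrightarrow>
      (\<exists>u\<in>carrier (R v) - q. u \<otimes>\<^bsub>R v\<^esub> h v i (a \<otimes>\<^bsub>R i\<^esub> b') = u \<otimes>\<^bsub>R v\<^esub> h v i (a' \<otimes>\<^bsub>R i\<^esub> b))"
    proof
      assume "\<exists>u\<in>carrier (R v) - q. u \<otimes>\<^bsub>R v\<^esub> (h v z r \<otimes>\<^bsub>R v\<^esub> h v i b') = u \<otimes>\<^bsub>R v\<^esub> h v i a'"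
      then obtain u where u: "u \<in> carrier (R v) - q" "u \<otimes>\<^bsub>R v\<^esub> (h v z r \<otimes>\<^bsub>R v\<^esub> h v i b') = u \<otimes>\<^bsub>R v\<^esub> h v i a'"
        by (elim bexE) (rule that)
      then show "\<exists>u\<in>carrier (R v) - q. u \<otimes>\<^bsub>R v\<^esub> h v i (a \<otimes>\<^bsub>R i\<^esub> b') = u \<otimes>\<^bsub>R v\<^esub> h v i (a' \<otimes>\<^bsub>R i\<^esub> b)"
        using e1[of u] e2[of u] by (intro bexI[of _ u]) simp_all
    next
      assume "\<exists>u\<in>carrier (R v) - q. u \<otimes>\<^bsub>R v\<^esub> h v i (a \<otimes>\<^bsub>R i\<^esub> b') = u \<otimes>\<^bsub>R v\<^esub> h v i (a' \<otimes>\<^bsub>R i\<^esub> b)"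
      then obtain u where u: "u \<in> carrier (R v)" "u \<notin> q"
        "u \<otimes>\<^bsub>R v\<^esub> h v i (a \<otimes>\<^bsub>R i\<^esub> b') = u \<otimes>\<^bsub>R v\<^esub> h v i (a' \<otimes>\<^bsub>R i\<^esub> b)" by auto
      have "(h v i b \<otimes>\<^bsub>R v\<^esub> u) \<otimes>\<^bsub>R v\<^esub> (h v z r \<otimes>\<^bsub>R v\<^esub> h v i b') = (h v i b \<otimes>\<^bsub>R v\<^esub> u) \<otimes>\<^bsub>R v\<^esub> h v i a'"
        using u(3) unfolding e1[OF u(1)] e2[OF u(1)] using u(1) hb(1) c \<rho> by (simp add: L.R'.m_assoc)
      moreover have "h v i b \<otimes>\<^bsub>R v\<^esub> u \<in> carrier (R v) - q"
        using L.Sp'.prime_mult[of q "h v i b" u] v(4) hb u(1,2) by simp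
      ultimately show "\<exists>u\<in>carrier (R v) - q. u \<otimes>\<^bsub>R v\<^esub> (h v z r \<otimes>\<^bsub>R v\<^esub> h v i b') = u \<otimes>\<^bsub>R v\<^esub> h v i a'"
        by (rule bexI)
    qed
    also have "\<dots> \<longleftrightarrow> (\<exists>u\<in>carrier (R i) - p. u \<otimes>\<^bsub>R i\<^esub> (a \<otimes>\<^bsub>R i\<^esub> b') = u \<otimes>\<^bsub>R i\<^esub> (a' \<otimes>\<^bsub>R i\<^esub> b))"
      using L.local_eq_iff[OF v(4), of "a \<otimes>\<^bsub>R i\<^esub> b'" "a' \<otimes>\<^bsub>R i\<^esub> b"] ab(1) b' a' bc v(6) by simp
    finally show ?thesis .
  qed
  \<comment> \<open>The existential over centres in \<open>gsec\<close> has a single candidate, so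
    it may be replaced by its instance.\<close>
  have uniq: "(\<exists>w q'. w \<in> I \<and> le w i \<and> le w z \<and> primeideal q' (R w) \<and> loc w q' \<and> pr w i q' = p \<and> P w q') \<longleftrightarrow> P v q" for P
  proof
    assume "\<exists>w q'. w \<in> I \<and> le w i \<and> le w z \<and> primeideal q' (R w) \<and> loc w q' \<and> pr w i q' = p \<and> P w q'"
    then obtain w q' where w: "w \<in> I" "le w i" "primeideal q' (R w)" "loc w q'" "pr w i q' = p" "P w q'"
      by (elim exE conjE) (rule that)
    then have "w = v \<and> q' = q"
      using Ctr_unique[OF iz(1), of v q p w q'] v by (simp add: Ctr_def)
    then show "P v q" using w(6) by simp
  next
    assume "P v q"
    with v show "\<exists>w q'. w \<in> I \<and> le w i \<and> le w z \<and> primeideal q' (R w) \<and> loc w q' \<and> pr w i q' = p \<and> P w q'"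
      by (intro exI[of _ v] exI[of _ q] conjI)
  qed
  have "gsec z r i p = {(a', b'). a' \<in> carrier (R i) \<and> b' \<in> carrier (R i) - p \<and>
      (\<exists>u\<in>carrier (R v) - q. u \<otimes>\<^bsub>R v\<^esub> (h v z r \<otimes>\<^bsub>R v\<^esub> h v i b') = u \<otimes>\<^bsub>R v\<^esub> h v i a')}"
    using p iz(1) by (simp only: gsec_def restrict_apply' uniq)
  also have "\<dots> = frac i p a b"
    unfolding fraction_def using core by auto
  finally show ?thesis .
qed

text \<open>The prime \<open>q\<close> may be any prime of \<open>R v\<close> over \<open>p\<close>:
  its centre lies below \<open>v\<close>, and the equation for \<open>a / b\<close> is pushed down
  to it. This freedom is what allows one fraction to be used at all primes near a given one.\<close>

lemma gsec_value:
  assumes iz: "i \<in> I" "z \<in> I" and v: "v \<in> I" "le v i" "le v z" "primeideal q (R v)" "pr v i q = p"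
    and r: "r \<in> carrier (R z)" and ab: "a \<in> carrier (R i)" "b \<in> carrier (R i) - p"
    and eq: "h v i b \<otimes>\<^bsub>R v\<^esub> h v z r = h v i a"
  shows "gsec z r i p = frac i p a b"
proof -
  obtain w r' where w: "w \<in> I" "le w v" "primeideal r' (R w)" "loc w r'" "pr w v r' = q"
    using centre_ex[OF v(1,4)] by (elim exE conjE) (rule that)
  interpret L: ring_localisation_hom "R v" "R w" "h w v" "S w v" by (rule localisation[OF w(1) v(1) w(2)])
  note le = le_trans[OF w(1) v(1) iz(1) w(2) v(2)] le_trans[OF w(1) v(1) iz(2) w(2) v(3)]
  have bc: "b \<in> carrier (R i)" using ab(2) by simp
  have "h w i b \<otimes>\<^bsub>R w\<^esub> h w z r = h w v (h v i b \<otimes>\<^bsub>R v\<^esub> h v z r)"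
    using L.h_mult[OF h_closed[OF v(1) iz(1) v(2) bc] h_closed[OF v(1) iz(2) v(3) r]]
      h_comp[OF w(1) v(1) iz(1) w(2) v(2) bc] h_comp[OF w(1) v(1) iz(2) w(2) v(3) r] by simp
  also have "\<dots> = h w i a"
    unfolding eq by (rule h_comp[OF w(1) v(1) iz(1) w(2) v(2) ab(1)])
  finally have e: "h w i b \<otimes>\<^bsub>R w\<^esub> h w z r = h w i a" .
  have "pr w i r' = p" using pr_comp[OF w(1) v(1) iz(1) w(2) v(2), of r'] w(5) v(5) by simp
  from gsec_value_centre[OF iz w(1) le w(3,4) this r ab e] show ?thesis .
qed

text \<open>Taking \<open>b\<close> from \<open>S v i\<close>, and not merely outside one prime,
  makes it an admissible denominator at every prime that comes from \<open>R v\<close>.\<close>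

lemma denominator:
  assumes iz: "i \<in> I" "z \<in> I" and v: "v \<in> I" "le v i" "le v z" "primeideal q (R v)" and r: "r \<in> carrier (R z)"
  obtains a b where "a \<in> carrier (R i)" "b \<in> S v i" "b \<in> carrier (R i) - pr v i q"
    "h v i b \<otimes>\<^bsub>R v\<^esub> h v z r = h v i a"
proof -
  interpret L: ring_localisation_hom "R i" "R v" "h v i" "S v i" by (rule localisation[OF v(1) iz(1) v(2)])
  obtain a b where ab: "a \<in> carrier (R i)" "b \<in> S v i" "h v i b \<otimes>\<^bsub>R v\<^esub> h v z r = h v i a"
    using L.surj[OF h_closed[OF v(1) iz(2) v(3) r]] by (elim bexE) (rule that)
  have "b \<in> carrier (R i) - pr v i q" using L.S_carrier[OF ab(2)] L.prime_S[OF v(4) ab(2)] by simp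
  with ab show ?thesis using that by simp
qed

lemma gsec_Sec:
  assumes z: "z \<in> I" and r: "r \<in> carrier (R z)"
  shows "gsec z r \<in> Sec (Vz z)"
proof (rule SecI)
  show "gsec z r \<in> extensional I" by (simp add: gsec_def)
next
  fix i assume i: "i \<in> I"
  show "gsec z r i \<in> structure_sections (R i) (zariski (R i)) (pre (Vz z) i)"
  proof (rule spectrum.sectionI[OF spec_R[OF i]])
    show "gsec z r i \<in> extensional (pre (Vz z) i)" using i by (simp add: gsec_def)
    fix p assume p: "p \<in> pre (Vz z) i"
    obtain v q where v: "v \<in> I" "primeideal q (R v)" "loc v q" "le v i" "le v z" "pr v i q = p"
      by (rule pre_VzE[OF i z p])
    obtain a b where ab: "a \<in> carrier (R i)" "b \<in> S v i" "b \<in> carrier (R i) - pr v i q"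
      "h v i b \<otimes>\<^bsub>R v\<^esub> h v z r = h v i a" by (rule denominator[OF i z v(1,4,5,2) r])
    obtain f where f: "f \<in> carrier (R i) - pr v i q"
      "\<forall>Q\<in>Sp i. f \<notin> Q \<longrightarrow> Q \<inter> S v i = {} \<and> (\<exists>q'. primeideal q' (R v) \<and> pr v i q' = Q)"
      by (rule Vz_neighbourhood[OF i z v(1,4,5,2)])
    \<comment> \<open>One fraction serves the whole neighbourhood: each prime \<open>Q\<close>
      missing \<open>f\<close> comes from \<open>R v\<close> and avoids \<open>S v i\<close>, from
      which the denominator \<open>b\<close> was taken.\<close>
    have main: "Q \<in> pre (Vz z) i \<and> b \<notin> Q \<and> gsec z r i Q = frac i Q a b" if Q: "Q \<in> Sp i" "f \<notin> Q" for Q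
    proof -
      obtain q' where q': "primeideal q' (R v)" "pr v i q' = Q" using f(2) Q by auto
      have bQ: "b \<notin> Q" using f(2) Q ab(2) by auto
      then have b: "b \<in> carrier (R i) - Q" using ab(3) by simp
      show ?thesis
        using mem_pre_Vz[OF i z v(1,4,5) q'(1)] gsec_value[OF i z v(1,4,5) q' r ab(1) b ab(4)] q'(2) bQ by simp
    qed
    show "p \<in> Sp i \<and> (\<exists>a\<in>carrier (R i). \<exists>b\<in>carrier (R i). \<exists>g\<in>carrier (R i). g \<notin> p \<and>
      (\<forall>Q\<in>Sp i. g \<notin> Q \<longrightarrow> Q \<in> pre (Vz z) i \<and> b \<notin> Q \<and> gsec z r i Q = frac i Q a b))"
      by (rule conjI, simp add: pre_prime[OF p], rule bexI[of _ a], rule bexI[of _ b], rule bexI[of _ f])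
        (use main f(1) ab(1,3) v(6) in auto)
  qed
next
  fix i j p assume ij: "i \<in> I" "j \<in> I" "le i j" and p: "p \<in> pre (Vz z) i"
  obtain v q where v: "v \<in> I" "primeideal q (R v)" "loc v q" "le v i" "le v z" "pr v i q = p"
    by (rule pre_VzE[OF ij(1) z p])
  have vj: "le v j" by (rule le_trans[OF v(1) ij(1,2) v(4) ij(3)])
  have pj: "pr v j q = pr i j p" using pr_comp[OF v(1) ij(1,2) v(4) ij(3), of q] v(6) by simp
  obtain a b where ab: "a \<in> carrier (R j)" "b \<in> S v j" "b \<in> carrier (R j) - pr v j q"
    "h v j b \<otimes>\<^bsub>R v\<^esub> h v z r = h v j a" by (rule denominator[OF ij(2) z v(1) vj v(5,2) r])
  have bj: "b \<in> carrier (R j) - pr i j p" using ab(3) pj by simp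
  have 1: "gsec z r j (pr i j p) = frac j (pr i j p) a b"
    by (rule gsec_value[OF ij(2) z v(1) vj v(5,2) pj r ab(1) bj ab(4)])
  have "h v i (h i j b) \<otimes>\<^bsub>R v\<^esub> h v z r = h v i (h i j a)"
    using ab(4) h_comp[OF v(1) ij(1,2) v(4) ij(3)] ab(1) bj by simp
  then have 2: "gsec z r i p = frac i p (h i j a) (h i j b)"
    by (rule gsec_value[OF ij(1) z v(1,4,5,2,6) r h_closed[OF ij ab(1)] h_notin[OF ij bj]])
  have "(a, b) \<in> gsec z r j (pr i j p)"
    unfolding 1 by (rule fraction_setting.fraction_self[OF frac_setting[OF ij(2) pr_prime[OF ij pre_prime[OF p]]] ab(1) bj])
  with 2 show "\<exists>a f. (a, f) \<in> gsec z r j (pr i j p) \<and> gsec z r i p = frac i p (h i j a) (h i j f)"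
    by (intro exI[of _ a] exI[of _ b] conjI)
qed

lemma gsec_eval:
  assumes z: "z \<in> I" and r: "r \<in> carrier (R z)" and p: "primeideal p (R z)"
  shows "gsec z r z p = frac z p r \<one>\<^bsub>R z\<^esub>" "p \<in> pre (Vz z) z" "(r, \<one>\<^bsub>R z\<^esub>) \<in> gsec z r z p"
proof -
  interpret R: cring "R z" by (rule cring_R[OF z])
  interpret F: fraction_setting "R z" "carrier (R z) - p" by (rule frac_setting[OF z p])
  have one: "\<one>\<^bsub>R z\<^esub> \<in> carrier (R z) - p" by (rule submonoid.one_closed[OF F.submonoid_S])
  show 1: "gsec z r z p = frac z p r \<one>\<^bsub>R z\<^esub>"
    by (rule gsec_value[OF z z z le_refl[OF z] le_refl[OF z] p pr_id[OF z p] r r one]) (simp add: h_id[OF z] r)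
  show "p \<in> pre (Vz z) z" using p by (auto simp: pre_def Vz_def)
  show "(r, \<one>\<^bsub>R z\<^esub>) \<in> gsec z r z p" unfolding 1 by (rule F.fraction_self[OF r one])
qed

lemma gsec_restrict: "gsec z x = (\<lambda>i\<in>I. \<lambda>p\<in>pre (Vz z) i. gsec z x i p)"
proof (rule extensionalityI[of _ I])
  show "gsec z x \<in> extensional I" by (simp add: gsec_def)
  fix i assume i: "i \<in> I"
  have "gsec z x i \<in> extensional (pre (Vz z) i)" using i by (simp add: gsec_def)
  then show "gsec z x i = (\<lambda>i\<in>I. \<lambda>p\<in>pre (Vz z) i. gsec z x i p) i"
    using i by (simp add: extensional_restrict)
qed simp

text \<open>At each point both sides can be compared in \<open>R v\<close> for a chart
  \<open>v\<close> below \<open>i\<close> and \<open>z\<close>. There the claim is the usual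
  arithmetic of fractions over the product of the two denominators.\<close>

lemma gsec_ring_hom:
  assumes z: "z \<in> I"
  shows "gsec z \<in> ring_hom (R z) (sect Y (Vz z))"
proof (rule ring_hom_memI)
  fix r assume r: "r \<in> carrier (R z)"
  show "gsec z r \<in> carrier (sect Y (Vz z))" unfolding sect_Y_carrier by (rule gsec_Sec[OF z r])
  fix r' assume r': "r' \<in> carrier (R z)"
  interpret Rz: cring "R z" by (rule cring_R[OF z])
  have both: "gsec z (r \<otimes>\<^bsub>R z\<^esub> r') i p = fraction_mult (R i) (carrier (R i) - p) (gsec z r i p) (gsec z r' i p) \<and>
     gsec z (r \<oplus>\<^bsub>R z\<^esub> r') i p = fraction_add (R i) (carrier (R i) - p) (gsec z r i p) (gsec z r' i p)"
    if i: "i \<in> I" and p: "p \<in> pre (Vz z) i" for i p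
  proof -
    obtain v q where v: "v \<in> I" "primeideal q (R v)" "loc v q" "le v i" "le v z" "pr v i q = p"
      by (rule pre_VzE[OF i z p])
    interpret L: ring_localisation_hom "R i" "R v" "h v i" "S v i" by (rule localisation[OF v(1) i v(4)])
    interpret Lz: ring_localisation_hom "R z" "R v" "h v z" "S v z" by (rule localisation[OF v(1) z v(5)])
    interpret F: fraction_setting "R i" "carrier (R i) - p" by (rule frac_setting[OF i pre_prime[OF p]])
    obtain a b where ab: "a \<in> carrier (R i)" "b \<in> S v i" "b \<in> carrier (R i) - pr v i q"
      "h v i b \<otimes>\<^bsub>R v\<^esub> h v z r = h v i a" by (rule denominator[OF i z v(1,4,5,2) r])
    obtain a' b' where ab': "a' \<in> carrier (R i)" "b' \<in> S v i" "b' \<in> carrier (R i) - pr v i q"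
      "h v i b' \<otimes>\<^bsub>R v\<^esub> h v z r' = h v i a'" by (rule denominator[OF i z v(1,4,5,2) r'])
    have b: "b \<in> carrier (R i) - p" "b' \<in> carrier (R i) - p" using ab(3) ab'(3) v(6) by auto
    have bc: "b \<in> carrier (R i)" "b' \<in> carrier (R i)" using b by auto
    have bb: "b \<otimes>\<^bsub>R i\<^esub> b' \<in> carrier (R i) - p" by (rule submonoid.m_closed[OF F.submonoid_S b])
    note c = h_closed[OF v(1) z v(5) r] h_closed[OF v(1) z v(5) r'] L.h_closed[OF bc(1)] L.h_closed[OF bc(2)]
    note v1 = gsec_value[OF i z v(1,4,5,2,6) r ab(1) b(1) ab(4)]
    note v2 = gsec_value[OF i z v(1,4,5,2,6) r' ab'(1) b(2) ab'(4)]
    have "h v i (b \<otimes>\<^bsub>R i\<^esub> b') \<otimes>\<^bsub>R v\<^esub> h v z (r \<otimes>\<^bsub>R z\<^esub> r') =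
        (h v i b \<otimes>\<^bsub>R v\<^esub> h v z r) \<otimes>\<^bsub>R v\<^esub> (h v i b' \<otimes>\<^bsub>R v\<^esub> h v z r')"
      unfolding L.h_mult[OF bc] Lz.h_mult[OF r r'] using c by (simp add: L.R'.m_ac)
    also have "\<dots> = h v i (a \<otimes>\<^bsub>R i\<^esub> a')" unfolding ab(4) ab'(4) L.h_mult[OF ab(1) ab'(1)] ..
    finally have m: "h v i (b \<otimes>\<^bsub>R i\<^esub> b') \<otimes>\<^bsub>R v\<^esub> h v z (r \<otimes>\<^bsub>R z\<^esub> r') = h v i (a \<otimes>\<^bsub>R i\<^esub> a')" .
    have "h v i (b \<otimes>\<^bsub>R i\<^esub> b') \<otimes>\<^bsub>R v\<^esub> h v z (r \<oplus>\<^bsub>R z\<^esub> r') =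
        (h v i b \<otimes>\<^bsub>R v\<^esub> h v z r) \<otimes>\<^bsub>R v\<^esub> h v i b' \<oplus>\<^bsub>R v\<^esub> (h v i b' \<otimes>\<^bsub>R v\<^esub> h v z r') \<otimes>\<^bsub>R v\<^esub> h v i b"
      unfolding L.h_mult[OF bc] Lz.h_add[OF r r'] using c by (simp add: L.R'.r_distr L.R'.m_ac)
    also have "\<dots> = h v i (a \<otimes>\<^bsub>R i\<^esub> b' \<oplus>\<^bsub>R i\<^esub> a' \<otimes>\<^bsub>R i\<^esub> b)"
      unfolding ab(4) ab'(4) using ab(1) ab'(1) bc by (simp add: L.h_mult L.h_add)
    finally have ad: "h v i (b \<otimes>\<^bsub>R i\<^esub> b') \<otimes>\<^bsub>R v\<^esub> h v z (r \<oplus>\<^bsub>R z\<^esub> r') =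
      h v i (a \<otimes>\<^bsub>R i\<^esub> b' \<oplus>\<^bsub>R i\<^esub> a' \<otimes>\<^bsub>R i\<^esub> b)" .
    have "gsec z (r \<otimes>\<^bsub>R z\<^esub> r') i p = frac i p (a \<otimes>\<^bsub>R i\<^esub> a') (b \<otimes>\<^bsub>R i\<^esub> b')"
      by (rule gsec_value[OF i z v(1,4,5,2,6) Rz.m_closed[OF r r'] _ bb m]) (use ab(1) ab'(1) in simp)
    moreover have "gsec z (r \<oplus>\<^bsub>R z\<^esub> r') i p = frac i p (a \<otimes>\<^bsub>R i\<^esub> b' \<oplus>\<^bsub>R i\<^esub> a' \<otimes>\<^bsub>R i\<^esub> b) (b \<otimes>\<^bsub>R i\<^esub> b')"
      by (rule gsec_value[OF i z v(1,4,5,2,6) Rz.a_closed[OF r r'] _ bb ad]) (use ab(1) ab'(1) bc in simp)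
    ultimately show ?thesis
      unfolding v1 v2 using F.fraction_mult_fraction[OF ab(1) ab'(1) b]
        fraction_add_fraction[OF cring_R[OF i] F.submonoid_S ab(1) ab'(1) b] by simp
  qed
  show "gsec z (r \<otimes>\<^bsub>R z\<^esub> r') = gsec z r \<otimes>\<^bsub>sect Y (Vz z)\<^esub> gsec z r'"
    unfolding Y_simps by (subst gsec_restrict, intro restrict_ext) (use both in blast)
  show "gsec z (r \<oplus>\<^bsub>R z\<^esub> r') = gsec z r \<oplus>\<^bsub>sect Y (Vz z)\<^esub> gsec z r'"
    unfolding Y_simps by (subst gsec_restrict, intro restrict_ext) (use both in blast)
next
  interpret Rz: cring "R z" by (rule cring_R[OF z])
  have one: "gsec z \<one>\<^bsub>R z\<^esub> i p = frac i p \<one>\<^bsub>R i\<^esub> \<one>\<^bsub>R i\<^esub>" if i: "i \<in> I" and p: "p \<in> pre (Vz z) i" for i p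
  proof -
    obtain v q where v: "v \<in> I" "primeideal q (R v)" "loc v q" "le v i" "le v z" "pr v i q = p"
      by (rule pre_VzE[OF i z p])
    interpret L: ring_localisation_hom "R i" "R v" "h v i" "S v i" by (rule localisation[OF v(1) i v(4)])
    interpret Lz: ring_localisation_hom "R z" "R v" "h v z" "S v z" by (rule localisation[OF v(1) z v(5)])
    interpret F: fraction_setting "R i" "carrier (R i) - p" by (rule frac_setting[OF i pre_prime[OF p]])
    show ?thesis
      by (rule gsec_value[OF i z v(1,4,5,2,6) Rz.one_closed L.R.one_closed submonoid.one_closed[OF F.submonoid_S]])
        (simp add: L.h_one Lz.h_one)
  qed
  show "gsec z \<one>\<^bsub>R z\<^esub> = \<one>\<^bsub>sect Y (Vz z)\<^esub>"
    unfolding Y_simps by (subst gsec_restrict, intro restrict_ext) (rule one)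
qed

end

section \<open>Addition of sections\<close>

lemma section_add:
  assumes R: "cring R" and s: "s \<in> structure_sections R (zariski R) U" and t: "t \<in> structure_sections R (zariski R) U"
  shows "(\<lambda>P\<in>U. fraction_add R (carrier R - P) (s P) (t P)) \<in> structure_sections R (zariski R) U"
proof -
  interpret R: cring R by fact
  interpret Sp: spectrum R "{P. primeideal P R}" "zariski R" by (rule spectrum_ring[OF R])
  show ?thesis
  proof (rule Sp.sectionI)
    fix P assume P: "P \<in> U"
    obtain a f where af: "a \<in> carrier R" "f \<in> carrier R" "f \<notin> P" "P \<in> {P. primeideal P R}"
      "\<forall>Q\<in>{P. primeideal P R}. f \<notin> Q \<longrightarrow> Q \<in> U \<and> s Q = fraction R (carrier R - Q) a f" by (rule Sp.sectionE[OF s P])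
    obtain b g where bg: "b \<in> carrier R" "g \<in> carrier R" "g \<notin> P" "P \<in> {P. primeideal P R}"
      "\<forall>Q\<in>{P. primeideal P R}. g \<notin> Q \<longrightarrow> Q \<in> U \<and> t Q = fraction R (carrier R - Q) b g" by (rule Sp.sectionE[OF t P])
    show "P \<in> {P. primeideal P R} \<and> (\<exists>a\<in>carrier R. \<exists>b\<in>carrier R. \<exists>g\<in>carrier R. g \<notin> P \<and>
      (\<forall>Q\<in>{P. primeideal P R}. g \<notin> Q \<longrightarrow> Q \<in> U \<and> b \<notin> Q \<and>
        (\<lambda>P\<in>U. fraction_add R (carrier R - P) (s P) (t P)) Q = fraction R (carrier R - Q) a b))"
    proof (rule conjI[OF af(4)], rule bexI[of _ "a \<otimes>\<^bsub>R\<^esub> g \<oplus>\<^bsub>R\<^esub> b \<otimes>\<^bsub>R\<^esub> f"], rule bexI[of _ "f \<otimes>\<^bsub>R\<^esub> g"],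
        rule bexI[of _ "f \<otimes>\<^bsub>R\<^esub> g"], intro conjI ballI impI)
      fix Q assume Q: "Q \<in> {P. primeideal P R}" "f \<otimes>\<^bsub>R\<^esub> g \<notin> Q"
      then have fg: "f \<notin> Q" "g \<notin> Q" using Sp.prime_mult[OF Q(1) af(2) bg(2)] by auto
      show "f \<otimes>\<^bsub>R\<^esub> g \<notin> Q" by fact
      show "Q \<in> U" using af(5)[rule_format, OF Q(1) fg(1)] by simp
      then show "(\<lambda>P\<in>U. fraction_add R (carrier R - P) (s P) (t P)) Q =
          fraction R (carrier R - Q) (a \<otimes>\<^bsub>R\<^esub> g \<oplus>\<^bsub>R\<^esub> b \<otimes>\<^bsub>R\<^esub> f) (f \<otimes>\<^bsub>R\<^esub> g)"
        using af(5)[rule_format, OF Q(1) fg(1)] bg(5)[rule_format, OF Q(1) fg(2)]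
          fraction_add_fraction[OF R Sp.prime_compl[OF Q(1)], of a b f g] af bg fg by simp
    qed (use af bg Sp.prime_mult in auto)
  qed simp
qed

lemma (in glue_diagram) Sec_add:
  assumes V: "openin (topo Y) V" and s: "s \<in> Sec V" "t \<in> Sec V"
  shows "(\<lambda>i\<in>I. \<lambda>p\<in>pre V i. fraction_add (R i) (carrier (R i) - p) (s i p) (t i p)) \<in> Sec V"
proof (rule SecI)
  fix i assume i: "i \<in> I"
  show "(\<lambda>i\<in>I. \<lambda>p\<in>pre V i. fraction_add (R i) (carrier (R i) - p) (s i p) (t i p)) i \<in>
    structure_sections (R i) (zariski (R i)) (pre V i)"
    using section_add[OF cring_R[OF i] SecD(2)[OF s(1) i] SecD(2)[OF s(2) i]] i by simp
next
  fix i j p assume ij: "i \<in> I" "j \<in> I" "le i j" and p: "p \<in> pre V i"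
  have pj: "pr i j p \<in> pre V j" using pr_pre_iff[OF ij pre_prime[OF p]] p by simp
  interpret L: ring_localisation_hom "R j" "R i" "h i j" "S i j" by (rule localisation[OF ij])
  interpret Fi: fraction_setting "R i" "carrier (R i) - p" by (rule frac_setting[OF ij(1) pre_prime[OF p]])
  interpret Fj: fraction_setting "R j" "carrier (R j) - pr i j p" by (rule frac_setting[OF ij(2) pre_prime[OF pj]])
  obtain a f where 1: "a \<in> carrier (R j)" "f \<in> carrier (R j) - pr i j p" "s j (pr i j p) = frac j (pr i j p) a f"
    "(a, f) \<in> s j (pr i j p)" by (rule Sec_rep[OF s(1) ij(2) pj])
  obtain b g where 2: "b \<in> carrier (R j)" "g \<in> carrier (R j) - pr i j p" "t j (pr i j p) = frac j (pr i j p) b g"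
    "(b, g) \<in> t j (pr i j p)" by (rule Sec_rep[OF s(2) ij(2) pj])
  let ?n = "a \<otimes>\<^bsub>R j\<^esub> g \<oplus>\<^bsub>R j\<^esub> b \<otimes>\<^bsub>R j\<^esub> f"
  have fgc: "f \<in> carrier (R j)" "g \<in> carrier (R j)" using 1(2) 2(2) by auto
  have n: "?n \<in> carrier (R j)" using 1(1) 2(1) fgc by simp
  have fg: "f \<otimes>\<^bsub>R j\<^esub> g \<in> carrier (R j) - pr i j p"
    by (rule submonoid.m_closed[OF Fj.submonoid_S 1(2) 2(2)])
  have "fraction_add (R j) (carrier (R j) - pr i j p) (s j (pr i j p)) (t j (pr i j p)) =
      frac j (pr i j p) ?n (f \<otimes>\<^bsub>R j\<^esub> g)"
    unfolding 1(3) 2(3) by (rule fraction_add_fraction[OF L.R.cring_axioms Fj.submonoid_S 1(1) 2(1) 1(2) 2(2)])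
  then have m: "(?n, f \<otimes>\<^bsub>R j\<^esub> g) \<in> fraction_add (R j) (carrier (R j) - pr i j p) (s j (pr i j p)) (t j (pr i j p))"
    using Fj.fraction_self[OF n fg] by simp
  have "fraction_add (R i) (carrier (R i) - p) (s i p) (t i p) = frac i p (h i j ?n) (h i j (f \<otimes>\<^bsub>R j\<^esub> g))"
    unfolding SecD(4)[OF s(1) ij p 1(4)] SecD(4)[OF s(2) ij p 2(4)]
    using fraction_add_fraction[OF L.R'.cring_axioms Fi.submonoid_S L.h_closed[OF 1(1)] L.h_closed[OF 2(1)] h_notin[OF ij 1(2)] h_notin[OF ij 2(2)]]
      1(1) 2(1) fgc by (simp add: L.h_mult L.h_add)
  then show "\<exists>a f. (a, f) \<in> (\<lambda>i\<in>I. \<lambda>p\<in>pre V i. fraction_add (R i) (carrier (R i) - p) (s i p) (t i p)) j (pr i j p) \<and>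
      (\<lambda>i\<in>I. \<lambda>p\<in>pre V i. fraction_add (R i) (carrier (R i) - p) (s i p) (t i p)) i p = frac i p (h i j a) (h i j f)"
    using m p pj ij by (intro exI[of _ ?n] exI[of _ "f \<otimes>\<^bsub>R j\<^esub> g"] conjI) simp_all
qed simp

subsection \<open>Points with values in a field\<close>

locale field_spec = field R for R :: "'a ring" (structure)
begin

abbreviation kfrac where "kfrac \<equiv> fraction R (carrier R - {\<zero>})"

text \<open>The constant \<open>x / 1\<close> on the one-point spectrum. Every section there is of
  this form for exactly one \<open>x\<close>, so the sections over the point are a copy of the
  field.\<close>

definition ksec where "ksec x = (\<lambda>P\<in>{{\<zero>}}. kfrac x \<one>)"

lemma spec_field: "{P. primeideal P R} = {{\<zero>}}"
proof (intro equalityI subsetI)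
  fix P assume "P \<in> {P. primeideal P R}"
  then interpret primeideal P R by simp
  have "x = \<zero>" if "x \<in> P" for x
  proof (rule ccontr)
    assume "x \<noteq> \<zero>"
    then have u: "x \<in> Units R" using that Icarr field_Units by auto
    have "inv x \<otimes> x \<in> P" using that u by (intro I_l_closed) auto
    then have "\<one> \<in> P" using u by simp
    then show False using I_notcarr one_imp_carrier by auto
  qed
  then show "P \<in> {{\<zero>}}" using additive_subgroup.zero_closed[OF additive_subgroup_axioms] by blast
next
  fix P assume "P \<in> {{\<zero>}}"
  then show "P \<in> {P. primeideal P R}" using zeroprimeideal by simp
qed

lemma spectrum_field: "spectrum R {{\<zero>}} (zariski R)"
  using spectrum_ring[OF cring_axioms] unfolding spec_field .

lemma kfrac_setting: "fraction_setting R (carrier R - {\<zero>})"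
  using spectrum.fraction_setting[OF spectrum_field, of "{\<zero>}"] by simp

lemma openin_field: "U \<subseteq> {{\<zero>}} \<Longrightarrow> openin (zariski R) U"
  unfolding spectrum.openin_iff[OF spectrum_field] by (auto intro!: bexI[of _ \<one>])

lemma kfrac_eq_iff:
  assumes "a \<in> carrier R" "b \<in> carrier R" "f \<in> carrier R - {\<zero>}" "g \<in> carrier R - {\<zero>}"
  shows "kfrac a f = kfrac b g \<longleftrightarrow> a \<otimes> g = b \<otimes> f"
proof -
  interpret F: fraction_setting R "carrier R - {\<zero>}" by (rule kfrac_setting)
  have "(\<exists>u\<in>carrier R - {\<zero>}. u \<otimes> (a \<otimes> g) = u \<otimes> (b \<otimes> f)) \<longleftrightarrow> a \<otimes> g = b \<otimes> f"
    using assms m_lcancel[of _ "a \<otimes> g" "b \<otimes> f"] by (auto intro!: bexI[of _ \<one>])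
  then show ?thesis using F.fraction_eq_iff[OF assms] by simp
qed

lemma one_nonzero: "\<one> \<in> carrier R - {\<zero>}" by simp

lemma ksec_apply: "ksec x {\<zero>} = kfrac x \<one>" by (simp add: ksec_def)

lemma ksec_inj: "x \<in> carrier R \<Longrightarrow> y \<in> carrier R \<Longrightarrow> ksec x = ksec y \<Longrightarrow> x = y"
proof -
  assume xy: "x \<in> carrier R" "y \<in> carrier R" and "ksec x = ksec y"
  from fun_cong[OF this(3), of "{\<zero>}"] have "kfrac x \<one> = kfrac y \<one>" by (simp only: ksec_apply)
  then show "x = y" using kfrac_eq_iff[OF xy one_nonzero one_nonzero] xy by simp
qed

lemma ksec_section: "x \<in> carrier R \<Longrightarrow> ksec x \<in> structure_sections R (zariski R) {{\<zero>}}"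
proof (rule spectrum.sectionI[OF spectrum_field])
  show "ksec x \<in> extensional {{\<zero>}}" by (simp add: ksec_def)
  assume x: "x \<in> carrier R"
  fix P assume P: "P \<in> {{\<zero>}}"
  show "P \<in> {{\<zero>}} \<and> (\<exists>a\<in>carrier R. \<exists>b\<in>carrier R. \<exists>g\<in>carrier R. g \<notin> P \<and>
      (\<forall>Q\<in>{{\<zero>}}. g \<notin> Q \<longrightarrow> Q \<in> {{\<zero>}} \<and> b \<notin> Q \<and> ksec x Q = fraction R (carrier R - Q) a b))"
    by (rule conjI[OF P], rule bexI[of _ x], rule bexI[of _ \<one>], rule bexI[of _ \<one>])
      (use x P in \<open>auto simp: ksec_apply\<close>)
qed

lemma section_ksec:
  assumes s: "s \<in> structure_sections R (zariski R) {{\<zero>}}"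
  shows "\<exists>x\<in>carrier R. s = ksec x"
proof -
  interpret F: fraction_setting R "carrier R - {\<zero>}" by (rule kfrac_setting)
  obtain a f where af: "a \<in> carrier R" "f \<in> carrier R - {\<zero>}" "s {\<zero>} = kfrac a f"
    using F.fractionsE[OF spectrum.section_fractions[OF spectrum_field s, of "{\<zero>}"]] by auto
  have u: "f \<in> Units R" using af(2) field_Units by simp
  have c: "a \<otimes> inv f \<in> carrier R" using af(1) u by simp
  have "kfrac a f = kfrac (a \<otimes> inv f) \<one>"
    unfolding kfrac_eq_iff[OF af(1) c af(2) one_nonzero] using af(1) u by (simp add: m_assoc Units_closed)
  then have "s = ksec (a \<otimes> inv f)"
    using spectrum.section_ext[OF spectrum_field s] af(3)
    by (intro extensionalityI[of _ "{{\<zero>}}"]) (auto simp: ksec_def)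
  then show ?thesis using c by blast
qed

lemma ksec_ops:
  assumes "x \<in> carrier R" "y \<in> carrier R"
  shows "(\<lambda>P\<in>{{\<zero>}}. fraction_mult R (carrier R - P) (ksec x P) (ksec y P)) = ksec (x \<otimes> y)"
    "(\<lambda>P\<in>{{\<zero>}}. fraction_add R (carrier R - P) (ksec x P) (ksec y P)) = ksec (x \<oplus> y)"
proof -
  interpret F: fraction_setting R "carrier R - {\<zero>}" by (rule kfrac_setting)
  show "(\<lambda>P\<in>{{\<zero>}}. fraction_mult R (carrier R - P) (ksec x P) (ksec y P)) = ksec (x \<otimes> y)"
    unfolding ksec_def[of "x \<otimes> y"]
    by (rule restrict_ext) (use F.fraction_mult_fraction[OF assms one_nonzero one_nonzero] in \<open>simp add: ksec_apply\<close>)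
  show "(\<lambda>P\<in>{{\<zero>}}. fraction_add R (carrier R - P) (ksec x P) (ksec y P)) = ksec (x \<oplus> y)"
    unfolding ksec_def[of "x \<oplus> y"]
    by (rule restrict_ext)
      (use fraction_add_fraction[OF cring_axioms F.submonoid_S assms one_nonzero one_nonzero] assms in \<open>simp add: ksec_apply\<close>)
qed

end

locale glue_points = glue_diagram I le R h S loc + K: field_spec K
  for I :: "'i set" and le and R :: "'i \<Rightarrow> 'r ring" and h S loc and K :: "'k ring"
begin

abbreviation pt where "pt \<equiv> {\<zero>\<^bsub>K\<^esub>}"
abbreviation kfrac where "kfrac \<equiv> fraction K (carrier K - {\<zero>\<^bsub>K\<^esub>})"
abbreviation ksec where "ksec \<equiv> field_spec.ksec K"
abbreviation kerp where "kerp z \<psi> \<equiv> {a \<in> carrier (R z). \<psi> a = \<zero>\<^bsub>K\<^esub>}"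

text \<open>The condition on the kernel selects one chart for each point; without it a point would
  be listed once for every chart that contains it.\<close>

definition local_homs where
  "local_homs = {(z, \<psi>). z \<in> I \<and> \<psi> \<in> ring_hom (R z) K \<and> \<psi> \<in> extensional (carrier (R z)) \<and> loc z (kerp z \<psi>)}"

text \<open>The map that \<open>\<psi>\<close> induces from the local ring at its kernel to the
  fractions of \<open>K\<close>.\<close>

definition ev where "ev \<psi> x = (\<Union>(a, b)\<in>x. kfrac (\<psi> a) (\<psi> b))"

definition point_map where "point_map z \<psi> = (\<lambda>x\<in>{pt}. cl z (kerp z \<psi>))"

text \<open>Over an open set that misses the image point the preimage is empty, and the innermost
  function is then the only section over the empty set. The outer restrictions give the extensional
  form in which morphisms are counted.\<close>

definition point_comap where
  "point_comap z \<psi> = (\<lambda>V\<in>{V. openin (topo Y) V}. \<lambda>s\<in>Sec V.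
     \<lambda>P\<in>preim (ring_spec K) (point_map z \<psi>) V. ev \<psi> (s z (kerp z \<psi>)))"

lemma topspace_K: "topspace (zariski K) = {pt}"
  by (rule spectrum.topspace_eq[OF K.spectrum_field])

lemma preim_K: "preim (ring_spec K) f V = (if f pt \<in> V then {pt} else {})"
  by (auto simp: preim_def topspace_K)

lemma kerp_prime:
  assumes "z \<in> I" "\<psi> \<in> ring_hom (R z) K"
  shows "primeideal (kerp z \<psi>) (R z)"
proof -
  interpret Rz: cring "R z" by (rule cring_R[OF assms(1)])
  interpret ring_hom_ring "R z" K \<psi>
    by (rule ring_hom_ringI2[OF Rz.ring_axioms K.ring_axioms assms(2)])
  show ?thesis using primeideal_vimage[OF Rz.cring_axioms K.zeroprimeideal] by simp
qed

lemma hom_nonzero: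
  assumes "\<psi> \<in> ring_hom (R z) K" "b \<in> carrier (R z) - kerp z \<psi>"
  shows "\<psi> b \<in> carrier K - {\<zero>\<^bsub>K\<^esub>}"
  using assms ring_hom_closed[OF assms(1)] by auto

text \<open>Two representatives agree up to a factor \<open>u\<close> outside the kernel of
  \<open>\<psi>\<close>; its image is nonzero and can be cancelled because \<open>K\<close> is a
  field.\<close>

lemma ev_frac:
  assumes z: "z \<in> I" and \<psi>: "\<psi> \<in> ring_hom (R z) K" and x: "x \<in> fractions (R z) (carrier (R z) - kerp z \<psi>)"
    and m: "(a, b) \<in> x"
  shows "ev \<psi> x = kfrac (\<psi> a) (\<psi> b)"
proof -
  interpret F: fraction_setting "R z" "carrier (R z) - kerp z \<psi>" by (rule frac_setting[OF z kerp_prime[OF z \<psi>]])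
  interpret Rz: cring "R z" by (rule cring_R[OF z])
  note 1 = F.fractions_mem[OF x m]
  show ?thesis
    unfolding ev_def
  proof (rule F.UN_fraction_eq[OF x])
    fix c d assume "(c, d) \<in> x"
    note 2 = F.fractions_mem[OF x this]
    have "fraction (R z) (carrier (R z) - kerp z \<psi>) c d = fraction (R z) (carrier (R z) - kerp z \<psi>) a b"
      using 1(3) 2(3) by simp
    then obtain u where u: "u \<in> carrier (R z) - kerp z \<psi>" "u \<otimes>\<^bsub>R z\<^esub> (c \<otimes>\<^bsub>R z\<^esub> b) = u \<otimes>\<^bsub>R z\<^esub> (a \<otimes>\<^bsub>R z\<^esub> d)"
      using F.fraction_eq_iff[OF 2(1) 1(1) 2(2) 1(2)] by (elim iffD1[THEN bexE]) simp_all
    have carr: "u \<in> carrier (R z)" "b \<in> carrier (R z)" "d \<in> carrier (R z)" using u(1) 1(2) 2(2) by auto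
    have "\<psi> u \<otimes>\<^bsub>K\<^esub> (\<psi> c \<otimes>\<^bsub>K\<^esub> \<psi> b) = \<psi> u \<otimes>\<^bsub>K\<^esub> (\<psi> a \<otimes>\<^bsub>K\<^esub> \<psi> d)"
      using arg_cong[OF u(2), of \<psi>] carr 1(1) 2(1) by (simp add: ring_hom_mult[OF \<psi>])
    then have "\<psi> c \<otimes>\<^bsub>K\<^esub> \<psi> b = \<psi> a \<otimes>\<^bsub>K\<^esub> \<psi> d"
      using hom_nonzero[OF \<psi> u(1)] carr 1(1) 2(1) by (simp add: K.m_lcancel ring_hom_closed[OF \<psi>])
    then show "kfrac (\<psi> c) (\<psi> d) = kfrac (\<psi> a) (\<psi> b)"
      using K.kfrac_eq_iff[OF ring_hom_closed[OF \<psi> 2(1)] ring_hom_closed[OF \<psi> 1(1)] hom_nonzero[OF \<psi> 2(2)] hom_nonzero[OF \<psi> 1(2)]]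
      by simp
  qed
qed

lemma kfrac_ksec:
  assumes "a \<in> carrier K" "b \<in> carrier K - {\<zero>\<^bsub>K\<^esub>}"
  shows "(\<lambda>P\<in>{pt}. kfrac a b) = ksec (a \<otimes>\<^bsub>K\<^esub> inv\<^bsub>K\<^esub> b)" "a \<otimes>\<^bsub>K\<^esub> inv\<^bsub>K\<^esub> b \<in> carrier K"
proof -
  have u: "b \<in> Units K" using assms(2) K.field_Units by simp
  show c: "a \<otimes>\<^bsub>K\<^esub> inv\<^bsub>K\<^esub> b \<in> carrier K" using assms(1) u by simp
  have "kfrac a b = kfrac (a \<otimes>\<^bsub>K\<^esub> inv\<^bsub>K\<^esub> b) \<one>\<^bsub>K\<^esub>"
    unfolding K.kfrac_eq_iff[OF assms(1) c assms(2) K.one_nonzero] using assms(1) u by (simp add: K.m_assoc K.Units_closed)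
  then show "(\<lambda>P\<in>{pt}. kfrac a b) = ksec (a \<otimes>\<^bsub>K\<^esub> inv\<^bsub>K\<^esub> b)" by (simp add: K.ksec_def)
qed

lemma ev_ops:
  assumes z: "z \<in> I" and \<psi>: "\<psi> \<in> ring_hom (R z) K"
    and x: "x \<in> fractions (R z) (carrier (R z) - kerp z \<psi>)" and y: "y \<in> fractions (R z) (carrier (R z) - kerp z \<psi>)"
  shows "ev \<psi> (fraction_mult (R z) (carrier (R z) - kerp z \<psi>) x y) = fraction_mult K (carrier K - pt) (ev \<psi> x) (ev \<psi> y)"
    "ev \<psi> (fraction_add (R z) (carrier (R z) - kerp z \<psi>) x y) = fraction_add K (carrier K - pt) (ev \<psi> x) (ev \<psi> y)"
proof -
  interpret F: fraction_setting "R z" "carrier (R z) - kerp z \<psi>" by (rule frac_setting[OF z kerp_prime[OF z \<psi>]])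
  interpret FK: fraction_setting K "carrier K - pt" by (rule K.kfrac_setting)
  interpret Rz: cring "R z" by (rule cring_R[OF z])
  obtain a f where 1: "a \<in> carrier (R z)" "f \<in> carrier (R z) - kerp z \<psi>" "x = fraction (R z) (carrier (R z) - kerp z \<psi>) a f"
    by (rule F.fractionsE[OF x])
  obtain b g where 2: "b \<in> carrier (R z)" "g \<in> carrier (R z) - kerp z \<psi>" "y = fraction (R z) (carrier (R z) - kerp z \<psi>) b g"
    by (rule F.fractionsE[OF y])
  have evf: "ev \<psi> (fraction (R z) (carrier (R z) - kerp z \<psi>) c d) = kfrac (\<psi> c) (\<psi> d)"
    if "c \<in> carrier (R z)" "d \<in> carrier (R z) - kerp z \<psi>" for c d
    by (rule ev_frac[OF z \<psi> F.fractionsI[OF that] F.fraction_self[OF that]])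
  have fg: "f \<otimes>\<^bsub>R z\<^esub> g \<in> carrier (R z) - kerp z \<psi>" by (rule submonoid.m_closed[OF F.submonoid_S 1(2) 2(2)])
  have c: "f \<in> carrier (R z)" "g \<in> carrier (R z)" using 1 2 by auto
  note K1 = ring_hom_closed[OF \<psi> 1(1)] ring_hom_closed[OF \<psi> 2(1)] hom_nonzero[OF \<psi> 1(2)] hom_nonzero[OF \<psi> 2(2)]
  have ab: "a \<otimes>\<^bsub>R z\<^esub> b \<in> carrier (R z)" "a \<otimes>\<^bsub>R z\<^esub> g \<oplus>\<^bsub>R z\<^esub> b \<otimes>\<^bsub>R z\<^esub> f \<in> carrier (R z)" using 1(1) 2(1) c by auto
  show "ev \<psi> (fraction_mult (R z) (carrier (R z) - kerp z \<psi>) x y) = fraction_mult K (carrier K - pt) (ev \<psi> x) (ev \<psi> y)"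
    unfolding 1(3) 2(3) F.fraction_mult_fraction[OF 1(1) 2(1) 1(2) 2(2)] evf[OF ab(1) fg] evf[OF 1(1,2)] evf[OF 2(1,2)]
      FK.fraction_mult_fraction[OF K1] ring_hom_mult[OF \<psi> 1(1) 2(1)] ring_hom_mult[OF \<psi> c] ..
  show "ev \<psi> (fraction_add (R z) (carrier (R z) - kerp z \<psi>) x y) = fraction_add K (carrier K - pt) (ev \<psi> x) (ev \<psi> y)"
    unfolding 1(3) 2(3) fraction_add_fraction[OF Rz.cring_axioms F.submonoid_S 1(1) 2(1) 1(2) 2(2)] evf[OF ab(2) fg]
      evf[OF 1(1,2)] evf[OF 2(1,2)] fraction_add_fraction[OF K.cring_axioms FK.submonoid_S K1]
    using 1(1) 2(1) c by (simp add: ring_hom_mult[OF \<psi>] ring_hom_add[OF \<psi>])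
qed

lemma Sec_sum_value:
  assumes "i \<in> I" "p \<in> pre V i"
  shows "(s \<otimes>\<^bsub>sect Y V\<^esub> t) i p = fraction_mult (R i) (carrier (R i) - p) (s i p) (t i p)"
    "(s \<oplus>\<^bsub>sect Y V\<^esub> t) i p = fraction_add (R i) (carrier (R i) - p) (s i p) (t i p)"
    "\<one>\<^bsub>sect Y V\<^esub> i p = frac i p \<one>\<^bsub>R i\<^esub> \<one>\<^bsub>R i\<^esub>"
  using assms by (simp_all add: Y_simps)

lemma section_empty: "s \<in> structure_sections K (zariski K) {} \<longleftrightarrow> s = (\<lambda>_. undefined)"
  by (auto simp: structure_sections_def)

lemma restrict_empty: "restrict f {} = (\<lambda>_. undefined)"
  by (simp add: restrict_def)

lemma point_in_lrs:
  assumes "(z, \<psi>) \<in> local_homs"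
  shows "(point_map z \<psi>, point_comap z \<psi>) \<in> lrs_morphisms (ring_spec K) Y"
proof -
  have z: "z \<in> I" and \<psi>: "\<psi> \<in> ring_hom (R z) K" using assms by (auto simp: local_homs_def)
  let ?p = "kerp z \<psi>" let ?f = "point_map z \<psi>" let ?\<phi> = "point_comap z \<psi>"
  interpret FK: fraction_setting K "carrier K - pt" by (rule K.kfrac_setting)
  interpret Rz: cring "R z" by (rule cring_R[OF z])
  have p: "primeideal ?p (R z)" by (rule kerp_prime[OF z \<psi>])
  have fpt: "?f pt = cl z ?p" by (simp add: point_map_def)
  have preV: "?p \<in> pre V z \<longleftrightarrow> ?f pt \<in> V" for V using p by (simp add: pre_def fpt)
  have val: "?\<phi> V s = (if ?f pt \<in> V then (\<lambda>P\<in>{pt}. ev \<psi> (s z ?p)) else (\<lambda>_. undefined))"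
    if "openin (topo Y) V" "s \<in> Sec V" for V s
    using that by (simp add: point_comap_def preim_K restrict_empty)
  have sec: "\<exists>a b. (a, b) \<in> s z ?p \<and> a \<in> carrier (R z) \<and> b \<in> carrier (R z) - ?p \<and> ev \<psi> (s z ?p) = kfrac (\<psi> a) (\<psi> b)"
    if V: "openin (topo Y) V" "s \<in> Sec V" "?f pt \<in> V" for V s
  proof -
    have pV: "?p \<in> pre V z" using V(3) preV by simp
    obtain a b where "a \<in> carrier (R z)" "b \<in> carrier (R z) - ?p" "(a, b) \<in> s z ?p"
      by (rule Sec_rep[OF V(2) z pV])
    then show ?thesis using ev_frac[OF z \<psi> SecD(3)[OF V(2) z pV], of a b] by (intro exI[of _ a] exI[of _ b]) simp
  qed
  have cont: "continuous_map (topo (ring_spec K)) (topo Y) ?f"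
    unfolding continuous_map_def ring_spec_simps topspace_K topspace_Y
  proof (intro conjI allI impI)
    show "?f \<in> {pt} \<rightarrow> points" using fpt z p by (auto simp: points_def)
    show "openin (zariski K) {x \<in> {pt}. ?f x \<in> U}" for U by (rule K.openin_field) auto
  qed
  have hom: "?\<phi> V \<in> ring_hom (sect Y V) (sect (ring_spec K) (preim (ring_spec K) ?f V)) \<inter> extensional (carrier (sect Y V))"
    if V: "openin (topo Y) V" for V
  proof (intro IntI ring_hom_memI)
    show "?\<phi> V \<in> extensional (carrier (sect Y V))" using V by (simp add: point_comap_def sect_Y_carrier)
    fix s assume s: "s \<in> carrier (sect Y V)"
    then have s': "s \<in> Sec V" by (simp add: sect_Y_carrier)
    show "?\<phi> V s \<in> carrier (sect (ring_spec K) (preim (ring_spec K) ?f V))"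
    proof (cases "?f pt \<in> V")
      case True
      from sec[OF V s' True] obtain a b where ab: "a \<in> carrier (R z)" "b \<in> carrier (R z) - ?p"
        "ev \<psi> (s z ?p) = kfrac (\<psi> a) (\<psi> b)" by (elim exE conjE) (rule that)
      show ?thesis
        using True kfrac_ksec[OF ring_hom_closed[OF \<psi> ab(1)] hom_nonzero[OF \<psi> ab(2)]]
        by (simp add: val[OF V s'] preim_K ab(3) K.ksec_section)
    next
      case False
      then show ?thesis by (simp add: val[OF V s'] preim_K section_empty)
    qed
    fix t assume t: "t \<in> carrier (sect Y V)"
    then have t': "t \<in> Sec V" by (simp add: sect_Y_carrier)
    have st: "s \<otimes>\<^bsub>sect Y V\<^esub> t \<in> Sec V"
      using Sec_mult[OF V s' t'] by (simp add: Y_simps)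
    show "?\<phi> V (s \<otimes>\<^bsub>sect Y V\<^esub> t) = ?\<phi> V s \<otimes>\<^bsub>sect (ring_spec K) (preim (ring_spec K) ?f V)\<^esub> ?\<phi> V t"
    proof (cases "?f pt \<in> V")
      case True
      then have pV: "?p \<in> pre V z" using preV by simp
      show ?thesis
        unfolding val[OF V st] val[OF V s'] val[OF V t'] ring_spec_simps preim_K
        using True ev_ops(1)[OF z \<psi> SecD(3)[OF s' z pV] SecD(3)[OF t' z pV]] Sec_sum_value(1)[OF z pV, of s t]
        by (auto intro!: restrict_ext)
    next
      case False
      then show ?thesis
        unfolding val[OF V st] val[OF V s'] val[OF V t'] ring_spec_simps preim_K by (simp add: restrict_empty)
    qed
  next
    fix s t assume "s \<in> carrier (sect Y V)" "t \<in> carrier (sect Y V)"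
    then have s': "s \<in> Sec V" and t': "t \<in> Sec V" by (simp_all add: sect_Y_carrier)
    have st: "s \<oplus>\<^bsub>sect Y V\<^esub> t \<in> Sec V"
      using Sec_add[OF V s' t'] by (simp add: Y_simps)
    show "?\<phi> V (s \<oplus>\<^bsub>sect Y V\<^esub> t) = ?\<phi> V s \<oplus>\<^bsub>sect (ring_spec K) (preim (ring_spec K) ?f V)\<^esub> ?\<phi> V t"
    proof (cases "?f pt \<in> V")
      case True
      then have pV: "?p \<in> pre V z" using preV by simp
      show ?thesis
        unfolding val[OF V st] val[OF V s'] val[OF V t'] ring_spec_simps preim_K
        using True ev_ops(2)[OF z \<psi> SecD(3)[OF s' z pV] SecD(3)[OF t' z pV]] Sec_sum_value(2)[OF z pV, of s t]
        by (auto intro!: restrict_ext)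
    next
      case False
      then show ?thesis
        unfolding val[OF V st] val[OF V s'] val[OF V t'] ring_spec_simps preim_K by (simp add: restrict_empty)
    qed
  next
    have one: "\<one>\<^bsub>sect Y V\<^esub> \<in> Sec V" using Sec_one[OF V] by (simp add: Y_simps)
    interpret F: fraction_setting "R z" "carrier (R z) - ?p" by (rule frac_setting[OF z p])
    note o = submonoid.one_closed[OF F.submonoid_S]
    show "?\<phi> V \<one>\<^bsub>sect Y V\<^esub> = \<one>\<^bsub>sect (ring_spec K) (preim (ring_spec K) ?f V)\<^esub>"
    proof (cases "?f pt \<in> V")
      case True
      then have pV: "?p \<in> pre V z" using preV by simp
      have "ev \<psi> (frac z ?p \<one>\<^bsub>R z\<^esub> \<one>\<^bsub>R z\<^esub>) = kfrac \<one>\<^bsub>K\<^esub> \<one>\<^bsub>K\<^esub>"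
        using ev_frac[OF z \<psi> F.fractionsI[OF Rz.one_closed o] F.fraction_self[OF Rz.one_closed o]]
        by (simp add: ring_hom_one[OF \<psi>])
      then show ?thesis
        unfolding val[OF V one] ring_spec_simps preim_K Sec_sum_value(3)[OF z pV] using True
        by (auto intro!: restrict_ext)
    next
      case False
      then show ?thesis unfolding val[OF V one] ring_spec_simps preim_K by (simp add: restrict_empty)
    qed
  qed
  have compat: "?\<phi> W (restr Y V W s) = restr (ring_spec K) (preim (ring_spec K) ?f V) (preim (ring_spec K) ?f W) (?\<phi> V s)"
    if VW: "openin (topo Y) V" "openin (topo Y) W" "W \<subseteq> V" and s: "s \<in> carrier (sect Y V)" for V W s
  proof -
    have s': "s \<in> Sec V" using s by (simp add: sect_Y_carrier)
    have r: "restr Y V W s \<in> Sec W" using Sec_restr[OF VW s'] by (simp add: Y_simps)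
    show ?thesis
    proof (cases "?f pt \<in> W")
      case True
      then have "?f pt \<in> V" "?p \<in> pre W z" using VW(3) preV by auto
      then show ?thesis
        unfolding val[OF VW(2) r] val[OF VW(1) s'] ring_spec_simps preim_K using True z by (simp add: Y_simps)
    next
      case False
      then show ?thesis
        unfolding val[OF VW(2) r] ring_spec_simps preim_K by (simp add: restrict_empty)
    qed
  qed
  \<comment> \<open>On both sides the unit condition is read off a numerator. Over \<open>K\<close>
    it asks that \<open>\<psi> a\<close> be nonzero, on the glued space that \<open>a\<close> avoid
    the kernel of \<open>\<psi>\<close>, which is the same.\<close>
  have local: "germ (ring_spec K) x (preim (ring_spec K) ?f V) (?\<phi> V s) \<in> Units (stalk (ring_spec K) x) \<longleftrightarrow>
      germ Y (?f x) V s \<in> Units (stalk Y (?f x))"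
    if x: "x \<in> topspace (topo (ring_spec K))" and V: "openin (topo Y) V" "?f x \<in> V" "s \<in> carrier (sect Y V)" for x V s
  proof -
    have s': "s \<in> Sec V" using V(3) by (simp add: sect_Y_carrier)
    have xp: "x = pt" using x by (simp add: topspace_K)
    then have fV: "?f pt \<in> V" using V(2) by simp
    then have pV: "?p \<in> pre V z" using preV by simp
    from sec[OF V(1) s' fV] obtain a b where ab: "(a, b) \<in> s z ?p" "a \<in> carrier (R z)" "b \<in> carrier (R z) - ?p"
      "ev \<psi> (s z ?p) = kfrac (\<psi> a) (\<psi> b)" by (elim exE conjE) (rule that)
    have pre: "preim (ring_spec K) ?f V = {pt}" using fV by (simp add: preim_K)
    have \<phi>s: "?\<phi> V s = (\<lambda>P\<in>{pt}. kfrac (\<psi> a) (\<psi> b))" using val[OF V(1) s'] fV ab(4) by simp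
    have sK: "?\<phi> V s \<in> structure_sections K (zariski K) {pt}"
      unfolding \<phi>s using kfrac_ksec[OF ring_hom_closed[OF \<psi> ab(2)] hom_nonzero[OF \<psi> ab(3)]] K.ksec_section by simp
    have mK: "(\<psi> a, \<psi> b) \<in> ?\<phi> V s pt"
      unfolding \<phi>s using FK.fraction_self[OF ring_hom_closed[OF \<psi> ab(2)] hom_nonzero[OF \<psi> ab(3)]] by simp
    have "germ (ring_spec K) pt {pt} (?\<phi> V s) \<in> Units (stalk (ring_spec K) pt) \<longleftrightarrow> \<psi> a \<notin> pt"
      by (rule germ_ring_spec_unit_iff[OF K.cring_axioms K.openin_field _ sK mK]) simp_all
    also have "\<dots> \<longleftrightarrow> a \<notin> ?p" using ab(2) by simp
    also have "\<dots> \<longleftrightarrow> germ Y (cl z ?p) V s \<in> Units (stalk Y (cl z ?p))"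
      by (rule germ_Y_unit_iff[OF V(1) s' z pV ab(1), symmetric])
    finally show ?thesis unfolding xp pre fpt .
  qed
  have ext: "?f \<in> extensional (topspace (topo (ring_spec K)))" by (simp add: point_map_def topspace_K)
  have phi: "?\<phi> \<in> (\<Pi>\<^sub>E V\<in>{V. openin (topo Y) V}. ring_hom (sect Y V) (sect (ring_spec K) (preim (ring_spec K) ?f V)) \<inter>
      extensional (carrier (sect Y V)))"
    unfolding PiE_def using hom by (auto simp: point_comap_def)
  show ?thesis
    unfolding lrs_morphisms_def
    by (intro CollectI case_prodI conjI ext cont phi allI impI ballI; (elim conjE)?; (rule compat local; assumption))
qed

end

section \<open>Recovering the chart and the homomorphism from a morphism\<close>

context glue_points
begin

text \<open>The image point is represented at its centre \<open>(z, p)\<close>. Pulling back the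
  sections \<open>gsec z r\<close> defines \<open>\<psi>\<close>, locality identifies its kernel
  with \<open>p\<close>, and the rest of the pullback is forced: near the point every section is a
  quotient of sections of the form \<open>gsec z r\<close>.\<close>

lemma lrs_point:
  assumes "(f, \<phi>) \<in> lrs_morphisms (ring_spec K) Y"
  shows "\<exists>z \<psi>. (z, \<psi>) \<in> local_homs \<and> f = point_map z \<psi> \<and> \<phi> = point_comap z \<psi>"
proof -
  have ext: "f \<in> extensional {pt}"
    and cont: "continuous_map (zariski K) (topo Y) f"
    and phi: "\<phi> \<in> (\<Pi>\<^sub>E V\<in>{V. openin (topo Y) V}. ring_hom (sect Y V) (sect (ring_spec K) (preim (ring_spec K) f V)) \<inter>
      extensional (carrier (sect Y V)))"
    and compat: "\<And>V W s. openin (topo Y) V \<Longrightarrow> openin (topo Y) W \<Longrightarrow> W \<subseteq> V \<Longrightarrow> s \<in> Sec V \<Longrightarrow>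
      \<phi> W (restr Y V W s) = restrict (\<phi> V s) (preim (ring_spec K) f W)"
    and local: "\<And>V s. openin (topo Y) V \<Longrightarrow> f pt \<in> V \<Longrightarrow> s \<in> Sec V \<Longrightarrow>
      germ (ring_spec K) pt (preim (ring_spec K) f V) (\<phi> V s) \<in> Units (stalk (ring_spec K) pt) \<longleftrightarrow>
      germ Y (f pt) V s \<in> Units (stalk Y (f pt))"
    using assms by (auto simp: lrs_morphisms_def topspace_K sect_Y_carrier)
  interpret FK: fraction_setting K "carrier K - pt" by (rule K.kfrac_setting)
  have "f pt \<in> points"
    using cont by (auto simp: continuous_map_def topspace_K topspace_Y Pi_iff)
  then obtain j q where jq: "f pt = cl j q" "j \<in> I" "primeideal q (R j)" by (auto simp: points_def)
  obtain z p where z: "z \<in> I" "le z j" "primeideal p (R z)" "loc z p" "pr z j p = q"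
    using centre_ex[OF jq(2,3)] by (elim exE conjE) (rule that)
  have y: "f pt = cl z p" using cl_pull[OF z(1) jq(2) z(2,3)] jq(1) z(5) by simp
  interpret Rz: cring "R z" by (rule cring_R[OF z(1)])
  interpret Fz: fraction_setting "R z" "carrier (R z) - p" by (rule frac_setting[OF z(1,3)])
  have pV: "p \<in> pre V z \<longleftrightarrow> f pt \<in> V" for V using z(3) by (simp add: pre_def y)
  have phiV: "\<phi> V \<in> ring_hom (sect Y V) (sect (ring_spec K) (preim (ring_spec K) f V))"
    "\<phi> V \<in> extensional (Sec V)" if "openin (topo Y) V" for V
    using phi that by (auto simp: sect_Y_carrier)
  have sec: "\<exists>x\<in>carrier K. \<phi> V s = ksec x" if V: "openin (topo Y) V" "s \<in> Sec V" "f pt \<in> V" for V s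
  proof -
    have "\<phi> V s \<in> carrier (sect (ring_spec K) (preim (ring_spec K) f V))"
      by (rule ring_hom_closed[OF phiV(1)[OF V(1)]]) (simp add: sect_Y_carrier V(2))
    then show ?thesis using V(3) K.section_ksec by (simp add: preim_K)
  qed
  have Vzo: "openin (topo Y) (Vz z)" by (rule Vz_open[OF z(1)])
  have fV: "f pt \<in> Vz z" using z(3) by (auto simp: y Vz_def)
  \<comment> \<open>The choice operator merely inverts \<open>ksec\<close>, which is
    injective.\<close>
  define \<psi> where "\<psi> = (\<lambda>r\<in>carrier (R z). SOME x. x \<in> carrier K \<and> \<phi> (Vz z) (gsec z r) = ksec x)"
  have \<psi>: "\<psi> r \<in> carrier K \<and> \<phi> (Vz z) (gsec z r) = ksec (\<psi> r)" if r: "r \<in> carrier (R z)" for r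
  proof -
    have "\<exists>x. x \<in> carrier K \<and> \<phi> (Vz z) (gsec z r) = ksec x"
      using sec[OF Vzo gsec_Sec[OF z(1) r] fV] by blast
    from someI_ex[OF this] show ?thesis using r by (simp add: \<psi>_def)
  qed
  have pre1: "preim (ring_spec K) f V = {pt}" if "f pt \<in> V" for V using that by (simp add: preim_K)
  note gh = gsec_ring_hom[OF z(1)]
  have gc: "gsec z r \<in> carrier (sect Y (Vz z))" if "r \<in> carrier (R z)" for r by (rule ring_hom_closed[OF gh that])
  have \<psi>h: "\<psi> \<in> ring_hom (R z) K"
  proof (rule ring_hom_memI)
    fix r assume r: "r \<in> carrier (R z)"
    show "\<psi> r \<in> carrier K" using \<psi>[OF r] by simp
    fix r' assume r': "r' \<in> carrier (R z)"
    have "ksec (\<psi> (r \<otimes>\<^bsub>R z\<^esub> r')) = \<phi> (Vz z) (gsec z r \<otimes>\<^bsub>sect Y (Vz z)\<^esub> gsec z r')"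
      using \<psi>[OF Rz.m_closed[OF r r']] ring_hom_mult[OF gh r r'] by simp
    also have "\<dots> = ksec (\<psi> r) \<otimes>\<^bsub>sect (ring_spec K) {pt}\<^esub> ksec (\<psi> r')"
      using ring_hom_mult[OF phiV(1)[OF Vzo] gc[OF r] gc[OF r']] \<psi>[OF r] \<psi>[OF r'] pre1[OF fV] by simp
    also have "\<dots> = ksec (\<psi> r \<otimes>\<^bsub>K\<^esub> \<psi> r')"
      using K.ksec_ops(1)[of "\<psi> r" "\<psi> r'"] \<psi>[OF r] \<psi>[OF r'] by simp
    finally show "\<psi> (r \<otimes>\<^bsub>R z\<^esub> r') = \<psi> r \<otimes>\<^bsub>K\<^esub> \<psi> r'"
      using K.ksec_inj \<psi>[OF r] \<psi>[OF r'] \<psi>[OF Rz.m_closed[OF r r']] K.m_closed by blast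
    have "ksec (\<psi> (r \<oplus>\<^bsub>R z\<^esub> r')) = \<phi> (Vz z) (gsec z r \<oplus>\<^bsub>sect Y (Vz z)\<^esub> gsec z r')"
      using \<psi>[OF Rz.a_closed[OF r r']] ring_hom_add[OF gh r r'] by simp
    also have "\<dots> = ksec (\<psi> r) \<oplus>\<^bsub>sect (ring_spec K) {pt}\<^esub> ksec (\<psi> r')"
      using ring_hom_add[OF phiV(1)[OF Vzo] gc[OF r] gc[OF r']] \<psi>[OF r] \<psi>[OF r'] pre1[OF fV] by simp
    also have "\<dots> = ksec (\<psi> r \<oplus>\<^bsub>K\<^esub> \<psi> r')"
      using K.ksec_ops(2)[of "\<psi> r" "\<psi> r'"] \<psi>[OF r] \<psi>[OF r'] by simp
    finally show "\<psi> (r \<oplus>\<^bsub>R z\<^esub> r') = \<psi> r \<oplus>\<^bsub>K\<^esub> \<psi> r'"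
      using K.ksec_inj \<psi>[OF r] \<psi>[OF r'] \<psi>[OF Rz.a_closed[OF r r']] K.a_closed by blast
  next
    have "ksec (\<psi> \<one>\<^bsub>R z\<^esub>) = \<phi> (Vz z) \<one>\<^bsub>sect Y (Vz z)\<^esub>"
      using \<psi>[OF Rz.one_closed] ring_hom_one[OF gh] by simp
    also have "\<dots> = \<one>\<^bsub>sect (ring_spec K) {pt}\<^esub>"
      using ring_hom_one[OF phiV(1)[OF Vzo]] pre1[OF fV] by simp
    also have "\<dots> = ksec \<one>\<^bsub>K\<^esub>" by (auto simp: K.ksec_def intro!: restrict_ext)
    finally show "\<psi> \<one>\<^bsub>R z\<^esub> = \<one>\<^bsub>K\<^esub>"
      using K.ksec_inj \<psi>[OF Rz.one_closed] K.one_closed by blast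
  qed
  \<comment> \<open>Locality enters here: a value is a unit over \<open>K\<close> exactly if it is
    nonzero, and the germ of \<open>gsec z r\<close> is a unit exactly if \<open>r\<close> is
    outside \<open>p\<close>.\<close>
  have ker: "\<psi> r = \<zero>\<^bsub>K\<^esub> \<longleftrightarrow> r \<in> p" if r: "r \<in> carrier (R z)" for r
  proof -
    have mK: "(\<psi> r, \<one>\<^bsub>K\<^esub>) \<in> ksec (\<psi> r) pt"
      unfolding K.ksec_apply by (rule FK.fraction_self[OF _ K.one_nonzero]) (use \<psi>[OF r] in simp)
    have kk: "ksec (\<psi> r) \<in> structure_sections K (zariski K) {pt}" using \<psi>[OF r] K.ksec_section by simp
    have "germ (ring_spec K) pt {pt} (ksec (\<psi> r)) \<in> Units (stalk (ring_spec K) pt) \<longleftrightarrow> \<psi> r \<notin> pt"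
      by (rule germ_ring_spec_unit_iff[OF K.cring_axioms K.openin_field _ kk mK]) simp_all
    moreover have "germ Y (cl z p) (Vz z) (gsec z r) \<in> Units (stalk Y (cl z p)) \<longleftrightarrow> r \<notin> p"
      by (rule germ_Y_unit_iff[OF Vzo gsec_Sec[OF z(1) r] z(1) gsec_eval(2,3)[OF z(1) r z(3)]])
    ultimately show ?thesis
      using local[OF Vzo fV gsec_Sec[OF z(1) r]] \<psi>[OF r] pre1[OF fV] by (simp add: y)
  qed
  have kp: "kerp z \<psi> = p"
    using ker ideal.Icarr[OF primeideal.axioms(1)[OF z(3)]] by auto
  have mem: "(z, \<psi>) \<in> local_homs"
    unfolding local_homs_def using z(1,4) \<psi>h kp by (simp add: \<psi>_def)
  have f: "f = point_map z \<psi>"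
    unfolding point_map_def kp by (rule extensionalityI[OF ext]) (use y in auto)
  have phi_value: "\<phi> V s = (\<lambda>P\<in>preim (ring_spec K) f V. ev \<psi> (s z p))" if V: "openin (topo Y) V" and s: "s \<in> Sec V" for V s
  proof (cases "f pt \<in> V")
    case False
    have "\<phi> V s \<in> carrier (sect (ring_spec K) (preim (ring_spec K) f V))"
      by (rule ring_hom_closed[OF phiV(1)[OF V]]) (simp add: sect_Y_carrier s)
    then show ?thesis using False by (simp add: preim_K section_empty restrict_empty)
  next
    case True
    then have pp: "p \<in> pre V z" using pV by simp
    obtain a b where ab: "a \<in> carrier (R z)" "b \<in> carrier (R z) - p" "s z p = frac z p a b" "(a, b) \<in> s z p"
      by (rule Sec_rep[OF s z(1) pp])
    have bc: "b \<in> carrier (R z)" using ab(2) by simp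
    \<comment> \<open>On the intersection, \<open>s\<close> and the sections defined by
      \<open>a\<close> and \<open>b\<close> can be compared. The identity "\<open>s\<close> times
      \<open>b\<close> is \<open>a\<close>" holds in the local ring at the point, hence on a
      neighbourhood \<open>W\<close>.\<close>
    let ?V = "V \<inter> Vz z"
    have Vo: "openin (topo Y) ?V" using V Vzo by (simp add: openin_Int)
    have fV': "f pt \<in> ?V" using True fV by simp
    have pp': "p \<in> pre ?V z" using pV fV' by simp
    define s' where "s' = restr Y V ?V s"
    define ga where "ga = restr Y (Vz z) ?V (gsec z a)"
    define gb where "gb = restr Y (Vz z) ?V (gsec z b)"
    have S: "s' \<in> Sec ?V" "ga \<in> Sec ?V" "gb \<in> Sec ?V"
      unfolding s'_def ga_def gb_def Y_simps
      using Sec_restr[OF V Vo _ s] Sec_restr[OF Vzo Vo _ gsec_Sec[OF z(1) ab(1)]] Sec_restr[OF Vzo Vo _ gsec_Sec[OF z(1) bc]]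
      by simp_all
    have m: "s' \<otimes>\<^bsub>sect Y ?V\<^esub> gb \<in> Sec ?V" using Sec_mult[OF Vo S(1,3)] by (simp add: Y_simps)
    have one: "\<one>\<^bsub>R z\<^esub> \<in> carrier (R z) - p" by (rule submonoid.one_closed[OF Fz.submonoid_S])
    have v: "s' z p = frac z p a b" "gb z p = frac z p b \<one>\<^bsub>R z\<^esub>" "ga z p = frac z p a \<one>\<^bsub>R z\<^esub>"
      unfolding s'_def ga_def gb_def Y_simps
      using pp' z(1) ab(3) gsec_eval(1)[OF z(1) ab(1) z(3)] gsec_eval(1)[OF z(1) bc z(3)] by simp_all
    have "(s' \<otimes>\<^bsub>sect Y ?V\<^esub> gb) z p = frac z p (a \<otimes>\<^bsub>R z\<^esub> b) (b \<otimes>\<^bsub>R z\<^esub> \<one>\<^bsub>R z\<^esub>)"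
      unfolding Sec_sum_value(1)[OF z(1) pp'] v by (rule Fz.fraction_mult_fraction[OF ab(1) bc ab(2) one])
    also have "\<dots> = ga z p"
      unfolding v
    proof (rule Fz.fraction_eqI[of "\<one>\<^bsub>R z\<^esub>"])
      show "b \<otimes>\<^bsub>R z\<^esub> \<one>\<^bsub>R z\<^esub> \<in> carrier (R z) - p" using ab(2) bc by simp
    qed (use ab(1) bc one in auto)
    finally have eqp: "(s' \<otimes>\<^bsub>sect Y ?V\<^esub> gb) z p = ga z p" .
    obtain W where W: "openin (topo Y) W" "W \<subseteq> ?V" "cl z p \<in> W"
      "restr Y ?V W (s' \<otimes>\<^bsub>sect Y ?V\<^esub> gb) = restr Y ?V W ga"
      by (rule germ_equal[OF Vo m S(2) z(1) pp' eqp])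
    have fW: "f pt \<in> W" using W(3) y by simp
    \<comment> \<open>Passing to \<open>W\<close> loses nothing after pullback, since the preimage
      of any neighbourhood of the image point is all of the one-point spectrum.\<close>
    have noop: "restrict (\<phi> U t) {pt} = \<phi> U t" if "openin (topo Y) U" "t \<in> Sec U" "f pt \<in> U" for U t
    proof -
      from sec[OF that] obtain x where "\<phi> U t = ksec x" by blast
      then show ?thesis by (simp add: K.ksec_def)
    qed
    have "\<phi> ?V (s' \<otimes>\<^bsub>sect Y ?V\<^esub> gb) = \<phi> ?V ga"
      using compat[OF Vo W(1,2) m] compat[OF Vo W(1,2) S(2)] W(4) pre1[OF fW] noop[OF Vo m fV'] noop[OF Vo S(2) fV'] by simp
    moreover have "\<phi> ?V s' = \<phi> V s" "\<phi> ?V ga = ksec (\<psi> a)" "\<phi> ?V gb = ksec (\<psi> b)"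
      unfolding s'_def ga_def gb_def
      using compat[OF V Vo _ s] compat[OF Vzo Vo _ gsec_Sec[OF z(1) ab(1)]] compat[OF Vzo Vo _ gsec_Sec[OF z(1) bc]]
        pre1[OF fV'] noop[OF V s True] noop[OF Vzo gsec_Sec[OF z(1) ab(1)] fV] noop[OF Vzo gsec_Sec[OF z(1) bc] fV]
        \<psi>[OF ab(1)] \<psi>[OF bc] by simp_all
    moreover have "\<phi> ?V (s' \<otimes>\<^bsub>sect Y ?V\<^esub> gb) = \<phi> ?V s' \<otimes>\<^bsub>sect (ring_spec K) {pt}\<^esub> \<phi> ?V gb"
      using ring_hom_mult[OF phiV(1)[OF Vo], of s' gb] S pre1[OF fV'] by (simp add: sect_Y_carrier)
    moreover obtain c where c: "c \<in> carrier K" "\<phi> V s = ksec c" using sec[OF V s True] by blast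
    ultimately have "ksec (\<psi> a) = ksec (c \<otimes>\<^bsub>K\<^esub> \<psi> b)"
      using K.ksec_ops(1)[OF c(1), of "\<psi> b"] \<psi>[OF bc] by simp
    then have eq: "\<psi> a = c \<otimes>\<^bsub>K\<^esub> \<psi> b"
      using K.ksec_inj[of "\<psi> a" "c \<otimes>\<^bsub>K\<^esub> \<psi> b"] \<psi>[OF ab(1)] \<psi>[OF bc] c(1) by simp
    have nz: "\<psi> b \<in> carrier K - pt" using ker[OF bc] ab(2) \<psi>[OF bc] by simp
    have "ev \<psi> (s z p) = kfrac (\<psi> a) (\<psi> b)"
      by (rule ev_frac[OF z(1) \<psi>h _ ab(4), unfolded kp]) (rule SecD(3)[OF s z(1) pp])
    also have "\<dots> = kfrac c \<one>\<^bsub>K\<^esub>"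
      unfolding K.kfrac_eq_iff[OF conjunct1[OF \<psi>[OF ab(1)]] c(1) nz K.one_nonzero] using eq c(1) \<psi>[OF bc] by simp
    finally show ?thesis
      unfolding c(2) pre1[OF True] by (simp add: K.ksec_def)
  qed
  have "\<phi> = point_comap z \<psi>"
  proof (rule extensionalityI[of _ "{V. openin (topo Y) V}"])
    show "\<phi> \<in> extensional {V. openin (topo Y) V}" using phi by (simp add: PiE_def)
    show "point_comap z \<psi> \<in> extensional {V. openin (topo Y) V}" by (simp add: point_comap_def)
    fix V assume "V \<in> {V. openin (topo Y) V}"
    then have V: "openin (topo Y) V" by simp
    show "\<phi> V = point_comap z \<psi> V"
    proof (rule extensionalityI[OF phiV(2)[OF V]])
      show "point_comap z \<psi> V \<in> extensional (Sec V)" using V by (simp add: point_comap_def)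
      fix s assume s: "s \<in> Sec V"
      show "\<phi> V s = point_comap z \<psi> V s"
        unfolding phi_value[OF V s] using V s by (simp add: point_comap_def kp f[symmetric])
    qed
  qed
  then show ?thesis using mem f by blast
qed

text \<open>Both kernels are centred, so each pair is its own centre; equal image points have equal
  centres, which forces \<open>z = z'\<close>. The homomorphism is then recovered by evaluating the
  pullback on \<open>gsec z a\<close>.\<close>

lemma point_inj:
  assumes 1: "(z, \<psi>) \<in> local_homs" and 2: "(z', \<psi>') \<in> local_homs"
    and eq: "point_map z \<psi> = point_map z' \<psi>'" "point_comap z \<psi> = point_comap z' \<psi>'"
  shows "z = z' \<and> \<psi> = \<psi>'"
proof -
  let ?p = "kerp z \<psi>" let ?p' = "kerp z' \<psi>'"
  have z: "z \<in> I" "\<psi> \<in> ring_hom (R z) K" "\<psi> \<in> extensional (carrier (R z))" "loc z ?p"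
    and z': "z' \<in> I" "\<psi>' \<in> ring_hom (R z') K" "\<psi>' \<in> extensional (carrier (R z'))" "loc z' ?p'"
    using 1 2 by (auto simp: local_homs_def)
  note p = kerp_prime[OF z(1,2)] and p' = kerp_prime[OF z'(1,2)]
  have c: "cl z ?p = cl z' ?p'" using fun_cong[OF eq(1), of pt] by (simp add: point_map_def)
  obtain v r where v: "v \<in> I" "primeideal r (R v)" "loc v r" "le v z" "le v z'" "pr v z r = ?p" "pr v z' r = ?p'"
    by (rule common_centre[OF z(1) p z'(1) p' c])
  have "v = z \<and> r = ?p"
    using Ctr_unique[OF z(1), of z ?p ?p v r] v z(1,4) p le_refl pr_id by (simp add: Ctr_def)
  moreover have "v = z' \<and> r = ?p'"
    using Ctr_unique[OF z'(1), of z' ?p' ?p' v r] v z'(1,4) p' le_refl pr_id by (simp add: Ctr_def)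
  ultimately have zz: "z' = z" by auto
  note z' = z'[unfolded zz]
  interpret Rz: cring "R z" by (rule cring_R[OF z(1)])
  have "\<psi> a = \<psi>' a" if a: "a \<in> carrier (R z)" for a
  proof -
    note g = gsec_Sec[OF z(1) a] and o = Vz_open[OF z(1)]
    have val: "point_comap z \<chi> (Vz z) (gsec z a) pt = kfrac (\<chi> a) \<one>\<^bsub>K\<^esub>"
      if \<chi>: "\<chi> \<in> ring_hom (R z) K" for \<chi>
    proof -
      note q = kerp_prime[OF z(1) \<chi>]
      note ge = gsec_eval[OF z(1) a q]
      have "point_map z \<chi> pt \<in> Vz z" using q by (auto simp: point_map_def Vz_def)
      then have "point_comap z \<chi> (Vz z) (gsec z a) pt = ev \<chi> (gsec z a z (kerp z \<chi>))"
        using g o by (simp add: point_comap_def preim_K)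
      also have "\<dots> = kfrac (\<chi> a) (\<chi> \<one>\<^bsub>R z\<^esub>)"
        by (rule ev_frac[OF z(1) \<chi> SecD(3)[OF g z(1) ge(2)] ge(3)])
      finally show ?thesis by (simp add: ring_hom_one[OF \<chi>])
    qed
    have "kfrac (\<psi> a) \<one>\<^bsub>K\<^esub> = kfrac (\<psi>' a) \<one>\<^bsub>K\<^esub>"
      using val[OF z(2)] val[OF z'(2)] eq(2)[unfolded zz] by simp
    then show ?thesis
      using K.kfrac_eq_iff[OF ring_hom_closed[OF z(2) a] ring_hom_closed[OF z'(2) a] K.one_nonzero K.one_nonzero]
        ring_hom_closed[OF z(2) a] ring_hom_closed[OF z'(2) a] by simp
  qed
  then show ?thesis using extensionalityI[OF z(3) z'(3)] zz by simp
qed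

lemma bij_points:
  "bij_betw (\<lambda>(z, \<psi>). (point_map z \<psi>, point_comap z \<psi>)) local_homs (lrs_morphisms (ring_spec K) Y)"
  unfolding bij_betw_def
proof (intro conjI inj_onI equalityI subsetI)
  fix x y assume "x \<in> local_homs" "y \<in> local_homs" and
    "(case x of (z, \<psi>) \<Rightarrow> (point_map z \<psi>, point_comap z \<psi>)) = (case y of (z, \<psi>) \<Rightarrow> (point_map z \<psi>, point_comap z \<psi>))"
  then show "x = y"
    using point_inj[of "fst x" "snd x" "fst y" "snd y"] by (simp add: split_beta prod_eq_iff)
next
  fix x assume "x \<in> (\<lambda>(z, \<psi>). (point_map z \<psi>, point_comap z \<psi>)) ` local_homs"
  then show "x \<in> lrs_morphisms (ring_spec K) Y" using point_in_lrs by auto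
next
  fix x assume x: "x \<in> lrs_morphisms (ring_spec K) Y"
  obtain f \<phi> where f: "x = (f, \<phi>)" by (cases x)
  from lrs_point[OF x[unfolded f]] obtain z \<psi> where "(z, \<psi>) \<in> local_homs" "f = point_map z \<psi>" "\<phi> = point_comap z \<psi>"
    by (elim exE conjE) (rule that)
  then show "x \<in> (\<lambda>(z, \<psi>). (point_map z \<psi>, point_comap z \<psi>)) ` local_homs"
    unfolding f by (intro image_eqI[of _ _ "(z, \<psi>)"]) simp_all
qed

end

subsection \<open>Spectra of finitely generated monoids\<close>

text \<open>The hypothesis provides every prime with a least neighbourhood, the primes contained in
  it. The topology is then that of the inclusion order, with the down-closed sets as open
  sets.\<close>

lemma (in spectrum) openin_iff_down_closed:
  assumes "\<And>P. P \<in> Spec \<Longrightarrow> \<exists>g\<in>carrier M - P. \<forall>Q\<in>Spec. g \<notin> Q \<longrightarrow> Q \<subseteq> P"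
  shows "openin T U \<longleftrightarrow> U \<subseteq> Spec \<and> (\<forall>P\<in>U. \<forall>Q\<in>Spec. Q \<subseteq> P \<longrightarrow> Q \<in> U)"
proof
  assume U: "openin T U"
  show "U \<subseteq> Spec \<and> (\<forall>P\<in>U. \<forall>Q\<in>Spec. Q \<subseteq> P \<longrightarrow> Q \<in> U)"
  proof (intro conjI ballI impI)
    show "U \<subseteq> Spec" using U openin_iff by simp
    fix P Q assume PQ: "P \<in> U" "Q \<in> Spec" "Q \<subseteq> P"
    then obtain f where "f \<in> carrier M - P" "\<forall>Q\<in>Spec. f \<notin> Q \<longrightarrow> Q \<in> U"
      using U[unfolded openin_iff] by auto
    then show "Q \<in> U" using PQ by auto
  qed
next
  assume U: "U \<subseteq> Spec \<and> (\<forall>P\<in>U. \<forall>Q\<in>Spec. Q \<subseteq> P \<longrightarrow> Q \<in> U)"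
  show "openin T U"
    unfolding openin_iff
  proof (intro conjI ballI)
    show "U \<subseteq> Spec" using U by simp
    fix P assume P: "P \<in> U"
    then have "P \<in> Spec" using U by auto
    from assms[OF this] obtain g where g: "g \<in> carrier M - P" "\<forall>Q\<in>Spec. g \<notin> Q \<longrightarrow> Q \<subseteq> P"
      by (elim bexE) (rule that)
    then show "\<exists>f\<in>carrier M - P. \<forall>Q\<in>Spec. f \<notin> Q \<longrightarrow> Q \<in> U"
      using U P by (intro bexI[of _ g]) auto
  qed
qed

text \<open>The witness is the product of the generators outside \<open>Q\<close>. A prime
  \<open>Q'\<close> that misses it contains no generator outside \<open>Q\<close>, and the elements
  that lie in \<open>Q\<close> or outside \<open>Q'\<close> form a submonoid; as it contains the
  generators, it is everything.\<close>

lemma fg_monoid_prime_generator: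
  assumes A: "comm_monoid A" and fg: "finitely_generated_monoid A" and Q: "monoid_prime Q A"
  shows "\<exists>g\<in>carrier A - Q. \<forall>Q'. monoid_prime Q' A \<longrightarrow> g \<notin> Q' \<longrightarrow> Q' \<subseteq> Q"
proof -
  interpret comm_monoid A by fact
  interpret Sp: spectrum A "{P. monoid_prime P A}" "monoid_zariski A" by (rule spectrum_monoid[OF A])
  from fg obtain E where E: "finite E" "E \<subseteq> carrier A" "\<And>H. submonoid H A \<Longrightarrow> E \<subseteq> H \<Longrightarrow> H = carrier A"
    by (auto simp: finitely_generated_monoid_def)
  have "\<exists>g\<in>carrier A - Q. \<forall>Q'. monoid_prime Q' A \<longrightarrow> g \<notin> Q' \<longrightarrow> F \<inter> Q' = {}" if "finite F" "F \<subseteq> carrier A - Q" for F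
    using that
  proof (induction F rule: finite_induct)
    case empty
    then show ?case using Sp.prime_one[of Q] Q by (intro bexI[of _ "\<one>\<^bsub>A\<^esub>"]) auto
  next
    case (insert x F)
    then obtain g where g: "g \<in> carrier A - Q" "\<forall>Q'. monoid_prime Q' A \<longrightarrow> g \<notin> Q' \<longrightarrow> F \<inter> Q' = {}" by auto
    have x: "x \<in> carrier A - Q" using insert.prems by simp
    show ?case
    proof (intro bexI[of _ "x \<otimes>\<^bsub>A\<^esub> g"] allI impI)
      show "x \<otimes>\<^bsub>A\<^esub> g \<in> carrier A - Q" using Sp.prime_mult[of Q x g] Q x g by simp
      fix Q' assume Q': "monoid_prime Q' A" "x \<otimes>\<^bsub>A\<^esub> g \<notin> Q'"
      then have "x \<notin> Q'" "g \<notin> Q'" using Sp.prime_mult[of Q' x g] x g by auto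
      then show "insert x F \<inter> Q' = {}" using g(2) Q'(1) by auto
    qed
  qed
  from this[of "E - Q"] E(1,2) obtain g where g: "g \<in> carrier A - Q"
    "\<forall>Q'. monoid_prime Q' A \<longrightarrow> g \<notin> Q' \<longrightarrow> (E - Q) \<inter> Q' = {}" by auto
  show ?thesis
  proof (intro bexI[of _ g] allI impI)
    fix Q' assume Q': "monoid_prime Q' A" "g \<notin> Q'"
    have H: "{a \<in> carrier A. a \<in> Q \<or> a \<notin> Q'} = carrier A"
    proof (rule E(3))
      show "submonoid {a \<in> carrier A. a \<in> Q \<or> a \<notin> Q'} A"
      proof
        show "\<one>\<^bsub>A\<^esub> \<in> {a \<in> carrier A. a \<in> Q \<or> a \<notin> Q'}" using Sp.prime_one[of Q'] Q' by simp
        fix x y assume xy: "x \<in> {a \<in> carrier A. a \<in> Q \<or> a \<notin> Q'}" "y \<in> {a \<in> carrier A. a \<in> Q \<or> a \<notin> Q'}"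
        then show "x \<otimes>\<^bsub>A\<^esub> y \<in> {a \<in> carrier A. a \<in> Q \<or> a \<notin> Q'}"
          using Sp.prime_mult[of Q x y] Sp.prime_mult[of Q' x y] Q Q'(1) by auto
      qed auto
      show "E \<subseteq> {a \<in> carrier A. a \<in> Q \<or> a \<notin> Q'}" using g(2) Q' E(2) by auto
    qed
    have "Q' \<subseteq> carrier A" using Q'(1) by (simp add: monoid_prime_def monoid_ideal_def)
    then show "Q' \<subseteq> Q" using H by auto
  qed (rule g(1))
qed

text \<open>A prime is determined by the generators it contains. The inclusion is proved with the
  same submonoid that yields least neighbourhoods.\<close>

lemma finite_fg_monoid_primes:
  assumes A: "comm_monoid A" and fg: "finitely_generated_monoid A"
  shows "finite {P. monoid_prime P A}"
proof -
  interpret comm_monoid A by fact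
  interpret Sp: spectrum A "{P. monoid_prime P A}" "monoid_zariski A" by (rule spectrum_monoid[OF A])
  from fg obtain E where E: "finite E" "E \<subseteq> carrier A" "\<And>H. submonoid H A \<Longrightarrow> E \<subseteq> H \<Longrightarrow> H = carrier A"
    by (auto simp: finitely_generated_monoid_def)
  have sub: "Q' \<subseteq> Q" if Q: "monoid_prime Q A" and Q': "monoid_prime Q' A" and e: "E \<inter> Q' \<subseteq> E \<inter> Q" for Q Q'
  proof -
    have "{a \<in> carrier A. a \<in> Q \<or> a \<notin> Q'} = carrier A"
    proof (rule E(3))
      show "submonoid {a \<in> carrier A. a \<in> Q \<or> a \<notin> Q'} A"
      proof
        show "\<one>\<^bsub>A\<^esub> \<in> {a \<in> carrier A. a \<in> Q \<or> a \<notin> Q'}" using Sp.prime_one[of Q'] Q' by simp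
        fix x y assume xy: "x \<in> {a \<in> carrier A. a \<in> Q \<or> a \<notin> Q'}" "y \<in> {a \<in> carrier A. a \<in> Q \<or> a \<notin> Q'}"
        then show "x \<otimes>\<^bsub>A\<^esub> y \<in> {a \<in> carrier A. a \<in> Q \<or> a \<notin> Q'}"
          using Sp.prime_mult[of Q x y] Sp.prime_mult[of Q' x y] Q Q' by auto
      qed auto
      show "E \<subseteq> {a \<in> carrier A. a \<in> Q \<or> a \<notin> Q'}" using e E(2) by auto
    qed
    moreover have "Q' \<subseteq> carrier A" using Q' by (simp add: monoid_prime_def monoid_ideal_def)
    ultimately show ?thesis by auto
  qed
  have "inj_on (\<lambda>P. E \<inter> P) {P. monoid_prime P A}"
  proof (rule inj_onI)
    fix P Q assume "P \<in> {P. monoid_prime P A}" "Q \<in> {P. monoid_prime P A}" and e: "E \<inter> P = E \<inter> Q"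
    then have PQ: "monoid_prime P A" "monoid_prime Q A" by simp_all
    have "P \<subseteq> Q" by (rule sub[OF PQ(2,1)]) (simp only: e subset_refl)
    moreover have "Q \<subseteq> P" by (rule sub[OF PQ]) (simp only: e subset_refl)
    ultimately show "P = Q" by (rule antisym)
  qed
  moreover have "(\<lambda>P. E \<inter> P) ` {P. monoid_prime P A} \<subseteq> Pow E" by auto
  ultimately show ?thesis using E(1) finite_Pow_iff by (metis inj_on_finite)
qed

lemma monoid_spec_simps [simp]:
  "topo (monoid_spec A) = monoid_zariski A"
  "restr (monoid_spec A) U V s = restrict s V"
  "carrier (sect (monoid_spec A) U) = structure_sections A (monoid_zariski A) U"
  "s \<otimes>\<^bsub>sect (monoid_spec A) U\<^esub> t = (\<lambda>P\<in>U. fraction_mult A (carrier A - P) (s P) (t P))"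
  "\<one>\<^bsub>sect (monoid_spec A) U\<^esub> = (\<lambda>P\<in>U. fraction A (carrier A - P) \<one>\<^bsub>A\<^esub> \<one>\<^bsub>A\<^esub>)"
  by (simp_all add: monoid_spec_def monoid_localisation_def)

lemma open_subspace_simps [simp]:
  "topo (open_subspace X U) = subtopology (topo X) U"
  "sect (open_subspace X U) = sect X"
  "restr (open_subspace X U) = restr X"
  by (simp_all add: open_subspace_def)

text \<open>The nonunits form the largest prime of a monoid, so the spectrum is the only neighbourhood of it.\<close>

lemma monoid_spec_closed_point:
  assumes A: "comm_monoid A"
  shows "\<exists>c. monoid_prime c A \<and> (\<forall>U. openin (monoid_zariski A) U \<and> c \<in> U \<longrightarrow> U = {P. monoid_prime P A})"
proof -
  interpret comm_monoid A by fact
  interpret Sp: spectrum A "{P. monoid_prime P A}" "monoid_zariski A" by (rule spectrum_monoid[OF A])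
  let ?c = "carrier A - Units A"
  have "submonoid (carrier A - ?c) A"
    by unfold_locales (auto simp: Units_closed)
  moreover have "monoid_ideal ?c A"
    unfolding monoid_ideal_def
  proof (intro conjI ballI)
    fix a x assume ax: "a \<in> carrier A" "x \<in> ?c"
    show "a \<otimes>\<^bsub>A\<^esub> x \<in> ?c"
    proof
      show "a \<otimes>\<^bsub>A\<^esub> x \<in> carrier A" using ax by simp
      show "a \<otimes>\<^bsub>A\<^esub> x \<notin> Units A"
      proof
        assume "a \<otimes>\<^bsub>A\<^esub> x \<in> Units A"
        then have "x \<in> Units A" using unit_factor[of x a] m_comm[of a x] ax by simp
        then show False using ax by simp
      qed
    qed
  qed simp
  ultimately have c: "monoid_prime ?c A" by (simp add: monoid_prime_def)
  have "U = {P. monoid_prime P A}" if U: "openin (monoid_zariski A) U" "?c \<in> U" for U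
  proof -
    from U obtain f where f: "f \<in> carrier A - ?c" "\<forall>Q\<in>{P. monoid_prime P A}. f \<notin> Q \<longrightarrow> Q \<in> U"
      using bspec[OF conjunct2[OF U(1)[unfolded Sp.openin_iff]] U(2)] by (elim bexE) (rule that)
    have "f \<in> Units A" using f(1) by simp
    then have "Q \<in> U" if "Q \<in> {P. monoid_prime P A}" for Q
      using bspec[OF f(2) that] Sp.prime_unit[OF that] by simp
    then have "{P. monoid_prime P A} \<subseteq> U" by (rule subsetI)
    then show ?thesis by (rule antisym[OF conjunct1[OF U(1)[unfolded Sp.openin_iff]]])
  qed
  with c show ?thesis by (intro exI[of _ ?c] conjI allI impI) auto
qed

subsection \<open>Affine charts\<close>

locale chart = monoid_sheaf X for X :: "('p, 'm) monoidal_space" +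
  fixes U0 :: "'p set" and A :: "'m monoid" and f :: "'p \<Rightarrow> 'm set"
    and \<phi> :: "'m set set \<Rightarrow> ('m set \<Rightarrow> ('m \<times> 'm) set) \<Rightarrow> 'm"
  assumes U0_open: "openin (topo X) U0" and comm_monoid_A: "comm_monoid A"
    and fg_A: "finitely_generated_monoid A"
    and iso: "monoidal_space_iso (open_subspace X U0) (monoid_spec A) f \<phi>"
begin

abbreviation Sp where "Sp \<equiv> {P. monoid_prime P A}"

sublocale A: spectrum A "{P. monoid_prime P A}" "monoid_zariski A"
  by (rule spectrum_monoid[OF comm_monoid_A])

text \<open>\<open>Od P\<close> is the least neighbourhood of \<open>P\<close>, \<open>W P\<close>
  the open subset of \<open>X\<close> that corresponds to it, and \<open>\<iota> P\<close> the map
  from \<open>A\<close> to the sections over \<open>W P\<close>, which turns out to be the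
  localisation at \<open>P\<close>. The opens \<open>W P\<close> will prove to be all affine opens
  inside the chart.\<close>

definition Od where "Od P = {Q. monoid_prime Q A \<and> Q \<subseteq> P}"
definition W where "W P = {x \<in> U0. f x \<subseteq> P}"
definition csec where "csec P a = (\<lambda>Q\<in>Od P. fraction A (carrier A - Q) a \<one>\<^bsub>A\<^esub>)"
definition \<iota> where "\<iota> P a = \<phi> (Od P) (csec P a)"

abbreviation G where "G P \<equiv> sect X (W P)"
abbreviation rs where "rs P Q \<equiv> restr X (W P) (W Q)"

lemma prime_generator: "P \<in> Sp \<Longrightarrow> \<exists>g\<in>carrier A - P. \<forall>Q\<in>Sp. g \<notin> Q \<longrightarrow> Q \<subseteq> P"
  using fg_monoid_prime_generator[OF comm_monoid_A fg_A, of P] by auto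

lemma openin_A: "openin (monoid_zariski A) U \<longleftrightarrow> U \<subseteq> Sp \<and> (\<forall>P\<in>U. \<forall>Q\<in>Sp. Q \<subseteq> P \<longrightarrow> Q \<in> U)"
  by (rule A.openin_iff_down_closed[OF prime_generator])

lemma Od_open: "openin (monoid_zariski A) (Od P)"
  unfolding openin_A by (auto simp: Od_def)

lemma homeo: "homeomorphic_map (subtopology (topo X) U0) (monoid_zariski A) f"
  using iso by (simp add: monoidal_space_iso_def)

lemma topspace_U0: "topspace (subtopology (topo X) U0) = U0"
  using openin_subset[OF U0_open] by auto

lemma f_bij: "bij_betw f U0 Sp"
proof -
  have "inj_on f U0" "f ` U0 = Sp"
    using homeomorphic_imp_injective_map[OF homeo] homeomorphic_imp_surjective_map[OF homeo]
    unfolding topspace_U0 A.topspace_eq by auto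
  then show ?thesis by (simp add: bij_betw_def)
qed

lemma f_prime: "x \<in> U0 \<Longrightarrow> f x \<in> Sp"
  using f_bij by (auto simp: bij_betw_def)

lemma openin_X_iff:
  assumes "V \<subseteq> U0"
  shows "openin (topo X) V \<longleftrightarrow> openin (monoid_zariski A) (f ` V)"
proof -
  have "openin (topo X) V \<longleftrightarrow> openin (subtopology (topo X) U0) V"
    using openin_open_subtopology[OF U0_open, of V] assms by simp
  also have "\<dots> \<longleftrightarrow> openin (monoid_zariski A) (f ` V)"
    by (rule homeomorphic_map_openness[OF homeo, symmetric]) (simp only: topspace_U0 assms)
  finally show ?thesis .
qed

lemma preim_Od: "preim (open_subspace X U0) f (Od P) = W P"
proof -
  have "topspace (topo (open_subspace X U0)) = U0" using topspace_U0 by simp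
  then show ?thesis unfolding preim_def W_def Od_def using f_prime by auto
qed

lemma f_image_W: "f ` W P = Od P"
proof -
  have im: "f ` U0 = Sp" using f_bij by (simp add: bij_betw_def)
  show ?thesis
  proof (intro equalityI subsetI)
    fix Q assume "Q \<in> Od P"
    then have Q: "Q \<in> Sp" "Q \<subseteq> P" by (simp_all add: Od_def)
    then obtain x where "x \<in> U0" "Q = f x" using im by (metis imageE)
    then show "Q \<in> f ` W P" using Q(2) by (simp add: W_def)
  qed (use f_prime in \<open>auto simp: W_def Od_def\<close>)
qed

lemma W_open: "openin (topo X) (W P)"
  using openin_X_iff[of "W P"] Od_open f_image_W[of P] by (simp add: W_def)

lemma W_subset: "W P \<subseteq> U0" by (auto simp: W_def)

lemma W_mono: "Q \<subseteq> P \<Longrightarrow> W Q \<subseteq> W P" by (auto simp: W_def)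

text \<open>Open sets are closed under passing to smaller primes, so a neighbourhood of
  \<open>x\<close> contains every point of the chart whose prime lies inside that of
  \<open>x\<close>.\<close>

lemma W_min:
  assumes "openin (topo X) V" "x \<in> V" "x \<in> U0"
  shows "W (f x) \<subseteq> V"
proof
  fix y assume y: "y \<in> W (f x)"
  have "openin (topo X) (V \<inter> U0)" using assms(1) U0_open by (rule openin_Int)
  then have o: "openin (monoid_zariski A) (f ` (V \<inter> U0))" using openin_X_iff[of "V \<inter> U0"] by simp
  have "f x \<in> f ` (V \<inter> U0)" using assms by blast
  moreover have "f y \<in> Sp" "f y \<subseteq> f x" "y \<in> U0" using y f_prime by (auto simp: W_def)
  ultimately have "f y \<in> f ` (V \<inter> U0)" using o unfolding openin_A by blast
  then obtain y' where "y' \<in> V" "y' \<in> U0" "f y' = f y" by auto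
  then show "y \<in> V" using f_bij \<open>y \<in> U0\<close> by (auto simp: bij_betw_def dest: inj_onD)
qed

lemma W_subset_iff: "P \<in> Sp \<Longrightarrow> W P \<subseteq> W Q \<longleftrightarrow> P \<subseteq> Q"
proof
  assume P: "P \<in> Sp" and s: "W P \<subseteq> W Q"
  have "P \<in> Od P" using P by (simp add: Od_def)
  then have "P \<in> Od Q" using image_mono[OF s, of f] unfolding f_image_W by (rule subsetD[rotated])
  then show "P \<subseteq> Q" by (simp add: Od_def)
qed (rule W_mono)

lemma \<phi>_iso: "\<phi> (Od P) \<in> Group.iso (sect (monoid_spec A) (Od P)) (G P)"
proof -
  have "\<forall>V. openin (topo (monoid_spec A)) V \<longrightarrow>
      \<phi> V \<in> Group.iso (sect (monoid_spec A) V) (sect (open_subspace X U0) (preim (open_subspace X U0) f V))"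
    using iso unfolding monoidal_space_iso_def by (elim conjE)
  from this[rule_format, of "Od P"] show ?thesis
    using Od_open[of P] preim_Od[of P] by simp
qed

lemma G_monoid: "comm_monoid (G P)" by (rule sect_monoid[OF W_open])

lemma rs_hom: "Q \<subseteq> P \<Longrightarrow> rs P Q \<in> hom (G P) (G Q)" "Q \<subseteq> P \<Longrightarrow> rs P Q \<one>\<^bsub>G P\<^esub> = \<one>\<^bsub>G Q\<^esub>"
  using restr_hom[OF W_open W_open W_mono] restr_one[OF W_open W_open W_mono] by auto

lemma csec_section: "a \<in> carrier A \<Longrightarrow> csec P a \<in> structure_sections A (monoid_zariski A) (Od P)"
proof (rule A.sectionI)
  assume a: "a \<in> carrier A"
  show "csec P a \<in> extensional (Od P)" by (simp add: csec_def)
  fix Q assume Q: "Q \<in> Od P"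
  then have Qs: "Q \<in> Sp" by (simp add: Od_def)
  from prime_generator[OF Qs] obtain g where g: "g \<in> carrier A - Q" "\<forall>Q'\<in>Sp. g \<notin> Q' \<longrightarrow> Q' \<subseteq> Q"
    by (elim bexE) (rule that)
  show "Q \<in> Sp \<and> (\<exists>c\<in>carrier A. \<exists>b\<in>carrier A. \<exists>g\<in>carrier A. g \<notin> Q \<and>
      (\<forall>Q\<in>Sp. g \<notin> Q \<longrightarrow> Q \<in> Od P \<and> b \<notin> Q \<and> csec P a Q = fraction A (carrier A - Q) c b))"
  proof (rule conjI[OF Qs], rule bexI[of _ a], rule bexI[of _ "\<one>\<^bsub>A\<^esub>"], rule bexI[of _ g], intro conjI ballI impI)
    show "g \<notin> Q" using g by simp
    fix Q' assume Q': "Q' \<in> Sp" "g \<notin> Q'"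
    then show "Q' \<in> Od P" using g(2) Q by (auto simp: Od_def)
    then show "csec P a Q' = fraction A (carrier A - Q') a \<one>\<^bsub>A\<^esub>" by (simp add: csec_def)
    show "\<one>\<^bsub>A\<^esub> \<notin> Q'" by (rule A.prime_one[OF Q'(1)])
  qed (use a g in auto)
qed

lemma csec_mult:
  assumes "a \<in> carrier A" "b \<in> carrier A"
  shows "csec P a \<otimes>\<^bsub>sect (monoid_spec A) (Od P)\<^esub> csec P b = csec P (a \<otimes>\<^bsub>A\<^esub> b)"
  unfolding monoid_spec_simps csec_def[of P "a \<otimes>\<^bsub>A\<^esub> b"]
proof (rule restrict_ext)
  fix Q assume Q: "Q \<in> Od P"
  then have Qs: "Q \<in> Sp" by (simp add: Od_def)
  interpret F: fraction_setting A "carrier A - Q" by (rule A.fraction_setting[OF Qs])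
  have o: "\<one>\<^bsub>A\<^esub> \<in> carrier A - Q" using A.prime_one[OF Qs] by simp
  show "fraction_mult A (carrier A - Q) (csec P a Q) (csec P b Q) = fraction A (carrier A - Q) (a \<otimes>\<^bsub>A\<^esub> b) \<one>\<^bsub>A\<^esub>"
    using Q F.fraction_mult_fraction[OF assms o o] by (simp add: csec_def)
qed

text \<open>Equality at \<open>P\<close> spreads to all of \<open>Od P\<close>, since a witness
  outside \<open>P\<close> is outside every smaller prime.\<close>

lemma csec_eq_iff:
  assumes P: "P \<in> Sp" and ab: "a \<in> carrier A" "b \<in> carrier A"
  shows "csec P a = csec P b \<longleftrightarrow> (\<exists>u\<in>carrier A - P. u \<otimes>\<^bsub>A\<^esub> a = u \<otimes>\<^bsub>A\<^esub> b)"
proof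
  interpret F: fraction_setting A "carrier A - P" by (rule A.fraction_setting[OF P])
  have o: "\<one>\<^bsub>A\<^esub> \<in> carrier A - P" using A.prime_one[OF P] by simp
  {
    assume "csec P a = csec P b"
    from fun_cong[OF this, of P] have "fraction A (carrier A - P) a \<one>\<^bsub>A\<^esub> = fraction A (carrier A - P) b \<one>\<^bsub>A\<^esub>"
      using P by (simp add: csec_def Od_def)
    then show "\<exists>u\<in>carrier A - P. u \<otimes>\<^bsub>A\<^esub> a = u \<otimes>\<^bsub>A\<^esub> b"
      using F.fraction_eq_iff[OF ab o o] ab by simp
  next
    assume "\<exists>u\<in>carrier A - P. u \<otimes>\<^bsub>A\<^esub> a = u \<otimes>\<^bsub>A\<^esub> b"
    then obtain u where u: "u \<in> carrier A - P" "u \<otimes>\<^bsub>A\<^esub> a = u \<otimes>\<^bsub>A\<^esub> b" by (elim bexE) (rule that)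
    show "csec P a = csec P b"
      unfolding csec_def
    proof (rule restrict_ext)
      fix Q assume Q: "Q \<in> Od P"
      then have Qs: "Q \<in> Sp" "Q \<subseteq> P" by (auto simp: Od_def)
      interpret FQ: fraction_setting A "carrier A - Q" by (rule A.fraction_setting[OF Qs(1)])
      show "fraction A (carrier A - Q) a \<one>\<^bsub>A\<^esub> = fraction A (carrier A - Q) b \<one>\<^bsub>A\<^esub>"
        by (rule FQ.fraction_eqI[of u]) (use u ab Qs A.prime_one[OF Qs(1)] in auto)
    qed
  }
qed

text \<open>As \<open>Od P\<close> is the least neighbourhood of \<open>P\<close>, a fraction that
  represents a section near \<open>P\<close> represents it everywhere.\<close>

lemma section_Od:
  assumes P: "P \<in> Sp" and s: "s \<in> structure_sections A (monoid_zariski A) (Od P)"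
  obtains a g where "a \<in> carrier A" "g \<in> carrier A - P"
    "csec P g \<otimes>\<^bsub>sect (monoid_spec A) (Od P)\<^esub> s = csec P a"
proof -
  have PO: "P \<in> Od P" using P by (simp add: Od_def)
  obtain a g where ag: "a \<in> carrier A" "g \<in> carrier A" "g \<notin> P" "P \<in> Sp"
    "\<forall>Q\<in>Sp. g \<notin> Q \<longrightarrow> Q \<in> Od P \<and> s Q = fraction A (carrier A - Q) a g" by (rule A.sectionE[OF s PO])
  show ?thesis
  proof (rule that)
    show "csec P g \<otimes>\<^bsub>sect (monoid_spec A) (Od P)\<^esub> s = csec P a"
      unfolding monoid_spec_simps csec_def[of P a]
    proof (rule restrict_ext)
      fix Q assume Q: "Q \<in> Od P"
      then have Qs: "Q \<in> Sp" "g \<in> carrier A - Q" using ag(2,3) by (auto simp: Od_def)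
      interpret F: fraction_setting A "carrier A - Q" by (rule A.fraction_setting[OF Qs(1)])
      have o: "\<one>\<^bsub>A\<^esub> \<in> carrier A - Q" using A.prime_one[OF Qs(1)] by simp
      have "s Q = fraction A (carrier A - Q) a g" using ag(5) Qs by simp
      then have "fraction_mult A (carrier A - Q) (csec P g Q) (s Q) = fraction A (carrier A - Q) (g \<otimes>\<^bsub>A\<^esub> a) (\<one>\<^bsub>A\<^esub> \<otimes>\<^bsub>A\<^esub> g)"
        using Q F.fraction_mult_fraction[OF ag(2,1) o Qs(2)] by (simp add: csec_def)
      also have "\<dots> = fraction A (carrier A - Q) a \<one>\<^bsub>A\<^esub>"
        by (rule F.fraction_eqI[of "\<one>\<^bsub>A\<^esub>"]) (use ag(1) Qs o in \<open>auto simp: A.m_comm\<close>)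
      finally show "fraction_mult A (carrier A - Q) (csec P g Q) (s Q) = fraction A (carrier A - Q) a \<one>\<^bsub>A\<^esub>" .
    qed
  qed (use ag in auto)
qed

lemma \<phi>_props:
  "\<And>s. s \<in> structure_sections A (monoid_zariski A) (Od P) \<Longrightarrow> \<phi> (Od P) s \<in> carrier (G P)"
  "\<And>s t. s \<in> structure_sections A (monoid_zariski A) (Od P) \<Longrightarrow> t \<in> structure_sections A (monoid_zariski A) (Od P) \<Longrightarrow>
    \<phi> (Od P) (s \<otimes>\<^bsub>sect (monoid_spec A) (Od P)\<^esub> t) = \<phi> (Od P) s \<otimes>\<^bsub>G P\<^esub> \<phi> (Od P) t"
  "\<And>s t. s \<in> structure_sections A (monoid_zariski A) (Od P) \<Longrightarrow> t \<in> structure_sections A (monoid_zariski A) (Od P) \<Longrightarrow>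
    \<phi> (Od P) s = \<phi> (Od P) t \<Longrightarrow> s = t"
  "\<And>m. m \<in> carrier (G P) \<Longrightarrow> \<exists>s\<in>structure_sections A (monoid_zariski A) (Od P). m = \<phi> (Od P) s"
proof -
  have b: "bij_betw (\<phi> (Od P)) (structure_sections A (monoid_zariski A) (Od P)) (carrier (G P))"
    and h: "\<phi> (Od P) \<in> hom (sect (monoid_spec A) (Od P)) (G P)"
    using \<phi>_iso[of P] by (auto simp: Group.iso_def)
  show "\<phi> (Od P) s \<in> carrier (G P)" if "s \<in> structure_sections A (monoid_zariski A) (Od P)" for s
    using bij_betwE[OF b] that by blast
  show "\<phi> (Od P) (s \<otimes>\<^bsub>sect (monoid_spec A) (Od P)\<^esub> t) = \<phi> (Od P) s \<otimes>\<^bsub>G P\<^esub> \<phi> (Od P) t"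
    if "s \<in> structure_sections A (monoid_zariski A) (Od P)" "t \<in> structure_sections A (monoid_zariski A) (Od P)" for s t
    by (rule hom_mult[OF h]) (use that in simp_all)
  show "s = t" if "s \<in> structure_sections A (monoid_zariski A) (Od P)" "t \<in> structure_sections A (monoid_zariski A) (Od P)"
    "\<phi> (Od P) s = \<phi> (Od P) t" for s t
    using inj_on_eq_iff[OF bij_betw_imp_inj_on[OF b] that(1,2)] that(3) by simp
  show "\<exists>s\<in>structure_sections A (monoid_zariski A) (Od P). m = \<phi> (Od P) s" if "m \<in> carrier (G P)" for m
    using that bij_betw_imp_surj_on[OF b] by blast
qed

lemma \<iota>_closed: "a \<in> carrier A \<Longrightarrow> \<iota> P a \<in> carrier (G P)"
  unfolding \<iota>_def by (rule \<phi>_props(1)[OF csec_section])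

lemma \<iota>_mult: "a \<in> carrier A \<Longrightarrow> b \<in> carrier A \<Longrightarrow> \<iota> P (a \<otimes>\<^bsub>A\<^esub> b) = \<iota> P a \<otimes>\<^bsub>G P\<^esub> \<iota> P b"
  unfolding \<iota>_def csec_mult[symmetric] by (rule \<phi>_props(2)[OF csec_section csec_section])

lemma \<iota>_surj:
  assumes P: "P \<in> Sp" and m: "m \<in> carrier (G P)"
  shows "\<exists>a\<in>carrier A. \<exists>g\<in>carrier A - P. \<iota> P g \<otimes>\<^bsub>G P\<^esub> m = \<iota> P a"
proof -
  from \<phi>_props(4)[OF m] obtain s where s: "s \<in> structure_sections A (monoid_zariski A) (Od P)" "m = \<phi> (Od P) s"
    by (elim bexE) (rule that)
  obtain a g where ag: "a \<in> carrier A" "g \<in> carrier A - P" "csec P g \<otimes>\<^bsub>sect (monoid_spec A) (Od P)\<^esub> s = csec P a"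
    by (rule section_Od[OF P s(1)])
  have "\<iota> P g \<otimes>\<^bsub>G P\<^esub> m = \<iota> P a"
    unfolding \<iota>_def s(2) ag(3)[symmetric] by (rule \<phi>_props(2)[OF csec_section s(1), symmetric]) (use ag in simp)
  then show ?thesis using ag(1,2) by (intro bexI[of _ a] bexI[of _ g])
qed

lemma \<iota>_eq_iff:
  assumes "P \<in> Sp" "a \<in> carrier A" "b \<in> carrier A"
  shows "\<iota> P a = \<iota> P b \<longleftrightarrow> (\<exists>u\<in>carrier A - P. u \<otimes>\<^bsub>A\<^esub> a = u \<otimes>\<^bsub>A\<^esub> b)"
  unfolding csec_eq_iff[OF assms, symmetric] \<iota>_def
  using \<phi>_props(3)[OF csec_section[OF assms(2)] csec_section[OF assms(3)]] by auto

text \<open>An element of \<open>iso\<close> is a multiplicative bijection, so preservation of the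
  unit has to be derived: the unit of \<open>G P\<close> is the image of some section
  \<open>s\<close>, and multiplying \<open>s\<close> by the section 1 leaves it fixed.\<close>

lemma \<iota>_one: assumes P: "P \<in> Sp" shows "\<iota> P \<one>\<^bsub>A\<^esub> = \<one>\<^bsub>G P\<^esub>"
proof -
  interpret GP: comm_monoid "G P" by (rule G_monoid)
  from \<phi>_props(4)[OF GP.one_closed] obtain s where s: "s \<in> structure_sections A (monoid_zariski A) (Od P)" "\<one>\<^bsub>G P\<^esub> = \<phi> (Od P) s"
    by (elim bexE) (rule that)
  have "csec P \<one>\<^bsub>A\<^esub> \<otimes>\<^bsub>sect (monoid_spec A) (Od P)\<^esub> s = s"
  proof (rule extensionalityI[of _ "Od P"])
    show "s \<in> extensional (Od P)" by (rule A.section_ext[OF s(1)])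
    fix Q assume Q: "Q \<in> Od P"
    then have Qs: "Q \<in> Sp" by (simp add: Od_def)
    interpret F: fraction_setting A "carrier A - Q" by (rule A.fraction_setting[OF Qs])
    have 1: "\<one>\<^bsub>A\<^esub> \<in> carrier A - Q" using A.prime_one[OF Qs] by simp
    obtain a g where ag: "a \<in> carrier A" "g \<in> carrier A - Q" "s Q = fraction A (carrier A - Q) a g"
      by (rule F.fractionsE[OF A.section_fractions[OF s(1) Q]])
    show "(csec P \<one>\<^bsub>A\<^esub> \<otimes>\<^bsub>sect (monoid_spec A) (Od P)\<^esub> s) Q = s Q"
      using Q F.fraction_mult_fraction[OF A.one_closed ag(1) 1 ag(2)] ag by (simp add: csec_def)
  qed simp
  then have "\<iota> P \<one>\<^bsub>A\<^esub> \<otimes>\<^bsub>G P\<^esub> \<one>\<^bsub>G P\<^esub> = \<one>\<^bsub>G P\<^esub>"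
    unfolding \<iota>_def s(2) using \<phi>_props(2)[OF csec_section[OF A.one_closed] s(1)] by simp
  then show ?thesis using \<iota>_closed[OF A.one_closed, of P] by simp
qed

text \<open>The isomorphism reflects and preserves invertibility, and on the least neighbourhood
  \<open>a / 1\<close> is invertible exactly if \<open>a\<close> avoids the largest prime there,
  which is \<open>P\<close>.\<close>

lemma \<iota>_unit_iff:
  assumes P: "P \<in> Sp" and a: "a \<in> carrier A"
  shows "\<iota> P a \<in> Units (G P) \<longleftrightarrow> a \<notin> P"
proof
  interpret GP: comm_monoid "G P" by (rule G_monoid)
  have PO: "P \<in> Od P" using P by (simp add: Od_def)
  {
    assume u: "\<iota> P a \<in> Units (G P)"
    from \<phi>_props(4)[OF GP.Units_inv_closed[OF u]] obtain t where
      t: "t \<in> structure_sections A (monoid_zariski A) (Od P)" "inv\<^bsub>G P\<^esub> \<iota> P a = \<phi> (Od P) t" by (elim bexE) (rule that)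
    have "\<phi> (Od P) (csec P a \<otimes>\<^bsub>sect (monoid_spec A) (Od P)\<^esub> t) = \<iota> P a \<otimes>\<^bsub>G P\<^esub> inv\<^bsub>G P\<^esub> \<iota> P a"
      unfolding t(2) unfolding \<iota>_def by (rule \<phi>_props(2)[OF csec_section[OF a] t(1)])
    also have "\<dots> = \<phi> (Od P) (csec P \<one>\<^bsub>A\<^esub>)" using GP.Units_r_inv[OF u] \<iota>_one[OF P] by (simp add: \<iota>_def)
    finally have "csec P a \<otimes>\<^bsub>sect (monoid_spec A) (Od P)\<^esub> t = csec P \<one>\<^bsub>A\<^esub>"
      using \<phi>_props(3)[OF _ csec_section[OF A.one_closed]] A.section_mult[OF csec_section[OF a] t(1)] by simp
    from fun_cong[OF this, of P] PO
    have e: "fraction_mult A (carrier A - P) (csec P a P) (t P) = fraction A (carrier A - P) \<one>\<^bsub>A\<^esub> \<one>\<^bsub>A\<^esub>"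
      by (simp add: csec_def)
    interpret F: fraction_setting A "carrier A - P" by (rule A.fraction_setting[OF P])
    have "(a, \<one>\<^bsub>A\<^esub>) \<in> csec P a P"
      using PO F.fraction_self[OF a, of "\<one>\<^bsub>A\<^esub>"] A.prime_one[OF P] by (simp add: csec_def)
    from A.unit_of_inverse[OF P A.section_fractions[OF csec_section[OF a] PO] A.section_fractions[OF t(1) PO] e this]
    show "a \<notin> P" .
  next
    assume aP: "a \<notin> P"
    have un: "\<exists>b g. (b, g) \<in> csec P a Q \<and> b \<notin> Q" if Q: "Q \<in> Od P" for Q
    proof -
      have Qs: "Q \<in> Sp" "a \<notin> Q" using Q aP by (auto simp: Od_def)
      interpret F: fraction_setting A "carrier A - Q" by (rule A.fraction_setting[OF Qs(1)])
      have "(a, \<one>\<^bsub>A\<^esub>) \<in> csec P a Q"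
        using Q F.fraction_self[OF a, of "\<one>\<^bsub>A\<^esub>"] A.prime_one[OF Qs(1)] by (simp add: csec_def)
      then show ?thesis using Qs(2) by (intro exI[of _ a] exI[of _ "\<one>\<^bsub>A\<^esub>"] conjI)
    qed
    let ?t = "\<lambda>Q\<in>Od P. (csec P a Q)\<inverse>"
    note cv = A.section_converse[OF csec_section[OF a] un]
    have "csec P a \<otimes>\<^bsub>sect (monoid_spec A) (Od P)\<^esub> ?t = csec P \<one>\<^bsub>A\<^esub>"
      unfolding monoid_spec_simps csec_def[of P "\<one>\<^bsub>A\<^esub>"] by (rule restrict_ext) (use cv(2) in simp)
    then have "\<iota> P a \<otimes>\<^bsub>G P\<^esub> \<phi> (Od P) ?t = \<one>\<^bsub>G P\<^esub>"
      using \<phi>_props(2)[OF csec_section[OF a] cv(1)] \<iota>_one[OF P] by (simp add: \<iota>_def)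
    then show "\<iota> P a \<in> Units (G P)"
      using \<phi>_props(1)[OF cv(1)] \<iota>_closed[OF a, of P] GP.m_comm[of "\<iota> P a" "\<phi> (Od P) ?t"]
      unfolding Units_def by (intro CollectI conjI bexI[of _ "\<phi> (Od P) ?t"]) auto
  }
qed

lemma \<iota>_restr:
  assumes "Q \<subseteq> P" "a \<in> carrier A"
  shows "rs P Q (\<iota> P a) = \<iota> Q a"
proof -
  have sub: "Od Q \<subseteq> Od P" using assms(1) by (auto simp: Od_def)
  have nat: "\<phi> (Od Q) (restr (monoid_spec A) (Od P) (Od Q) s) =
      restr (open_subspace X U0) (preim (open_subspace X U0) f (Od P)) (preim (open_subspace X U0) f (Od Q)) (\<phi> (Od P) s)"
    if "s \<in> carrier (sect (monoid_spec A) (Od P))" for s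
  proof -
    have "\<forall>V W. openin (topo (monoid_spec A)) V \<and> openin (topo (monoid_spec A)) W \<and> W \<subseteq> V \<longrightarrow>
      (\<forall>s\<in>carrier (sect (monoid_spec A) V). \<phi> W (restr (monoid_spec A) V W s) =
        restr (open_subspace X U0) (preim (open_subspace X U0) f V) (preim (open_subspace X U0) f W) (\<phi> V s))"
      using iso unfolding monoidal_space_iso_def by (elim conjE)
    from this[rule_format, of "Od P" "Od Q" s] show ?thesis
      using Od_open[of P] Od_open[of Q] sub that by simp
  qed
  have "restrict (csec P a) (Od Q) = csec Q a"
    unfolding csec_def by (simp add: Int_absorb1[OF sub])
  then show ?thesis
    using nat[of "csec P a"] csec_section[OF assms(2), of P] unfolding preim_Od by (simp add: \<iota>_def)
qed

lemma \<iota>_localisation: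
  assumes P: "P \<in> Sp"
  shows "localisation_hom A (G P) (\<iota> P) (carrier A - P)"
proof (rule localisation_hom.intro)
  show "comm_monoid A" "comm_monoid (G P)" by (rule comm_monoid_A, rule G_monoid)
  show "\<iota> P \<in> hom A (G P)" by (auto intro!: homI \<iota>_closed \<iota>_mult)
  show "\<iota> P \<one>\<^bsub>A\<^esub> = \<one>\<^bsub>G P\<^esub>" by (rule \<iota>_one[OF P])
  show "submonoid (carrier A - P) A" by (rule A.prime_compl[OF P])
  show "\<iota> P s \<in> Units (G P)" if "s \<in> carrier A - P" for s using \<iota>_unit_iff[OF P, of s] that by simp
  show "\<exists>a\<in>carrier A. \<exists>b\<in>carrier A - P. \<iota> P b \<otimes>\<^bsub>G P\<^esub> x = \<iota> P a" if "x \<in> carrier (G P)" for x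
    by (rule \<iota>_surj[OF P that])
  show "\<exists>b\<in>carrier A - P. b \<otimes>\<^bsub>A\<^esub> a = b \<otimes>\<^bsub>A\<^esub> a'" if "a \<in> carrier A" "a' \<in> carrier A" "\<iota> P a = \<iota> P a'" for a a'
    using \<iota>_eq_iff[OF P that(1,2)] that(3) by simp
qed

end

section \<open>Elements of a localisation as classes of fractions, and towers of
  localisations\<close>

context localisation_hom
begin

interpretation M: comm_monoid M by (rule comm_monoid_dom)
interpretation M': comm_monoid M' by (rule comm_monoid_cod)
interpretation S: submonoid S M by (rule submonoid)

text \<open>The isomorphism from an abstract localisation to concrete fractions, given without
  choosing representatives: the pairs collected are all ways of writing \<open>y\<close> as
  \<open>m / n\<close>.\<close>

definition fr where "fr y = {(m, n). m \<in> carrier M \<and> n \<in> S \<and> h n \<otimes>\<^bsub>M'\<^esub> y = h m}"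

lemma h_carr: "m \<in> carrier M \<Longrightarrow> h m \<in> carrier M'" using hom by (auto simp: hom_def)
lemma h_prod: "m \<in> carrier M \<Longrightarrow> n \<in> carrier M \<Longrightarrow> h (m \<otimes>\<^bsub>M\<^esub> n) = h m \<otimes>\<^bsub>M'\<^esub> h n"
  using hom_mult[OF hom] .
lemma S_carr: "s \<in> S \<Longrightarrow> s \<in> carrier M" using S.subset by blast

lemma fraction_setting: "fraction_setting M S"
  by (intro fraction_setting.intro fraction_setting_axioms.intro comm_monoid_dom submonoid)

lemma unit_cancel:
  assumes "u \<in> Units M'" "x \<in> carrier M'" "y \<in> carrier M'" "u \<otimes>\<^bsub>M'\<^esub> x = u \<otimes>\<^bsub>M'\<^esub> y"
  shows "x = y"
  using assms by (metis M'.Units_l_cancel)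

lemma fr_ex: "y \<in> carrier M' \<Longrightarrow> \<exists>m n. (m, n) \<in> fr y"
  using surj[of y] by (auto simp: fr_def)

text \<open>Cross multiplication in \<open>M'\<close> loses nothing because denominators become
  units; the resulting equation between images is pulled back to \<open>M\<close> by
  \<open>ker\<close>, and in the other direction the unit \<open>h u\<close> cancels.\<close>

lemma fr_eq:
  assumes y: "y \<in> carrier M'" and m: "(m, n) \<in> fr y"
  shows "fr y = fraction M S m n"
proof -
  have mn: "m \<in> carrier M" "n \<in> S" "h n \<otimes>\<^bsub>M'\<^esub> y = h m" using m by (auto simp: fr_def)
  have nc: "n \<in> carrier M" by (rule S_carr[OF mn(2)])
  note hn = h_carr[OF nc] units[OF mn(2)]
  have "h n' \<otimes>\<^bsub>M'\<^esub> y = h m' \<longleftrightarrow> (\<exists>u\<in>S. u \<otimes>\<^bsub>M\<^esub> (m \<otimes>\<^bsub>M\<^esub> n') = u \<otimes>\<^bsub>M\<^esub> (m' \<otimes>\<^bsub>M\<^esub> n))"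
    if m': "m' \<in> carrier M" "n' \<in> S" for m' n'
  proof -
    have n'c: "n' \<in> carrier M" by (rule S_carr[OF m'(2)])
    note c = h_carr[OF m'(1)] h_carr[OF n'c]
    have "h n' \<otimes>\<^bsub>M'\<^esub> y = h m' \<longleftrightarrow> h n \<otimes>\<^bsub>M'\<^esub> (h n' \<otimes>\<^bsub>M'\<^esub> y) = h n \<otimes>\<^bsub>M'\<^esub> h m'"
      using unit_cancel[OF hn(2), of "h n' \<otimes>\<^bsub>M'\<^esub> y" "h m'"] c y by auto
    also have "h n \<otimes>\<^bsub>M'\<^esub> (h n' \<otimes>\<^bsub>M'\<^esub> y) = h n' \<otimes>\<^bsub>M'\<^esub> (h n \<otimes>\<^bsub>M'\<^esub> y)"
      using hn(1) c y by (simp add: M'.m_ac)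
    also have "\<dots> = h (m \<otimes>\<^bsub>M\<^esub> n')"
      unfolding mn(3) h_prod[OF mn(1) n'c] using c h_carr[OF mn(1)] by (simp add: M'.m_comm)
    also have "h n \<otimes>\<^bsub>M'\<^esub> h m' = h (m' \<otimes>\<^bsub>M\<^esub> n)"
      unfolding h_prod[OF m'(1) nc] using c hn(1) by (simp add: M'.m_comm)
    also have "h (m \<otimes>\<^bsub>M\<^esub> n') = h (m' \<otimes>\<^bsub>M\<^esub> n) \<longleftrightarrow>
        (\<exists>u\<in>S. u \<otimes>\<^bsub>M\<^esub> (m \<otimes>\<^bsub>M\<^esub> n') = u \<otimes>\<^bsub>M\<^esub> (m' \<otimes>\<^bsub>M\<^esub> n))"
    proof
      assume "h (m \<otimes>\<^bsub>M\<^esub> n') = h (m' \<otimes>\<^bsub>M\<^esub> n)"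
      then show "\<exists>u\<in>S. u \<otimes>\<^bsub>M\<^esub> (m \<otimes>\<^bsub>M\<^esub> n') = u \<otimes>\<^bsub>M\<^esub> (m' \<otimes>\<^bsub>M\<^esub> n)"
        using ker[of "m \<otimes>\<^bsub>M\<^esub> n'" "m' \<otimes>\<^bsub>M\<^esub> n"] mn(1) n'c m'(1) nc by simp
    next
      assume "\<exists>u\<in>S. u \<otimes>\<^bsub>M\<^esub> (m \<otimes>\<^bsub>M\<^esub> n') = u \<otimes>\<^bsub>M\<^esub> (m' \<otimes>\<^bsub>M\<^esub> n)"
      then obtain u where u: "u \<in> S" "u \<otimes>\<^bsub>M\<^esub> (m \<otimes>\<^bsub>M\<^esub> n') = u \<otimes>\<^bsub>M\<^esub> (m' \<otimes>\<^bsub>M\<^esub> n)" by (elim bexE) (rule that)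
      have cc: "m \<otimes>\<^bsub>M\<^esub> n' \<in> carrier M" "m' \<otimes>\<^bsub>M\<^esub> n \<in> carrier M" using mn(1) n'c m'(1) nc by auto
      have "h u \<otimes>\<^bsub>M'\<^esub> h (m \<otimes>\<^bsub>M\<^esub> n') = h u \<otimes>\<^bsub>M'\<^esub> h (m' \<otimes>\<^bsub>M\<^esub> n)"
        unfolding h_prod[OF S_carr[OF u(1)] cc(1), symmetric] h_prod[OF S_carr[OF u(1)] cc(2), symmetric] u(2) ..
      then show "h (m \<otimes>\<^bsub>M\<^esub> n') = h (m' \<otimes>\<^bsub>M\<^esub> n)"
        by (rule unit_cancel[OF units[OF u(1)] h_carr[OF cc(1)] h_carr[OF cc(2)]])
    qed
    finally show ?thesis .
  qed
  then show ?thesis unfolding fr_def fraction_def by auto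
qed

lemma fr_inj:
  assumes y: "y \<in> carrier M'" "y' \<in> carrier M'" and eq: "fr y = fr y'"
  shows "y = y'"
proof -
  obtain m n where mn: "(m, n) \<in> fr y" using fr_ex[OF y(1)] by (elim exE) (rule that)
  then have "(m, n) \<in> fr y'" using eq by simp
  with mn have "n \<in> S" "h n \<otimes>\<^bsub>M'\<^esub> y = h n \<otimes>\<^bsub>M'\<^esub> y'" by (auto simp: fr_def)
  then show ?thesis using unit_cancel[OF units y] by blast
qed

lemma fr_surj:
  assumes "m \<in> carrier M" "n \<in> S"
  shows "\<exists>y\<in>carrier M'. (m, n) \<in> fr y"
proof -
  note u = units[OF assms(2)]
  have c: "inv\<^bsub>M'\<^esub> h n \<otimes>\<^bsub>M'\<^esub> h m \<in> carrier M'" using u h_carr[OF assms(1)] by simp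
  have "h n \<otimes>\<^bsub>M'\<^esub> (inv\<^bsub>M'\<^esub> h n \<otimes>\<^bsub>M'\<^esub> h m) = h m"
    using u h_carr[OF assms(1)] by (simp add: M'.m_assoc[symmetric] M'.Units_closed)
  then show ?thesis using assms c by (intro bexI[of _ "inv\<^bsub>M'\<^esub> h n \<otimes>\<^bsub>M'\<^esub> h m"]) (simp_all add: fr_def)
qed

lemma fr_mult:
  assumes y: "y \<in> carrier M'" "y' \<in> carrier M'"
  shows "fraction_mult M S (fr y) (fr y') = fr (y \<otimes>\<^bsub>M'\<^esub> y')"
proof -
  obtain m n where 1: "(m, n) \<in> fr y" using fr_ex[OF y(1)] by (elim exE) (rule that)
  obtain m' n' where 2: "(m', n') \<in> fr y'" using fr_ex[OF y(2)] by (elim exE) (rule that)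
  have mn: "m \<in> carrier M" "n \<in> S" "h n \<otimes>\<^bsub>M'\<^esub> y = h m" "m' \<in> carrier M" "n' \<in> S" "h n' \<otimes>\<^bsub>M'\<^esub> y' = h m'"
    using 1 2 by (auto simp: fr_def)
  note c = S_carr[OF mn(2)] S_carr[OF mn(5)]
  have "h (n \<otimes>\<^bsub>M\<^esub> n') \<otimes>\<^bsub>M'\<^esub> (y \<otimes>\<^bsub>M'\<^esub> y') = (h n \<otimes>\<^bsub>M'\<^esub> y) \<otimes>\<^bsub>M'\<^esub> (h n' \<otimes>\<^bsub>M'\<^esub> y')"
    unfolding h_prod[OF c] using h_carr[OF c(1)] h_carr[OF c(2)] y by (simp add: M'.m_ac)
  also have "\<dots> = h (m \<otimes>\<^bsub>M\<^esub> m')" unfolding mn(3,6) h_prod[OF mn(1,4)] ..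
  finally have "(m \<otimes>\<^bsub>M\<^esub> m', n \<otimes>\<^bsub>M\<^esub> n') \<in> fr (y \<otimes>\<^bsub>M'\<^esub> y')"
    unfolding fr_def using mn S.m_closed[OF mn(2,5)] by simp
  then show ?thesis
    unfolding fr_eq[OF y(1) 1] fr_eq[OF y(2) 2]
    using fr_eq[of "y \<otimes>\<^bsub>M'\<^esub> y'"] fraction_setting.fraction_mult_fraction[OF fraction_setting mn(1,4,2,5)] y by simp
qed

end

text \<open>Elements and equations of \<open>M\<close> can be pulled back to \<open>A\<close> by
  clearing denominators, and there the properties of \<open>\<kappa>\<close> apply. The set inverted
  is saturated, so that it can be described by \<open>\<rho>\<close> without mentioning
  \<open>A\<close>.\<close>

lemma localisation_tower:
  assumes \<iota>: "localisation_hom A M \<iota> SA" and \<kappa>: "localisation_hom A N \<kappa> SB" and sub: "SA \<subseteq> SB"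
    and \<rho>: "\<rho> \<in> hom M N" "\<rho> \<one>\<^bsub>M\<^esub> = \<one>\<^bsub>N\<^esub>" "\<And>a. a \<in> carrier A \<Longrightarrow> \<rho> (\<iota> a) = \<kappa> a"
  shows "localisation_hom M N \<rho> {b \<in> carrier M. \<rho> b \<in> Units N}"
proof -
  interpret \<iota>: localisation_hom A M \<iota> SA by fact
  interpret \<kappa>: localisation_hom A N \<kappa> SB by fact
  interpret A: comm_monoid A by (rule \<iota>.comm_monoid_dom)
  interpret M: comm_monoid M by (rule \<iota>.comm_monoid_cod)
  interpret N: comm_monoid N by (rule \<kappa>.comm_monoid_cod)
  have rc: "\<rho> m \<in> carrier N" if "m \<in> carrier M" for m using \<rho>(1) that by (auto simp: hom_def)
  show ?thesis
  proof (rule localisation_hom.intro)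
    show "comm_monoid M" "comm_monoid N" by (rule \<iota>.comm_monoid_cod, rule \<kappa>.comm_monoid_cod)
    show "\<rho> \<in> hom M N" "\<rho> \<one>\<^bsub>M\<^esub> = \<one>\<^bsub>N\<^esub>" by fact+
    show "submonoid {b \<in> carrier M. \<rho> b \<in> Units N} M"
      by unfold_locales (auto simp: \<rho>(2) hom_mult[OF \<rho>(1)])
    show "\<rho> s \<in> Units N" if "s \<in> {b \<in> carrier M. \<rho> b \<in> Units N}" for s using that by simp
  next
    fix x assume "x \<in> carrier N"
    from \<kappa>.surj[OF this] obtain a b where ab: "a \<in> carrier A" "b \<in> SB" "\<kappa> b \<otimes>\<^bsub>N\<^esub> x = \<kappa> a"
      by (elim bexE) (rule that)
    have bc: "b \<in> carrier A" by (rule \<kappa>.S_carr[OF ab(2)])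
    show "\<exists>a\<in>carrier M. \<exists>b\<in>{b \<in> carrier M. \<rho> b \<in> Units N}. \<rho> b \<otimes>\<^bsub>N\<^esub> x = \<rho> a"
      by (rule bexI[of _ "\<iota> a"], rule bexI[of _ "\<iota> b"])
        (use ab bc \<kappa>.units[OF ab(2)] \<rho>(3) \<iota>.h_carr in auto)
  next
    fix m1 m2 assume m: "m1 \<in> carrier M" "m2 \<in> carrier M" "\<rho> m1 = \<rho> m2"
    from \<iota>.surj[OF m(1)] obtain a1 g1 where 1: "a1 \<in> carrier A" "g1 \<in> SA" "\<iota> g1 \<otimes>\<^bsub>M\<^esub> m1 = \<iota> a1" by (elim bexE) (rule that)
    from \<iota>.surj[OF m(2)] obtain a2 g2 where 2: "a2 \<in> carrier A" "g2 \<in> SA" "\<iota> g2 \<otimes>\<^bsub>M\<^esub> m2 = \<iota> a2" by (elim bexE) (rule that)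
    note g = \<iota>.S_carr[OF 1(2)] \<iota>.S_carr[OF 2(2)]
    have k: "\<kappa> g1 \<otimes>\<^bsub>N\<^esub> \<rho> m1 = \<kappa> a1" "\<kappa> g2 \<otimes>\<^bsub>N\<^esub> \<rho> m1 = \<kappa> a2"
      using arg_cong[OF 1(3), of \<rho>] arg_cong[OF 2(3), of \<rho>] hom_mult[OF \<rho>(1) \<iota>.h_carr[OF g(1)] m(1)]
        hom_mult[OF \<rho>(1) \<iota>.h_carr[OF g(2)] m(2)] \<rho>(3) g 1(1) 2(1) m(3) by simp_all
    have "\<kappa> (g2 \<otimes>\<^bsub>A\<^esub> a1) = \<kappa> g2 \<otimes>\<^bsub>N\<^esub> (\<kappa> g1 \<otimes>\<^bsub>N\<^esub> \<rho> m1)" unfolding k \<kappa>.h_prod[OF g(2) 1(1)] ..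
    also have "\<dots> = \<kappa> g1 \<otimes>\<^bsub>N\<^esub> (\<kappa> g2 \<otimes>\<^bsub>N\<^esub> \<rho> m1)"
      using \<kappa>.h_carr[OF g(1)] \<kappa>.h_carr[OF g(2)] rc[OF m(1)] by (simp add: N.m_ac)
    also have "\<dots> = \<kappa> (g1 \<otimes>\<^bsub>A\<^esub> a2)" unfolding k \<kappa>.h_prod[OF g(1) 2(1)] ..
    finally obtain u where u: "u \<in> SB" "u \<otimes>\<^bsub>A\<^esub> (g2 \<otimes>\<^bsub>A\<^esub> a1) = u \<otimes>\<^bsub>A\<^esub> (g1 \<otimes>\<^bsub>A\<^esub> a2)"
      using \<kappa>.ker[of "g2 \<otimes>\<^bsub>A\<^esub> a1" "g1 \<otimes>\<^bsub>A\<^esub> a2"] g 1(1) 2(1) by auto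
    have uc: "u \<in> carrier A" by (rule \<kappa>.S_carr[OF u(1)])
    note I = \<iota>.h_carr[OF g(1)] \<iota>.h_carr[OF g(2)] \<iota>.h_carr[OF uc] \<iota>.h_carr[OF 1(1)] \<iota>.h_carr[OF 2(1)]
    \<comment> \<open>\<open>g1\<close> and \<open>g2\<close> clear the denominators of
      \<open>m1\<close> and \<open>m2\<close>, and \<open>u\<close> identifies the resulting
      numerators.\<close>
    let ?b = "\<iota> (u \<otimes>\<^bsub>A\<^esub> (g1 \<otimes>\<^bsub>A\<^esub> g2))"
    have b: "?b = \<iota> u \<otimes>\<^bsub>M\<^esub> (\<iota> g1 \<otimes>\<^bsub>M\<^esub> \<iota> g2)" using g uc by (simp add: \<iota>.h_prod)
    have "?b \<otimes>\<^bsub>M\<^esub> m1 = \<iota> u \<otimes>\<^bsub>M\<^esub> (\<iota> g2 \<otimes>\<^bsub>M\<^esub> (\<iota> g1 \<otimes>\<^bsub>M\<^esub> m1))" unfolding b using I m(1) by (simp add: M.m_ac)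
    also have "\<dots> = \<iota> (u \<otimes>\<^bsub>A\<^esub> (g2 \<otimes>\<^bsub>A\<^esub> a1))" unfolding 1(3) using g uc 1(1) by (simp add: \<iota>.h_prod)
    also have "\<dots> = \<iota> u \<otimes>\<^bsub>M\<^esub> (\<iota> g1 \<otimes>\<^bsub>M\<^esub> (\<iota> g2 \<otimes>\<^bsub>M\<^esub> m2))" unfolding u(2) 2(3) using g uc 2(1) by (simp add: \<iota>.h_prod)
    also have "\<dots> = ?b \<otimes>\<^bsub>M\<^esub> m2" unfolding b using I m(2) by (simp add: M.m_ac)
    finally have eq: "?b \<otimes>\<^bsub>M\<^esub> m1 = ?b \<otimes>\<^bsub>M\<^esub> m2" .
    have "u \<otimes>\<^bsub>A\<^esub> (g1 \<otimes>\<^bsub>A\<^esub> g2) \<in> SB"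
      using submonoid.m_closed[OF \<kappa>.submonoid u(1) submonoid.m_closed[OF \<kappa>.submonoid]] 1(2) 2(2) sub by blast
    then have "?b \<in> {b \<in> carrier M. \<rho> b \<in> Units N}"
      using \<kappa>.units \<rho>(3)[of "u \<otimes>\<^bsub>A\<^esub> (g1 \<otimes>\<^bsub>A\<^esub> g2)"] \<iota>.h_carr uc g by simp
    with eq show "\<exists>b\<in>{b \<in> carrier M. \<rho> b \<in> Units N}. b \<otimes>\<^bsub>M\<^esub> m1 = b \<otimes>\<^bsub>M\<^esub> m2" by (rule bexI[of _ ?b])
  qed
qed

section \<open>Primes of the monoid of sections over \<open>W P\<close>\<close>

context chart
begin

text \<open>The saturated set of denominators for passing from \<open>G P\<close> to
  \<open>G Q\<close>. Its complement \<open>pm P Q\<close> is the prime of \<open>G P\<close> that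
  corresponds to \<open>Q\<close>.\<close>

definition Su where "Su P Q = {b \<in> carrier (G P). rs P Q b \<in> Units (G Q)}"
definition pm where "pm P Q = carrier (G P) - Su P Q"

lemma rs_localisation:
  assumes "P \<in> Sp" "Q \<in> Sp" "Q \<subseteq> P"
  shows "localisation_hom (G P) (G Q) (rs P Q) (Su P Q)"
  unfolding Su_def
  by (rule localisation_tower[OF \<iota>_localisation[OF assms(1)] \<iota>_localisation[OF assms(2)]])
    (use assms(3) rs_hom \<iota>_restr in auto)

text \<open>As \<open>g\<close> is outside \<open>P\<close>, and so outside \<open>Q\<close>, its
  image \<open>\<iota> Q g\<close> is a unit; \<open>m\<close> and its numerator \<open>a\<close>
  therefore become units on \<open>W Q\<close> together.\<close>

lemma Su_iff:
  assumes PQ: "P \<in> Sp" "Q \<in> Sp" "Q \<subseteq> P" and m: "m \<in> carrier (G P)" and a: "a \<in> carrier A" and g: "g \<in> carrier A - P"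
    and eq: "\<iota> P g \<otimes>\<^bsub>G P\<^esub> m = \<iota> P a"
  shows "m \<in> Su P Q \<longleftrightarrow> a \<notin> Q"
proof -
  interpret Q: comm_monoid "G Q" by (rule G_monoid)
  have gc: "g \<in> carrier A" "g \<notin> Q" using g PQ(3) by auto
  have rm: "rs P Q m \<in> carrier (G Q)" using rs_hom(1)[OF PQ(3)] m by (auto simp: hom_def)
  have e: "\<iota> Q g \<otimes>\<^bsub>G Q\<^esub> rs P Q m = \<iota> Q a"
    using arg_cong[OF eq, of "rs P Q"] hom_mult[OF rs_hom(1)[OF PQ(3)] \<iota>_closed[OF gc(1)] m]
      \<iota>_restr[OF PQ(3) gc(1)] \<iota>_restr[OF PQ(3) a] by simp
  have u: "\<iota> Q g \<in> Units (G Q)" using \<iota>_unit_iff[OF PQ(2) gc(1)] gc(2) by simp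
  have "rs P Q m \<in> Units (G Q) \<longleftrightarrow> \<iota> Q a \<in> Units (G Q)"
  proof
    assume "rs P Q m \<in> Units (G Q)"
    then show "\<iota> Q a \<in> Units (G Q)" unfolding e[symmetric] using u by simp
  next
    assume "\<iota> Q a \<in> Units (G Q)"
    then have "rs P Q m \<otimes>\<^bsub>G Q\<^esub> \<iota> Q g \<in> Units (G Q)" using e Q.m_comm[OF rm \<iota>_closed[OF gc(1), of Q]] by simp
    then show "rs P Q m \<in> Units (G Q)" using Q.unit_factor[OF _ rm \<iota>_closed[OF gc(1), of Q]] by simp
  qed
  then show ?thesis using m \<iota>_unit_iff[OF PQ(2) a] by (simp add: Su_def)
qed

lemma Su_\<iota>: "P \<in> Sp \<Longrightarrow> Q \<in> Sp \<Longrightarrow> Q \<subseteq> P \<Longrightarrow> a \<in> carrier A \<Longrightarrow> \<iota> P a \<in> Su P Q \<longleftrightarrow> a \<notin> Q"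
  using \<iota>_unit_iff[of Q a] \<iota>_restr[of Q P a] \<iota>_closed[of a P] by (simp add: Su_def)

lemma pm_iff:
  assumes PQ: "P \<in> Sp" "Q \<in> Sp" "Q \<subseteq> P" and m: "m \<in> carrier (G P)" and a: "a \<in> carrier A" and g: "g \<in> carrier A - P"
    and eq: "\<iota> P g \<otimes>\<^bsub>G P\<^esub> m = \<iota> P a"
  shows "m \<in> pm P Q \<longleftrightarrow> a \<in> Q"
  using Su_iff[OF assms] m by (simp add: pm_def)

lemma pm_prime:
  assumes PQ: "P \<in> Sp" "Q \<in> Sp" "Q \<subseteq> P"
  shows "monoid_prime (pm P Q) (G P)"
proof -
  interpret P: comm_monoid "G P" by (rule G_monoid)
  interpret Q: comm_monoid "G Q" by (rule G_monoid)
  interpret L: localisation_hom "G P" "G Q" "rs P Q" "Su P Q" by (rule rs_localisation[OF assms])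
  have "carrier (G P) - pm P Q = Su P Q" by (auto simp: pm_def Su_def)
  then have "submonoid (carrier (G P) - pm P Q) (G P)" using L.submonoid by simp
  moreover have "monoid_ideal (pm P Q) (G P)"
    unfolding monoid_ideal_def
  proof (intro conjI ballI)
    fix a x assume ax: "a \<in> carrier (G P)" "x \<in> pm P Q"
    then have x: "x \<in> carrier (G P)" "x \<notin> Su P Q" by (auto simp: pm_def)
    have "a \<otimes>\<^bsub>G P\<^esub> x \<notin> Su P Q"
    proof
      assume "a \<otimes>\<^bsub>G P\<^esub> x \<in> Su P Q"
      then have "rs P Q x \<otimes>\<^bsub>G Q\<^esub> rs P Q a \<in> Units (G Q)"
        using L.h_prod[OF ax(1) x(1)] Q.m_comm[OF L.h_carr[OF x(1)] L.h_carr[OF ax(1)]] by (simp add: Su_def)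
      then have "rs P Q x \<in> Units (G Q)" using Q.unit_factor[OF _ L.h_carr[OF x(1)] L.h_carr[OF ax(1)]] by simp
      then show False using x by (simp add: Su_def)
    qed
    then show "a \<otimes>\<^bsub>G P\<^esub> x \<in> pm P Q" using ax(1) x(1) by (simp add: pm_def)
  qed (auto simp: pm_def)
  ultimately show ?thesis by (simp add: monoid_prime_def)
qed

lemma pm_\<iota>: "P \<in> Sp \<Longrightarrow> Q \<in> Sp \<Longrightarrow> Q \<subseteq> P \<Longrightarrow> a \<in> carrier A \<Longrightarrow> \<iota> P a \<in> pm P Q \<longleftrightarrow> a \<in> Q"
  using Su_\<iota>[of P Q a] \<iota>_closed[of a P] by (simp add: pm_def)

lemma prime_carrier: "Q \<in> Sp \<Longrightarrow> Q \<subseteq> carrier A"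
  by (simp add: monoid_prime_def monoid_ideal_def)

text \<open>Numerators decide membership on both sides, so \<open>pm P\<close> is an embedding of
  orders, and \<open>qof_prime\<close> will show that it reaches every prime of \<open>G P\<close>.
  Since the topologies are those of inclusion, this amounts to a homeomorphism.\<close>

lemma pm_subset_iff:
  assumes P: "P \<in> Sp" and Q: "Q \<in> Sp" "Q \<subseteq> P" and Q': "Q' \<in> Sp" "Q' \<subseteq> P"
  shows "pm P Q \<subseteq> pm P Q' \<longleftrightarrow> Q \<subseteq> Q'"
proof
  assume s: "pm P Q \<subseteq> pm P Q'"
  show "Q \<subseteq> Q'"
  proof
    fix a assume a: "a \<in> Q"
    then have ac: "a \<in> carrier A" using prime_carrier[OF Q(1)] by blast
    have "\<iota> P a \<in> pm P Q'" using subsetD[OF s] pm_\<iota>[OF P Q ac] a by simp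
    then show "a \<in> Q'" using pm_\<iota>[OF P Q' ac] by simp
  qed
next
  assume s: "Q \<subseteq> Q'"
  show "pm P Q \<subseteq> pm P Q'"
  proof
    fix m assume m: "m \<in> pm P Q"
    then have mc: "m \<in> carrier (G P)" by (simp add: pm_def)
    from \<iota>_surj[OF P mc] obtain a g where ag: "a \<in> carrier A" "g \<in> carrier A - P" "\<iota> P g \<otimes>\<^bsub>G P\<^esub> m = \<iota> P a"
      by (elim bexE) (rule that)
    show "m \<in> pm P Q'" using pm_iff[OF P Q mc ag] pm_iff[OF P Q' mc ag] m s by auto
  qed
qed

definition qof where "qof P \<pp> = {a \<in> carrier A. \<iota> P a \<in> \<pp>}"

lemma qof_pm: "P \<in> Sp \<Longrightarrow> Q \<in> Sp \<Longrightarrow> Q \<subseteq> P \<Longrightarrow> qof P (pm P Q) = Q"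
  using pm_\<iota>[of P Q] prime_carrier[of Q] by (auto simp: qof_def)

text \<open>The contraction lies inside \<open>P\<close> because everything outside \<open>P\<close>
  maps to units. Expanding it again returns the original prime: an element of \<open>G P\<close>
  differs from its numerator only by the unit \<open>\<iota> P g\<close>.\<close>

lemma qof_prime:
  assumes P: "P \<in> Sp" and p: "monoid_prime \<pp> (G P)"
  shows "qof P \<pp> \<in> Sp" "qof P \<pp> \<subseteq> P" "pm P (qof P \<pp>) = \<pp>"
proof -
  interpret P: comm_monoid "G P" by (rule G_monoid)
  interpret B: spectrum "G P" "{\<pp>. monoid_prime \<pp> (G P)}" "monoid_zariski (G P)" by (rule spectrum_monoid[OF G_monoid])
  have pp: "\<pp> \<in> {\<pp>. monoid_prime \<pp> (G P)}" using p by simp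
  have m: "\<iota> P (a \<otimes>\<^bsub>A\<^esub> b) \<in> \<pp> \<longleftrightarrow> \<iota> P a \<in> \<pp> \<or> \<iota> P b \<in> \<pp>" if "a \<in> carrier A" "b \<in> carrier A" for a b
    using B.prime_mult[OF pp \<iota>_closed \<iota>_closed] \<iota>_mult that by simp
  have "submonoid (carrier A - qof P \<pp>) A"
    by unfold_locales (auto simp: qof_def m \<iota>_one[OF P] B.prime_one[OF pp])
  moreover have "monoid_ideal (qof P \<pp>) A"
    unfolding monoid_ideal_def by (auto simp: qof_def m)
  ultimately show Q: "qof P \<pp> \<in> Sp" by (simp add: monoid_prime_def)
  show sub: "qof P \<pp> \<subseteq> P"
    using \<iota>_unit_iff[OF P] B.prime_unit[OF pp] by (auto simp: qof_def)
  have key: "x \<in> pm P (qof P \<pp>) \<longleftrightarrow> x \<in> \<pp>" if x: "x \<in> carrier (G P)" for x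
  proof -
    from \<iota>_surj[OF P x] obtain a g where ag: "a \<in> carrier A" "g \<in> carrier A - P" "\<iota> P g \<otimes>\<^bsub>G P\<^esub> x = \<iota> P a"
      by (elim bexE) (rule that)
    have "\<iota> P g \<notin> \<pp>" using \<iota>_unit_iff[OF P, of g] B.prime_unit[OF pp] ag(2) by auto
    then have "x \<in> \<pp> \<longleftrightarrow> \<iota> P a \<in> \<pp>" using B.prime_mult[OF pp \<iota>_closed[of g P] x] ag by simp
    then show ?thesis using pm_iff[OF P Q sub x ag] ag(1) by (simp add: qof_def)
  qed
  have "\<pp> \<subseteq> carrier (G P)" using p by (simp add: monoid_prime_def monoid_ideal_def)
  then show "pm P (qof P \<pp>) = \<pp>" using key by (auto simp: pm_def)
qed

text \<open>The least neighbourhood is found in \<open>A\<close>, where finite generation is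
  available, and carried to \<open>G P\<close> along \<open>\<iota> P\<close>.\<close>

lemma Su_generator:
  assumes PQ: "P \<in> Sp" "Q \<in> Sp" "Q \<subseteq> P"
  shows "\<exists>g\<in>Su P Q. \<forall>\<pp>. monoid_prime \<pp> (G P) \<and> g \<notin> \<pp> \<longrightarrow> \<pp> \<subseteq> pm P Q"
proof -
  from prime_generator[OF PQ(2)] obtain g where g: "g \<in> carrier A - Q" "\<forall>Q'\<in>Sp. g \<notin> Q' \<longrightarrow> Q' \<subseteq> Q"
    by (elim bexE) (rule that)
  show ?thesis
  proof (intro bexI[of _ "\<iota> P g"] allI impI; (elim conjE)?)
    show "\<iota> P g \<in> Su P Q" using Su_\<iota>[OF PQ, of g] g(1) by simp
    fix \<pp> assume p: "monoid_prime \<pp> (G P)" "\<iota> P g \<notin> \<pp>"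
    note q = qof_prime[OF PQ(1) p(1)]
    have "g \<notin> qof P \<pp>" using p(2) by (simp add: qof_def)
    then have "qof P \<pp> \<subseteq> Q" using g(2) q(1) by simp
    then show "\<pp> \<subseteq> pm P Q" using pm_subset_iff[OF PQ(1) q(1,2) PQ(2,3)] q(3) by simp
  qed
qed

end

subsection \<open>Basic opens of a chart are affine\<close>

text \<open>The maps of an isomorphism of spaces run from sections of the spectrum to sections of
  \<open>X\<close>, against the direction in which the comparison map \<open>Psi\<close> will be
  constructed.\<close>

lemma (in comm_monoid) iso_inv_into:
  assumes g: "g \<in> carrier G \<rightarrow> carrier H" "\<And>x y. x \<in> carrier G \<Longrightarrow> y \<in> carrier G \<Longrightarrow> g (x \<otimes> y) = g x \<otimes>\<^bsub>H\<^esub> g y"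
    and b: "bij_betw g (carrier G) (carrier H)"
  shows "inv_into (carrier G) g \<in> Group.iso H G"
proof -
  let ?k = "inv_into (carrier G) g"
  have bk: "bij_betw ?k (carrier H) (carrier G)" by (rule bij_betw_inv_into[OF b])
  have "?k (x \<otimes>\<^bsub>H\<^esub> y) = ?k x \<otimes> ?k y" if xy: "x \<in> carrier H" "y \<in> carrier H" for x y
  proof -
    have k: "?k x \<in> carrier G" "?k y \<in> carrier G" using bij_betwE[OF bk] xy by auto
    have "g (?k x \<otimes> ?k y) = x \<otimes>\<^bsub>H\<^esub> y"
      using g(2)[OF k] bij_betw_inv_into_right[OF b] xy by simp
    then show ?thesis using bij_betw_inv_into_left[OF b m_closed[OF k]] by simp
  qed
  then show ?thesis using bk bij_betwE[OF bk] by (auto simp: Group.iso_def hom_def)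
qed

text \<open>The aim is to show that \<open>W P\<close> is affine. Fractions of \<open>A\<close> live
  on another type, while \<open>affine_open\<close> asks for a monoid on the type of sections;
  \<open>G P\<close> is a copy of the localisation of \<open>A\<close> at \<open>P\<close> on that
  type.\<close>

locale chart_open = chart X U0 A f \<phi> for X :: "('p, 'm) monoidal_space" and U0 A f \<phi> +
  fixes P
  assumes P: "P \<in> Sp"
begin

abbreviation M where "M \<equiv> G P"
abbreviation Sm where "Sm \<equiv> {\<pp>. monoid_prime \<pp> M}"
abbreviation q where "q \<equiv> qof P"
abbreviation \<rho> where "\<rho> \<pp> \<equiv> rs P (q \<pp>)"

sublocale B: spectrum "sect X (W P)" "{\<pp>. monoid_prime \<pp> (sect X (W P))}" "monoid_zariski (sect X (W P))"
  by (rule spectrum_monoid[OF G_monoid])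

definition F where "F x = pm P (f x)"
definition T where "T V = {x \<in> W P. F x \<in> V}"

lemma q_prime: "\<pp> \<in> Sm \<Longrightarrow> q \<pp> \<in> Sp" "\<pp> \<in> Sm \<Longrightarrow> q \<pp> \<subseteq> P" "\<pp> \<in> Sm \<Longrightarrow> pm P (q \<pp>) = \<pp>"
  using qof_prime[OF P] by auto

lemma q_mono: "\<pp> \<in> Sm \<Longrightarrow> \<pp>' \<in> Sm \<Longrightarrow> q \<pp> \<subseteq> q \<pp>' \<longleftrightarrow> \<pp> \<subseteq> \<pp>'"
  using pm_subset_iff[OF P q_prime(1,2) q_prime(1,2), of \<pp> \<pp>'] q_prime(3)[of \<pp>] q_prime(3)[of \<pp>'] by simp

lemma M_generator: "\<pp> \<in> Sm \<Longrightarrow> \<exists>g\<in>carrier M - \<pp>. \<forall>\<pp>'\<in>Sm. g \<notin> \<pp>' \<longrightarrow> \<pp>' \<subseteq> \<pp>"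
proof -
  assume p: "\<pp> \<in> Sm"
  from Su_generator[OF P q_prime(1,2)[OF p]] obtain g where g: "g \<in> Su P (q \<pp>)"
    "\<forall>\<pp>'. monoid_prime \<pp>' M \<and> g \<notin> \<pp>' \<longrightarrow> \<pp>' \<subseteq> pm P (q \<pp>)" by (elim bexE) (rule that)
  have "Su P (q \<pp>) = carrier M - \<pp>" using q_prime(3)[OF p] by (auto simp: pm_def Su_def)
  then show ?thesis using g q_prime(3)[OF p] by (intro bexI[of _ g]) auto
qed

lemma openin_M: "openin (monoid_zariski M) V \<longleftrightarrow> V \<subseteq> Sm \<and> (\<forall>\<pp>\<in>V. \<forall>\<pp>'\<in>Sm. \<pp>' \<subseteq> \<pp> \<longrightarrow> \<pp>' \<in> V)"
  by (rule B.openin_iff_down_closed[OF M_generator])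

lemma f_in_P: "x \<in> W P \<Longrightarrow> f x \<in> Sp" "x \<in> W P \<Longrightarrow> f x \<subseteq> P"
  using f_prime by (auto simp: W_def)

lemma F_prime: "x \<in> W P \<Longrightarrow> F x \<in> Sm"
  using pm_prime[OF P f_in_P] by (simp add: F_def)

lemma q_F: "x \<in> W P \<Longrightarrow> q (F x) = f x"
  using qof_pm[OF P f_in_P] by (simp add: F_def)

lemma F_bij: "bij_betw F (W P) Sm"
proof (rule bij_betwI')
  fix x y assume xy: "x \<in> W P" "y \<in> W P"
  have "x = y" if "F x = F y"
  proof -
    have "f x = f y" using q_F[OF xy(1)] q_F[OF xy(2)] that by simp
    then show ?thesis using inj_on_eq_iff[OF bij_betw_imp_inj_on[OF f_bij]] xy W_subset by blast
  qed
  then show "(F x = F y) = (x = y)" by auto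
next
  fix \<pp> assume p: "\<pp> \<in> Sm"
  have "q \<pp> \<in> Od P" using q_prime[OF p] by (simp add: Od_def)
  then obtain x where "x \<in> W P" "f x = q \<pp>" using f_image_W by (metis imageE)
  then show "\<exists>x\<in>W P. \<pp> = F x" using q_prime(3)[OF p] by (intro bexI[of _ x]) (simp_all add: F_def)
qed (rule F_prime)

lemma W_q_subset: "openin (monoid_zariski M) V \<Longrightarrow> \<pp> \<in> V \<Longrightarrow> W (q \<pp>) \<subseteq> T V"
proof
  fix y assume V: "openin (monoid_zariski M) V" "\<pp> \<in> V" and y: "y \<in> W (q \<pp>)"
  have p: "\<pp> \<in> Sm" using V openin_M by blast
  have yP: "y \<in> W P" using y W_mono[OF q_prime(2)[OF p]] by blast
  have "q (F y) \<subseteq> q \<pp>" using y q_F[OF yP] by (simp add: W_def)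
  then have "F y \<subseteq> \<pp>" using q_mono[OF F_prime[OF yP] p] by simp
  then have "F y \<in> V" using V F_prime[OF yP] unfolding openin_M by auto
  then show "y \<in> T V" using yP by (simp add: T_def)
qed

text \<open>Every open set is the union of the least neighbourhoods of its points. This is the cover
  along which sections are compared and glued.\<close>

lemma T_Union: "openin (monoid_zariski M) V \<Longrightarrow> T V = \<Union>((\<lambda>\<pp>. W (q \<pp>)) ` V)"
proof (intro equalityI subsetI)
  fix y assume "y \<in> T V"
  then have y: "y \<in> W P" "F y \<in> V" by (auto simp: T_def)
  have "y \<in> W (q (F y))" using y(1) q_F[OF y(1)] by (simp add: W_def)
  then show "y \<in> \<Union>((\<lambda>\<pp>. W (q \<pp>)) ` V)" using y(2) by blast
qed (use W_q_subset in auto)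

lemma T_open: "openin (monoid_zariski M) V \<Longrightarrow> openin (topo X) (T V)"
  unfolding T_Union by (rule openin_Union) (use W_open in auto)

lemma T_mono: "V \<subseteq> V' \<Longrightarrow> T V \<subseteq> T V'" by (auto simp: T_def)

text \<open>On both sides an open set is one that is closed under passing to smaller primes, and
  \<open>F\<close> matches the two orders.\<close>

lemma F_homeo: "homeomorphic_map (subtopology (topo X) (W P)) (monoid_zariski M) F"
proof (rule bijective_open_imp_homeomorphic_map)
  have ts: "topspace (subtopology (topo X) (W P)) = W P" using openin_subset[OF W_open[of P]] by auto
  have im: "F ` W P = Sm" and inj: "inj_on F (W P)" using F_bij by (auto simp: bij_betw_def)
  show "F ` topspace (subtopology (topo X) (W P)) = topspace (monoid_zariski M)"
    unfolding ts B.topspace_eq by (rule im)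
  show "inj_on F (topspace (subtopology (topo X) (W P)))" unfolding ts by (rule inj)
  show "continuous_map (subtopology (topo X) (W P)) (monoid_zariski M) F"
    unfolding continuous_map_def ts B.topspace_eq
  proof (intro conjI allI impI)
    show "F \<in> W P \<rightarrow> Sm" using F_prime by auto
    fix V assume "openin (monoid_zariski M) V"
    then have "openin (topo X) (T V)" by (rule T_open)
    then show "openin (subtopology (topo X) (W P)) {x \<in> W P. F x \<in> V}"
      using openin_open_subtopology[OF W_open[of P], of "T V"] by (simp add: T_def)
  qed
  show "open_map (subtopology (topo X) (W P)) (monoid_zariski M) F"
    unfolding open_map_def
  proof (intro allI impI)
    fix U assume "openin (subtopology (topo X) (W P)) U"
    then have U: "openin (topo X) U" "U \<subseteq> W P" using openin_open_subtopology[OF W_open[of P], of U] by auto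
    show "openin (monoid_zariski M) (F ` U)"
      unfolding openin_M
    proof (intro conjI ballI impI)
      show "F ` U \<subseteq> Sm" using U(2) F_prime by auto
      fix \<pp> \<pp>' assume p: "\<pp> \<in> F ` U" "\<pp>' \<in> Sm" "\<pp>' \<subseteq> \<pp>"
      then obtain x where x: "x \<in> U" "\<pp> = F x" by auto
      obtain y where y: "y \<in> W P" "\<pp>' = F y" using p(2) im by (metis imageE)
      have xP: "x \<in> W P" using x(1) U(2) by blast
      have "f y \<subseteq> f x" using q_mono[OF p(2) F_prime[OF xP]] p(3) x y q_F[OF xP] q_F[OF y(1)] by simp
      then have "y \<in> W (f x)" using y(1) by (simp add: W_def)
      then have "y \<in> U" using W_min[OF U(1) x(1)] xP W_subset by blast
      then show "\<pp>' \<in> F ` U" using y(2) by simp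
    qed
  qed
qed

text \<open>Restriction to the least neighbourhood of a point is taking the germ there.\<close>

definition st where "st V t \<pp> = restr X (T V) (W (q \<pp>)) t"

abbreviation loc where "loc \<pp> \<equiv> localisation_hom.fr M (G (q \<pp>)) (\<rho> \<pp>) (carrier M - \<pp>)"

lemma \<rho>_localisation: "\<pp> \<in> Sm \<Longrightarrow> localisation_hom M (G (q \<pp>)) (\<rho> \<pp>) (carrier M - \<pp>)"
proof -
  assume p: "\<pp> \<in> Sm"
  have "Su P (q \<pp>) = carrier M - \<pp>" using q_prime(3)[OF p] by (auto simp: pm_def Su_def)
  then show ?thesis using rs_localisation[OF P q_prime(1,2)[OF p]] by simp
qed

lemma st_closed: "openin (monoid_zariski M) V \<Longrightarrow> \<pp> \<in> V \<Longrightarrow> t \<in> carrier (sect X (T V)) \<Longrightarrow> st V t \<pp> \<in> carrier (G (q \<pp>))"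
  unfolding st_def using restr_hom[OF T_open W_open W_q_subset] by (auto simp: hom_def Pi_iff)

lemma st_mult:
  assumes "openin (monoid_zariski M) V" "\<pp> \<in> V" "t \<in> carrier (sect X (T V))" "t' \<in> carrier (sect X (T V))"
  shows "st V (t \<otimes>\<^bsub>sect X (T V)\<^esub> t') \<pp> = st V t \<pp> \<otimes>\<^bsub>G (q \<pp>)\<^esub> st V t' \<pp>"
  unfolding st_def by (rule hom_mult[OF restr_hom[OF T_open[OF assms(1)] W_open W_q_subset[OF assms(1,2)]] assms(3,4)])

lemma rs_comp: "Q \<subseteq> Q' \<Longrightarrow> Q' \<subseteq> P \<Longrightarrow> m \<in> carrier M \<Longrightarrow> rs Q' Q (rs P Q' m) = rs P Q m"
  by (rule restr_comp[OF W_open W_open W_open W_mono W_mono])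

text \<open>A denominator outside \<open>\<pp>\<close> is outside every smaller prime, and the
  identity that expresses \<open>y\<close> as \<open>m / n\<close> survives restriction.\<close>

lemma rep_down:
  assumes p: "\<pp> \<in> Sm" "\<pp>' \<in> Sm" "\<pp>' \<subseteq> \<pp>" and y: "y \<in> carrier (G (q \<pp>))" and m: "(m, n) \<in> loc \<pp> y"
  shows "(m, n) \<in> loc \<pp>' (rs (q \<pp>) (q \<pp>') y)"
proof -
  interpret L: localisation_hom M "G (q \<pp>)" "\<rho> \<pp>" "carrier M - \<pp>" by (rule \<rho>_localisation[OF p(1)])
  interpret L': localisation_hom M "G (q \<pp>')" "\<rho> \<pp>'" "carrier M - \<pp>'" by (rule \<rho>_localisation[OF p(2)])
  have mn: "m \<in> carrier M" "n \<in> carrier M - \<pp>" "\<rho> \<pp> n \<otimes>\<^bsub>G (q \<pp>)\<^esub> y = \<rho> \<pp> m" using m by (auto simp: L.fr_def)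
  have sub: "q \<pp>' \<subseteq> q \<pp>" using q_mono[OF p(2,1)] p(3) by simp
  have nc: "n \<in> carrier M" using mn(2) by simp
  have "\<rho> \<pp>' n \<otimes>\<^bsub>G (q \<pp>')\<^esub> rs (q \<pp>) (q \<pp>') y = rs (q \<pp>) (q \<pp>') (\<rho> \<pp> n \<otimes>\<^bsub>G (q \<pp>)\<^esub> y)"
    using hom_mult[OF rs_hom(1)[OF sub] L.h_carr[OF nc] y] rs_comp[OF sub q_prime(2)[OF p(1)] nc] by simp
  also have "\<dots> = \<rho> \<pp>' m" unfolding mn(3) by (rule rs_comp[OF sub q_prime(2)[OF p(1)] mn(1)])
  finally show ?thesis using mn(1,2) p(3) by (auto simp: L'.fr_def)
qed

lemma st_restr:
  assumes "openin (monoid_zariski M) V" "\<pp> \<in> V" "\<pp>' \<in> V" "\<pp>' \<subseteq> \<pp>" "t \<in> carrier (sect X (T V))"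
  shows "rs (q \<pp>) (q \<pp>') (st V t \<pp>) = st V t \<pp>'"
proof -
  have "\<pp> \<in> Sm" "\<pp>' \<in> Sm" using assms(1-3) openin_M by blast+
  then have "q \<pp>' \<subseteq> q \<pp>" using q_mono assms(4) by simp
  then show ?thesis
    unfolding st_def by (intro restr_comp[OF T_open[OF assms(1)] W_open W_open W_mono W_q_subset[OF assms(1,2)] assms(5)])
qed

text \<open>The comparison map from sections of \<open>X\<close> to sections of the spectrum of
  \<open>M\<close>: at each prime the germ, written as a class of fractions. By
  \<open>rep_down\<close> the fraction found at one prime serves on its least neighbourhood, which
  gives the local form that sections must have.\<close>

definition Psi where "Psi V t = (\<lambda>\<pp>\<in>V. loc \<pp> (st V t \<pp>))"

lemma Psi_section:
  assumes V: "openin (monoid_zariski M) V" and t: "t \<in> carrier (sect X (T V))"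
  shows "Psi V t \<in> structure_sections M (monoid_zariski M) V"
proof (rule B.sectionI)
  show "Psi V t \<in> extensional V" by (simp add: Psi_def)
  fix \<pp> assume pV: "\<pp> \<in> V"
  then have p: "\<pp> \<in> Sm" using V openin_M by blast
  interpret L: localisation_hom M "G (q \<pp>)" "\<rho> \<pp>" "carrier M - \<pp>" by (rule \<rho>_localisation[OF p])
  note y = st_closed[OF V pV t]
  obtain m n where mn: "(m, n) \<in> L.fr (st V t \<pp>)" using L.fr_ex[OF y] by (elim exE) (rule that)
  have mnc: "m \<in> carrier M" "n \<in> carrier M" "n \<notin> \<pp>" using mn by (auto simp: L.fr_def)
  from M_generator[OF p] obtain g where g: "g \<in> carrier M - \<pp>" "\<forall>\<pp>'\<in>Sm. g \<notin> \<pp>' \<longrightarrow> \<pp>' \<subseteq> \<pp>" by (elim bexE) (rule that)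
  show "\<pp> \<in> Sm \<and> (\<exists>a\<in>carrier M. \<exists>b\<in>carrier M. \<exists>g\<in>carrier M. g \<notin> \<pp> \<and>
      (\<forall>Q\<in>Sm. g \<notin> Q \<longrightarrow> Q \<in> V \<and> b \<notin> Q \<and> Psi V t Q = fraction M (carrier M - Q) a b))"
  proof (rule conjI[OF p], rule bexI[of _ m], rule bexI[of _ n], rule bexI[of _ g], intro conjI ballI impI)
    fix \<pp>' assume p': "\<pp>' \<in> Sm" "g \<notin> \<pp>'"
    then have sub: "\<pp>' \<subseteq> \<pp>" using g(2) by simp
    show p'V: "\<pp>' \<in> V" using V pV p'(1) sub unfolding openin_M by blast
    show "n \<notin> \<pp>'" using mnc(3) sub by blast
    interpret L': localisation_hom M "G (q \<pp>')" "\<rho> \<pp>'" "carrier M - \<pp>'" by (rule \<rho>_localisation[OF p'(1)])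
    have "(m, n) \<in> loc \<pp>' (st V t \<pp>')"
      using rep_down[OF p p'(1) sub y mn] st_restr[OF V pV p'V sub t] by simp
    from L'.fr_eq[OF st_closed[OF V p'V t] this] show "Psi V t \<pp>' = fraction M (carrier M - \<pp>') m n"
      using p'V by (simp add: Psi_def)
  qed (use mnc g in auto)
qed

lemma Psi_mult:
  assumes V: "openin (monoid_zariski M) V" and t: "t \<in> carrier (sect X (T V))" "t' \<in> carrier (sect X (T V))"
  shows "Psi V (t \<otimes>\<^bsub>sect X (T V)\<^esub> t') = Psi V t \<otimes>\<^bsub>sect (monoid_spec M) V\<^esub> Psi V t'"
  unfolding monoid_spec_simps Psi_def[of V "t \<otimes>\<^bsub>sect X (T V)\<^esub> t'"]
proof (rule restrict_ext)
  fix \<pp> assume pV: "\<pp> \<in> V"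
  then have p: "\<pp> \<in> Sm" using V openin_M by blast
  interpret L: localisation_hom M "G (q \<pp>)" "\<rho> \<pp>" "carrier M - \<pp>" by (rule \<rho>_localisation[OF p])
  show "L.fr (st V (t \<otimes>\<^bsub>sect X (T V)\<^esub> t') \<pp>) = fraction_mult M (carrier M - \<pp>) (Psi V t \<pp>) (Psi V t' \<pp>)"
    using L.fr_mult[OF st_closed[OF V pV t(1)] st_closed[OF V pV t(2)]] st_mult[OF V pV t] pV by (simp add: Psi_def)
qed

text \<open>The germs at the points of \<open>V\<close> are the restrictions to the members of a
  cover, so they determine a section by the locality axiom.\<close>

lemma Psi_inj:
  assumes V: "openin (monoid_zariski M) V" and t: "t \<in> carrier (sect X (T V))" "t' \<in> carrier (sect X (T V))"
    and eq: "Psi V t = Psi V t'"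
  shows "t = t'"
proof -
  have st: "st V t \<pp> = st V t' \<pp>" if pV: "\<pp> \<in> V" for \<pp>
  proof -
    have p: "\<pp> \<in> Sm" using V openin_M pV by blast
    interpret L: localisation_hom M "G (q \<pp>)" "\<rho> \<pp>" "carrier M - \<pp>" by (rule \<rho>_localisation[OF p])
    show ?thesis
      using L.fr_inj[OF st_closed[OF V pV t(1)] st_closed[OF V pV t(2)]] fun_cong[OF eq, of \<pp>] pV by (simp add: Psi_def)
  qed
  show ?thesis
  proof (rule locality[of "(\<lambda>\<pp>. W (q \<pp>)) ` V"])
    show "\<forall>V\<in>(\<lambda>\<pp>. W (q \<pp>)) ` V. openin (topo X) V" using W_open by auto
    show "t \<in> carrier (sect X (\<Union>((\<lambda>\<pp>. W (q \<pp>)) ` V)))" "t' \<in> carrier (sect X (\<Union>((\<lambda>\<pp>. W (q \<pp>)) ` V)))"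
      using t unfolding T_Union[OF V] .
    show "\<forall>U\<in>(\<lambda>\<pp>. W (q \<pp>)) ` V. restr X (\<Union>((\<lambda>\<pp>. W (q \<pp>)) ` V)) U t = restr X (\<Union>((\<lambda>\<pp>. W (q \<pp>)) ` V)) U t'"
      using st unfolding st_def T_Union[OF V] by auto
  qed
qed

text \<open>A section of the spectrum prescribes a germ at each prime of \<open>V\<close>, that is,
  a section over each least neighbourhood. Because one fraction represents the given section near
  each prime, these are compatible with restriction to smaller primes, and the gluing axiom
  applies.\<close>

lemma Psi_surj:
  assumes V: "openin (monoid_zariski M) V" and s: "s \<in> structure_sections M (monoid_zariski M) V"
  shows "\<exists>t\<in>carrier (sect X (T V)). Psi V t = s"
proof -
  have VS: "\<pp> \<in> Sm" if "\<pp> \<in> V" for \<pp> using that V openin_M by blast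
  have "\<exists>y\<in>carrier (G (q \<pp>)). loc \<pp> y = s \<pp>" if pV: "\<pp> \<in> V" for \<pp>
  proof -
    interpret L: localisation_hom M "G (q \<pp>)" "\<rho> \<pp>" "carrier M - \<pp>" by (rule \<rho>_localisation[OF VS[OF pV]])
    obtain m n where mn: "m \<in> carrier M" "n \<in> carrier M - \<pp>" "s \<pp> = fraction M (carrier M - \<pp>) m n"
      by (rule fraction_setting.fractionsE[OF L.fraction_setting B.section_fractions[OF s pV]])
    from L.fr_surj[OF mn(1,2)] obtain y where y: "y \<in> carrier (G (q \<pp>))" "(m, n) \<in> L.fr y" by (elim bexE) (rule that)
    then show ?thesis using L.fr_eq[OF y] mn(3) by (intro bexI[of _ y]) simp_all
  qed
  then obtain \<sigma> where \<sigma>: "\<And>\<pp>. \<pp> \<in> V \<Longrightarrow> \<sigma> \<pp> \<in> carrier (G (q \<pp>))" "\<And>\<pp>. \<pp> \<in> V \<Longrightarrow> loc \<pp> (\<sigma> \<pp>) = s \<pp>"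
    by metis
  have down: "rs (q \<pp>) (q \<pp>') (\<sigma> \<pp>) = \<sigma> \<pp>'" if p: "\<pp> \<in> V" "\<pp>' \<in> Sm" "\<pp>' \<subseteq> \<pp>" for \<pp> \<pp>'
  proof -
    have p'V: "\<pp>' \<in> V" using V p unfolding openin_M by blast
    interpret L: localisation_hom M "G (q \<pp>)" "\<rho> \<pp>" "carrier M - \<pp>" by (rule \<rho>_localisation[OF VS[OF p(1)]])
    interpret L': localisation_hom M "G (q \<pp>')" "\<rho> \<pp>'" "carrier M - \<pp>'" by (rule \<rho>_localisation[OF p(2)])
    obtain m n where mn: "m \<in> carrier M" "n \<in> carrier M" "n \<notin> \<pp>" "\<pp> \<in> Sm"
      "\<forall>Q\<in>Sm. n \<notin> Q \<longrightarrow> Q \<in> V \<and> s Q = fraction M (carrier M - Q) m n" by (rule B.sectionE[OF s p(1)])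
    have n': "n \<notin> \<pp>'" using mn(3) p(3) by blast
    have "(m, n) \<in> loc \<pp> (\<sigma> \<pp>)"
      using \<sigma>(2)[OF p(1)] mn(5) mn(3,4) fraction_setting.fraction_self[OF L.fraction_setting mn(1), of n] mn(2) by simp
    from rep_down[OF mn(4) p(2,3) \<sigma>(1)[OF p(1)] this]
    have 1: "(m, n) \<in> loc \<pp>' (rs (q \<pp>) (q \<pp>') (\<sigma> \<pp>))" .
    have sub: "q \<pp>' \<subseteq> q \<pp>" using q_mono[OF p(2) mn(4)] p(3) by simp
    have c: "rs (q \<pp>) (q \<pp>') (\<sigma> \<pp>) \<in> carrier (G (q \<pp>'))"
      using rs_hom(1)[OF sub] \<sigma>(1)[OF p(1)] by (auto simp: hom_def)
    have "loc \<pp>' (rs (q \<pp>) (q \<pp>') (\<sigma> \<pp>)) = loc \<pp>' (\<sigma> \<pp>')"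
      using L'.fr_eq[OF c 1] \<sigma>(2)[OF p'V] mn(5) p(2) n' by simp
    then show ?thesis by (rule L'.fr_inj[OF c \<sigma>(1)[OF p'V]])
  qed
  have inj: "\<pp> = \<pp>'" if "\<pp> \<in> V" "\<pp>' \<in> V" "W (q \<pp>) = W (q \<pp>')" for \<pp> \<pp>'
  proof -
    have "q \<pp> \<subseteq> q \<pp>'" using W_subset_iff[OF q_prime(1)[OF VS[OF that(1)]]] equalityD1[OF that(3)] by (rule iffD1)
    moreover have "q \<pp>' \<subseteq> q \<pp>" using W_subset_iff[OF q_prime(1)[OF VS[OF that(2)]]] equalityD2[OF that(3)] by (rule iffD1)
    ultimately have "q \<pp> = q \<pp>'" by (rule equalityI)
    from arg_cong[OF this, of "pm P"] show ?thesis
      unfolding q_prime(3)[OF VS[OF that(1)]] q_prime(3)[OF VS[OF that(2)]] .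
  qed
  \<comment> \<open>The gluing axiom indexes sections by open sets; as distinct primes have distinct
    least neighbourhoods, the family \<open>\<sigma>\<close> can be reindexed.\<close>
  define \<tau> where "\<tau> U = \<sigma> (SOME \<pp>. \<pp> \<in> V \<and> W (q \<pp>) = U)" for U
  have \<tau>: "\<tau> (W (q \<pp>)) = \<sigma> \<pp>" if "\<pp> \<in> V" for \<pp>
  proof -
    have "\<exists>\<pp>'. \<pp>' \<in> V \<and> W (q \<pp>') = W (q \<pp>)" by (rule exI[of _ \<pp>]) (simp add: that)
    note some = someI_ex[OF this]
    have "(SOME \<pp>'. \<pp>' \<in> V \<and> W (q \<pp>') = W (q \<pp>)) = \<pp>"
      by (rule inj[OF conjunct1[OF some] that conjunct2[OF some]])
    then show ?thesis unfolding \<tau>_def by (rule arg_cong)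
  qed
  have overlap: "restr X (W (q \<pp>)) (W (q \<pp>) \<inter> W (q \<pp>')) (\<sigma> \<pp>) = restr X (W (q \<pp>')) (W (q \<pp>) \<inter> W (q \<pp>')) (\<sigma> \<pp>')"
    (is "?l = ?r") if p: "\<pp> \<in> V" "\<pp>' \<in> V" for \<pp> \<pp>'
  proof -
    let ?O = "W (q \<pp>) \<inter> W (q \<pp>')"
    have oO: "openin (topo X) ?O" by (rule openin_Int[OF W_open W_open])
    \<comment> \<open>The overlap of two least neighbourhoods need not be one itself, but it is
      covered by those of the primes inside both, where \<open>down\<close> applies to either
      section.\<close>
    let ?C = "(\<lambda>\<pp>''. W (q \<pp>'')) ` {\<pp>'' \<in> Sm. \<pp>'' \<subseteq> \<pp> \<and> \<pp>'' \<subseteq> \<pp>'}"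
    have U: "\<Union>?C = ?O"
    proof (intro equalityI subsetI)
      fix x assume "x \<in> \<Union>?C"
      then obtain \<pp>'' where p'': "\<pp>'' \<in> Sm" "\<pp>'' \<subseteq> \<pp>" "\<pp>'' \<subseteq> \<pp>'" "x \<in> W (q \<pp>'')" by auto
      then show "x \<in> ?O"
        using W_mono[of "q \<pp>''" "q \<pp>"] W_mono[of "q \<pp>''" "q \<pp>'"] q_mono[OF p''(1) VS[OF p(1)]] q_mono[OF p''(1) VS[OF p(2)]] by auto
    next
      fix x assume x: "x \<in> ?O"
      then have xP: "x \<in> W P" using W_mono[OF q_prime(2)[OF VS[OF p(1)]]] by blast
      have "F x \<subseteq> \<pp>" "F x \<subseteq> \<pp>'"
        using x q_F[OF xP] q_mono[OF F_prime[OF xP] VS[OF p(1)]] q_mono[OF F_prime[OF xP] VS[OF p(2)]] by (auto simp: W_def)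
      moreover have "x \<in> W (q (F x))" using q_F[OF xP] xP by (simp add: W_def)
      ultimately show "x \<in> \<Union>?C" using F_prime[OF xP] by blast
    qed
    have lc: "?l \<in> carrier (sect X ?O)" "?r \<in> carrier (sect X ?O)"
      using restr_hom[OF W_open oO, of "q \<pp>"] restr_hom[OF W_open oO, of "q \<pp>'"] \<sigma>(1)[OF p(1)] \<sigma>(1)[OF p(2)]
      by (auto simp: hom_def Pi_iff)
    show ?thesis
    proof (rule locality[of ?C, unfolded U, OF _ lc])
      show "\<forall>V\<in>?C. openin (topo X) V" using W_open by auto
      show "\<forall>Z\<in>?C. restr X ?O Z ?l = restr X ?O Z ?r"
      proof
        fix Z assume Z: "Z \<in> ?C"
        then obtain \<pp>'' where p'': "\<pp>'' \<in> Sm" "\<pp>'' \<subseteq> \<pp>" "\<pp>'' \<subseteq> \<pp>'" "Z = W (q \<pp>'')" by auto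
        have ZO: "W (q \<pp>'') \<subseteq> ?O" using Z U p''(4) by blast
        have "restr X ?O Z ?l = rs (q \<pp>) (q \<pp>'') (\<sigma> \<pp>)"
          unfolding p''(4) by (rule restr_comp[OF W_open oO W_open ZO _ \<sigma>(1)[OF p(1)]]) simp
        also have "\<dots> = rs (q \<pp>') (q \<pp>'') (\<sigma> \<pp>')" using down[OF p(1) p''(1,2)] down[OF p(2) p''(1,3)] by simp
        also have "\<dots> = restr X ?O Z ?r"
          unfolding p''(4) by (rule restr_comp[OF W_open oO W_open ZO _ \<sigma>(1)[OF p(2)], symmetric]) simp
        finally show "restr X ?O Z ?l = restr X ?O Z ?r" .
      qed
    qed
  qed
  let ?C = "(\<lambda>\<pp>. W (q \<pp>)) ` V"
  have "\<exists>t\<in>carrier (sect X (\<Union>?C)). \<forall>U\<in>?C. restr X (\<Union>?C) U t = \<tau> U"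
  proof (rule gluing)
    show "\<forall>V\<in>?C. openin (topo X) V" using W_open by auto
    show "\<forall>U\<in>?C. \<tau> U \<in> carrier (sect X U)" using \<tau> \<sigma>(1) by auto
    show "\<forall>U\<in>?C. \<forall>U'\<in>?C. restr X U (U \<inter> U') (\<tau> U) = restr X U' (U \<inter> U') (\<tau> U')" using \<tau> overlap by auto
  qed
  then obtain t where t: "t \<in> carrier (sect X (T V))" "\<forall>U\<in>?C. restr X (T V) U t = \<tau> U"
    unfolding T_Union[OF V, symmetric] by (elim bexE) (rule that)
  have "Psi V t = s"
  proof (rule extensionalityI[of _ V])
    show "s \<in> extensional V" by (rule B.section_ext[OF s])
    fix \<pp> assume p: "\<pp> \<in> V"
    have "st V t \<pp> = \<sigma> \<pp>" using t(2) p \<tau>[OF p] by (simp add: st_def)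
    then show "Psi V t \<pp> = s \<pp>" using \<sigma>(2)[OF p] p by (simp add: Psi_def)
  qed (simp add: Psi_def)
  then show ?thesis using t(1) by blast
qed

lemma affine: "affine_open X (W P)"
proof -
  define \<Phi> where "\<Phi> V = inv_into (carrier (sect X (T V))) (Psi V)" for V
  have bij: "bij_betw (Psi V) (carrier (sect X (T V))) (carrier (sect (monoid_spec M) V))"
    if V: "openin (monoid_zariski M) V" for V
    unfolding bij_betw_def monoid_spec_simps
  proof (intro conjI equalityI subsetI inj_onI)
    fix s assume "s \<in> structure_sections M (monoid_zariski M) V"
    then show "s \<in> Psi V ` carrier (sect X (T V))" using Psi_surj[OF V] by blast
  qed (use Psi_inj[OF V] Psi_section[OF V] in auto)
  have pre: "preim (open_subspace X (W P)) F V = T V" for V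
    using openin_subset[OF W_open[of P]] by (auto simp: preim_def T_def)
  have iso: "\<Phi> V \<in> Group.iso (sect (monoid_spec M) V) (sect X (T V))" if V: "openin (monoid_zariski M) V" for V
    unfolding \<Phi>_def
    by (rule comm_monoid.iso_inv_into[OF sect_monoid[OF T_open[OF V]] _ Psi_mult[OF V] bij[OF V]])
      (use Psi_section[OF V] in auto)
  have nat: "\<Phi> V' (restrict s V') = restr X (T V) (T V') (\<Phi> V s)"
    if V: "openin (monoid_zariski M) V" "openin (monoid_zariski M) V'" "V' \<subseteq> V"
      and s: "s \<in> structure_sections M (monoid_zariski M) V" for V V' s
  proof -
    have s': "s \<in> carrier (sect (monoid_spec M) V)" using s by simp
    let ?t = "\<Phi> V s"
    have t: "?t \<in> carrier (sect X (T V))" "Psi V ?t = s"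
      unfolding \<Phi>_def using bij_betwE[OF bij_betw_inv_into[OF bij[OF V(1)]]] s' bij_betw_inv_into_right[OF bij[OF V(1)] s'] by auto
    have r: "restr X (T V) (T V') ?t \<in> carrier (sect X (T V'))"
      using restr_hom[OF T_open[OF V(1)] T_open[OF V(2)] T_mono[OF V(3)]] t(1) by (auto simp: hom_def)
    have "Psi V' (restr X (T V) (T V') ?t) = restrict (Psi V ?t) V'"
    proof (rule extensionalityI[of _ V'])
      fix \<pp> assume p: "\<pp> \<in> V'"
      have "st V' (restr X (T V) (T V') ?t) \<pp> = st V ?t \<pp>"
        unfolding st_def by (rule restr_comp[OF T_open[OF V(1)] T_open[OF V(2)] W_open W_q_subset[OF V(2) p] T_mono[OF V(3)] t(1)])
      then show "Psi V' (restr X (T V) (T V') ?t) \<pp> = restrict (Psi V ?t) V' \<pp>"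
        using p V(3) by (auto simp: Psi_def)
    qed (simp add: Psi_def, rule restrict_extensional)
    then have "restrict s V' = Psi V' (restr X (T V) (T V') ?t)" using t(2) by simp
    then show ?thesis unfolding \<Phi>_def[of V'] using bij_betw_inv_into_left[OF bij[OF V(2)] r] by simp
  qed
  have "monoidal_space_iso (open_subspace X (W P)) (monoid_spec M) F \<Phi>"
    unfolding monoidal_space_iso_def pre
    using F_homeo iso nat by (intro conjI allI impI ballI; (elim conjE)?; simp)
  then show ?thesis
    unfolding affine_open_def using W_open[of P] G_monoid[of P]
    by - (rule conjI, assumption, rule exI[of _ M], rule exI[of _ F], rule exI[of _ \<Phi>], rule conjI)
qed

end

subsection \<open>Characters of finitely generated abelian groups\<close>

text \<open>Homomorphisms on \<open>H\<close> with a fixed value outside \<open>H\<close>, so that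
  each is counted once.\<close>

definition ext_homs :: "('a, 'x) monoid_scheme \<Rightarrow> 'a set \<Rightarrow> ('c, 'y) monoid_scheme \<Rightarrow> ('a \<Rightarrow> 'c) set" where
  "ext_homs G H C = extensional H \<inter> hom (G\<lparr>carrier := H\<rparr>) C"

definition adjoin :: "('a, 'x) monoid_scheme \<Rightarrow> 'a set \<Rightarrow> 'a \<Rightarrow> 'a set" where
  "adjoin G H g = {h \<otimes>\<^bsub>G\<^esub> g [^]\<^bsub>G\<^esub> (k::int) | h k. h \<in> H}"

lemma ext_homsD:
  assumes "\<chi> \<in> ext_homs G H C"
  shows "\<chi> \<in> extensional H" "\<And>x. x \<in> H \<Longrightarrow> \<chi> x \<in> carrier C"
    "\<And>x y. x \<in> H \<Longrightarrow> y \<in> H \<Longrightarrow> \<chi> (x \<otimes>\<^bsub>G\<^esub> y) = \<chi> x \<otimes>\<^bsub>C\<^esub> \<chi> y"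
  using assms by (auto simp: ext_homs_def hom_def)

lemma ext_homs_group_hom:
  assumes "group G" "group C" "subgroup H G" "\<chi> \<in> ext_homs G H C"
  shows "group_hom (G\<lparr>carrier := H\<rparr>) C \<chi>"
  using assms group.subgroup_imp_group[OF assms(1,3)]
  by (auto simp: ext_homs_def group_hom_def group_hom_axioms_def)

lemma ext_homs_int_pow:
  assumes "group G" "group C" "subgroup H G" "\<chi> \<in> ext_homs G H C" "x \<in> H"
  shows "\<chi> (x [^]\<^bsub>G\<^esub> (n::int)) = \<chi> x [^]\<^bsub>C\<^esub> n"
  using group_hom.hom_int_pow[OF ext_homs_group_hom[OF assms(1-4)]] assms(5)
    group.int_pow_consistent[OF assms(1,3,5)] by simp

context comm_group
begin

lemma adjoin_subgroup:
  assumes "subgroup H G" "g \<in> carrier G"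
  shows "subgroup (adjoin G H g) G"
proof -
  interpret H: subgroup H G by fact
  show ?thesis
  proof (rule subgroupI)
    show "adjoin G H g \<subseteq> carrier G"
      using assms by (auto simp: adjoin_def)
    have "\<one> \<otimes> g [^] (0::int) \<in> adjoin G H g"
      unfolding adjoin_def using H.one_closed by blast
    then show "adjoin G H g \<noteq> {}" by blast
  next
    fix x assume "x \<in> adjoin G H g"
    then obtain h and k :: int where hk: "h \<in> H" "x = h \<otimes> g [^] k"
      by (auto simp: adjoin_def)
    have "inv x = inv h \<otimes> g [^] (-k)"
      using hk assms by (simp add: inv_mult int_pow_neg)
    then show "inv x \<in> adjoin G H g"
      unfolding adjoin_def using hk H.m_inv_closed by blast
  next
    fix x y assume "x \<in> adjoin G H g" "y \<in> adjoin G H g"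
    then obtain h h' and k l :: int
      where hk: "h \<in> H" "x = h \<otimes> g [^] k" "h' \<in> H" "y = h' \<otimes> g [^] l"
      by (auto simp: adjoin_def)
    have c: "h \<in> carrier G" "h' \<in> carrier G" "g [^] k \<in> carrier G" "g [^] l \<in> carrier G"
      using hk assms by auto
    have "x \<otimes> y = (h \<otimes> h') \<otimes> g [^] (k + l)"
      unfolding hk int_pow_mult[OF assms(2)] using c by (simp add: m_ac)
    then show "x \<otimes> y \<in> adjoin G H g"
      unfolding adjoin_def using hk H.m_closed by blast
  qed
qed

lemma adjoin_superset:
  assumes "subgroup H G" "g \<in> carrier G"
  shows "H \<subseteq> adjoin G H g" "g \<in> adjoin G H g"
proof -
  interpret H: subgroup H G by fact
  show "H \<subseteq> adjoin G H g"
  proof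
    fix h assume "h \<in> H"
    then have "h = h \<otimes> g [^] (0::int)" by simp
    with \<open>h \<in> H\<close> show "h \<in> adjoin G H g" unfolding adjoin_def by blast
  qed
  have "g = \<one> \<otimes> g [^] (1::int)" using assms by simp
  then show "g \<in> adjoin G H g" unfolding adjoin_def using H.one_closed by blast
qed

lemma generate_insert:
  assumes "F \<subseteq> carrier G" "g \<in> carrier G"
  shows "generate G (insert g F) = adjoin G (generate G F) g"
proof (rule generateI[symmetric])
  have sg: "subgroup (generate G F) G" by (rule generate_is_subgroup[OF assms(1)])
  show "subgroup (adjoin G (generate G F) g) G"
    by (rule adjoin_subgroup[OF sg assms(2)])
  show "insert g F \<subseteq> adjoin G (generate G F) g"
    using adjoin_superset[OF sg assms(2)] generate.incl[of _ F G] by blast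
  fix K assume K: "subgroup K G" "insert g F \<subseteq> K"
  then have "generate G F \<subseteq> K" by (intro generate_subgroup_incl) auto
  then show "adjoin G (generate G F) g \<subseteq> K"
    using K subgroup.m_closed[OF K(1)] subgroup_int_pow_closed[OF K(1), of g] by (auto simp: adjoin_def)
qed

text \<open>The extension must send the product of \<open>h\<close> and a power of \<open>g\<close>
  to the product of \<open>\<chi> h\<close> and the same power of \<open>c\<close>. Two such
  expressions for one element differ by a power of \<open>g\<close> that lies in \<open>H\<close>,
  and there \<open>compat\<close> equates the two values.\<close>

lemma extend_ext_hom:
  assumes H: "subgroup H G" and g: "g \<in> carrier G" and C: "comm_group C"
    and \<chi>: "\<chi> \<in> ext_homs G H C" and c: "c \<in> carrier C"
    and compat: "\<And>n::int. g [^] n \<in> H \<Longrightarrow> \<chi> (g [^] n) = c [^]\<^bsub>C\<^esub> n"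
  shows "\<exists>\<chi>'\<in>ext_homs G (adjoin G H g) C. restrict \<chi>' H = \<chi> \<and> \<chi>' g = c"
proof -
  interpret H: subgroup H G by fact
  interpret C: comm_group C by fact
  note \<chi>D = ext_homsD[OF \<chi>]
  have wd: "\<chi> h \<otimes>\<^bsub>C\<^esub> c [^]\<^bsub>C\<^esub> k = \<chi> h' \<otimes>\<^bsub>C\<^esub> c [^]\<^bsub>C\<^esub> l"
    if hk: "h \<in> H" "h' \<in> H" "h \<otimes> g [^] k = h' \<otimes> g [^] l" for h h' and k l :: int
  proof -
    have cc: "h \<in> carrier G" "h' \<in> carrier G" "g [^] k \<in> carrier G" "g [^] l \<in> carrier G"
      using hk g by auto
    have "h \<otimes> g [^] (k - l) = (h \<otimes> g [^] k) \<otimes> inv (g [^] l)"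
      unfolding int_pow_diff[OF g] using cc by (simp add: m_ac)
    also have "\<dots> = h'"
      unfolding hk(3) using cc by (simp add: m_assoc)
    finally have e: "h \<otimes> g [^] (k - l) = h'" .
    then have "g [^] (k - l) = inv h \<otimes> h'"
      using cc g by (metis int_pow_closed inv_closed inv_solve_left)
    then have m: "g [^] (k - l) \<in> H" using hk by simp
    have "\<chi> h' = \<chi> h \<otimes>\<^bsub>C\<^esub> c [^]\<^bsub>C\<^esub> (k - l)"
      using \<chi>D(3)[OF hk(1) m] compat[OF m] e by simp
    then have "\<chi> h' \<otimes>\<^bsub>C\<^esub> c [^]\<^bsub>C\<^esub> l = \<chi> h \<otimes>\<^bsub>C\<^esub> (c [^]\<^bsub>C\<^esub> (k - l) \<otimes>\<^bsub>C\<^esub> c [^]\<^bsub>C\<^esub> l)"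
      using c hk \<chi>D(2) by (simp add: C.m_assoc)
    then show ?thesis using c by (simp add: C.int_pow_mult[symmetric])
  qed
  define \<chi>' where "\<chi>' = (\<lambda>x\<in>adjoin G H g.
    SOME v. \<exists>h k. h \<in> H \<and> x = h \<otimes> g [^] (k::int) \<and> v = \<chi> h \<otimes>\<^bsub>C\<^esub> c [^]\<^bsub>C\<^esub> k)"
  have val: "\<chi>' (h \<otimes> g [^] k) = \<chi> h \<otimes>\<^bsub>C\<^esub> c [^]\<^bsub>C\<^esub> k" if "h \<in> H" for h and k :: int
  proof -
    have mem: "h \<otimes> g [^] k \<in> adjoin G H g" using that by (auto simp: adjoin_def)
    have "\<exists>v. \<exists>h' l. h' \<in> H \<and> h \<otimes> g [^] k = h' \<otimes> g [^] (l::int) \<and> v = \<chi> h' \<otimes>\<^bsub>C\<^esub> c [^]\<^bsub>C\<^esub> l"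
      using that by blast
    from someI_ex[OF this] mem obtain h' and l :: int
      where "h' \<in> H" "h \<otimes> g [^] k = h' \<otimes> g [^] l" "\<chi>' (h \<otimes> g [^] k) = \<chi> h' \<otimes>\<^bsub>C\<^esub> c [^]\<^bsub>C\<^esub> l"
      unfolding \<chi>'_def by auto
    then show ?thesis using wd[OF that] by metis
  qed
  have "\<chi>' \<in> ext_homs G (adjoin G H g) C"
    unfolding ext_homs_def
  proof (intro IntI homI)
    show "\<chi>' \<in> extensional (adjoin G H g)" by (simp add: \<chi>'_def)
    fix x assume "x \<in> carrier (G\<lparr>carrier := adjoin G H g\<rparr>)"
    then obtain h and k :: int where hk: "h \<in> H" "x = h \<otimes> g [^] k" by (auto simp: adjoin_def)
    then show "\<chi>' x \<in> carrier C" using val \<chi>D(2) c by simp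
    fix y assume "y \<in> carrier (G\<lparr>carrier := adjoin G H g\<rparr>)"
    then obtain h' and l :: int where hl: "h' \<in> H" "y = h' \<otimes> g [^] l" by (auto simp: adjoin_def)
    have cc: "h \<in> carrier G" "h' \<in> carrier G" "g [^] k \<in> carrier G" "g [^] l \<in> carrier G"
      "\<chi> h \<in> carrier C" "\<chi> h' \<in> carrier C" "c [^]\<^bsub>C\<^esub> k \<in> carrier C" "c [^]\<^bsub>C\<^esub> l \<in> carrier C"
      using hk hl g c \<chi>D(2) by auto
    have "x \<otimes> y = (h \<otimes> h') \<otimes> g [^] (k + l)"
      unfolding hk hl int_pow_mult[OF g] using cc by (simp add: m_ac)
    then have "\<chi>' (x \<otimes> y) = (\<chi> h \<otimes>\<^bsub>C\<^esub> \<chi> h') \<otimes>\<^bsub>C\<^esub> c [^]\<^bsub>C\<^esub> (k + l)"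
      using val[of "h \<otimes> h'" "k + l"] hk hl \<chi>D(3) by simp
    also have "\<dots> = \<chi>' x \<otimes>\<^bsub>C\<^esub> \<chi>' y"
      unfolding hk(2) hl(2) val[OF hk(1)] val[OF hl(1)] C.int_pow_mult[OF c] using cc by (simp add: C.m_ac)
    finally show "\<chi>' (x \<otimes>\<^bsub>G\<lparr>carrier := adjoin G H g\<rparr>\<^esub> y) = \<chi>' x \<otimes>\<^bsub>C\<^esub> \<chi>' y" by simp
  qed
  moreover have "restrict \<chi>' H = \<chi>"
  proof (rule extensionalityI[OF _ \<chi>D(1)])
    fix h assume h: "h \<in> H"
    then show "restrict \<chi>' H h = \<chi> h" using val[OF h, of 0] \<chi>D(2)[OF h] by simp
  qed simp
  moreover have "\<chi>' g = c"
  proof -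
    have "\<chi> \<one> = \<one>\<^bsub>C\<^esub>" using compat[of 0] by simp
    then show ?thesis using val[OF H.one_closed, of 1] g c by simp
  qed
  ultimately show ?thesis by blast
qed

text \<open>Counting the extensions of \<open>\<chi>\<close> thus means counting the values at
  \<open>g\<close> that are compatible with \<open>\<chi>\<close> on the powers of \<open>g\<close>
  in \<open>H\<close>.\<close>

lemma bij_ext_homs_adjoin:
  assumes H: "subgroup H G" and g: "g \<in> carrier G" and C: "comm_group C"
  shows "bij_betw (\<lambda>\<chi>. (restrict \<chi> H, \<chi> g)) (ext_homs G (adjoin G H g) C)
    {(\<chi>, c). \<chi> \<in> ext_homs G H C \<and> c \<in> carrier C \<and>
      (\<forall>n::int. g [^] n \<in> H \<longrightarrow> \<chi> (g [^] n) = c [^]\<^bsub>C\<^esub> n)}"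
  unfolding bij_betw_def
proof (intro conjI equalityI subsetI)
  interpret C: comm_group C by fact
  note sg = adjoin_subgroup[OF H g] and sup = adjoin_superset[OF H g]
  show "inj_on (\<lambda>\<chi>. (restrict \<chi> H, \<chi> g)) (ext_homs G (adjoin G H g) C)"
  proof (rule inj_onI)
    fix \<chi> \<chi>' assume 1: "\<chi> \<in> ext_homs G (adjoin G H g) C" "\<chi>' \<in> ext_homs G (adjoin G H g) C"
      and "(restrict \<chi> H, \<chi> g) = (restrict \<chi>' H, \<chi>' g)"
    then have eq: "restrict \<chi> H = restrict \<chi>' H" "\<chi> g = \<chi>' g" by auto
    have eqH: "\<chi> h = \<chi>' h" if "h \<in> H" for h using fun_cong[OF eq(1), of h] that by simp
    have pw: "\<chi> (g [^] k) = \<chi>' (g [^] k)" for k :: int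
      using ext_homs_int_pow[OF is_group C.is_group sg 1(1) sup(2)]
        ext_homs_int_pow[OF is_group C.is_group sg 1(2) sup(2)] eq(2) by simp
    show "\<chi> = \<chi>'"
    proof (rule extensionalityI[OF ext_homsD(1)[OF 1(1)] ext_homsD(1)[OF 1(2)]])
      fix x assume "x \<in> adjoin G H g"
      then obtain h and k :: int where hk: "h \<in> H" "x = h \<otimes> g [^] k" by (auto simp: adjoin_def)
      have "h \<in> adjoin G H g" "g [^] k \<in> adjoin G H g"
        using hk sup subgroup_int_pow_closed[OF sg sup(2)] by auto
      then show "\<chi> x = \<chi>' x"
        unfolding hk(2) using ext_homsD(3)[OF 1(1)] ext_homsD(3)[OF 1(2)] eqH[OF hk(1)] pw by simp
    qed
  qed
next
  interpret C: comm_group C by fact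
  note sg = adjoin_subgroup[OF H g] and sup = adjoin_superset[OF H g]
  fix y assume "y \<in> (\<lambda>\<chi>. (restrict \<chi> H, \<chi> g)) ` ext_homs G (adjoin G H g) C"
  then obtain \<chi> where \<chi>: "\<chi> \<in> ext_homs G (adjoin G H g) C" "y = (restrict \<chi> H, \<chi> g)" by blast
  have "restrict \<chi> H \<in> ext_homs G H C"
    unfolding ext_homs_def using ext_homsD[OF \<chi>(1)] sup subgroup.m_closed[OF H]
    by (auto intro!: homI simp: subset_iff)
  then show "y \<in> {(\<chi>, c). \<chi> \<in> ext_homs G H C \<and> c \<in> carrier C \<and>
      (\<forall>n::int. g [^] n \<in> H \<longrightarrow> \<chi> (g [^] n) = c [^]\<^bsub>C\<^esub> n)}"
    using \<chi> sup ext_homsD(2)[OF \<chi>(1)] ext_homs_int_pow[OF is_group C.is_group sg \<chi>(1) sup(2)] by auto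
next
  fix y assume "y \<in> {(\<chi>, c). \<chi> \<in> ext_homs G H C \<and> c \<in> carrier C \<and>
      (\<forall>n::int. g [^] n \<in> H \<longrightarrow> \<chi> (g [^] n) = c [^]\<^bsub>C\<^esub> n)}"
  then obtain \<chi> c where y: "y = (\<chi>, c)" "\<chi> \<in> ext_homs G H C" "c \<in> carrier C"
      "\<And>n::int. g [^] n \<in> H \<Longrightarrow> \<chi> (g [^] n) = c [^]\<^bsub>C\<^esub> n"
    by auto
  from extend_ext_hom[OF H g C y(2-4)]
  show "y \<in> (\<lambda>\<chi>. (restrict \<chi> H, \<chi> g)) ` ext_homs G (adjoin G H g) C"
    unfolding y(1) by (auto simp: image_iff)
qed

end

text \<open>The order of an element in the kernel of the \<open>k\<close>-th power map divides both
  \<open>k\<close> and the order of \<open>C\<close>, hence is 1. An injective map of a finite set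
  to itself is onto.\<close>

lemma ex1_root_coprime:
  assumes "comm_group C" "finite (carrier C)" "coprime (card (carrier C)) k" "d \<in> carrier C"
  shows "\<exists>!c. c \<in> carrier C \<and> c [^]\<^bsub>C\<^esub> (k::nat) = d"
proof -
  interpret comm_group C by fact
  have inj: "inj_on (\<lambda>c. c [^]\<^bsub>C\<^esub> k) (carrier C)"
  proof (rule inj_onI)
    fix x y assume xy: "x \<in> carrier C" "y \<in> carrier C" "x [^]\<^bsub>C\<^esub> k = y [^]\<^bsub>C\<^esub> k"
    let ?z = "x \<otimes>\<^bsub>C\<^esub> inv\<^bsub>C\<^esub> y"
    have z: "?z \<in> carrier C" using xy by simp
    have "?z [^]\<^bsub>C\<^esub> k = \<one>\<^bsub>C\<^esub>"
    proof -
      have "?z [^]\<^bsub>C\<^esub> k = x [^]\<^bsub>C\<^esub> k \<otimes>\<^bsub>C\<^esub> (inv\<^bsub>C\<^esub> y) [^]\<^bsub>C\<^esub> k"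
        using xy(1,2) by (intro pow_mult_distrib m_comm) auto
      also have "\<dots> = y [^]\<^bsub>C\<^esub> k \<otimes>\<^bsub>C\<^esub> inv\<^bsub>C\<^esub> (y [^]\<^bsub>C\<^esub> k)"
        unfolding xy(3) using xy(2) by (simp add: nat_pow_inv)
      finally show ?thesis using xy(2) by simp
    qed
    then have "ord ?z dvd k" using pow_eq_id[OF z] by simp
    moreover have "ord ?z dvd card (carrier C)" using ord_dvd_group_order[OF z] by (simp add: Coset.order_def)
    ultimately have "is_unit (ord ?z)" using coprime_common_divisor[OF assms(3)] by blast
    then have "ord ?z = 1" by simp
    then have "?z = \<one>\<^bsub>C\<^esub>" using ord_eq_1[OF z] by simp
    then show "x = y" using inv_equality[of x "inv\<^bsub>C\<^esub> y"] xy(1,2) by simp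
  qed
  have "(\<lambda>c. c [^]\<^bsub>C\<^esub> k) ` carrier C = carrier C"
    by (rule endo_inj_surj[OF assms(2) _ inj]) auto
  then have "d \<in> (\<lambda>c. c [^]\<^bsub>C\<^esub> k) ` carrier C" using assms(4) by simp
  then obtain c where c: "c \<in> carrier C" "c [^]\<^bsub>C\<^esub> k = d" by (elim imageE) simp
  show ?thesis
  proof (rule ex1I[of _ c])
    fix c' assume "c' \<in> carrier C \<and> c' [^]\<^bsub>C\<^esub> k = d"
    then show "c' = c" using inj_onD[OF inj, of c' c] c by simp
  qed (use c in simp)
qed

text \<open>If no positive power of \<open>g\<close> lies in \<open>H\<close>, the value at
  \<open>g\<close> is free, whence \<open>e = 1\<close> and \<open>d = 1\<close>. Otherwise let
  \<open>k\<close> be the order of \<open>g\<close> modulo \<open>H\<close>; the value is a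
  \<open>k\<close>-th root of a prescribed element, which exists and is unique when the order of
  \<open>C\<close> is prime to \<open>k\<close>, whence \<open>e = k\<close> and
  \<open>d = 0\<close>. Neither number depends on \<open>C\<close>.\<close>

lemma card_ext_homs_adjoin:
  assumes G: "comm_group G" and H: "subgroup H G" and g: "g \<in> carrier G"
  shows "\<exists>e d::nat. e > 0 \<and> (\<forall>C :: 'c monoid. comm_group C \<and> finite (carrier C) \<and> coprime (card (carrier C)) e \<and>
      finite (ext_homs G H C) \<longrightarrow>
      finite (ext_homs G (adjoin G H g) C) \<and>
      card (ext_homs G (adjoin G H g) C) = card (ext_homs G H C) * card (carrier C) ^ d)"
proof (cases "\<exists>k::nat. k > 0 \<and> g [^]\<^bsub>G\<^esub> k \<in> H")
  interpret comm_group G by fact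
  interpret H: subgroup H G by fact
  case False
  have zero: "n = 0" if "g [^]\<^bsub>G\<^esub> (n::int) \<in> H" for n
  proof (rule ccontr)
    assume "n \<noteq> 0"
    have "g [^]\<^bsub>G\<^esub> (int (nat \<bar>n\<bar>)) \<in> H"
    proof (cases "n \<ge> 0")
      case False
      then have "int (nat \<bar>n\<bar>) = - n" by simp
      then show ?thesis using H.m_inv_closed[OF that] g by (simp add: int_pow_neg)
    qed (use that in simp)
    then have "g [^]\<^bsub>G\<^esub> (nat \<bar>n\<bar>) \<in> H" by (simp only: int_pow_int)
    moreover have "nat \<bar>n\<bar> > 0" using \<open>n \<noteq> 0\<close> by simp
    ultimately show False using False by blast
  qed
  show ?thesis
  proof (rule exI[of _ 1], rule exI[of _ 1], intro conjI allI impI; (elim conjE)?)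
    fix C :: "'c monoid"
    assume C: "comm_group C" "finite (carrier C)" "finite (ext_homs G H C)"
    interpret C: comm_group C by fact
    have one: "\<chi> \<one>\<^bsub>G\<^esub> = \<one>\<^bsub>C\<^esub>" if "\<chi> \<in> ext_homs G H C" for \<chi>
      using ext_homs_int_pow[OF is_group C.is_group H that H.one_closed, of 0] by simp
    have "{(\<chi>, c). \<chi> \<in> ext_homs G H C \<and> c \<in> carrier C \<and>
      (\<forall>n::int. g [^]\<^bsub>G\<^esub> n \<in> H \<longrightarrow> \<chi> (g [^]\<^bsub>G\<^esub> n) = c [^]\<^bsub>C\<^esub> n)} = ext_homs G H C \<times> carrier C"
    proof -
      have "\<chi> (g [^]\<^bsub>G\<^esub> n) = c [^]\<^bsub>C\<^esub> n"
        if "\<chi> \<in> ext_homs G H C" "g [^]\<^bsub>G\<^esub> n \<in> H" for \<chi> c and n :: int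
        using zero[OF that(2)] one[OF that(1)] by simp
      then show ?thesis by blast
    qed
    note bij = bij_ext_homs_adjoin[OF H g C(1), unfolded this]
    show "finite (ext_homs G (adjoin G H g) C)"
      using bij_betw_finite[OF bij] C by simp
    show "card (ext_homs G (adjoin G H g) C) = card (ext_homs G H C) * card (carrier C) ^ 1"
      using bij_betw_same_card[OF bij] by (simp add: card_cartesian_product)
  qed simp
next
  interpret comm_group G by fact
  interpret H: subgroup H G by fact
  case True
  define k where "k = (LEAST k::nat. k > 0 \<and> g [^]\<^bsub>G\<^esub> k \<in> H)"
  have k: "k > 0" "g [^]\<^bsub>G\<^esub> k \<in> H"
    using LeastI_ex[OF True] by (auto simp: k_def)
  have least: "k \<le> l" if "l > 0" "g [^]\<^bsub>G\<^esub> (l::nat) \<in> H" for l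
    unfolding k_def by (rule Least_le) (use that in auto)
  \<comment> \<open>Division with remainder: by minimality of \<open>k\<close>, the exponents whose
    power of \<open>g\<close> lies in \<open>H\<close> are multiples of \<open>k\<close>, so the
    condition on \<open>c\<close> reduces to the exponent \<open>k\<close> alone.\<close>
  have dvd: "\<exists>m. n = int k * m" if n: "g [^]\<^bsub>G\<^esub> (n::int) \<in> H" for n
  proof -
    define r where "r = nat (n mod int k)"
    have r: "int r = n mod int k" "r < k"
      using k(1) by (simp_all add: r_def nat_less_iff)
    have "int r = n - int k * (n div int k)" unfolding r(1) by (simp add: minus_mult_div_eq_mod)
    then have "g [^]\<^bsub>G\<^esub> (int r) = g [^]\<^bsub>G\<^esub> n \<otimes>\<^bsub>G\<^esub> inv\<^bsub>G\<^esub> ((g [^]\<^bsub>G\<^esub> int k) [^]\<^bsub>G\<^esub> (n div int k))"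
      using g by (simp add: int_pow_diff int_pow_pow)
    also have "\<dots> \<in> H"
      using n k(2) subgroup_int_pow_closed[OF H, of "g [^]\<^bsub>G\<^esub> k"] by (simp add: int_pow_int)
    finally have "g [^]\<^bsub>G\<^esub> r \<in> H" by (simp only: int_pow_int)
    then have "r = 0" using least[of r] r(2) by (cases "r = 0") auto
    then have "n mod int k = 0" using r(1) by simp
    then show ?thesis by (meson dvdE mod_0_imp_dvd)
  qed
  show ?thesis
  proof (rule exI[of _ k], rule exI[of _ 0], intro conjI allI impI; (elim conjE)?)
    show "k > 0" by fact
    fix C :: "'c monoid"
    assume C: "comm_group C" "finite (carrier C)" "coprime (card (carrier C)) k" "finite (ext_homs G H C)"
    interpret C: comm_group C by fact
    have iff: "(\<forall>n::int. g [^]\<^bsub>G\<^esub> n \<in> H \<longrightarrow> \<chi> (g [^]\<^bsub>G\<^esub> n) = c [^]\<^bsub>C\<^esub> n) \<longleftrightarrow> c [^]\<^bsub>C\<^esub> k = \<chi> (g [^]\<^bsub>G\<^esub> k)"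
      if \<chi>: "\<chi> \<in> ext_homs G H C" and c: "c \<in> carrier C" for \<chi> c
    proof
      assume "\<forall>n::int. g [^]\<^bsub>G\<^esub> n \<in> H \<longrightarrow> \<chi> (g [^]\<^bsub>G\<^esub> n) = c [^]\<^bsub>C\<^esub> n"
      then show "c [^]\<^bsub>C\<^esub> k = \<chi> (g [^]\<^bsub>G\<^esub> k)"
        using k(2) by (metis int_pow_int)
    next
      assume a: "c [^]\<^bsub>C\<^esub> k = \<chi> (g [^]\<^bsub>G\<^esub> k)"
      show "\<forall>n::int. g [^]\<^bsub>G\<^esub> n \<in> H \<longrightarrow> \<chi> (g [^]\<^bsub>G\<^esub> n) = c [^]\<^bsub>C\<^esub> n"
      proof (intro allI impI)
        fix n :: int assume "g [^]\<^bsub>G\<^esub> n \<in> H"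
        then obtain m where m: "n = int k * m" using dvd by blast
        have "g [^]\<^bsub>G\<^esub> n = (g [^]\<^bsub>G\<^esub> k) [^]\<^bsub>G\<^esub> m"
          unfolding m using int_pow_pow[OF g, of "int k" m] by (simp add: int_pow_int)
        then have "\<chi> (g [^]\<^bsub>G\<^esub> n) = (c [^]\<^bsub>C\<^esub> k) [^]\<^bsub>C\<^esub> m"
          using ext_homs_int_pow[OF is_group C.is_group H \<chi> k(2)] a by simp
        also have "\<dots> = c [^]\<^bsub>C\<^esub> n"
          unfolding m using C.int_pow_pow[OF c, of "int k" m] by (simp add: int_pow_int)
        finally show "\<chi> (g [^]\<^bsub>G\<^esub> n) = c [^]\<^bsub>C\<^esub> n" .
      qed
    qed
    let ?P = "{(\<chi>, c). \<chi> \<in> ext_homs G H C \<and> c \<in> carrier C \<and>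
      (\<forall>n::int. g [^]\<^bsub>G\<^esub> n \<in> H \<longrightarrow> \<chi> (g [^]\<^bsub>G\<^esub> n) = c [^]\<^bsub>C\<^esub> n)}"
    have P: "?P = {(\<chi>, c). \<chi> \<in> ext_homs G H C \<and> c \<in> carrier C \<and> c [^]\<^bsub>C\<^esub> k = \<chi> (g [^]\<^bsub>G\<^esub> k)}"
      using iff by auto
    have bij2: "bij_betw fst ?P (ext_homs G H C)"
      unfolding P
    proof (rule bij_betwI')
      fix x assume "x \<in> ext_homs G H C"
      with ex1_root_coprime[OF C(1-3) ext_homsD(2)[OF this k(2)]]
      show "\<exists>y\<in>{(\<chi>, c). \<chi> \<in> ext_homs G H C \<and> c \<in> carrier C \<and> c [^]\<^bsub>C\<^esub> k = \<chi> (g [^]\<^bsub>G\<^esub> k)}. x = fst y"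
        by auto
    next
      fix x y assume "x \<in> {(\<chi>, c). \<chi> \<in> ext_homs G H C \<and> c \<in> carrier C \<and> c [^]\<^bsub>C\<^esub> k = \<chi> (g [^]\<^bsub>G\<^esub> k)}"
        "y \<in> {(\<chi>, c). \<chi> \<in> ext_homs G H C \<and> c \<in> carrier C \<and> c [^]\<^bsub>C\<^esub> k = \<chi> (g [^]\<^bsub>G\<^esub> k)}"
      then have x: "fst x \<in> ext_homs G H C" "snd x \<in> carrier C" "snd x [^]\<^bsub>C\<^esub> k = fst x (g [^]\<^bsub>G\<^esub> k)"
          and y: "snd y \<in> carrier C" "snd y [^]\<^bsub>C\<^esub> k = fst y (g [^]\<^bsub>G\<^esub> k)"
        by auto
      have "snd x = snd y" if eq: "fst x = fst y"
      proof (rule ex1E[OF ex1_root_coprime[OF C(1-3) ext_homsD(2)[OF x(1) k(2)]]])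
        fix c assume u: "\<forall>d. d \<in> carrier C \<and> d [^]\<^bsub>C\<^esub> k = fst x (g [^]\<^bsub>G\<^esub> k) \<longrightarrow> d = c"
        have "snd x = c" using u x(2,3) by simp
        moreover have "snd y = c" using u y eq by simp
        ultimately show ?thesis by simp
      qed
      then show "(fst x = fst y) = (x = y)"
        by (auto intro: prod_eqI)
    qed auto
    note bij = bij_betw_trans[OF bij_ext_homs_adjoin[OF H g C(1)] bij2]
    show "finite (ext_homs G (adjoin G H g) C)"
      using bij_betw_finite[OF bij] C by simp
    show "card (ext_homs G (adjoin G H g) C) = card (ext_homs G H C) * card (carrier C) ^ 0"
      using bij_betw_same_card[OF bij] by simp
  qed
qed

text \<open>Adjoining generators one by one avoids splitting the group into cyclic factors. The
  constant \<open>e\<close> becomes the product of the finite relative orders that occur, a multiple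
  of the order of the torsion subgroup, and \<open>r\<close> counts the generators of infinite order
  modulo those adjoined before.\<close>

lemma card_ext_homs_generate:
  assumes G: "comm_group G" and F: "finite F" "F \<subseteq> carrier G"
  shows "\<exists>e r::nat. e > 0 \<and> (\<forall>C :: 'c monoid. comm_group C \<and> finite (carrier C) \<and> coprime (card (carrier C)) e \<longrightarrow>
      finite (ext_homs G (generate G F) C) \<and> card (ext_homs G (generate G F) C) = card (carrier C) ^ r)"
  using F
proof (induction F rule: finite_induct)
  interpret comm_group G by fact
  case empty
  show ?case
  proof (rule exI[of _ 1], rule exI[of _ 0], intro conjI allI impI; (elim conjE)?)
    fix C :: "'c monoid" assume C: "comm_group C"
    interpret C: comm_group C by fact
    have sg: "subgroup {\<one>\<^bsub>G\<^esub>} G" by (rule triv_subgroup)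
    have "ext_homs G (generate G {}) C = {\<lambda>x\<in>{\<one>\<^bsub>G\<^esub>}. \<one>\<^bsub>C\<^esub>}"
      unfolding generate_empty
    proof (intro equalityI subsetI)
      fix \<chi> assume \<chi>: "\<chi> \<in> ext_homs G {\<one>\<^bsub>G\<^esub>} C"
      have "\<chi> \<one>\<^bsub>G\<^esub> = \<one>\<^bsub>C\<^esub>"
        using ext_homs_int_pow[OF is_group C.is_group sg \<chi>, of "\<one>\<^bsub>G\<^esub>" 0] by simp
      then show "\<chi> \<in> {\<lambda>x\<in>{\<one>\<^bsub>G\<^esub>}. \<one>\<^bsub>C\<^esub>}"
        using ext_homsD(1)[OF \<chi>] by (auto intro!: extensionalityI[of _ "{\<one>\<^bsub>G\<^esub>}"])
    qed (auto simp: ext_homs_def hom_def)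
    then show "finite (ext_homs G (generate G {}) C)" "card (ext_homs G (generate G {}) C) = card (carrier C) ^ 0"
      by simp_all
  qed simp
next
  interpret comm_group G by fact
  case (insert g F)
  let ?H = "generate G F"
  have F: "F \<subseteq> carrier G" and g: "g \<in> carrier G" using insert.prems by auto
  from insert.IH[OF F] obtain e r :: nat where er: "e > 0"
    "\<And>C :: 'c monoid. comm_group C \<Longrightarrow> finite (carrier C) \<Longrightarrow> coprime (card (carrier C)) e \<Longrightarrow>
      finite (ext_homs G ?H C) \<and> card (ext_homs G ?H C) = card (carrier C) ^ r" by blast
  from card_ext_homs_adjoin[OF G generate_is_subgroup[OF F] g] obtain e' d :: nat where ed: "e' > 0"
    "\<And>C :: 'c monoid. comm_group C \<Longrightarrow> finite (carrier C) \<Longrightarrow> coprime (card (carrier C)) e' \<Longrightarrow>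
      finite (ext_homs G ?H C) \<Longrightarrow>
      finite (ext_homs G (adjoin G ?H g) C) \<and>
      card (ext_homs G (adjoin G ?H g) C) = card (ext_homs G ?H C) * card (carrier C) ^ d" by blast
  show ?case
    unfolding generate_insert[OF F g]
  proof (rule exI[of _ "e * e'"], rule exI[of _ "r + d"], intro conjI allI impI; (elim conjE)?)
    fix C :: "'c monoid" assume C: "comm_group C" "finite (carrier C)" "coprime (card (carrier C)) (e * e')"
    show "finite (ext_homs G (adjoin G ?H g) C)"
      using er(2)[of C] ed(2)[of C] C by auto
    show "card (ext_homs G (adjoin G ?H g) C) = card (carrier C) ^ (r + d)"
      using er(2)[of C] ed(2)[of C] C by (auto simp: power_add)
  qed (use er ed in auto)
qed

subsection \<open>Uniqueness of the counting polynomial\<close>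

lemma CHAR_bit: "CHAR(bit) = 2"
proof (rule CHAR_eqI)
  show "of_nat 2 = (0 :: bit)" by simp
next
  fix n assume "of_nat n = (0 :: bit)"
  then have "even (of_nat n :: bit)" by simp
  then show "2 dvd n" by (simp only: even_of_nat)
qed

text \<open>The fixed points are the roots of \<open>x ^ q - x\<close>, which splits over the
  algebraic closure. Its derivative is -1 because \<open>q\<close> vanishes in characteristic 2, so
  no root is multiple and there are \<open>q\<close> of them.\<close>

lemma card_frobenius_fixed_points:
  assumes "k \<ge> 1"
  shows "finite {x :: bit alg_closure. x ^ (2 ^ k) = x}"
    and "card {x :: bit alg_closure. x ^ (2 ^ k) = x} = 2 ^ k"
proof -
  define q :: nat where "q = 2 ^ k"
  have q: "q \<ge> 2" using assms unfolding q_def by (cases k) auto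
  have q0: "(of_nat q :: bit alg_closure) = 0"
    using assms by (simp add: q_def of_nat_eq_0_iff_char_dvd CHAR_bit del: of_nat_power)
  define p :: "bit alg_closure poly" where "p = Polynomial.monom 1 q - Polynomial.monom 1 1"
  have cp: "Polynomial.coeff p q = 1" using q by (simp add: p_def)
  have deg: "Polynomial.degree p = q"
    by (rule antisym[OF Polynomial.degree_le Polynomial.le_degree]) (use q cp in \<open>auto simp: p_def\<close>)
  have p0: "p \<noteq> 0" using cp by auto
  have root: "poly p x = 0 \<longleftrightarrow> x ^ q = x" for x
    by (simp add: p_def poly_monom)
  have pd: "pderiv p = [:-1:]"
    by (simp add: p_def pderiv_diff pderiv_monom q0 monom_0)
  obtain A where A: "size A = Polynomial.degree p" "p = Polynomial.smult (Polynomial.lead_coeff p) (\<Prod>x\<in>#A. [:-x, 1:])"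
    using alg_closed_imp_factorization[OF p0] by blast
  have pA: "p = (\<Prod>x\<in>#A. [:-x, 1:])" using A(2) by (simp add: deg cp)
  \<comment> \<open>A repeated linear factor would leave a root of the derivative, which is a
    nonzero constant. Once multiplicities are at most 1, the size of the multiset of roots is the
    number of roots.\<close>
  have cnt: "count A x \<le> 1" for x
  proof (rule ccontr)
    assume "\<not> count A x \<le> 1"
    then obtain n where n: "count A x = Suc (Suc n)" by (metis One_nat_def Suc_le_eq less_Suc_eq not0_implies_Suc not_le zero_less_Suc)
    then have "x \<in># A" by (simp add: count_inI)
    then obtain B where B: "A = add_mset x B" by (blast dest: multi_member_split)
    then have "x \<in># B" using n by (auto intro!: count_inI)
    then obtain D where "B = add_mset x D" by (blast dest: multi_member_split)
    define l where "l = [:-x, 1:]"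
    have l: "poly l x = 0" by (simp add: l_def)
    have "p = l * (l * (\<Prod>x\<in>#D. [:-x, 1:]))"
      unfolding l_def using pA B \<open>B = add_mset x D\<close> by simp
    then have "poly (pderiv p) x = 0" by (simp add: pderiv_mult l)
    then show False by (simp add: pd)
  qed
  have "A = mset_set (set_mset A)"
  proof (rule multiset_eqI)
    fix x show "count A x = count (mset_set (set_mset A)) x"
    proof (cases "x \<in># A")
      case True
      then have "count A x > 0" by simp
      then have "count A x = 1" using cnt[of x] by linarith
      then show ?thesis using True by simp
    qed (simp add: not_in_iff)
  qed
  then have "card (set_mset A) = q" using A(1) deg by (metis size_mset_set)
  moreover have "set_mset A = {x. x ^ q = x}"
    unfolding root[symmetric] pA by (auto simp: poly_prod_mset prod_mset_zero_iff)
  ultimately show "finite {x :: bit alg_closure. x ^ (2 ^ k) = x}"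
    "card {x :: bit alg_closure. x ^ (2 ^ k) = x} = 2 ^ k"
    unfolding q_def[symmetric] by (metis finite_set_mset, metis)
qed

text \<open>Counting says nothing about a \<open>q\<close> without a field of \<open>q\<close>
  elements on the natural numbers, so uniqueness rests on the existence of such fields. The fixed
  points of the Frobenius power form a subfield of the algebraic closure, which is copied to the
  natural numbers along an injection.\<close>

lemma ex_field_card_two_power:
  assumes "k \<ge> 1"
  shows "\<exists>K :: nat ring. field K \<and> card (carrier K) = 2 ^ k"
proof -
  define F where "F = {x :: bit alg_closure. x ^ (2 ^ k) = x}"
  define L :: "bit alg_closure ring" where
    "L = \<lparr>carrier = F, monoid.mult = (*), one = 1, ring.zero = 0, add = (+)\<rparr>"
  \<comment> \<open>In characteristic 2 every element is its own negative, so that closure under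
    addition takes care of negatives.\<close>
  have two: "x + x = 0" for x :: "bit alg_closure"
  proof -
    have "of_nat CHAR(bit alg_closure) = (0 :: bit alg_closure)" by (rule of_nat_CHAR)
    then have "(2 :: bit alg_closure) = 0" by (simp add: CHAR_bit)
    then show ?thesis by (simp only: mult_2[symmetric] mult_zero_left)
  qed
  have neg: "\<exists>y\<in>F. x + y = 0" if "x \<in> F" for x
    using two[of x] that by blast
  have add: "x + y \<in> F" if "x \<in> F" "y \<in> F" for x y
    using that freshmans_dream'[of "2 ^ k" k x y] by (simp add: F_def CHAR_bit)
  have F: "1 \<in> F" "0 \<in> F" "\<And>x y. x \<in> F \<Longrightarrow> y \<in> F \<Longrightarrow> x * y \<in> F" "\<And>x. x \<in> F \<Longrightarrow> inverse x \<in> F"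
    by (auto simp: F_def power_mult_distrib power_inverse)
  have "field L"
  proof (rule cring.cring_fieldI)
    show "cring L"
    proof (rule cringI)
      show "abelian_group L"
        by (rule abelian_groupI) (use neg in \<open>auto simp: L_def F add add_ac\<close>)
      show "comm_monoid L"
        by (rule comm_monoidI) (auto simp: L_def F mult_ac)
    qed (auto simp: L_def algebra_simps)
    show "Units L = carrier L - {\<zero>\<^bsub>L\<^esub>}"
    proof (intro equalityI subsetI)
      fix x assume "x \<in> carrier L - {\<zero>\<^bsub>L\<^esub>}"
      then show "x \<in> Units L" using F(4)[of x]
        by (auto simp: L_def Units_def intro!: bexI[of _ "inverse x"])
    qed (auto simp: L_def Units_def)
  qed
  have fin: "finite F" and card: "card F = 2 ^ k"
    using card_frobenius_fixed_points[OF assms] by (auto simp: F_def)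
  obtain g :: "_ \<Rightarrow> nat" where g: "inj_on g F"
    using fin finite_imp_inj_to_nat_seg by blast
  then have inj: "inj_on g (carrier L)" by (simp add: L_def)
  have "field (image_ring g L)"
    using field.inj_imp_image_ring_is_field[OF \<open>field L\<close> inj] .
  moreover have "card (carrier (image_ring g L)) = 2 ^ k"
    using card card_image[OF g] by (simp add: image_ring_carrier L_def)
  ultimately show ?thesis by blast
qed

text \<open>The exponent is 1 modulo \<open>totient m\<close>, so by Euler's theorem the power of 2
  is congruent to 2 modulo \<open>m\<close>; subtracting 1 leaves 1, which is prime to
  \<open>m\<close>.\<close>

lemma coprime_two_power_minus_one:
  fixes m j :: nat
  assumes "odd m"
  shows "coprime (2 ^ (1 + totient m * j) - 1) m"
proof (rule coprimeI)
  fix d assume d: "d dvd 2 ^ (1 + totient m * j) - 1" "d dvd m"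
  have "[2 ^ totient m = 1] (mod m)"
    using assms by (intro euler_theorem) auto
  then have "[2 * (2 ^ totient m) ^ j = 2 * 1 ^ j] (mod m)"
    by (intro cong_mult cong_pow) auto
  then have "[2 ^ (1 + totient m * j) = 2] (mod m)"
    by (simp add: power_add power_mult)
  then have "[int (2 ^ (1 + totient m * j)) = int 2] (mod int m)"
    by (simp only: cong_int_iff)
  then have "int m dvd int (2 ^ (1 + totient m * j)) - 2"
    by (simp add: cong_iff_dvd_diff)
  then have 1: "int d dvd int (2 ^ (1 + totient m * j)) - 2"
    using d(2) by (meson dvd_trans int_dvd_int_iff)
  have "int d dvd int (2 ^ (1 + totient m * j) - 1)" using d(1) by (simp only: int_dvd_int_iff)
  then have "int d dvd int (2 ^ (1 + totient m * j)) - 1" by (simp add: of_nat_diff)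
  from dvd_diff[OF this 1] show "is_unit d" by simp
qed

text \<open>For a power \<open>q\<close> of 2 greater than 1, \<open>q - 1\<close> is odd, which
  disposes of the power of 2 in \<open>e\<close>; the odd part is treated by the choice of exponents
  in \<open>f\<close>.\<close>

lemma infinite_two_powers_coprime:
  assumes "e > 0"
  shows "infinite {q::nat. gcd (q - 1) e = 1 \<and> (\<exists>k\<ge>1. q = 2 ^ k)}"
proof -
  obtain m where m: "e = 2 ^ multiplicity 2 e * m" "odd m"
    using assms multiplicity_decompose'[of e 2] by auto
  define f where "f = (\<lambda>j. 2 ^ (1 + totient m * j) :: nat)"
  have "m > 0" using m(2) by (cases m) auto
  then have "inj f" by (auto simp: f_def inj_def)
  moreover have "range f \<subseteq> {q::nat. gcd (q - 1) e = 1 \<and> (\<exists>k\<ge>1. q = 2 ^ k)}"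
  proof safe
    fix j
    have "coprime (f j - 1) (2 ^ multiplicity 2 e)"
      by (auto simp: f_def)
    moreover have "coprime (f j - 1) m" unfolding f_def by (rule coprime_two_power_minus_one[OF m(2)])
    ultimately have "coprime (f j - 1) e" using m(1) by (metis coprime_mult_right_iff)
    then show "gcd (f j - 1) e = 1" by (simp only: coprime_iff_gcd_eq_1)
    show "\<exists>k\<ge>1. f j = 2 ^ k" unfolding f_def by (intro exI[of _ "1 + totient m * j"]) auto
  qed
  ultimately show ?thesis by (meson finite_subset range_inj_infinite)
qed

text \<open>A power \<open>q\<close> of 2 with \<open>q - 1\<close> prime to \<open>e * e'\<close>
  satisfies both conditions at once, so the two polynomials agree at infinitely many
  integers.\<close>

lemma counts_points_unique:
  assumes "e > 0" "counts_points X e N" "e' > 0" "counts_points X e' N'"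
  shows "N = N'"
proof (rule ccontr)
  assume "N \<noteq> N'"
  then have fin: "finite {x. poly (N - N') x = 0}" by (intro poly_roots_finite) simp
  let ?Q = "{q::nat. gcd (q - 1) (e * e') = 1 \<and> (\<exists>k\<ge>1. q = 2 ^ k)}"
  have "int ` ?Q \<subseteq> {x. poly (N - N') x = 0}"
  proof
    fix x assume "x \<in> int ` ?Q"
    then obtain k :: nat where x: "x = int (2 ^ k)" and g: "gcd (2 ^ k - 1) (e * e') = 1" and k: "k \<ge> 1"
      by auto
    let ?q = "2 ^ k :: nat"
    obtain K :: "nat ring" where K: "field K" "card (carrier K) = ?q"
      using ex_field_card_two_power[OF k] by blast
    have q: "primepow ?q" using k by (simp add: primepow_power_iff_nat)
    have "coprime (?q - 1) (e * e')" using g by (simp only: coprime_iff_gcd_eq_1)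
    then have "coprime (?q - 1) e" "coprime (?q - 1) e'"
      unfolding coprime_mult_right_iff by simp_all
    then have "gcd (?q - 1) e = 1" "gcd (?q - 1) e' = 1"
      by (simp_all only: coprime_iff_gcd_eq_1)
    then have "poly N (int ?q) = poly N' (int ?q)"
      using assms(2,4) q K unfolding counts_points_def by metis
    then show "x \<in> {x. poly (N - N') x = 0}" unfolding x by simp
  qed
  then have "finite (int ` ?Q)" by (rule finite_subset[OF _ fin])
  then have "finite ?Q" by (rule finite_imageD) simp
  then show False using infinite_two_powers_coprime[of "e * e'"] assms(1,3) by simp
qed

subsection \<open>Affine opens of a scheme of finite type\<close>

text \<open>The point sought is the one whose prime consists of the nonunits. A neighbourhood of it
  that did not contain \<open>V\<close> would cut out a proper open subset of the spectrum
  containing this prime.\<close>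

lemma affine_open_minimal:
  fixes X :: "('p, 'm) monoidal_space"
  assumes "affine_open X V"
  shows "\<exists>c\<in>V. \<forall>O'. openin (topo X) O' \<and> c \<in> O' \<longrightarrow> V \<subseteq> O'"
proof -
  from assms obtain A f \<phi> where V: "openin (topo X) V" and A: "comm_monoid (A :: 'm monoid)"
    and iso: "monoidal_space_iso (open_subspace X V) (monoid_spec A) f \<phi>"
    unfolding affine_open_def by (elim conjE exE) (rule that)
  have h: "homeomorphic_map (subtopology (topo X) V) (monoid_zariski A) f"
    using iso by (simp add: monoidal_space_iso_def)
  interpret Sp: spectrum A "{P. monoid_prime P A}" "monoid_zariski A" by (rule spectrum_monoid[OF A])
  have ts: "topspace (subtopology (topo X) V) = V" using openin_subset[OF V] by auto
  have im: "f ` V = {P. monoid_prime P A}" and inj: "inj_on f V"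
    using homeomorphic_imp_surjective_map[OF h] homeomorphic_imp_injective_map[OF h] unfolding ts Sp.topspace_eq .
  from monoid_spec_closed_point[OF A] obtain p where p: "monoid_prime p A"
    "\<forall>U. openin (monoid_zariski A) U \<and> p \<in> U \<longrightarrow> U = {P. monoid_prime P A}" by (elim exE conjE) (rule that)
  have "p \<in> f ` V" using p(1) im by simp
  then obtain c where c: "c \<in> V" "f c = p" by (elim imageE) (rule that, simp_all)
  have "V \<subseteq> O'" if O: "openin (topo X) O'" "c \<in> O'" for O'
  proof -
    have "openin (subtopology (topo X) V) (V \<inter> O')" by (rule openin_subtopology_Int2[OF O(1)])
    then have "openin (monoid_zariski A) (f ` (V \<inter> O'))"
      using homeomorphic_imp_open_map[OF h] by (simp add: open_map_def)
    moreover have "p \<in> f ` (V \<inter> O')" using c O(2) by auto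
    ultimately have "f ` (V \<inter> O') = f ` V" unfolding im using p(2) by simp
    then have "V \<inter> O' = V" using inj_on_image_eq_iff[OF inj, of "V \<inter> O'" V] by simp
    then show ?thesis by auto
  qed
  with c(1) show ?thesis by (intro bexI[of _ c]) auto
qed

lemma affine_open_open: "affine_open X V \<Longrightarrow> openin (topo X) V"
  by (simp add: affine_open_def)

context chart
begin

lemma affine_W: "P \<in> Sp \<Longrightarrow> affine_open X (W P)"
  by (rule chart_open.affine[OF chart_open.intro[OF chart_axioms chart_open_axioms.intro]])

text \<open>\<open>V\<close> and \<open>W (f c)\<close> are both the least neighbourhood of the
  closed point \<open>c\<close> of \<open>V\<close>.\<close>

lemma affine_eq_W:
  assumes V: "affine_open X V" "V \<subseteq> U0"
  shows "\<exists>P\<in>Sp. V = W P"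
proof -
  from affine_open_minimal[OF V(1)] obtain c where c: "c \<in> V" "\<forall>O'. openin (topo X) O' \<and> c \<in> O' \<longrightarrow> V \<subseteq> O'"
    by (elim bexE) (rule that)
  have cU: "c \<in> U0" using c(1) V(2) by blast
  have "c \<in> W (f c)" using cU by (simp add: W_def)
  then have "V \<subseteq> W (f c)" using c(2) W_open by simp
  moreover have "W (f c) \<subseteq> V" by (rule W_min[OF affine_open_open[OF V(1)] c(1) cU])
  ultimately show ?thesis using f_prime[OF cU] by (intro bexI[of _ "f c"]) auto
qed

lemma finite_affine_subsets: "finite {V. affine_open X V \<and> V \<subseteq> U0}"
proof (rule finite_subset)
  show "{V. affine_open X V \<and> V \<subseteq> U0} \<subseteq> W ` Sp" using affine_eq_W by auto
  show "finite (W ` Sp)" by (rule finite_imageI[OF finite_fg_monoid_primes[OF comm_monoid_A fg_A]])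
qed

text \<open>A unit is a quotient of images of elements outside \<open>P\<close>, so the images of
  the generators of \<open>A\<close> outside \<open>P\<close> generate the group of units.\<close>

lemma Units_finitely_generated:
  assumes P: "P \<in> Sp"
  shows "\<exists>F. finite F \<and> F \<subseteq> Units (G P) \<and> generate (units_of (G P)) F = Units (G P)"
proof -
  interpret M: comm_monoid "G P" by (rule G_monoid)
  interpret U: comm_group "units_of (G P)" by (rule M.units_comm_group)
  from fg_A obtain E where E: "finite E" "E \<subseteq> carrier A" "\<forall>H. submonoid H A \<and> E \<subseteq> H \<longrightarrow> H = carrier A"
    unfolding finitely_generated_monoid_def by (elim exE conjE) (rule that)
  define F where "F = \<iota> P ` (E - P)"
  let ?H = "{a \<in> carrier A. a \<in> P \<or> \<iota> P a \<in> generate (units_of (G P)) F}"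
  have F: "F \<subseteq> Units (G P)" using \<iota>_unit_iff[OF P] E(2) by (auto simp: F_def)
  have FU: "F \<subseteq> carrier (units_of (G P))" using F by (simp add: units_of_carrier)
  have gen: "generate (units_of (G P)) F \<subseteq> Units (G P)" using U.generate_incl[OF FU] by (simp add: units_of_carrier)
  have sub: "submonoid ?H A"
  proof
    show "\<one>\<^bsub>A\<^esub> \<in> ?H" using \<iota>_one[OF P] generate.one[of "units_of (G P)" F] by (simp add: units_of_one)
    fix a b assume ab: "a \<in> ?H" "b \<in> ?H"
    show "a \<otimes>\<^bsub>A\<^esub> b \<in> ?H"
    proof (cases "a \<in> P \<or> b \<in> P")
      case True
      then show ?thesis using A.prime_mult[OF P, of a b] ab by auto
    next
      case False
      then have "\<iota> P a \<otimes>\<^bsub>units_of (G P)\<^esub> \<iota> P b \<in> generate (units_of (G P)) F"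
        using ab generate.eng[of "\<iota> P a" "units_of (G P)" F "\<iota> P b"] by simp
      then show ?thesis using ab \<iota>_mult[of a b P] by (simp add: units_of_mult)
    qed
  qed auto
  have EH: "E \<subseteq> ?H" using E(2) generate.incl[of _ F "units_of (G P)"] by (auto simp: F_def)
  have H: "?H = carrier A" by (rule mp[OF spec[OF E(3)] conjI[OF sub EH]])
  have in_gen: "\<iota> P a \<in> generate (units_of (G P)) F" if "a \<in> carrier A" "a \<notin> P" for a
  proof -
    have "a \<in> ?H" unfolding H by (rule that(1))
    then show ?thesis using that(2) by simp
  qed
  have "u \<in> generate (units_of (G P)) F" if u: "u \<in> Units (G P)" for u
  proof -
    have uc: "u \<in> carrier (G P)" by (rule M.Units_closed[OF u])
    from \<iota>_surj[OF P uc] obtain a g where ag: "a \<in> carrier A" "g \<in> carrier A - P" "\<iota> P g \<otimes>\<^bsub>G P\<^esub> u = \<iota> P a"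
      by (elim bexE) (rule that)
    have gU: "\<iota> P g \<in> Units (G P)" using \<iota>_unit_iff[OF P, of g] ag(2) by simp
    have "\<iota> P a \<in> Units (G P)" unfolding ag(3)[symmetric] by (rule M.Units_m_closed[OF gU u])
    then have a: "\<iota> P a \<in> generate (units_of (G P)) F" using \<iota>_unit_iff[OF P ag(1)] in_gen[OF ag(1)] by simp
    have g: "\<iota> P g \<in> generate (units_of (G P)) F" using in_gen[of g] ag(2) by simp
    have c: "u \<in> carrier (units_of (G P))" "\<iota> P g \<in> carrier (units_of (G P))" "\<iota> P a \<in> carrier (units_of (G P))"
      using u gU a gen by (auto simp: units_of_carrier)
    have "u = inv\<^bsub>units_of (G P)\<^esub> \<iota> P g \<otimes>\<^bsub>units_of (G P)\<^esub> \<iota> P a"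
      using U.inv_solve_left'[of u "\<iota> P g" "\<iota> P a"] c ag(3) by (simp add: units_of_mult)
    also have "\<dots> \<in> generate (units_of (G P)) F"
      by (rule generate.eng[OF U.generate_m_inv_closed[OF FU g] a])
    finally show ?thesis .
  qed
  then show ?thesis using F gen E(1) by (intro exI[of _ F]) (auto simp: F_def)
qed

end

text \<open>The set \<open>Su\<close> freed from the chart: for affine opens its complement is the
  prime of the sections over \<open>U\<close> that corresponds to \<open>V\<close>.\<close>

definition unit_set :: "('p, 'm) monoidal_space \<Rightarrow> 'p set \<Rightarrow> 'p set \<Rightarrow> 'm set" where
  "unit_set X V U = {b \<in> carrier (sect X U). restr X U V b \<in> Units (sect X V)}"

context F1_scheme_of_finite_type
begin

text \<open>A member of the cover that contains the closed point of \<open>U\<close> contains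
  \<open>U\<close>, the least neighbourhood of this point.\<close>

lemma affine_in_chart:
  assumes "affine_open X U"
  shows "\<exists>U0 A f \<phi>. chart X U0 A f \<phi> \<and> U \<subseteq> U0"
proof -
  from finite_type obtain \<U> where \<U>: "\<Union>\<U> = topspace (topo X)"
    "\<forall>U\<in>\<U>. openin (topo X) U \<and> (\<exists>A f \<phi>. comm_monoid (A :: 'm monoid) \<and> finitely_generated_monoid A \<and>
          monoidal_space_iso (open_subspace X U) (monoid_spec A) f \<phi>)" by (elim exE conjE) (rule that)
  from affine_open_minimal[OF assms] obtain c where c: "c \<in> U" "\<forall>O'. openin (topo X) O' \<and> c \<in> O' \<longrightarrow> U \<subseteq> O'"
    by (elim bexE) (rule that)
  have "c \<in> \<Union>\<U>" using c(1) openin_subset[OF affine_open_open[OF assms]] \<U>(1) by blast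
  then obtain U0 where U0: "U0 \<in> \<U>" "c \<in> U0" by (elim UnionE) (rule that)
  from bspec[OF \<U>(2) U0(1)] obtain A f \<phi> where A: "openin (topo X) U0" "comm_monoid (A :: 'm monoid)"
    "finitely_generated_monoid A" "monoidal_space_iso (open_subspace X U0) (monoid_spec A) f \<phi>"
    by (elim exE conjE) (rule that)
  have "chart X U0 A f \<phi>" by (intro chart.intro chart_axioms.intro monoid_sheaf_axioms A)
  moreover have "U \<subseteq> U0" using c(2) A(1) U0(2) by simp
  ultimately show ?thesis by blast
qed

text \<open>For the same reason each affine open lies in a member of the finite cover, and inside
  one member there are at most as many as there are primes of a finitely generated monoid.\<close>

lemma finite_affine_opens: "finite {U. affine_open X U}"
proof -
  from finite_type obtain \<U> where \<U>: "finite \<U>" "\<Union>\<U> = topspace (topo X)"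
    "\<forall>U\<in>\<U>. openin (topo X) U \<and> (\<exists>A f \<phi>. comm_monoid (A :: 'm monoid) \<and> finitely_generated_monoid A \<and>
          monoidal_space_iso (open_subspace X U) (monoid_spec A) f \<phi>)" by (elim exE conjE) (rule that)
  have "finite {V. affine_open X V \<and> V \<subseteq> U}" if "U \<in> \<U>" for U
  proof -
    from bspec[OF \<U>(3) that] obtain A f \<phi> where A: "openin (topo X) U" "comm_monoid (A :: 'm monoid)"
      "finitely_generated_monoid A" "monoidal_space_iso (open_subspace X U) (monoid_spec A) f \<phi>"
      by (elim exE conjE) (rule that)
    have "chart X U A f \<phi>" by (intro chart.intro chart_axioms.intro monoid_sheaf_axioms A)
    then show ?thesis by (rule chart.finite_affine_subsets)
  qed
  then have "finite (\<Union>U\<in>\<U>. {V. affine_open X V \<and> V \<subseteq> U})" using \<U>(1) by simp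
  moreover have "{U. affine_open X U} \<subseteq> (\<Union>U\<in>\<U>. {V. affine_open X V \<and> V \<subseteq> U})"
  proof
    fix V assume "V \<in> {U. affine_open X U}"
    then have V: "affine_open X V" by simp
    from affine_open_minimal[OF V] obtain c where c: "c \<in> V" "\<forall>O'. openin (topo X) O' \<and> c \<in> O' \<longrightarrow> V \<subseteq> O'"
      by (elim bexE) (rule that)
    have "c \<in> \<Union>\<U>" using c(1) openin_subset[OF affine_open_open[OF V]] \<U>(2) by blast
    then obtain U where U: "U \<in> \<U>" "c \<in> U" by (elim UnionE) (rule that)
    have "V \<subseteq> U" using c(2) \<U>(3) U by simp
    then show "V \<in> (\<Union>U\<in>\<U>. {V. affine_open X V \<and> V \<subseteq> U})" using U(1) V by blast
  qed
  ultimately show ?thesis by (rule finite_subset[rotated])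
qed

lemma sect_comm_monoid: "affine_open X U \<Longrightarrow> comm_monoid (sect X U)"
  by (rule sect_monoid[OF affine_open_open])

text \<open>In a chart around \<open>U\<close> the sections over both opens are localisations of one
  finitely generated monoid, so the results on \<open>Su\<close> apply; the conclusions no longer
  mention the chart.\<close>

lemma affine_localisation:
  assumes U: "affine_open X U" "affine_open X V" "V \<subseteq> U"
  shows "localisation_hom (sect X U) (sect X V) (restr X U V) (unit_set X V U)"
    and "\<exists>g\<in>unit_set X V U. \<forall>\<pp>. monoid_prime \<pp> (sect X U) \<and> g \<notin> \<pp> \<longrightarrow> \<pp> \<inter> unit_set X V U = {}"
proof -
  from affine_in_chart[OF U(1)] obtain U0 A f \<phi> where c: "chart X U0 A f \<phi>" "U \<subseteq> U0" by (elim exE conjE) (rule that)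
  interpret c: chart X U0 A f \<phi> by (rule c(1))
  from c.affine_eq_W[OF U(1) c(2)] obtain P where P: "P \<in> {P. monoid_prime P A}" "U = c.W P" by (elim bexE) (rule that)
  from c.affine_eq_W[OF U(2) subset_trans[OF U(3) c(2)]] obtain Q where Q: "Q \<in> {P. monoid_prime P A}" "V = c.W Q"
    by (elim bexE) (rule that)
  have QP: "Q \<subseteq> P" using c.W_subset_iff[OF Q(1)] U(3) unfolding P(2) Q(2) by simp
  have S: "unit_set X V U = c.Su P Q" unfolding unit_set_def c.Su_def P(2) Q(2) ..
  show "localisation_hom (sect X U) (sect X V) (restr X U V) (unit_set X V U)"
    unfolding S unfolding P(2) Q(2) by (rule c.rs_localisation[OF P(1) Q(1) QP])
  from c.Su_generator[OF P(1) Q(1) QP] obtain g where g: "g \<in> c.Su P Q"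
    "\<forall>\<pp>. monoid_prime \<pp> (c.G P) \<and> g \<notin> \<pp> \<longrightarrow> \<pp> \<subseteq> c.pm P Q" by (elim bexE) (rule that)
  have "\<pp> \<inter> c.Su P Q = {}" if "monoid_prime \<pp> (c.G P)" "g \<notin> \<pp>" for \<pp>
  proof -
    have "\<pp> \<subseteq> c.pm P Q" using g(2) that by simp
    then show ?thesis by (auto simp: c.pm_def)
  qed
  then show "\<exists>g\<in>unit_set X V U. \<forall>\<pp>. monoid_prime \<pp> (sect X U) \<and> g \<notin> \<pp> \<longrightarrow> \<pp> \<inter> unit_set X V U = {}"
    unfolding S unfolding P(2) using g(1) by (intro bexI[of _ g]) auto
qed

text \<open>Together with \<open>unit_set_inj\<close>, each prime of the monoid of sections over
  \<open>U\<close> belongs to exactly one affine open inside \<open>U\<close>. This is the source of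
  the centres.\<close>

lemma affine_prime:
  assumes U: "affine_open X U" and p: "monoid_prime \<pp> (sect X U)"
  shows "\<exists>V. affine_open X V \<and> V \<subseteq> U \<and> \<pp> = carrier (sect X U) - unit_set X V U"
proof -
  from affine_in_chart[OF U(1)] obtain U0 A f \<phi> where c: "chart X U0 A f \<phi>" "U \<subseteq> U0" by (elim exE conjE) (rule that)
  interpret c: chart X U0 A f \<phi> by (rule c(1))
  from c.affine_eq_W[OF U(1) c(2)] obtain P where P: "P \<in> {P. monoid_prime P A}" "U = c.W P" by (elim bexE) (rule that)
  note q = c.qof_prime[OF P(1) p[unfolded P(2)]]
  show ?thesis
  proof (intro exI[of _ "c.W (c.qof P \<pp>)"] conjI)
    show "affine_open X (c.W (c.qof P \<pp>))" by (rule c.affine_W[OF q(1)])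
    show "c.W (c.qof P \<pp>) \<subseteq> U" unfolding P(2) by (rule c.W_mono[OF q(2)])
    show "\<pp> = carrier (sect X U) - unit_set X (c.W (c.qof P \<pp>)) U"
      using q(3) unfolding P(2) c.pm_def c.Su_def unit_set_def by (rule sym)
  qed
qed

lemma unit_set_inj:
  assumes U: "affine_open X U" "affine_open X V" "affine_open X V'" "V \<subseteq> U" "V' \<subseteq> U"
    and eq: "unit_set X V U = unit_set X V' U"
  shows "V = V'"
proof -
  from affine_in_chart[OF U(1)] obtain U0 A f \<phi> where c: "chart X U0 A f \<phi>" "U \<subseteq> U0" by (elim exE conjE) (rule that)
  interpret c: chart X U0 A f \<phi> by (rule c(1))
  from c.affine_eq_W[OF U(1) c(2)] obtain P where P: "P \<in> {P. monoid_prime P A}" "U = c.W P" by (elim bexE) (rule that)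
  from c.affine_eq_W[OF U(2) subset_trans[OF U(4) c(2)]] obtain Q where Q: "Q \<in> {P. monoid_prime P A}" "V = c.W Q"
    by (elim bexE) (rule that)
  from c.affine_eq_W[OF U(3) subset_trans[OF U(5) c(2)]] obtain Q' where Q': "Q' \<in> {P. monoid_prime P A}" "V' = c.W Q'"
    by (elim bexE) (rule that)
  have QP: "Q \<subseteq> P" using c.W_subset_iff[OF Q(1)] U(4) unfolding P(2) Q(2) by simp
  have QP': "Q' \<subseteq> P" using c.W_subset_iff[OF Q'(1)] U(5) unfolding P(2) Q'(2) by simp
  have "c.pm P Q = c.pm P Q'"
    using eq unfolding unit_set_def P(2) Q(2) Q'(2) c.pm_def c.Su_def by (rule arg_cong)
  then have "Q \<subseteq> Q'" "Q' \<subseteq> Q"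
    using c.pm_subset_iff[OF P(1) Q(1) QP Q'(1) QP'] c.pm_subset_iff[OF P(1) Q'(1) QP' Q(1) QP] by simp_all
  then show ?thesis unfolding Q(2) Q'(2) by (intro arg_cong[of _ _ c.W] equalityI)
qed

lemma affine_Units_finitely_generated:
  assumes U: "affine_open X U"
  shows "\<exists>F. finite F \<and> F \<subseteq> Units (sect X U) \<and> generate (units_of (sect X U)) F = Units (sect X U)"
proof -
  from affine_in_chart[OF U(1)] obtain U0 A f \<phi> where c: "chart X U0 A f \<phi>" "U \<subseteq> U0" by (elim exE conjE) (rule that)
  interpret c: chart X U0 A f \<phi> by (rule c(1))
  from c.affine_eq_W[OF U(1) c(2)] obtain P where P: "P \<in> {P. monoid_prime P A}" "U = c.W P" by (elim bexE) (rule that)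
  show ?thesis unfolding P(2) by (rule c.Units_finitely_generated[OF P(1)])
qed

end

subsection \<open>The diagram of monoid rings\<close>

lemma monoid_prime_frag_of:
  assumes A: "comm_monoid A" and q: "primeideal q (monoid_ring A)"
  shows "monoid_prime {m \<in> carrier A. frag_of m \<in> q} A"
    and "u \<in> Units A \<Longrightarrow> frag_of u \<notin> q"
proof -
  interpret A: comm_monoid A by fact
  interpret Sp: spectrum "monoid_ring A" "{p. primeideal p (monoid_ring A)}" "zariski (monoid_ring A)"
    by (rule spectrum_ring[OF cring_monoid_ring[OF A]])
  have qq: "q \<in> {p. primeideal p (monoid_ring A)}" using q by simp
  show "frag_of u \<notin> q" if "u \<in> Units A" for u
    using Sp.prime_unit[OF qq] Units_monoid_ring[OF A that] by simp
  then have one: "frag_of \<one>\<^bsub>A\<^esub> \<notin> q" by simp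
  have m: "frag_of (a \<otimes>\<^bsub>A\<^esub> b) \<in> q \<longleftrightarrow> frag_of a \<in> q \<or> frag_of b \<in> q"
    if "a \<in> carrier A" "b \<in> carrier A" for a b
    using Sp.prime_mult[OF qq, of "frag_of a" "frag_of b"] that by simp
  have "submonoid (carrier A - {m \<in> carrier A. frag_of m \<in> q}) A"
    by unfold_locales (auto simp: m one)
  moreover have "monoid_ideal {m \<in> carrier A. frag_of m \<in> q} A"
    unfolding monoid_ideal_def by (auto simp: m)
  ultimately show "monoid_prime {m \<in> carrier A. frag_of m \<in> q} A" by (simp add: monoid_prime_def)
qed

text \<open>For primes of the monoid ring: lying over the closed point of the spectrum of
  \<open>M\<close>. One inclusion is enough to say so, since a unit of \<open>M\<close> stays a unit
  in the ring and is in no prime.\<close>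

definition unit_centred :: "'m monoid \<Rightarrow> ('m \<Rightarrow>\<^sub>0 int) set \<Rightarrow> bool" where
  "unit_centred M p \<longleftrightarrow> (\<forall>m\<in>carrier M - Units M. frag_of m \<in> p)"

lemma frag_of_mem_unit_centred:
  assumes "comm_monoid M" "primeideal p (monoid_ring M)" "unit_centred M p" "m \<in> carrier M"
  shows "frag_of m \<in> p \<longleftrightarrow> m \<notin> Units M"
  using monoid_prime_frag_of(2)[OF assms(1,2), of m] assms(3,4) by (auto simp: unit_centred_def)

context F1_scheme_of_finite_type
begin

abbreviation R where "R U \<equiv> monoid_ring (sect X U)"
abbreviation h where "h V U \<equiv> monoid_ring_map (restr X U V)"
abbreviation S where "S V U \<equiv> frag_of ` unit_set X V U"
abbreviation loc where "loc U \<equiv> unit_centred (sect X U)"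

lemma ring_localisation:
  assumes "affine_open X U" "affine_open X V" "V \<subseteq> U"
  shows "ring_localisation_hom (R U) (R V) (h V U) (S V U)"
proof -
  note L = affine_localisation(1)[OF assms]
  note hm = localisation_hom.hom[OF L] localisation_hom.hom_one[OF L]
  show ?thesis
    by (intro ring_localisation_hom.intro ring_localisation_hom_axioms.intro localisation_hom_monoid_ring L
      cring_monoid_ring sect_comm_monoid assms monoid_ring_map_hom hm)
qed

text \<open>The charts are ordered by inclusion of affine opens, and the centre of a prime
  \<open>q\<close> lies in the affine open that belongs to the contraction of \<open>q\<close> to
  the monoid.\<close>

lemma glue_diagram_affine: "glue_diagram {U. affine_open X U} (\<subseteq>) R h S loc"
proof (rule glue_diagram.intro, simp_all only: mem_Collect_eq)
  fix U V assume U: "affine_open X V" "affine_open X U" "V \<subseteq> U"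
  show "ring_localisation_hom (R U) (R V) (h V U) (S V U)" by (rule ring_localisation[OF U(2,1,3)])
  from affine_localisation(2)[OF U(2,1,3)] obtain g where g: "g \<in> unit_set X V U"
    "\<forall>\<pp>. monoid_prime \<pp> (sect X U) \<and> g \<notin> \<pp> \<longrightarrow> \<pp> \<inter> unit_set X V U = {}" by (elim bexE) (rule that)
  \<comment> \<open>The element that separates monoid primes also separates primes of the monoid
    ring, because only their contractions matter.\<close>
  show "\<exists>f\<in>S V U. \<forall>q. primeideal q (R U) \<and> f \<notin> q \<longrightarrow> q \<inter> S V U = {}"
  proof (intro bexI[of _ "frag_of g"] allI impI; (elim conjE)?)
    fix q assume q: "primeideal q (R U)" "frag_of g \<notin> q"
    have "{m \<in> carrier (sect X U). frag_of m \<in> q} \<inter> unit_set X V U = {}"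
      using spec[OF g(2), of "{m \<in> carrier (sect X U). frag_of m \<in> q}"]
        monoid_prime_frag_of(1)[OF sect_comm_monoid[OF U(2)] q(1)] q(2) by simp
    then show "q \<inter> S V U = {}" by (auto simp: unit_set_def)
  qed (use g(1) in simp)
next
  fix U a assume U: "affine_open X U" and a: "a \<in> carrier (R U)"
  show "h U U a = a" using a
  proof (induction rule: monoid_ring_induct)
    case zero show ?case by (simp add: monoid_ring_map_def)
  next
    case (one a) then show ?case using restr_id[OF affine_open_open[OF U]] by simp
  next
    case (diff c d) then show ?case by (simp add: monoid_ring_map_diff)
  qed
next
  fix W V U a assume U: "affine_open X W" "affine_open X V" "affine_open X U" "W \<subseteq> V" "V \<subseteq> U"
    and a: "a \<in> carrier (R U)"
  show "h W V (h V U a) = h W U a" using a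
  proof (induction rule: monoid_ring_induct)
    case zero show ?case by (simp add: monoid_ring_map_def)
  next
    case (one a) then show ?case
      using restr_comp[OF affine_open_open[OF U(3)] affine_open_open[OF U(2)] affine_open_open[OF U(1)] U(4,5)] by simp
  next
    case (diff c d) then show ?case by (simp add: monoid_ring_map_diff)
  qed
next
  fix U q assume U: "affine_open X U" and q: "primeideal q (R U)"
  note M = sect_comm_monoid[OF U]
  \<comment> \<open>The contraction of \<open>q\<close> to the monoid of sections determines
    \<open>V\<close>; as \<open>q\<close> avoids the sections that become units there, it extends to
    the ring of \<open>V\<close>.\<close>
  from affine_prime[OF U monoid_prime_frag_of(1)[OF M q]] obtain V where V: "affine_open X V" "V \<subseteq> U"
    "{m \<in> carrier (sect X U). frag_of m \<in> q} = carrier (sect X U) - unit_set X V U" by (elim exE conjE) (rule that)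
  have mem: "frag_of m \<in> q \<longleftrightarrow> m \<notin> unit_set X V U" if "m \<in> carrier (sect X U)" for m
    using set_eq_iff[THEN iffD1, OF V(3), rule_format, of m] that by simp
  interpret L: localisation_hom "sect X U" "sect X V" "restr X U V" "unit_set X V U"
    by (rule affine_localisation(1)[OF U V(1,2)])
  interpret RL: ring_localisation_hom "R U" "R V" "h V U" "S V U" by (rule ring_localisation[OF U V(1,2)])
  interpret V: comm_monoid "sect X V" by (rule sect_comm_monoid[OF V(1)])
  have "q \<inter> S V U = {}" using mem by (auto simp: unit_set_def)
  from RL.prime_lift[OF q this] obtain r where r: "primeideal r (R V)" "ring_spec_map (R U) (h V U) r = q"
    by (elim exE conjE) (rule that)
  \<comment> \<open>A nonunit \<open>m\<close> over \<open>V\<close> is a quotient of restrictions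
    of \<open>a\<close> and \<open>b\<close>. If \<open>a\<close> became a unit on \<open>V\<close>,
    so would \<open>m\<close>; hence \<open>a\<close> is in \<open>q\<close> and \<open>m\<close> in
    the lifted prime.\<close>
  have "frag_of m \<in> r" if m: "m \<in> carrier (sect X V)" "m \<notin> Units (sect X V)" for m
  proof -
    from L.surj[OF m(1)] obtain a b where ab: "a \<in> carrier (sect X U)" "b \<in> unit_set X V U"
      "restr X U V b \<otimes>\<^bsub>sect X V\<^esub> m = restr X U V a" by (elim bexE) (rule that)
    have bc: "b \<in> carrier (sect X U)" using ab(2) by (simp add: unit_set_def)
    have "a \<notin> unit_set X V U"
    proof
      assume "a \<in> unit_set X V U"
      then have "m \<otimes>\<^bsub>sect X V\<^esub> restr X U V b \<in> Units (sect X V)"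
        using ab(3) V.m_comm[OF m(1) L.h_carr[OF bc]] by (simp add: unit_set_def)
      then show False using V.unit_factor[OF _ m(1) L.h_carr[OF bc]] m(2) by simp
    qed
    then have "frag_of a \<in> q" using mem[OF ab(1)] by simp
    moreover have "h V U (frag_of b) \<otimes>\<^bsub>R V\<^esub> frag_of m = h V U (frag_of a)" using ab(3) by simp
    ultimately show ?thesis
      using RL.mem_iff_numerator[OF r(1), of "frag_of m" "frag_of a" "frag_of b"] m(1) ab(1,2) r(2) by simp
  qed
  then have "loc V r" by (simp add: unit_centred_def)
  with V(1,2) r show "\<exists>i r. affine_open X i \<and> i \<subseteq> U \<and> primeideal r (R i) \<and> loc i r \<and> ring_spec_map (R U) (h i U) r = q"
    by - (rule exI[of _ V], rule exI[of _ r], simp)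
next
  fix V V' U r r' assume U: "affine_open X V" "affine_open X V'" "affine_open X U" "V \<subseteq> U" "V' \<subseteq> U"
    and r: "primeideal r (R V)" "primeideal r' (R V')" "loc V r" "loc V' r'"
    and eq: "ring_spec_map (R U) (h V U) r = ring_spec_map (R U) (h V' U) r'"
  \<comment> \<open>The pulled back prime remembers which sections over \<open>U\<close> become
    units on \<open>V\<close>, and by \<open>unit_set_inj\<close> these determine
    \<open>V\<close>.\<close>
  have key: "frag_of m \<in> ring_spec_map (R U) (h V U) r \<longleftrightarrow> m \<notin> unit_set X V U"
    if "affine_open X V" "V \<subseteq> U" "primeideal r (R V)" "loc V r" "m \<in> carrier (sect X U)" for V r m
  proof -
    interpret L: localisation_hom "sect X U" "sect X V" "restr X U V" "unit_set X V U"
      by (rule affine_localisation(1)[OF U(3) that(1,2)])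
    show ?thesis
      using frag_of_mem_unit_centred[OF sect_comm_monoid[OF that(1)] that(3,4) L.h_carr[OF that(5)]] that(5)
      by (simp add: ring_spec_map_def unit_set_def)
  qed
  have "unit_set X V U = unit_set X V' U"
  proof (rule Set.set_eqI)
    fix m
    show "m \<in> unit_set X V U \<longleftrightarrow> m \<in> unit_set X V' U"
      using key[OF U(1,4) r(1,3), of m] key[OF U(2,5) r(2,4), of m] eq
      by (cases "m \<in> carrier (sect X U)") (auto simp: unit_set_def)
  qed
  then show "V = V'" by (rule unit_set_inj[OF U(3,1,2,4,5)])
qed

lemma ascent_eq: "ascent X = glue_diagram.Y {U. affine_open X U} (\<subseteq>) R h"
  unfolding ascent_def Let_def glue_diagram.Y_def[OF glue_diagram_affine] ..

end

subsection \<open>Counting points\<close>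

lemma (in field) card_units_of: "finite (carrier R) \<Longrightarrow> card (carrier (units_of R)) = card (carrier R) - 1"
  by (simp add: units_of_carrier field_Units)

text \<open>
  A homomorphism out of \<open>\<int>[M]\<close> whose kernel is centred at the nonunits vanishes on them, so it is a
  character of the group of units, extended by zero.
\<close>

lemma bij_unit_centred_homs:
  fixes K :: "'k ring"
  assumes M: "comm_monoid M" and K: "field K"
  defines "D \<equiv> {\<psi> \<in> ring_hom (monoid_ring M) K. \<psi> \<in> extensional (carrier (monoid_ring M)) \<and>
    unit_centred M {a \<in> carrier (monoid_ring M). \<psi> a = \<zero>\<^bsub>K\<^esub>}}"
  shows "bij_betw (\<lambda>\<psi>. \<lambda>u\<in>Units M. \<psi> (frag_of u)) D (ext_homs (units_of M) (Units M) (units_of K))"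
    (is "bij_betw ?b _ _")
proof -
  interpret M: comm_monoid M by fact
  interpret K: field K by fact
  interpret MR: cring "monoid_ring M" by (rule cring_monoid_ring[OF M])
  have D: "\<psi> \<in> ring_hom (monoid_ring M) K" "\<psi> \<in> extensional (carrier (monoid_ring M))" if "\<psi> \<in> D" for \<psi>
    using that by (auto simp: D_def)
  have D_nonunit: "\<psi> (frag_of m) = \<zero>\<^bsub>K\<^esub>" if "\<psi> \<in> D" "m \<in> carrier M" "m \<notin> Units M" for \<psi> m
    using that by (auto simp: D_def unit_centred_def)
  have mult: "\<psi> (frag_of (a \<otimes>\<^bsub>M\<^esub> b)) = \<psi> (frag_of a) \<otimes>\<^bsub>K\<^esub> \<psi> (frag_of b)"
    if "\<psi> \<in> D" "a \<in> carrier M" "b \<in> carrier M" for \<psi> a b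
    using ring_hom_mult[OF D(1)[OF that(1)], of "frag_of a" "frag_of b"] that(2,3) by simp
  have closed: "\<psi> (frag_of a) \<in> carrier K" if "\<psi> \<in> D" "a \<in> carrier M" for \<psi> a
    using ring_hom_closed[OF D(1)[OF that(1)], of "frag_of a"] that(2) by simp
  have one: "\<psi> (frag_of \<one>\<^bsub>M\<^esub>) = \<one>\<^bsub>K\<^esub>" if "\<psi> \<in> D" for \<psi>
    using ring_hom_one[OF D(1)[OF that]] by simp
  have unit: "\<psi> (frag_of u) \<in> Units K" if "\<psi> \<in> D" "u \<in> Units M" for \<psi> u
  proof -
    have "\<psi> (frag_of u) \<otimes>\<^bsub>K\<^esub> \<psi> (frag_of (inv\<^bsub>M\<^esub> u)) = \<one>\<^bsub>K\<^esub>"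
      using mult[OF that(1), of u "inv\<^bsub>M\<^esub> u"] that(2) one[OF that(1)] by (simp add: M.Units_closed)
    then show ?thesis
      using K.unit_factor[of "\<psi> (frag_of u)" "\<psi> (frag_of (inv\<^bsub>M\<^esub> u))"] closed[OF that(1)] that(2) by (simp add: M.Units_closed)
  qed
  have maps: "?b \<psi> \<in> ext_homs (units_of M) (Units M) (units_of K)" if \<psi>: "\<psi> \<in> D" for \<psi>
    using unit[OF \<psi>] mult[OF \<psi>]
    by (auto simp: ext_homs_def hom_def units_of_carrier units_of_mult M.Units_closed)
  have inj: "\<psi> = \<psi>'" if \<psi>: "\<psi> \<in> D" "\<psi>' \<in> D" and eq: "?b \<psi> = ?b \<psi>'" for \<psi> \<psi>'
  proof (rule extensionalityI[OF D(2)[OF \<psi>(1)] D(2)[OF \<psi>(2)]])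
    fix c assume c: "c \<in> carrier (monoid_ring M)"
    show "\<psi> c = \<psi>' c"
    proof (rule monoid_ring_hom_eqI[OF M K.is_ring D(1)[OF \<psi>(1)] D(1)[OF \<psi>(2)] _ c])
      fix a assume a: "a \<in> carrier M"
      show "\<psi> (frag_of a) = \<psi>' (frag_of a)"
      proof (cases "a \<in> Units M")
        case True then show ?thesis using fun_cong[OF eq, of a] by simp
      next
        case False then show ?thesis using D_nonunit[OF \<psi>(1) a] D_nonunit[OF \<psi>(2) a] by simp
      qed
    qed
  qed
  have surj: "\<exists>\<psi>\<in>D. ?b \<psi> = \<chi>" if \<chi>: "\<chi> \<in> ext_homs (units_of M) (Units M) (units_of K)" for \<chi>
  proof -
    note E = ext_homsD[OF \<chi>]
    have \<chi>c: "\<chi> u \<in> Units K" if "u \<in> Units M" for u using E(2)[OF that] by (simp add: units_of_carrier)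
    have \<chi>m: "\<chi> (u \<otimes>\<^bsub>M\<^esub> v) = \<chi> u \<otimes>\<^bsub>K\<^esub> \<chi> v" if "u \<in> Units M" "v \<in> Units M" for u v
      using E(3)[OF that] by (simp add: units_of_mult)
    \<comment> \<open>Elements of \<open>hom\<close> are only multiplicative, so the value at the
      unit is known to be idempotent; being a unit of \<open>K\<close>, it is 1.\<close>
    have "\<chi> \<one>\<^bsub>M\<^esub> \<otimes>\<^bsub>K\<^esub> \<chi> \<one>\<^bsub>M\<^esub> = \<chi> \<one>\<^bsub>M\<^esub> \<otimes>\<^bsub>K\<^esub> \<one>\<^bsub>K\<^esub>"
      using \<chi>m[of "\<one>\<^bsub>M\<^esub>" "\<one>\<^bsub>M\<^esub>"] \<chi>c[of "\<one>\<^bsub>M\<^esub>"] by (simp add: K.Units_closed)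
    then have \<chi>1: "\<chi> \<one>\<^bsub>M\<^esub> = \<one>\<^bsub>K\<^esub>"
      using K.Units_l_cancel[OF \<chi>c K.Units_closed[OF \<chi>c] K.one_closed] by (rule iffD1[rotated]) simp_all
    \<comment> \<open>Extension by zero is multiplicative because a product is a unit of
      \<open>M\<close> only if both factors are.\<close>
    define \<chi>0 where "\<chi>0 a = (if a \<in> Units M then \<chi> a else \<zero>\<^bsub>K\<^esub>)" for a
    have \<chi>0c: "\<chi>0 a \<in> carrier K" for a using \<chi>c[of a] by (simp add: \<chi>0_def K.Units_closed)
    have "\<chi>0 (a \<otimes>\<^bsub>M\<^esub> b) = \<chi>0 a \<otimes>\<^bsub>K\<^esub> \<chi>0 b" if ab: "a \<in> carrier M" "b \<in> carrier M" for a b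
    proof (cases "a \<in> Units M \<and> b \<in> Units M")
      case True then show ?thesis using \<chi>m by (simp add: \<chi>0_def)
    next
      case False
      have "a \<otimes>\<^bsub>M\<^esub> b \<notin> Units M"
        using False M.unit_factor[OF _ ab] M.unit_factor[OF _ ab(2,1)] M.m_comm[OF ab] by auto
      moreover have "\<chi>0 a = \<zero>\<^bsub>K\<^esub> \<or> \<chi>0 b = \<zero>\<^bsub>K\<^esub>" using False by (auto simp: \<chi>0_def)
      ultimately show ?thesis using \<chi>0c[of a] \<chi>0c[of b] by (auto simp: \<chi>0_def)
    qed
    then have "\<chi>0 \<in> hom M K" using \<chi>0c by (auto simp: hom_def)
    moreover have "\<chi>0 \<one>\<^bsub>M\<^esub> = \<one>\<^bsub>K\<^esub>" using \<chi>1 by (simp add: \<chi>0_def)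
    ultimately obtain \<psi> where \<psi>: "\<psi> \<in> ring_hom (monoid_ring M) K" "\<forall>a\<in>carrier M. \<psi> (frag_of a) = \<chi>0 a"
      using monoid_ring_universal[OF M K.is_cring] by (elim bexE[rotated]) auto
    let ?\<psi> = "restrict \<psi> (carrier (monoid_ring M))"
    have "?\<psi> \<in> ring_hom (monoid_ring M) K"
      by (rule MR.ring_hom_restrict[OF \<psi>(1)]) simp
    moreover have r: "?\<psi> (frag_of a) = \<chi>0 a" if "a \<in> carrier M" for a using \<psi>(2) that by simp
    ultimately have "?\<psi> \<in> D" unfolding D_def unit_centred_def by (auto simp: \<chi>0_def)
    moreover have "?b ?\<psi> = \<chi>"
    proof (rule extensionalityI[OF _ E(1)])
      fix u assume u: "u \<in> Units M"
      then show "?b ?\<psi> u = \<chi> u" using r[OF M.Units_closed[OF u]] by (simp add: \<chi>0_def)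
    qed simp
    ultimately show ?thesis by (rule bexI[of _ ?\<psi>, rotated])
  qed
  show ?thesis
    unfolding bij_betw_def
  proof (intro conjI equalityI subsetI inj_onI)
    fix \<chi> assume "\<chi> \<in> ext_homs (units_of M) (Units M) (units_of K)"
    from surj[OF this] show "\<chi> \<in> ?b ` D" by (elim bexE) (rule image_eqI[OF sym])
  next
    fix \<chi> assume "\<chi> \<in> ?b ` D"
    then show "\<chi> \<in> ext_homs (units_of M) (Units M) (units_of K)" by (elim imageE) (simp only: maps)
  qed (rule inj)
qed

context F1_scheme_of_finite_type
begin

text \<open>Only finitely many affine opens contribute, so the product of their constants
  \<open>e U\<close> is positive and serves all of them at once.\<close>

lemma ex_counts_points: "\<exists>e N. e > 0 \<and> counts_points X e N"
proof -
  let ?I = "{U. affine_open X U}"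
  let ?H = "\<lambda>U C. ext_homs (units_of (sect X U)) (Units (sect X U)) C"
  have "\<exists>e r::nat. e > 0 \<and> (\<forall>C :: nat monoid. comm_group C \<and> finite (carrier C) \<and> coprime (card (carrier C)) e \<longrightarrow>
      finite (?H U C) \<and> card (?H U C) = card (carrier C) ^ r)" if U: "affine_open X U" for U
  proof -
    interpret M: comm_monoid "sect X U" by (rule sect_comm_monoid[OF U])
    from affine_Units_finitely_generated[OF U] obtain F where F: "finite F" "F \<subseteq> Units (sect X U)"
      "generate (units_of (sect X U)) F = Units (sect X U)" by (elim exE conjE) (rule that)
    have "F \<subseteq> carrier (units_of (sect X U))" using F(2) by (simp add: units_of_carrier)
    from card_ext_homs_generate[OF M.units_comm_group F(1) this] show ?thesis unfolding F(3) .
  qed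
  then have "\<forall>U\<in>?I. \<exists>e r::nat. e > 0 \<and> (\<forall>C :: nat monoid. comm_group C \<and> finite (carrier C) \<and> coprime (card (carrier C)) e \<longrightarrow>
      finite (?H U C) \<and> card (?H U C) = card (carrier C) ^ r)" by simp
  from bchoice[OF this] obtain e where e: "\<forall>U\<in>?I. \<exists>r::nat. e U > 0 \<and> (\<forall>C :: nat monoid. comm_group C \<and> finite (carrier C) \<and>
      coprime (card (carrier C)) (e U) \<longrightarrow> finite (?H U C) \<and> card (?H U C) = card (carrier C) ^ r)" by (elim exE) (rule that)
  from bchoice[OF e] obtain r where er: "\<forall>U\<in>?I. e U > 0 \<and> (\<forall>C :: nat monoid. comm_group C \<and> finite (carrier C) \<and>
      coprime (card (carrier C)) (e U) \<longrightarrow> finite (?H U C) \<and> card (?H U C) = card (carrier C) ^ r U)" by (elim exE) (rule that)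
  define e0 where "e0 = prod e ?I"
  \<comment> \<open>Characters with values in the \<open>q - 1\<close> units of the field number
    \<open>(q - 1) ^ r U\<close> for each affine open \<open>U\<close>; \<open>[:-1, 1:]\<close> is
    the polynomial that takes the value \<open>q - 1\<close> at \<open>q\<close>.\<close>
  define N :: "int poly" where "N = (\<Sum>U\<in>?I. [:-1, 1:] ^ r U)"
  have "e0 > 0" unfolding e0_def by (rule prod_pos) (use er in auto)
  moreover have "counts_points X e0 N"
    unfolding counts_points_def
  proof (intro allI impI; (elim conjE)?)
    fix q :: nat and K :: "nat ring"
    assume q: "primepow q" "gcd (q - 1) e0 = 1" and K: "field K" "card (carrier K) = q"
    interpret K: field K by (rule K(1))
    have q0: "q > 0" using primepow_gt_0_nat[OF q(1)] .
    then have finK: "finite (carrier K)" using K(2) card_ge_0_finite by blast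
    interpret gp: glue_points ?I "(\<subseteq>)" R h S loc K
      by (intro glue_points.intro glue_diagram_affine field_spec.intro K(1))
    let ?D = "\<lambda>U. {\<psi> \<in> ring_hom (R U) K. \<psi> \<in> extensional (carrier (R U)) \<and> loc U {a \<in> carrier (R U). \<psi> a = \<zero>\<^bsub>K\<^esub>}}"
    have card: "card (carrier (units_of K)) = q - 1" using K.card_units_of[OF finK] K(2) by simp
    have fin: "finite (carrier (units_of K))"
      by (rule finite_subset[OF _ finK]) (auto simp: units_of_carrier K.Units_closed)
    have D: "finite (?D U) \<and> card (?D U) = (q - 1) ^ r U" if U: "U \<in> ?I" for U
    proof -
      have "coprime (card (carrier (units_of K))) (e U)"
        unfolding card
      proof (rule coprime_divisors[of "q - 1" _ "e U" e0])
        show "e U dvd e0" unfolding e0_def by (rule dvd_prodI[OF finite_affine_opens U])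
        show "coprime (q - 1) e0" using q(2) unfolding coprime_iff_gcd_eq_1 .
      qed simp
      from mp[OF spec[OF conjunct2[OF bspec[OF er U]]] conjI[OF K.units_comm_group conjI[OF fin this]]]
      have H: "finite (?H U (units_of K)) \<and> card (?H U (units_of K)) = (q - 1) ^ r U" unfolding card .
      have b: "bij_betw (\<lambda>\<psi>. \<lambda>u\<in>Units (sect X U). \<psi> (frag_of u)) (?D U) (?H U (units_of K))"
        by (rule bij_unit_centred_homs[OF sect_comm_monoid K(1)]) (use U in simp)
      show ?thesis using H bij_betw_finite[OF b] bij_betw_same_card[OF b] by simp
    qed
    \<comment> \<open>Each point is listed at exactly one affine open, so the count is a sum over a
      disjoint union.\<close>
    have lh: "gp.local_homs = Sigma ?I ?D" unfolding gp.local_homs_def by auto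
    have vp: "valued_points (ascent X) K = lrs_morphisms (ring_spec K) gp.Y"
      unfolding valued_points_def ascent_eq ..
    have "finite gp.local_homs" unfolding lh by (rule finite_SigmaI[OF finite_affine_opens]) (use D in blast)
    then have f: "finite (valued_points (ascent X) K)" unfolding vp using bij_betw_finite[OF gp.bij_points] by simp
    have "card (valued_points (ascent X) K) = card gp.local_homs"
      unfolding vp by (rule bij_betw_same_card[OF gp.bij_points, symmetric])
    also have "\<dots> = (\<Sum>U\<in>?I. card (?D U))"
      unfolding lh by (rule card_SigmaI[OF finite_affine_opens]) (use D in blast)
    also have "\<dots> = (\<Sum>U\<in>?I. (q - 1) ^ r U)" by (rule sum.cong[OF refl]) (use D in blast)
    finally have "int (card (valued_points (ascent X) K)) = (\<Sum>U\<in>?I. (int q - 1) ^ r U)"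
      using q0 by (simp add: of_nat_diff)
    also have "\<dots> = poly N (int q)" by (simp add: N_def poly_sum poly_power)
    finally show "finite (valued_points (ascent X) K) \<and> int (card (valued_points (ascent X) K)) = poly N (int q)"
      using f by simp
  qed
  ultimately show ?thesis by blast
qed

end

theorem theorem1:
  fixes X :: "('p, 'm) monoidal_space"
  assumes "F1_scheme_of_finite_type X"
  shows "(\<exists>e N. e > 0 \<and> counts_points X e N) \<and>
    (\<forall>e e' N N'. e > 0 \<and> counts_points X e N \<and> e' > 0 \<and> counts_points X e' N' \<longrightarrow> N = N')"
proof (intro conjI allI impI; (elim conjE)?)
  show "\<exists>e N. e > 0 \<and> counts_points X e N" by (rule F1_scheme_of_finite_type.ex_counts_points[OF assms])
qed (rule counts_points_unique)

end
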